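(* For each $n$, let $\mathscr C_n$ be a finite collection of partitions of a finite set $\mathsf X_n$, each partition having at least two elements, and for each $\mathcal C\in\mathscr C_n$ let $S_{\mathcal C}\in\mathbb R^{\mathcal C}$ be a random vector on a probability space with measure $\Pr_0$. Suppose $\{S_{\mathcal C}\}_{\mathcal C\in\cup_n\mathscr C_n}$ satisfies the Almost Sure Asymptotic Gaussian Representation Condition below under $\Pr_0$. Let $\alpha\le2\Phi(-\sqrt3)$, where $\Phi$ is the standard Gaussian c.d.f. For each $n$ let $\hat{\mathcal C}_n\in\mathscr C_n$ and $\hat\alpha_n\in[0,\alpha]$ be random (data-dependent) choices, and define the test $\hat T_{\mathrm{IM}(\alpha),n}$ to reject iff $T_{\mathrm{IM}(\hat\alpha_n),\hat{\mathcal C}_n}$ rejects. Suppose there are sets $\mathscr C_{1,n}\subseteq\mathscr C_n$ with (i) $\lim_n\Pr_0(\hat{\mathcal C}_n\notin\mathscr C_{1,n})=0$ and (ii) $\lim_n\sup_{\mathcal C\in\mathscr C_{1,n}}|\Pr_0(T_{\mathrm{IM}(\alpha),\mathcal C}=\mathrm{Reject}\mid\hat{\mathcal C}_n=\mathcal C)-\Pr_0(T_{\mathrm{IM}(\alpha),\mathcal C}=\mathrm{Reject})|=0$. Then $\limsup_{n\to\infty}\Pr_0(\hat T_{\mathrm{IM}(\alpha),n}=\mathrm{Reject})\le\alpha$.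
   Context: For $S\in\mathbb R^{\mathcal C}$ with $k=|\mathcal C|\ge2$, $t(S)=\dfrac{k^{-1/2}\sum_{\mathsf C\in\mathcal C}S_{\mathsf C}}{\sqrt{(k-1)^{-1}\sum_{\mathsf C\in\mathcal C}(S_{\mathsf C}-k^{-1}\sum_{\mathsf C'\in\mathcal C}S_{\mathsf C'})^2}}$. For $a\in(0,1)$ the IM test $T_{\mathrm{IM}(a),\mathcal C}$ rejects iff $|t(S_{\mathcal C})|>t_{1-a/2,k-1}$, the $(1-a/2)$-quantile of the $t$-distribution with $k-1$ degrees of freedom. (In the application, $S_{\mathcal C,\mathsf C}=(n/k)^{1/2}(\hat\theta_{\mathsf C}-\theta^\circledast)$ for cluster-wise estimators $\hat\theta_{\mathsf C}$.) Almost Sure Asymptotic Gaussian Representation Condition: there is a common probability space $(\tilde\Omega,\tilde{\mathscr F},\tilde\Pr)$ carrying random vectors $\tilde S_{\mathcal C},\tilde S^*_{\mathcal C}\in\mathbb R^{\mathcal C}$ for all $\mathcal C\in\cup_n\mathscr C_n$ such that $\tilde S_{\mathcal C}$ has the same distribution as $S_{\mathcal C}$; $\tilde S^*_{\mathcal C}$ is zero-mean Gaussian with independent components; $\liminf_n\min_{\mathcal C\in\mathscr C_n,\mathsf C\in\mathcal C}\mathrm{var}(\tilde S^*_{\mathcal C,\mathsf C})>0$; $\limsup_n\max_{\mathcal C\in\mathscr C_n,\mathsf C\in\mathcal C}\mathrm{var}(\tilde S^*_{\mathcal C,\mathsf C})<\infty$; and $\sup_{\mathcal C\in\mathscr C_n}\|\tilde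 S_{\mathcal C}-\tilde S^*_{\mathcal C}\|_2\to0$ $\tilde\Pr$-almost surely. *)

theory Defs
  imports "HOL-Probability.Probability" "HOL-Library.Disjoint_Sets"
begin

definition Phi :: "real \<Rightarrow> real" where
  "Phi x = cdf (density lborel std_normal_density) x"

definition t_density :: "real \<Rightarrow> real \<Rightarrow> real" where
  "t_density \<nu> x = Gamma ((\<nu> + 1) / 2) / (sqrt (\<nu> * pi) * Gamma (\<nu> / 2))
                    * (1 + x\<^sup>2 / \<nu>) powr (- (\<nu> + 1) / 2)"

definition t_cdf :: "real \<Rightarrow> real \<Rightarrow> real" where
  "t_cdf \<nu> x = cdf (density lborel (t_density \<nu>)) x"

definition t_quantile :: "real \<Rightarrow> real \<Rightarrow> real" where
  "t_quantile \<nu> p = Inf {x. p \<le> t_cdf \<nu> x}"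

definition tstat :: "'c set \<Rightarrow> ('c \<Rightarrow> real) \<Rightarrow> real" where
  "tstat \<C> S =
     (let k = real (card \<C>); m = (\<Sum>C\<in>\<C>. S C) / k in
      (k powr (-1/2) * (\<Sum>C\<in>\<C>. S C)) /
      sqrt ((\<Sum>C\<in>\<C>. (S C - m)\<^sup>2) / (k - 1)))"

(* IM(a) test on the partition \<C>: rejects iff |t(S)| > t_{1-a/2,k-1}.
   Convention: for a = 0 the test never rejects (t_{1,k-1} = +infinity). *)
definition IM_reject :: "real \<Rightarrow> 'c set \<Rightarrow> ('c \<Rightarrow> real) \<Rightarrow> bool" where
  "IM_reject a \<C> S \<longleftrightarrow>
     0 < a \<and> \<bar>tstat \<C> S\<bar> > t_quantile (real (card \<C>) - 1) (1 - a / 2)"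

definition centered_gaussian :: "'w measure \<Rightarrow> ('w \<Rightarrow> real) \<Rightarrow> bool" where
  "centered_gaussian M X \<longleftrightarrow>
     (\<exists>\<sigma>>0. distributed M lborel X (normal_density 0 \<sigma>)) \<or> (AE \<omega> in M. X \<omega> = 0)"

(* Almost Sure Asymptotic Gaussian Representation Condition for the family
   S_\<C>, \<C> \<in> \<Union>n. Cs n, living on the probability space M (= Pr_0),
   realised on the probability space M' by S' (copies) and Sg (Gaussians). *)
definition ASAGR ::
  "'w measure \<Rightarrow> ('x set set \<Rightarrow> 'w \<Rightarrow> 'x set \<Rightarrow> real) \<Rightarrow> ('x set set \<Rightarrow> 'w \<Rightarrow> 'x set \<Rightarrow> real)
   \<Rightarrow> 'o measure \<Rightarrow> (nat \<Rightarrow> 'x set set set) \<Rightarrow> ('x set set \<Rightarrow> 'o \<Rightarrow> 'x set \<Rightarrow> real) \<Rightarrow> bool" where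
  "ASAGR M' S' Sg M Cs S \<longleftrightarrow>
     prob_space M' \<and>
     (\<forall>\<C>\<in>(\<Union>n. Cs n). \<forall>C\<in>\<C>.
        (\<lambda>\<omega>. S' \<C> \<omega> C) \<in> borel_measurable M' \<and> (\<lambda>\<omega>. Sg \<C> \<omega> C) \<in> borel_measurable M') \<and>
     (\<forall>\<C>\<in>(\<Union>n. Cs n).
        distr M' (PiM \<C> (\<lambda>_. borel)) (\<lambda>\<omega>. restrict (S' \<C> \<omega>) \<C>)
        = distr M (PiM \<C> (\<lambda>_. borel)) (\<lambda>\<omega>. restrict (S \<C> \<omega>) \<C>)) \<and>
     (\<forall>\<C>\<in>(\<Union>n. Cs n).
        (\<forall>C\<in>\<C>. centered_gaussian M' (\<lambda>\<omega>. Sg \<C> \<omega> C)) \<and>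
        prob_space.indep_vars M' (\<lambda>_. borel) (\<lambda>C \<omega>. Sg \<C> \<omega> C) \<C>) \<and>
     \<comment> \<open>liminf_n min variance > 0\<close>
     (\<exists>c>0. \<forall>\<^sub>F n in sequentially. \<forall>\<C>\<in>Cs n. \<forall>C\<in>\<C>.
        c \<le> prob_space.variance M' (\<lambda>\<omega>. Sg \<C> \<omega> C)) \<and>
     \<comment> \<open>limsup_n max variance < infinity\<close>
     (\<exists>K. \<forall>\<^sub>F n in sequentially. \<forall>\<C>\<in>Cs n. \<forall>C\<in>\<C>.
        prob_space.variance M' (\<lambda>\<omega>. Sg \<C> \<omega> C) \<le> K) \<and>
     \<comment> \<open>sup_{\<C> \<in> Cs n} ||S'_\<C> - Sg_\<C>||_2 \<longrightarrow> 0 almost surely\<close>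
     (AE \<omega> in M'. \<forall>\<epsilon>>0. \<forall>\<^sub>F n in sequentially. \<forall>\<C>\<in>Cs n.
        sqrt (\<Sum>C\<in>\<C>. (S' \<C> \<omega> C - Sg \<C> \<omega> C)\<^sup>2) \<le> \<epsilon>)"

end

theory Submission
  imports Defs "HOL-Real_Asymp.Real_Asymp"
begin

text \<open>
  Rejection of the test amounts to \<open>R = (\<Sum>X)\<^sup>2 / \<Sum>X\<^sup>2\<close> exceeding a level \<open>r\<close>. For independent centred
  Gaussians with arbitrary variances and \<open>r\<close> at least some \<open>r\<^sub>k\<close>, the tail of \<open>R\<close> is largest when the
  variances are equal (Bakirov and Szekely), and then it is given by the \<open>t\<close>-distribution; numerical
  bounds show that the levels \<open>\<alpha> \<le> 2 * Phi (- sqrt 3)\<close> are small enough for \<open>r \<ge> r\<^sub>k\<close>.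

  For the comparison let \<open>y(u) = \<Sum> u \<tau>\<^sub>i / (1 + u \<tau>\<^sub>i)\<close> and \<open>H(u) = \<Prod> (1 + u \<tau>\<^sub>i)\<^bsup>-1/2\<^esup>\<close>, where \<open>\<tau>\<^sub>i\<close>
  are the variances, and let \<open>U\<close> have survival function \<open>H\<close>. Exponential tilting expresses the moments
  of \<open>R\<close> through those of \<open>y(U)\<close>, so that Abel's inversion gives
  \<open>\<pi> / (2 sqrt r) * P(R > r) = E (1 / (y(U) sqrt (y(U) - r)); y(U) > r)\<close>. For \<open>k\<close> equal variances \<open>y(U)\<close>
  has survival function \<open>(1 - y/k)\<^bsup>k/2\<^esup>\<close>. The gap between the two survival functions, divided by
  \<open>f(y) = y\<^sup>2 (1 - y/k)\<^bsup>k/2 - 4/3\<^esup>\<close>, decreases in \<open>y\<close>, so it suffices to integrate the kernel against \<open>f\<close>,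
  which is explicit. The same argument against \<open>e\<^bsup>-y/2\<^esup>\<close>, the limit for large \<open>k\<close>, bounds the tail
  for equal variances from below by the normal one.

  The passage from \<open>S\<close> to its Gaussian approximation has to be uniform in the number of components.
  An \<open>\<epsilon>\<close>-perturbation shifts the boundary of the rejection region by at most a multiple of \<open>\<epsilon>\<close> in the
  direction of the normalised sum, and this boundary layer has small Gaussian measure because many
  translates of it along the diagonal are disjoint and have comparable measure.
\<close>

section \<open>Comparison of survival functions\<close>

text \<open>The kernel decreases in \<open>y\<close>, so it does not suffice that the survival
  function for equal variances lies above the other one. Expressed through the masses of the
  intervals \<open>{r<..y}\<close>, the claim is that the gap at \<open>r\<close> exceeds the gap at
  \<open>y\<close> on average over \<open>y > r\<close>, with a weight that is singular at
  \<open>r\<close>. For two and three components the gap itself decreases. For more components it is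
  compared with the multiple of \<open>f\<close> that meets it at \<open>r\<close> and dominates it
  beyond; the average for \<open>f\<close> has the sign of \<open>r * (k + 4/3) - 3 * k\<close>.
  Hence \<open>r\<^sub>k = 3 * k / (k + 4/3)\<close>, which increases to 3, and this limit is the
  origin of \<open>sqrt 3\<close> in the bound on the level. The exponent 4/3 is the one for which
  the underlying bound on a logarithm is exact to first order, and \<open>8/3 \<le> y\<close> is the
  range in which that bound can be integrated. Since \<open>r\<^sub>k < 8/3\<close> for
  \<open>k \<le> 10\<close>, and the limit for large \<open>k\<close> is only used from
  \<open>k = 18\<close> on, small \<open>k\<close> need numerical values: \<open>k = 2, 3, 4\<close>
  each have their own, and one value at \<open>k = 5\<close> is carried up to 17.\<close>

lemma ln_one_minus_lower:
  fixes m :: real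
  assumes "0 \<le> m" "m < 1"
  shows "m * (5 * m - 6) / (2 * (3 - m) * (1 - m)) \<le> ln (1 - m)"
proof -
  define d where "d = (\<lambda>t::real. ln (1 - t) - t * (5 * t - 6) / (2 * (3 - t) * (1 - t)))"
  have "d 0 \<le> d m"
  proof (rule DERIV_nonneg_imp_nondecreasing[OF assms(1)])
    fix t :: real assume t: "0 \<le> t" "t \<le> m"
    then have t1: "t < 1" using assms by simp
    \<comment> \<open>The rational minorant agrees with the logarithm at 0 through third order,
      which leaves this single term in the derivative of the difference.\<close>
    have "(d has_real_derivative t ^ 3 / ((3 - t)\<^sup>2 * (1 - t)\<^sup>2)) (at t)"
      unfolding d_def
    proof -
      have nz: "1 - t \<noteq> 0" "3 - t \<noteq> 0" "0 < 1 - t" "2 * (3 - t) * (1 - t) \<noteq> 0" using t1 by auto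
      show "((\<lambda>t. ln (1 - t) - t * (5 * t - 6) / (2 * (3 - t) * (1 - t)))
              has_real_derivative t ^ 3 / ((3 - t)\<^sup>2 * (1 - t)\<^sup>2)) (at t)"
        apply (rule DERIV_cong)
         apply (rule derivative_intros nz)+
        using nz(1,2) by (simp add: field_split_simps del: right_minus_eq) algebra
    qed
    then show "\<exists>y. (d has_real_derivative y) (at t) \<and> 0 \<le> y"
      using t by (intro exI[of _ "t ^ 3 / ((3 - t)\<^sup>2 * (1 - t)\<^sup>2)"] conjI) (auto)
  qed
  then show ?thesis by (simp add: d_def)
qed

text \<open>For \<open>z = u * \<tau> / (1 + u * \<tau>)\<close> one has
  \<open>- ln (1 - z) = ln (1 + u * \<tau>)\<close>, so the sum of \<open>z * phi_log z\<close> over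
  the components is minus twice the logarithm of \<open>Hexp\<close>, with weights \<open>z\<close>
  that add up to \<open>ysum\<close>.\<close>

definition phi_log :: "real \<Rightarrow> real" where "phi_log z = - ln (1 - z) / z"

definition phi_log' :: "real \<Rightarrow> real" where
  "phi_log' z = (z / (1 - z) + ln (1 - z)) / z\<^sup>2"

lemma phi_log_deriv:
  assumes "0 < z" "z < 1"
  shows "(phi_log has_real_derivative phi_log' z) (at z)"
proof -
  have nz: "1 - z \<noteq> 0" "0 < 1 - z" "z \<noteq> 0" using assms by auto
  show ?thesis
    unfolding phi_log_def[abs_def] phi_log'_def
    apply (rule DERIV_cong)
     apply (rule derivative_intros nz)+
    using nz by (simp add: divide_simps del: right_minus_eq) algebra
qed

text \<open>The minorant of the logarithm inserted into \<open>phi_log'\<close> gives the left side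
  exactly. Both sides are \<open>1 + m / 3\<close> to first order; this fixes the coefficient 2/3 in
  \<open>B\<close> below and with it the exponent 4/3 of the comparison function.\<close>

lemma phi_log'_bound:
  assumes "0 < m" "m < 1"
  shows "1 / (1 - m / 3) \<le> 2 * phi_log' m * (1 - m)"
proof -
  have l: "m * (5 * m - 6) / (2 * (3 - m) * (1 - m)) \<le> ln (1 - m)"
    using ln_one_minus_lower assms by simp
  have "2 * (1 - m) / m\<^sup>2 * (m / (1 - m) + m * (5 * m - 6) / (2 * (3 - m) * (1 - m))) = 1 / (1 - m / 3)"
  proof -
    have nz: "1 - m \<noteq> 0" "3 - m \<noteq> 0" "1 - m / 3 \<noteq> 0" "m \<noteq> 0" using assms by auto
    show ?thesis using nz by (simp add: divide_simps del: right_minus_eq) algebra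
  qed
  moreover have "2 * (1 - m) / m\<^sup>2 * (m / (1 - m) + m * (5 * m - 6) / (2 * (3 - m) * (1 - m)))
      \<le> 2 * (1 - m) / m\<^sup>2 * (m / (1 - m) + ln (1 - m))"
    using assms l by (intro mult_left_mono) auto
  moreover have "2 * phi_log' m * (1 - m) = 2 * (1 - m) / m\<^sup>2 * (m / (1 - m) + ln (1 - m))"
    by (simp only: phi_log'_def times_divide_eq_left times_divide_eq_right mult_ac)
  ultimately show ?thesis by linarith
qed

lemma phi_log_second_deriv:
  assumes "0 < z" "z < 1"
  shows "(phi_log' has_real_derivative
     ((z / (1 - z))\<^sup>2 - 2 * (z / (1 - z)) - 2 * ln (1 - z)) / z ^ 3) (at z)"
proof -
  have nz: "1 - z \<noteq> 0" "0 < 1 - z" "z \<noteq> 0" "z\<^sup>2 \<noteq> 0" using assms by auto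
  show ?thesis
    unfolding phi_log'_def[abs_def]
    apply (rule DERIV_cong)
     apply (rule derivative_intros nz)+
    using nz by (simp add: divide_simps del: right_minus_eq) algebra
qed

lemma phi_log_second_deriv_nonneg:
  fixes z :: real
  assumes "0 \<le> z" "z < 1"
  shows "0 \<le> (z / (1 - z))\<^sup>2 - 2 * (z / (1 - z)) - 2 * ln (1 - z)"
proof -
  define d where "d = (\<lambda>t::real. (t / (1 - t))\<^sup>2 - 2 * (t / (1 - t)) - 2 * ln (1 - t))"
  have "d 0 \<le> d z"
  proof (rule DERIV_nonneg_imp_nondecreasing[OF assms(1)])
    fix t :: real assume t: "0 \<le> t" "t \<le> z"
    then have t1: "t < 1" using assms by simp
    have "(d has_real_derivative 2 * t\<^sup>2 / (1 - t) ^ 3) (at t)"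
    proof -
      have nz: "1 - t \<noteq> 0" "0 < 1 - t" using t1 by auto
      show ?thesis
        unfolding d_def
        apply (rule DERIV_cong)
         apply (rule derivative_intros nz)+
        using nz by (simp add: divide_simps del: right_minus_eq) algebra
    qed
    then show "\<exists>y. (d has_real_derivative y) (at t) \<and> 0 \<le> y"
      using t t1 by (intro exI[of _ "2 * t\<^sup>2 / (1 - t) ^ 3"] conjI) (auto)
  qed
  then show ?thesis by (simp add: d_def)
qed

lemma phi_log_convex: "convex_on {0<..<1} phi_log"
  by (rule f''_ge0_imp_convex[OF _ phi_log_deriv phi_log_second_deriv])
     (use phi_log_second_deriv_nonneg in \<open>auto intro!: divide_nonneg_nonneg simp: less_imp_le\<close>)

text \<open>Jensen for \<^term>\<open>phi_log\<close> with the weights \<open>z i / (\<Sum>z)\<close>.\<close>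
lemma sum_ln_lower:
  fixes z :: "'i \<Rightarrow> real"
  assumes I: "finite I" "I \<noteq> {}" and z: "\<And>i. i \<in> I \<Longrightarrow> 0 < z i \<and> z i < 1"
  defines "y \<equiv> \<Sum>i\<in>I. z i"
  shows "y * phi_log ((\<Sum>i\<in>I. (z i)\<^sup>2) / y) \<le> (\<Sum>i\<in>I. - ln (1 - z i))"
proof -
  have y: "y > 0" unfolding y_def using I z by (intro sum_pos) auto
  have "phi_log (\<Sum>i\<in>I. (z i / y) *\<^sub>R z i) \<le> (\<Sum>i\<in>I. (z i / y) * phi_log (z i))"
    by (rule convex_on_sum[OF I phi_log_convex])
       (use y z in \<open>auto simp: y_def sum_divide_distrib[symmetric] less_imp_le\<close>)
  also have "(\<Sum>i\<in>I. (z i / y) *\<^sub>R z i) = (\<Sum>i\<in>I. (z i)\<^sup>2) / y"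
    by (simp add: sum_divide_distrib power2_eq_square)
  also have "(\<Sum>i\<in>I. (z i / y) * phi_log (z i)) = (\<Sum>i\<in>I. - ln (1 - z i)) / y"
    unfolding sum_divide_distrib by (rule sum.cong) (use z in \<open>force simp: phi_log_def\<close>)+
  finally show ?thesis using y by (simp add: pos_le_divide_eq mult.commute)
qed

text \<open>As functions of \<open>m\<close> both sides equal 1 at \<open>m = x\<close>, and the
  logarithmic derivative of the left side \<open>V\<close> is the smaller one. Replacing the
  exponential by a function affine in \<open>1 / (1 - m)\<close> makes the later sign condition
  algebraic.\<close>

lemma exp_phi_log_bound:
  fixes x m y :: real
  assumes x: "0 < x" "x \<le> m" "m < 1" and y: "8 / 3 \<le> y"
  defines "B \<equiv> 1 + 2 / 3 * x / (1 - x)"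
  shows "1 + y / (4 * B) * (1 / (1 - m) - 1 / (1 - x)) \<le> exp (y / 2 * (phi_log m - phi_log x))"
proof -
  have B1: "B \<ge> 1" using x by (simp add: B_def)
  define V where "V = (\<lambda>t. 1 + y / (4 * B) * (1 / (1 - t) - 1 / (1 - x)))"
  have V1: "V t \<ge> 1" if "x \<le> t" "t < 1" for t
  proof -
    have "1 / (1 - x) \<le> 1 / (1 - t)" using that x by (intro divide_left_mono) auto
    then show ?thesis using y B1 by (simp add: V_def)
  qed
  define d where "d = (\<lambda>t. y / 2 * (phi_log t - phi_log x) - ln (V t))"
  have "d x \<le> d m"
  proof (rule DERIV_nonneg_imp_nondecreasing[OF x(2)])
    fix t :: real assume t: "x \<le> t" "t \<le> m"
    then have t1: "0 < t" "t < 1" using x by auto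
    have Vt: "V t \<ge> 1" using V1 t t1 by simp
    have dV: "(V has_real_derivative y / (4 * B) * (1 / (1 - t)\<^sup>2)) (at t)"
    proof -
      have nz: "1 - t \<noteq> 0" using t1 by auto
      show ?thesis
        unfolding V_def
        apply (rule DERIV_cong)
         apply (rule derivative_intros nz)+
        by (simp add: power2_eq_square)
    qed
    have "(d has_real_derivative y / 2 * phi_log' t - (y / (4 * B) * (1 / (1 - t)\<^sup>2)) / V t) (at t)"
    proof -
      have "0 < V t" using Vt by simp
      then show ?thesis
        unfolding d_def
        apply -
        apply (rule DERIV_cong)
         apply (rule derivative_intros phi_log_deriv dV t1 | assumption)+
        by (simp add: mult_ac)
    qed
    moreover have "0 \<le> y / 2 * phi_log' t - (y / (4 * B) * (1 / (1 - t)\<^sup>2)) / V t"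
    proof -
      have x1: "x < 1" using x by simp
      have BV: "B * V t * (1 - t) = (1 - t) * B + y / 4 * ((t - x) / (1 - x))"
      proof -
        have nz: "1 - t \<noteq> 0" "1 - x \<noteq> 0" "B \<noteq> 0" using t1 x1 B1 by auto
        show ?thesis unfolding V_def using nz by (simp add: divide_simps del: right_minus_eq)
      qed
      have Bx: "(1 - x) * B = 1 - x / 3"
      proof -
        have nz: "1 - x \<noteq> 0" using x1 by auto
        show ?thesis unfolding B_def using nz by (simp add: divide_simps del: right_minus_eq)
      qed
      have "(1 - t / 3) * (1 - x) \<le> B * V t * (1 - t) * (1 - x)"
      proof -
        \<comment> \<open>The value 8/3 is the one for which this combination factors; a larger
          \<open>y\<close> only adds to it because \<open>x \<le> t\<close>.\<close>
        have eq: "(1 - t) * (1 - x / 3) + (8 / 3) / 4 * (t - x) = (1 - t / 3) * (1 - x)"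
          by (simp add: field_simps)
        have "B * V t * (1 - t) * (1 - x) = (1 - t) * ((1 - x) * B) + y / 4 * (t - x)"
        proof -
          have nz: "1 - x \<noteq> 0" using x1 by auto
          show ?thesis unfolding BV using nz by (simp add: divide_simps del: right_minus_eq) algebra
        qed
        also have "\<dots> = (1 - t) * (1 - x / 3) + y / 4 * (t - x)" by (simp only: Bx)
        also have "\<dots> \<ge> (1 - t) * (1 - x / 3) + (8 / 3) / 4 * (t - x)"
          using y t by (intro add_left_mono mult_right_mono) auto
        finally show ?thesis unfolding eq .
      qed
      then have le: "1 - t / 3 \<le> B * V t * (1 - t)" using x1 by simp
      have "1 \<le> 2 * phi_log' t * (1 - t) * (1 - t / 3)"
        using phi_log'_bound[OF t1] t1 by (simp add: divide_simps)
      also have "\<dots> \<le> 2 * phi_log' t * (1 - t) * (B * V t * (1 - t))"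
      proof (rule mult_left_mono[OF le])
        have "0 \<le> 1 / (1 - t / 3)" using t1 by simp
        then show "0 \<le> 2 * phi_log' t * (1 - t)" using phi_log'_bound[OF t1] by linarith
      qed
      finally have key: "1 \<le> 2 * phi_log' t * (1 - t) * (B * V t * (1 - t))" .
      have pos: "0 < B * V t * (1 - t)\<^sup>2" using B1 Vt t1 by simp
      have "(y / (4 * B) * (1 / (1 - t)\<^sup>2)) / V t = y / 4 / (B * V t * (1 - t)\<^sup>2)"
        by simp
      also have "\<dots> \<le> y / 2 * phi_log' t"
      proof -
        have "y / 4 * 1 \<le> y / 4 * (2 * phi_log' t * (1 - t) * (B * V t * (1 - t)))"
          using y key by (intro mult_left_mono) auto
        also have "\<dots> = y / 2 * phi_log' t * (B * V t * (1 - t)\<^sup>2)"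
          by (simp add: power2_eq_square)
        finally show ?thesis by (simp only: pos_divide_le_eq[OF pos] mult_1_right)
      qed
      finally show ?thesis by simp
    qed
    ultimately show "\<exists>y. (d has_real_derivative y) (at t) \<and> 0 \<le> y" by blast
  qed
  moreover have "d x = 0" by (simp add: d_def V_def)
  ultimately have "ln (V m) \<le> y / 2 * (phi_log m - phi_log x)" by (simp add: d_def)
  moreover have "0 < V m" using V1[of m] x by simp
  ultimately have "V m \<le> exp (y / 2 * (phi_log m - phi_log x))" by (metis exp_le_cancel_iff exp_ln)
  then show ?thesis by (simp only: V_def)
qed

text \<open>\<open>m\<close> is the mean of the \<open>z i\<close> under weights proportional to
  \<open>z i\<close>. Cauchy-Schwarz gives \<open>x \<le> m\<close>, and Jensen bounds
  \<open>\<rho>\<close> by the exponential of \<open>- y / 2 * (phi_log m - phi_log x)\<close>. As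
  \<open>y / N = 1 / (1 - m)\<close>, the bracket in the first conclusion is \<open>B\<close> times
  the affine function of \<open>exp_phi_log_bound\<close>. That conclusion is the sign of the
  derivative in \<open>ratio_decreasing\<close>.\<close>

lemma rho_bound:
  fixes z :: "'i \<Rightarrow> real" and k :: real
  assumes I: "finite I" "I \<noteq> {}" and z: "\<And>i. i \<in> I \<Longrightarrow> 0 < z i \<and> z i < 1"
    and k: "real (card I) \<le> k" and y: "y = (\<Sum>i\<in>I. z i)" "8 / 3 \<le> y"
    and x: "x = y / k" and N: "N = (\<Sum>i\<in>I. z i * (1 - z i))"
    and B: "B = 1 + 2 / 3 * x / (1 - x)"
    and rho: "\<rho> = exp ((\<Sum>i\<in>I. ln (1 - z i)) / 2 - k / 2 * ln (1 - x))"
  shows "\<rho> * (B + y / 4 * (y / N - 1 / (1 - x))) \<le> B" "\<rho> \<le> 1" "0 < N" "y * (1 - x) \<ge> N" "0 < x" "x < 1"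
proof -
  define m where "m = (\<Sum>i\<in>I. (z i)\<^sup>2) / y"
  have y0: "0 < y" using y by simp
  have ylt: "y < real (card I)"
  proof -
    have "(\<Sum>i\<in>I. z i) < (\<Sum>i\<in>I. 1)" using I z by (intro sum_strict_mono) auto
    then show ?thesis using y by simp
  qed
  then have yk: "y < k" and k0: "0 < k" using k y0 by auto
  show x0: "0 < x" and x1: "x < 1" using yk y0 k0 by (auto simp: x)
  have Npos: "0 < N" unfolding N using I z by (intro sum_pos) auto
  then show "0 < N" .
  have N_eq: "N = y * (1 - m)"
    using y0 by (simp add: N m_def y right_diff_distrib sum_subtractf power2_eq_square)
  have m1: "m < 1" using Npos y0 by (simp add: N_eq zero_less_mult_iff)
  have xm: "x \<le> m"
  proof -
    have "(\<Sum>i\<in>I. z i)\<^sup>2 \<le> real (card I) * (\<Sum>i\<in>I. (z i)\<^sup>2)"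
      using sum_squared_le_sum_of_squares[of z I] by (simp add: mult.commute)
    also have "\<dots> \<le> k * (\<Sum>i\<in>I. (z i)\<^sup>2)" using k by (intro mult_right_mono sum_nonneg) auto
    finally have "y * y \<le> k * (m * y)" using y0 by (simp add: m_def y(1)[symmetric] power2_eq_square)
    then have "y \<le> k * m" using y0 by (simp add: mult.assoc[symmetric])
    then show ?thesis using k0 by (simp add: x divide_le_eq mult.commute)
  qed
  show "y * (1 - x) \<ge> N" using y0 xm by (simp add: N_eq)
  have B1: "1 \<le> B" using x0 x1 by (simp add: B)
  have yN: "y / N = 1 / (1 - m)" using y0 by (simp add: N_eq)
  define E where "E = exp (y / 2 * (phi_log m - phi_log x))"
  have E: "1 + y / (4 * B) * (1 / (1 - m) - 1 / (1 - x)) \<le> E"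
    unfolding E_def B by (rule exp_phi_log_bound) (use x0 xm m1 y in auto)
  have "1 / (1 - x) \<le> 1 / (1 - m)" using xm m1 by (intro divide_left_mono) auto
  then have d0: "0 \<le> y / (4 * B) * (1 / (1 - m) - 1 / (1 - x))" using y0 B1 by simp
  have rE: "\<rho> \<le> inverse E"
  proof -
    have "y * phi_log m \<le> (\<Sum>i\<in>I. - ln (1 - z i))"
      unfolding m_def y(1) using I z by (intro sum_ln_lower) auto
    then have "(\<Sum>i\<in>I. ln (1 - z i)) \<le> - (y * phi_log m)" by (simp add: sum_negf)
    moreover have "k * ln (1 - x) = - (y * phi_log x)"
      using y0 k0 by (simp add: phi_log_def x)
    ultimately show ?thesis by (simp add: rho E_def exp_minus[symmetric] right_diff_distrib)
  qed
  have E1: "1 \<le> E" using E d0 by simp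
  show "\<rho> \<le> 1" using rE E1 le_imp_inverse_le[of 1 E] by simp
  have "B + y / 4 * (y / N - 1 / (1 - x)) = B * (1 + y / (4 * B) * (1 / (1 - m) - 1 / (1 - x)))"
    using B1 by (simp add: yN distrib_left)
  also have "\<dots> \<le> B * E" using E B1 by simp
  finally have "\<rho> * (B + y / 4 * (y / N - 1 / (1 - x))) \<le> \<rho> * (B * E)"
    by (intro mult_left_mono) (simp_all add: rho)
  also have "\<dots> \<le> inverse E * (B * E)" using rE B1 E1 by (intro mult_right_mono) auto
  also have "\<dots> = B" using E1 by simp
  finally show "\<rho> * (B + y / 4 * (y / N - 1 / (1 - x))) \<le> B" .
qed

text \<open>For independent centred Gaussians with variances \<open>\<tau> i\<close> (up to scale), tilting by
  \<open>exp (- u * T / 2)\<close> with \<open>T = \<Sum>(X i)\<^sup>2\<close> turns the variance of \<open>\<Sum>X i\<close> into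
  \<open>ysum I \<tau> u / u\<close>, at the price of the normalising factor \<open>Hexp I \<tau> u\<close>.\<close>
definition ysum :: "'i set \<Rightarrow> ('i \<Rightarrow> real) \<Rightarrow> real \<Rightarrow> real" where
  "ysum I \<tau> u = (\<Sum>i\<in>I. u * \<tau> i / (1 + u * \<tau> i))"

definition Hexp :: "'i set \<Rightarrow> ('i \<Rightarrow> real) \<Rightarrow> real \<Rightarrow> real" where
  "Hexp I \<tau> u = exp (- (\<Sum>i\<in>I. ln (1 + u * \<tau> i)) / 2)"

section \<open>\<open>ysum\<close> and \<open>Hexp\<close> as functions of the tilt
  parameter\<close>

locale variances =
  fixes I :: "'i set" and \<tau> :: "'i \<Rightarrow> real"
  assumes fin: "finite I" and ne: "I \<noteq> {}" and pos: "\<And>i. i \<in> I \<Longrightarrow> 0 < \<tau> i"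
begin

lemma one_plus_pos: "0 \<le> u \<Longrightarrow> i \<in> I \<Longrightarrow> 0 < 1 + u * \<tau> i"
  using pos[of i] by (simp add: add_pos_nonneg)

lemma ysum_deriv:
  assumes "0 \<le> u"
  shows "(ysum I \<tau> has_real_derivative (\<Sum>i\<in>I. \<tau> i / (1 + u * \<tau> i)\<^sup>2)) (at u)"
  unfolding ysum_def[abs_def]
proof (rule DERIV_sum)
  fix i assume i: "i \<in> I"
  have nz: "1 + u * \<tau> i \<noteq> 0" using one_plus_pos[OF assms i] by simp
  show "((\<lambda>u. u * \<tau> i / (1 + u * \<tau> i)) has_real_derivative \<tau> i / (1 + u * \<tau> i)\<^sup>2) (at u)"
    apply (rule DERIV_cong)
     apply (rule derivative_intros nz)+
    using nz by (simp add: power2_eq_square) (simp add: algebra_simps)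
qed

lemma Hexp_deriv:
  assumes "0 \<le> u"
  shows "(Hexp I \<tau> has_real_derivative - (Hexp I \<tau> u * (\<Sum>i\<in>I. \<tau> i / (1 + u * \<tau> i)) / 2)) (at u)"
proof -
  have "((\<lambda>u. \<Sum>i\<in>I. ln (1 + u * \<tau> i)) has_real_derivative (\<Sum>i\<in>I. \<tau> i / (1 + u * \<tau> i))) (at u)"
  proof (rule DERIV_sum)
    fix i assume i: "i \<in> I"
    have nz: "0 < 1 + u * \<tau> i" using one_plus_pos[OF assms i] by simp
    show "((\<lambda>u. ln (1 + u * \<tau> i)) has_real_derivative \<tau> i / (1 + u * \<tau> i)) (at u)"
      apply (rule DERIV_cong)
       apply (rule derivative_intros nz)+
      by simp
  qed
  note d = this
  show ?thesis
    unfolding Hexp_def[abs_def]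
    by (rule DERIV_cong, (rule d derivative_intros)+) simp_all
qed

lemma ysum_div: "u \<noteq> 0 \<Longrightarrow> (\<Sum>i\<in>I. \<tau> i / (1 + u * \<tau> i)) = ysum I \<tau> u / u"
  by (simp add: ysum_def sum_divide_distrib)

lemma ysum_strict_mono:
  assumes "0 \<le> u" "u < v" shows "ysum I \<tau> u < ysum I \<tau> v"
proof (rule DERIV_pos_imp_increasing[OF assms(2)])
  fix t assume "u \<le> t" "t \<le> v"
  then have t: "0 \<le> t" using assms by simp
  have "0 < (\<Sum>i\<in>I. \<tau> i / (1 + t * \<tau> i)\<^sup>2)"
    using one_plus_pos[OF t] pos by (intro sum_pos fin ne) (auto simp: less_imp_neq[symmetric] intro!: divide_pos_pos)
  then show "\<exists>y. (ysum I \<tau> has_real_derivative y) (at t) \<and> 0 < y"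
    using ysum_deriv[OF t] by blast
qed

lemma ysum_less_card: "0 \<le> u \<Longrightarrow> ysum I \<tau> u < real (card I)"
proof -
  assume u: "0 \<le> u"
  have "ysum I \<tau> u < (\<Sum>i\<in>I. 1)" unfolding ysum_def
    using one_plus_pos[OF u] by (intro sum_strict_mono fin ne) simp
  then show ?thesis by simp
qed

lemma ysum_pos: "0 < u \<Longrightarrow> 0 < ysum I \<tau> u"
  using ysum_strict_mono[of 0 u] by (simp add: ysum_def)

lemma Hexp_pos: "0 < Hexp I \<tau> u" by (simp add: Hexp_def)

lemma ysum_tendsto: "(ysum I \<tau> \<longlongrightarrow> real (card I)) at_top"
proof -
  have "((\<lambda>u. u * \<tau> i / (1 + u * \<tau> i)) \<longlongrightarrow> 1) at_top" if "i \<in> I" for i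
    using pos[OF that] by real_asymp
  then have "(ysum I \<tau> \<longlongrightarrow> (\<Sum>i\<in>I. 1)) at_top"
    unfolding ysum_def[abs_def] by (intro tendsto_sum)
  then show ?thesis by simp
qed

lemma Hexp_tendsto: "(Hexp I \<tau> \<longlongrightarrow> 0) at_top"
proof -
  obtain j where j: "j \<in> I" using ne by blast
  have "((\<lambda>u. exp (- ln (1 + u * \<tau> j) / 2)) \<longlongrightarrow> 0) at_top"
    using pos[OF j] by real_asymp
  then show ?thesis
  proof (rule tendsto_0_le[where K = 1])
    show "\<forall>\<^sub>F u in at_top. norm (Hexp I \<tau> u) \<le> norm (exp (- ln (1 + u * \<tau> j) / 2)) * 1"
      using eventually_ge_at_top[of 0]
    proof eventually_elim
      case (elim u)
      have "ln (1 + u * \<tau> j) \<le> (\<Sum>i\<in>I. ln (1 + u * \<tau> i))"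
        using pos elim by (intro member_le_sum j fin ln_ge_zero) (auto simp: less_imp_le)
      then show ?case by (simp add: Hexp_def)
    qed
  qed
qed

lemma ysum_surj:
  assumes "0 < Y" "Y < real (card I)"
  obtains u where "0 < u" "ysum I \<tau> u = Y"
proof -
  obtain v where v: "0 < v" "Y < ysum I \<tau> v"
  proof -
    have "\<forall>\<^sub>F u in at_top. Y < ysum I \<tau> u \<and> 0 < u"
      using order_tendstoD(1)[OF ysum_tendsto assms(2)] eventually_gt_at_top[of 0]
      by eventually_elim auto
    then show ?thesis using that by (auto simp: eventually_at_top_linorder)
  qed
  have "\<exists>u\<ge>0. u \<le> v \<and> ysum I \<tau> u = Y"
  proof (rule IVT)
    show "ysum I \<tau> 0 \<le> Y" using assms by (simp add: ysum_def)
    show "Y \<le> ysum I \<tau> v" "0 \<le> v" using v by auto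
    show "\<forall>x. 0 \<le> x \<and> x \<le> v \<longrightarrow> isCont (ysum I \<tau>) x"
      using ysum_deriv DERIV_isCont by blast
  qed
  then obtain u where u: "0 \<le> u" "ysum I \<tau> u = Y" by blast
  moreover have "u \<noteq> 0" using u assms by (auto simp: ysum_def)
  ultimately show ?thesis by (intro that[of u]) auto
qed

text \<open>The ratio of the survival function \<^term>\<open>Hexp I \<tau> u\<close> to the equal-variance one at the same \<open>y\<close>.\<close>
definition rho :: "real \<Rightarrow> real \<Rightarrow> real" where
  "rho k u = exp (- (\<Sum>i\<in>I. ln (1 + u * \<tau> i)) / 2 - k / 2 * ln (1 - ysum I \<tau> u / k))"

lemma rho_alt:
  assumes "0 \<le> u"
  shows "rho k u = exp ((\<Sum>i\<in>I. ln (1 - u * \<tau> i / (1 + u * \<tau> i))) / 2 - k / 2 * ln (1 - ysum I \<tau> u / k))"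
proof -
  have "ln (1 - u * \<tau> i / (1 + u * \<tau> i)) = - ln (1 + u * \<tau> i)" if "i \<in> I" for i
  proof -
    have p: "0 < 1 + u * \<tau> i" using one_plus_pos[OF assms that] .
    then have "1 - u * \<tau> i / (1 + u * \<tau> i) = inverse (1 + u * \<tau> i)" by (simp add: divide_simps)
    then show ?thesis using p by (simp add: ln_inverse)
  qed
  then show ?thesis by (simp add: rho_def sum_negf)
qed

lemma one_minus_mult:
  assumes "0 \<le> u" "i \<in> I"
  shows "u * \<tau> i / (1 + u * \<tau> i) * (1 - u * \<tau> i / (1 + u * \<tau> i)) = u * (\<tau> i / (1 + u * \<tau> i)\<^sup>2)"
  using one_plus_pos[OF assms] by (simp add: divide_simps power2_eq_square)

text \<open>Up to reparametrisation, \<open>q\<close> is the gap between the two survival functions divided by the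
  comparison function \<open>y\<^sup>2 (1 - y/k)\<^bsup>k/2 - 4/3\<^esup>\<close>.\<close>
lemma ratio_decreasing:
  fixes k :: real
  assumes k: "real (card I) \<le> k" and u: "0 < u" "u \<le> v" and y: "8 / 3 \<le> ysum I \<tau> u"
  defines "q \<equiv> \<lambda>u. (1 - rho k u) * exp (4 / 3 * ln (1 - ysum I \<tau> u / k) - 2 * ln (ysum I \<tau> u))"
  shows "q v \<le> q u"
proof (rule DERIV_nonpos_imp_nonincreasing[OF u(2)])
  fix t assume t: "u \<le> t" "t \<le> v"
  then have t0: "0 < t" using u by simp
  define Y where "Y = ysum I \<tau> t"
  define Y' where "Y' = (\<Sum>i\<in>I. \<tau> i / (1 + t * \<tau> i)\<^sup>2)"
  define x where "x = Y / k"
  define B where "B = 1 + 2 / 3 * x / (1 - x)"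
  define G where "G = exp (4 / 3 * ln (1 - x) - 2 * ln Y)"
  define rh where "rh = rho k t"
  have Y: "8 / 3 \<le> Y" using y ysum_strict_mono[of u t] u t by (cases "u = t") (auto simp: Y_def)
  have "0 < k" using k ysum_less_card[of t] ysum_pos[OF t0] t0 by simp
  then have k0: "0 < k" "k \<noteq> 0" by simp_all
  have N: "t * Y' = (\<Sum>i\<in>I. t * \<tau> i / (1 + t * \<tau> i) * (1 - t * \<tau> i / (1 + t * \<tau> i)))"
    unfolding Y'_def sum_distrib_left using one_minus_mult t0 by (intro sum.cong) auto
  have *: "rh * (B + Y / 4 * (Y / (t * Y') - 1 / (1 - x))) \<le> B" "rh \<le> 1" "0 < t * Y'"
       "Y * (1 - x) \<ge> t * Y'" "0 < x" "x < 1"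
    by (rule rho_bound[OF fin ne _ k _ Y x_def N B_def];
        use t0 pos one_plus_pos in \<open>auto simp: Y_def ysum_def rh_def rho_alt x_def\<close>)+
  have Y'0: "0 < Y'" using *(3) t0 by (simp add: zero_less_mult_iff)
  have dY: "(ysum I \<tau> has_real_derivative Y') (at t)"
    unfolding Y'_def using t0 by (intro ysum_deriv) simp
  have dx: "((\<lambda>t. ln (1 - ysum I \<tau> t / k)) has_real_derivative - (Y' / k / (1 - x))) (at t)"
  proof -
    have "0 < 1 - ysum I \<tau> t / k" using * by (simp add: x_def Y_def)
    then show ?thesis
      apply -
      apply (rule DERIV_cong)
       apply (rule dY k0 derivative_intros | assumption)+
      using k0 by (simp add: x_def Y_def field_simps)
  qed
  have dL: "((\<lambda>u. \<Sum>i\<in>I. ln (1 + u * \<tau> i)) has_real_derivative Y / t) (at t)"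
  proof -
    have "((\<lambda>u. \<Sum>i\<in>I. ln (1 + u * \<tau> i)) has_real_derivative (\<Sum>i\<in>I. \<tau> i / (1 + t * \<tau> i))) (at t)"
    proof (rule DERIV_sum)
      fix i assume i: "i \<in> I"
      have nz: "0 < 1 + t * \<tau> i" using one_plus_pos[of t] t0 i by simp
      show "((\<lambda>u. ln (1 + u * \<tau> i)) has_real_derivative \<tau> i / (1 + t * \<tau> i)) (at t)"
        by (rule DERIV_cong, (rule derivative_intros nz)+) simp
    qed
    then show ?thesis using ysum_div t0 by (simp add: Y_def)
  qed
  have drho: "(rho k has_real_derivative rh * (Y' / (2 * (1 - x)) - Y / t / 2)) (at t)"
  proof -
    note d = DERIV_fun_exp[OF DERIV_diff[OF DERIV_cdivide[OF DERIV_minus[OF dL], of 2] DERIV_cmult[OF dx, of "k / 2"]]]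
    show ?thesis
      unfolding rho_def[abs_def] rh_def
      by (rule DERIV_cong[OF d]) (use k0 in simp)
  qed
  have dlY: "((\<lambda>t. ln (ysum I \<tau> t)) has_real_derivative Y' / Y) (at t)"
  proof -
    have "0 < ysum I \<tau> t" using t0 by (rule ysum_pos)
    then show ?thesis
      apply -
      apply (rule DERIV_cong)
       apply (rule dY derivative_intros | assumption)+
      by (simp add: Y_def)
  qed
  have dq: "(q has_real_derivative
     G * (rh * (Y / t / 2 - Y' / (2 * (1 - x))) - (1 - rh) * (Y' * (4 / 3 / k / (1 - x) + 2 / Y)))) (at t)"
    unfolding q_def
    apply (rule DERIV_cong[OF DERIV_mult[OF DERIV_diff[OF DERIV_const drho]
       DERIV_fun_exp[OF DERIV_diff[OF DERIV_cmult[OF dx, of "4 / 3"] DERIV_cmult[OF dlY, of 2]]]]])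
    by (simp add: G_def rh_def[symmetric] Y_def[symmetric] x_def[symmetric]) (simp add: algebra_simps)
  \<comment> \<open>\<open>2 / Y * B\<close> is the logarithmic derivative in \<open>y\<close> of
    \<open>y^2 * (1 - y/k) powr (- 4/3)\<close>. After division by \<open>Y' * (2 / Y)\<close> the
    inequality is the first conclusion of \<open>rho_bound\<close>.\<close>
  have "rh * (Y / t / 2 - Y' / (2 * (1 - x))) \<le> (1 - rh) * (Y' * (4 / 3 / k / (1 - x) + 2 / Y))"
  proof -
    have Y0: "0 < Y" using Y by simp
    have e1: "Y' * (2 / Y) * (Y / 4 * (Y / (t * Y') - 1 / (1 - x))) = Y / t / 2 - Y' / (2 * (1 - x))"
    proof -
      have "Y' * (2 / Y) * (Y / 4 * (Y / (t * Y') - 1 / (1 - x))) = Y' / 2 * (Y / (t * Y') - 1 / (1 - x))"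
        using Y0 by simp
      then show ?thesis using Y'0 t0 by (simp add: right_diff_distrib)
    qed
    have e2: "Y' * (2 / Y) * B = Y' * (4 / 3 / k / (1 - x) + 2 / Y)"
    proof -
      have nz: "k \<noteq> 0" "1 - x \<noteq> 0" "Y \<noteq> 0" using k0 * Y0 by auto
      have "2 / Y * B = 4 / 3 * (x / Y) / (1 - x) + 2 / Y"
        unfolding B_def using nz by (simp add: divide_simps del: right_minus_eq)
      moreover have "x / Y = 1 / k" using Y0 by (simp add: x_def)
      ultimately have e: "2 / Y * B = 4 / 3 / k / (1 - x) + 2 / Y" by simp
      show ?thesis by (simp only: mult.assoc e)
    qed
    have "rh * (Y / 4 * (Y / (t * Y') - 1 / (1 - x))) \<le> (1 - rh) * B"
      using *(1) by (simp add: algebra_simps)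
    then have "Y' * (2 / Y) * (rh * (Y / 4 * (Y / (t * Y') - 1 / (1 - x)))) \<le> Y' * (2 / Y) * ((1 - rh) * B)"
      using Y'0 Y0 by (intro mult_left_mono) auto
    then have "rh * (Y' * (2 / Y) * (Y / 4 * (Y / (t * Y') - 1 / (1 - x)))) \<le> (1 - rh) * (Y' * (2 / Y) * B)"
      by (simp only: mult_ac)
    then show ?thesis unfolding e1 e2 .
  qed
  then have "G * (rh * (Y / t / 2 - Y' / (2 * (1 - x))) - (1 - rh) * (Y' * (4 / 3 / k / (1 - x) + 2 / Y))) \<le> 0"
    by (simp add: G_def mult_le_0_iff)
  with dq show "\<exists>y. (q has_real_derivative y) (at t) \<and> y \<le> 0" by blast
qed

end

section \<open>Two and three components\<close>

lemma elem_sym_bound: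
  fixes a b c s :: real
  assumes s: "s = a + b + c" "s \<le> 1" and pos: "0 < a" "0 < b" "0 < c"
  shows "(3 - s) * sqrt (a * b * c) \<le> (s - (a\<^sup>2 + b\<^sup>2 + c\<^sup>2)) * sqrt (s / 3)"
proof -
  define e where "e = a * b + b * c + c * a"
  have s0: "0 < s" using s pos by simp
  have e0: "0 < e" using pos by (simp add: e_def add_pos_pos)
  have N: "s - (a\<^sup>2 + b\<^sup>2 + c\<^sup>2) = s - s\<^sup>2 + 2 * e"
    by (simp add: s e_def power2_eq_square algebra_simps)
  \<comment> \<open>The variables stand for \<open>1 - z i\<close>. This identity and the one behind
    \<open>n1\<close> give Newton's inequalities for the elementary symmetric functions as sums of
    squares; the second one enters through the factor \<open>1 - s\<close>, which is nonnegative by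
    assumption.\<close>
  have "e\<^sup>2 - 3 * s * (a * b * c) = ((a * b - b * c)\<^sup>2 + (b * c - c * a)\<^sup>2 + (c * a - a * b)\<^sup>2) / 2"
    by (simp add: s e_def power2_eq_square field_simps)
  then have n2: "3 * s * (a * b * c) \<le> e\<^sup>2" by (smt (verit) sum_power2_ge_zero zero_le_power2 divide_nonneg_pos)
  have "s\<^sup>2 - 3 * e = ((a - b)\<^sup>2 + (b - c)\<^sup>2 + (c - a)\<^sup>2) / 2"
    by (simp add: s e_def power2_eq_square field_simps)
  then have n1: "3 * e \<le> s\<^sup>2" by (smt (verit) sum_power2_ge_zero zero_le_power2 divide_nonneg_pos)
  have "(1 - s) * (3 * e) \<le> (1 - s) * s\<^sup>2" using n1 s by (intro mult_left_mono) auto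
  then have key: "e * (3 - s) \<le> s * (s - s\<^sup>2 + 2 * e)"
    by (simp add: algebra_simps power2_eq_square)
  have "3 * s * ((3 - s) * sqrt (a * b * c))\<^sup>2 = (3 - s)\<^sup>2 * (3 * s * (a * b * c))"
    using pos by (simp add: power_mult_distrib)
  also have "\<dots> \<le> (3 - s)\<^sup>2 * e\<^sup>2" using n2 by (intro mult_left_mono) auto
  also have "\<dots> = (e * (3 - s))\<^sup>2" by (simp add: power_mult_distrib)
  also have "\<dots> \<le> (s * (s - s\<^sup>2 + 2 * e))\<^sup>2"
    using key e0 s by (intro power_mono) auto
  also have "\<dots> = 3 * s * ((s - s\<^sup>2 + 2 * e) * sqrt (s / 3))\<^sup>2"
    using s0 by (simp add: power_mult_distrib power2_eq_square)
  finally have "((3 - s) * sqrt (a * b * c))\<^sup>2 \<le> ((s - s\<^sup>2 + 2 * e) * sqrt (s / 3))\<^sup>2"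
    using s0 by simp
  moreover have "0 \<le> (s - s\<^sup>2 + 2 * e) * sqrt (s / 3)"
  proof -
    have "s * s \<le> s * 1" using s s0 by (intro mult_left_mono) auto
    then show ?thesis using e0 s0 by (intro mult_nonneg_nonneg) (auto simp: power2_eq_square)
  qed
  ultimately show ?thesis unfolding N by (rule power2_le_imp_le)
qed

lemma two_var_bound:
  fixes a b s :: real
  assumes s: "s = a + b" "s \<le> 2 / 3" and pos: "0 < a" "0 < b"
  shows "(2 - s) * sqrt (a * b) \<le> s - (a\<^sup>2 + b\<^sup>2)"
proof -
  define p where "p = sqrt (a * b)"
  have p2: "p\<^sup>2 = a * b" using pos by (simp add: p_def)
  have p: "p \<le> s / 2" using arith_geo_mean_sqrt[of a b] pos s by (simp add: p_def)
  \<comment> \<open>Expanding the product gives the claim. Its second factor is nonnegative because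
    \<open>p \<le> s / 2 \<le> 1 / 3 \<le> 1 - s\<close>; this is where 2/3 comes from.\<close>
  have "0 \<le> (s / 2 - p) * (1 - s - p)" using p s by (intro mult_nonneg_nonneg) auto
  then have "(2 - s) * p \<le> s - s\<^sup>2 + 2 * p\<^sup>2"
    by (simp add: field_simps power2_eq_square)
  also have "\<dots> = s - (a\<^sup>2 + b\<^sup>2)" unfolding p2 s by (simp add: power2_eq_square algebra_simps)
  finally show ?thesis by (simp add: p_def)
qed

context variances
begin

lemma Hexp_prod: "0 \<le> u \<Longrightarrow> Hexp I \<tau> u = sqrt (\<Prod>i\<in>I. 1 - u * \<tau> i / (1 + u * \<tau> i))"
proof -
  assume u: "0 \<le> u"
  have "(\<Prod>i\<in>I. 1 - u * \<tau> i / (1 + u * \<tau> i)) = (\<Prod>i\<in>I. exp (- ln (1 + u * \<tau> i)))"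
  proof (rule prod.cong[OF refl])
    fix i assume "i \<in> I"
    then have "0 < 1 + u * \<tau> i" using one_plus_pos u by simp
    then show "1 - u * \<tau> i / (1 + u * \<tau> i) = exp (- ln (1 + u * \<tau> i))"
      by (simp add: exp_minus divide_simps)
  qed
  also have "\<dots> = exp (- (\<Sum>i\<in>I. ln (1 + u * \<tau> i)))" by (simp add: exp_sum[OF fin, symmetric] sum_negf)
  also have "\<dots> = (Hexp I \<tau> u)\<^sup>2" by (simp add: Hexp_def exp_double[symmetric])
  finally show ?thesis using Hexp_pos[of u] by simp
qed

text \<open>Up to a positive factor, left side minus right side is the derivative in
  \<open>u\<close> of \<open>Hk k (ysum I \<tau> u) - Hexp I \<tau> u\<close> with
  \<open>k = card I\<close>, so the gap between the survival functions itself decreases. Both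
  thresholds, 4/3 and 2, are two thirds of the number of components.\<close>

lemma small_card_pointwise:
  assumes u: "0 < u" and c: "card I = 2 \<and> 4 / 3 \<le> ysum I \<tau> u \<or> card I = 3 \<and> 2 \<le> ysum I \<tau> u"
  shows "ysum I \<tau> u * Hexp I \<tau> u \<le> (\<Sum>i\<in>I. u * \<tau> i / (1 + u * \<tau> i) * (1 - u * \<tau> i / (1 + u * \<tau> i)))
            * (1 - ysum I \<tau> u / real (card I)) powr (real (card I) / 2 - 1)"
proof -
  define z where "z = (\<lambda>i. u * \<tau> i / (1 + u * \<tau> i))"
  have z: "0 < 1 - z i" if "i \<in> I" for i
    using one_plus_pos[of u i] u that by (simp add: z_def)
  have H: "Hexp I \<tau> u = sqrt (\<Prod>i\<in>I. 1 - z i)" using Hexp_prod u by (simp add: z_def)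
  have Y: "ysum I \<tau> u = (\<Sum>i\<in>I. z i)" by (simp add: ysum_def z_def)
  have "ysum I \<tau> u * Hexp I \<tau> u \<le> (\<Sum>i\<in>I. z i * (1 - z i)) * (1 - ysum I \<tau> u / real (card I)) powr (real (card I) / 2 - 1)"
    using c
  proof
    assume c: "card I = 2 \<and> 4 / 3 \<le> ysum I \<tau> u"
    then obtain i j where ij: "I = {i, j}" "i \<noteq> j" by (auto simp: card_2_iff)
    have y: "4 / 3 \<le> z i + z j" using c ij Y by simp
    have "(z i + z j) * sqrt ((1 - z i) * (1 - z j)) \<le> z i * (1 - z i) + z j * (1 - z j)"
      using two_var_bound[of "2 - (z i + z j)" "1 - z i" "1 - z j"] z ij y
      by (simp add: algebra_simps power2_eq_square)
    moreover have "(z i * (1 - z i) + z j * (1 - z j)) * (1 - (z i + z j) / 2) powr 0 = z i * (1 - z i) + z j * (1 - z j)"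
      using z[of i] z[of j] ij by (simp add: field_simps)
    moreover have "(\<Sum>i\<in>I. z i) = z i + z j" "(\<Prod>i\<in>I. 1 - z i) = (1 - z i) * (1 - z j)"
      "(\<Sum>i\<in>I. z i * (1 - z i)) = z i * (1 - z i) + z j * (1 - z j)"
      using ij by auto
    moreover have "real (card I) / 2 - 1 = 0" "real (card I) = 2" using c by auto
    ultimately show ?thesis by (simp only: Y H)
  next
    assume c: "card I = 3 \<and> 2 \<le> ysum I \<tau> u"
    then obtain i j l where ij: "I = {i, j, l}" "i \<noteq> j" "j \<noteq> l" "i \<noteq> l" by (auto simp: card_3_iff)
    have y: "2 \<le> z i + z j + z l" using c ij Y by (simp add: add.assoc)
    have zz: "0 < 1 - z i" "0 < 1 - z j" "0 < 1 - z l" using z ij by auto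
    have "(3 - (3 - (z i + z j + z l))) * sqrt ((1 - z i) * (1 - z j) * (1 - z l))
        \<le> ((3 - (z i + z j + z l)) - ((1 - z i)\<^sup>2 + (1 - z j)\<^sup>2 + (1 - z l)\<^sup>2)) * sqrt ((3 - (z i + z j + z l)) / 3)"
      using zz y by (intro elem_sym_bound) auto
    moreover have "3 - (3 - (z i + z j + z l)) = z i + z j + z l" by simp
    moreover have "(3 - (z i + z j + z l)) - ((1 - z i)\<^sup>2 + (1 - z j)\<^sup>2 + (1 - z l)\<^sup>2)
       = z i * (1 - z i) + z j * (1 - z j) + z l * (1 - z l)"
      by (simp add: algebra_simps power2_eq_square)
    moreover have "(3 - (z i + z j + z l)) / 3 = 1 - (z i + z j + z l) / 3" by (simp add: field_simps)
    moreover have "(1 - (z i + z j + z l) / 3) powr (1 / 2) = sqrt (1 - (z i + z j + z l) / 3)"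
      using zz by (intro powr_half_sqrt) simp
    ultimately have "(z i + z j + z l) * sqrt ((1 - z i) * (1 - z j) * (1 - z l))
      \<le> (z i * (1 - z i) + z j * (1 - z j) + z l * (1 - z l)) * (1 - (z i + z j + z l) / 3) powr (1 / 2)" by (simp only:)
    moreover have "(\<Sum>i\<in>I. z i) = z i + z j + z l" "(\<Prod>i\<in>I. 1 - z i) = (1 - z i) * (1 - z j) * (1 - z l)"
      "(\<Sum>i\<in>I. z i * (1 - z i)) = z i * (1 - z i) + z j * (1 - z j) + z l * (1 - z l)"
      using ij by auto
    moreover have "real (card I) / 2 - 1 = 1 / 2" "real (card I) = 3" using c by auto
    ultimately show ?thesis by (simp only: Y H)
  qed
  then show ?thesis by (simp add: z_def)
qed

end

section \<open>Abel's inversion\<close>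

text \<open>The kernel of the half-derivative that recovers tail probabilities of the self-normalised
  sum from survival functions; \<open>tail_weight r\<close> is minus its derivative.\<close>
definition tail_kernel :: "real \<Rightarrow> real \<Rightarrow> real" where
  "tail_kernel r y = (if r < y then 1 / (y * sqrt (y - r)) else 0)"

definition tail_weight :: "real \<Rightarrow> real \<Rightarrow> real" where
  "tail_weight r y = (if r < y then 1 / (y\<^sup>2 * sqrt (y - r)) + 1 / (2 * y * sqrt (y - r) ^ 3) else 0)"

lemma tail_kernel_nonneg: "0 < r \<Longrightarrow> 0 \<le> tail_kernel r y"
  by (simp add: tail_kernel_def)

lemma tail_weight_nonneg: "0 < r \<Longrightarrow> 0 \<le> tail_weight r y"
  by (simp add: tail_weight_def)

lemma tail_kernel_measurable[measurable]: "tail_kernel r \<in> borel_measurable borel"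
  unfolding tail_kernel_def[abs_def] by measurable

lemma tail_weight_measurable[measurable]: "tail_weight r \<in> borel_measurable borel"
  unfolding tail_weight_def[abs_def] by measurable

lemma tail_kernel_eq:
  assumes "0 < r"
  shows "ennreal (tail_kernel r s) = (\<integral>\<^sup>+y. ennreal (tail_weight r y) * indicator {y. r < s \<and> s \<le> y} y \<partial>lborel)"
proof (cases "r < s")
  case True
  have "(\<integral>\<^sup>+y. ennreal (tail_weight r y) * indicator {s ..} y \<partial>lborel) = ennreal (0 - (- tail_kernel r s))"
  proof (rule nn_integral_FTC_atLeast)
    show "tail_weight r \<in> borel_measurable borel" by simp
    show "0 \<le> tail_weight r x" for x using tail_weight_nonneg assms by blast
    show "((\<lambda>y. - tail_kernel r y) has_real_derivative tail_weight r x) (at x)" if "s \<le> x" for x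
    proof -
      have rx: "r < x" using that True by simp
      have nz: "x - r \<noteq> 0" "0 < x - r" "x \<noteq> 0" "sqrt (x - r) \<noteq> 0" "x * sqrt (x - r) \<noteq> 0" using rx assms by auto
      define S where "S = sqrt (x - r)"
      have S: "S \<noteq> 0" using nz by (simp add: S_def)
      have "((\<lambda>y. - (1 / (y * sqrt (y - r)))) has_real_derivative tail_weight r x) (at x)"
      proof -
        have dS: "((\<lambda>y. sqrt (y - r)) has_real_derivative 1 / (2 * S)) (at x)"
          using nz by (auto intro!: derivative_eq_intros simp: S_def inverse_eq_divide)
        have d: "((\<lambda>y. - (1 / (y * sqrt (y - r)))) has_real_derivative
            - ((0 * (x * sqrt (x - r)) - 1 * (1 * sqrt (x - r) + 1 / (2 * S) * x)) / (x * sqrt (x - r) * (x * sqrt (x - r))))) (at x)"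
          using nz by (intro DERIV_minus DERIV_divide DERIV_const DERIV_mult dS DERIV_ident) auto
        show ?thesis
          by (rule DERIV_cong[OF d])
             (use rx S nz in \<open>simp add: tail_weight_def S_def[symmetric] divide_simps power2_eq_square power3_eq_cube\<close>)
      qed
      then show ?thesis
        by (rule has_field_derivative_transform_within_open[where S = "{r<..}"])
          (use rx in \<open>auto simp: tail_kernel_def\<close>)
    qed
    have "((\<lambda>y. - (1 / (y * sqrt (y - r)))) \<longlongrightarrow> 0) at_top" by real_asymp
    then show "((\<lambda>y. - tail_kernel r y) \<longlongrightarrow> 0) at_top"
      by (rule Lim_transform_eventually)
         (use eventually_gt_at_top[of r] in eventually_elim, simp add: tail_kernel_def)
  qed
  moreover have "(\<lambda>y. indicator {y. r < s \<and> s \<le> y} y :: ennreal) = indicator {s ..}"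
    using True by (auto simp: indicator_def fun_eq_iff)
  ultimately show ?thesis by simp
next
  case False
  then show ?thesis by (simp add: tail_kernel_def)
qed

text \<open>Layer-cake formula: the decreasing kernel is an integral of indicators with weight
  \<open>tail_weight\<close>, so kernel integrals can be compared through the masses of the
  intervals \<open>{r<..y}\<close>, which are differences of survival functions.\<close>

lemma tail_kernel_integral:
  assumes r: "0 < r" and \<mu>: "sigma_finite_measure \<mu>" and [measurable_cong]: "sets \<mu> = sets borel"
  shows "(\<integral>\<^sup>+s. ennreal (tail_kernel r s) \<partial>\<mu>) = (\<integral>\<^sup>+y. ennreal (tail_weight r y) * emeasure \<mu> {r<..y} \<partial>lborel)"
proof -
  interpret \<mu>: sigma_finite_measure \<mu> by fact
  interpret P: pair_sigma_finite \<mu> lborel ..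
  have m: "(\<lambda>(s, y). ennreal (tail_weight r y) * indicator {y. r < s \<and> s \<le> y} y) \<in> borel_measurable (\<mu> \<Otimes>\<^sub>M lborel)"
    by measurable
  have "(\<integral>\<^sup>+s. ennreal (tail_kernel r s) \<partial>\<mu>) =
     (\<integral>\<^sup>+s. (\<integral>\<^sup>+y. ennreal (tail_weight r y) * indicator {y. r < s \<and> s \<le> y} y \<partial>lborel) \<partial>\<mu>)"
    using tail_kernel_eq[OF r] by simp
  also have "\<dots> = (\<integral>\<^sup>+y. (\<integral>\<^sup>+s. ennreal (tail_weight r y) * indicator {y. r < s \<and> s \<le> y} y \<partial>\<mu>) \<partial>lborel)"
    using P.Fubini'[OF m] by simp
  also have "\<dots> = (\<integral>\<^sup>+y. ennreal (tail_weight r y) * emeasure \<mu> {r<..y} \<partial>lborel)"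
  proof (rule nn_integral_cong)
    fix y :: real
    have "(\<integral>\<^sup>+s. ennreal (tail_weight r y) * indicator {y. r < s \<and> s \<le> y} y \<partial>\<mu>)
       = (\<integral>\<^sup>+s. ennreal (tail_weight r y) * indicator {r<..y} s \<partial>\<mu>)"
      by (intro nn_integral_cong) (auto simp: indicator_def)
    also have "\<dots> = ennreal (tail_weight r y) * emeasure \<mu> {r<..y}"
      by (rule nn_integral_cmult_indicator) simp
    finally show "(\<integral>\<^sup>+s. ennreal (tail_weight r y) * indicator {y. r < s \<and> s \<le> y} y \<partial>\<mu>) = ennreal (tail_weight r y) * emeasure \<mu> {r<..y}" .
  qed
  finally show ?thesis .
qed

text \<open>\<open>\<nu>\<close> and \<open>\<nu>'\<close> serve to carry the two parts of a signed
  density, a multiple of the derivative of the comparison function, so that all terms stay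
  nonnegative. Finiteness for \<open>\<nu>'\<close> permits the cancellation at the end.\<close>

lemma tail_kernel_compare:
  assumes r: "0 < r"
    and s1: "sigma_finite_measure \<mu>" "sets \<mu> = sets borel" and s2: "sigma_finite_measure \<mu>'" "sets \<mu>' = sets borel"
    and t1: "sigma_finite_measure \<nu>" "sets \<nu> = sets borel" and t2: "sigma_finite_measure \<nu>'" "sets \<nu>' = sets borel"
    and le: "\<And>y. r < y \<Longrightarrow> emeasure \<mu> {r<..y} + emeasure \<nu> {r<..y} \<le> emeasure \<mu>' {r<..y} + emeasure \<nu>' {r<..y}"
    and nu: "(\<integral>\<^sup>+s. ennreal (tail_kernel r s) \<partial>\<nu>') \<le> (\<integral>\<^sup>+s. ennreal (tail_kernel r s) \<partial>\<nu>)"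
    and fin: "(\<integral>\<^sup>+s. ennreal (tail_kernel r s) \<partial>\<nu>') < \<infinity>"
  shows "(\<integral>\<^sup>+s. ennreal (tail_kernel r s) \<partial>\<mu>) \<le> (\<integral>\<^sup>+s. ennreal (tail_kernel r s) \<partial>\<mu>')"
proof -
  let ?I = "\<lambda>\<mu>. \<integral>\<^sup>+s. ennreal (tail_kernel r s) \<partial>\<mu>"
  have m: "(\<lambda>y. emeasure \<mu> {r<..y}) \<in> borel_measurable lborel"
    if "sigma_finite_measure \<mu>" and [measurable_cong]: "sets \<mu> = sets borel" for \<mu> :: "real measure"
  proof -
    interpret sigma_finite_measure \<mu> by fact
    have "(\<lambda>y. \<integral>\<^sup>+s. (if r < s \<and> s \<le> y then 1 else 0) \<partial>\<mu>) \<in> borel_measurable lborel"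
      by measurable
    moreover have "(\<integral>\<^sup>+s. (if r < s \<and> s \<le> y then 1 else 0) \<partial>\<mu>) = emeasure \<mu> {r<..y}" for y
    proof -
      have "(\<integral>\<^sup>+s. (if r < s \<and> s \<le> y then 1 else 0) \<partial>\<mu>) = (\<integral>\<^sup>+s. indicator {r<..y} s \<partial>\<mu>)"
        by (intro nn_integral_cong) (auto simp: indicator_def)
      then show ?thesis using that(2) by simp
    qed
    ultimately show ?thesis by simp
  qed
  note ms = m[OF s1] m[OF s2] m[OF t1] m[OF t2]
  note eq = tail_kernel_integral[OF r]
  have "?I \<mu> + ?I \<nu> \<le> ?I \<mu>' + ?I \<nu>'"
    unfolding eq[OF s1] eq[OF s2] eq[OF t1] eq[OF t2]
  proof (subst (1 2) nn_integral_add[symmetric])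
    show "(\<integral>\<^sup>+y. ennreal (tail_weight r y) * emeasure \<mu> {r<..y} + ennreal (tail_weight r y) * emeasure \<nu> {r<..y} \<partial>lborel)
     \<le> (\<integral>\<^sup>+y. ennreal (tail_weight r y) * emeasure \<mu>' {r<..y} + ennreal (tail_weight r y) * emeasure \<nu>' {r<..y} \<partial>lborel)"
      unfolding distrib_left[symmetric]
    proof (rule nn_integral_mono)
      fix y
      show "ennreal (tail_weight r y) * (emeasure \<mu> {r<..y} + emeasure \<nu> {r<..y})
        \<le> ennreal (tail_weight r y) * (emeasure \<mu>' {r<..y} + emeasure \<nu>' {r<..y})"
        by (cases "r < y") (use le[of y] in \<open>auto intro!: mult_left_mono\<close>)
    qed
  qed (use ms in measurable)
  with add_left_mono[OF nu, of "?I \<mu>"] have "?I \<mu> + ?I \<nu>' \<le> ?I \<mu>' + ?I \<nu>'"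
    by (rule order_trans)
  then have "?I \<nu>' + ?I \<mu> \<le> ?I \<nu>' + ?I \<mu>'" by (simp only: add.commute)
  then show ?thesis using fin by (auto simp: ennreal_add_left_cancel_le)
qed

lemma nn_integral_has_integral_set:
  fixes f :: "real \<Rightarrow> real"
  assumes I: "(f has_integral I) S" and [measurable]: "f \<in> borel_measurable borel" "S \<in> sets borel"
    and nn: "\<And>x. x \<in> S \<Longrightarrow> 0 \<le> f x"
  shows "(\<integral>\<^sup>+x. ennreal (f x) * indicator S x \<partial>lborel) = ennreal I"
proof -
  have "(\<integral>\<^sup>+x. ennreal (if x \<in> S then f x else 0) \<partial>lborel) = ennreal I"
  proof (rule nn_integral_has_integral_lborel)
    show "((\<lambda>x. if x \<in> S then f x else 0) has_integral I) UNIV"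
      using I by (simp only: has_integral_restrict_UNIV)
  qed (use nn in auto)
  moreover have "(\<integral>\<^sup>+x. ennreal (f x) * indicator S x \<partial>lborel)
    = (\<integral>\<^sup>+x. ennreal (if x \<in> S then f x else 0) \<partial>lborel)"
    by (intro nn_integral_cong) (auto simp: indicator_def)
  ultimately show ?thesis by simp
qed

section \<open>Moments determine a law with bounded support\<close>

lemma char_sums_moments:
  assumes M: "real_distribution M" and K: "AE x in M. \<bar>x\<bar> \<le> K"
  shows "(\<lambda>n. (\<i> * of_real t) ^ n / of_nat (fact n) * complex_of_real (\<integral>x. x ^ n \<partial>M)) sums char M t"
proof -
  interpret real_distribution M by fact
  define f where "f = (\<lambda>n x. (\<i> * of_real t * complex_of_real x) ^ n /\<^sub>R fact n)"
  have fm[measurable]: "f n \<in> borel_measurable M" for n unfolding f_def by measurable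
  \<comment> \<open>The bound \<open>K\<close> makes the exponential series absolutely integrable,
    so the characteristic function is a power series in the moments.\<close>
  have bnd: "AE x in M. norm (f n x) \<le> (\<bar>t\<bar> * K) ^ n / fact n" for n
    using K
  proof eventually_elim
    case (elim x)
    have "\<bar>t * x\<bar> ^ n \<le> (\<bar>t\<bar> * K) ^ n"
      using elim by (intro power_mono) (auto simp: abs_mult intro: mult_left_mono)
    then show ?case
      by (simp add: f_def norm_power norm_mult abs_mult divide_simps)
  qed
  have int: "integrable M (f n)" for n
    by (rule integrable_const_bound[OF bnd]) simp
  have "(\<lambda>n. integral\<^sup>L M (f n)) sums (\<integral>x. (\<Sum>n. f n x) \<partial>M)"
  proof (rule sums_integral[OF int])
    show "AE x in M. summable (\<lambda>n. norm (f n x))"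
    proof (rule AE_I2)
      fix x
      have "summable (\<lambda>n. norm ((\<i> * of_real t * complex_of_real x) ^ n /\<^sub>R fact n))"
        by (rule summable_norm_exp)
      then show "summable (\<lambda>n. norm (f n x))" by (simp add: f_def)
    qed
    show "summable (\<lambda>n. \<integral>x. norm (f n x) \<partial>M)"
    proof (rule summable_comparison_test)
      have "(\<integral>x. norm (f n x) \<partial>M) \<le> (\<bar>t\<bar> * K) ^ n / fact n" for n
        using integral_mono_AE[OF integrable_norm[OF int] _ bnd, of n] prob_space by simp
      then show "\<exists>N. \<forall>n\<ge>N. norm (\<integral>x. norm (f n x) \<partial>M) \<le> (\<bar>t\<bar> * K) ^ n / fact n" by simp
      show "summable (\<lambda>n. (\<bar>t\<bar> * K) ^ n / fact n)"
        using summable_exp_generic[of "\<bar>t\<bar> * K"] by (simp add: divide_inverse mult.commute)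
    qed
  qed
  also have "(\<integral>x. (\<Sum>n. f n x) \<partial>M) = char M t"
    unfolding char_def
  proof (rule Bochner_Integration.integral_cong[OF refl])
    fix x
    have "(\<lambda>n. f n x) sums exp (\<i> * of_real t * complex_of_real x)" unfolding f_def by (rule exp_converges)
    then show "(\<Sum>n. f n x) = iexp (t * x)" by (simp add: sums_iff mult.assoc)
  qed
  also have "(\<lambda>n. integral\<^sup>L M (f n)) = (\<lambda>n. (\<i> * of_real t) ^ n / of_nat (fact n) * complex_of_real (\<integral>x. x ^ n \<partial>M))"
  proof
    fix n
    have "f n = (\<lambda>x. (\<i> * of_real t) ^ n / of_nat (fact n) * complex_of_real (x ^ n))"
      by (auto simp: f_def power_mult_distrib scaleR_conv_of_real divide_inverse)
    then show "integral\<^sup>L M (f n) = (\<i> * of_real t) ^ n / of_nat (fact n) * complex_of_real (\<integral>x. x ^ n \<partial>M)"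
      by (simp del: of_real_power)
  qed
  finally show ?thesis .
qed

lemma bounded_moments_unique:
  assumes "real_distribution M1" "real_distribution M2"
    and "AE x in M1. \<bar>x\<bar> \<le> K" "AE x in M2. \<bar>x\<bar> \<le> K"
    and "\<And>n. (\<integral>x. x ^ n \<partial>M1) = (\<integral>x. x ^ n \<partial>M2)"
  shows "M1 = M2"
proof (rule Levy_uniqueness[OF assms(1,2)])
  show "char M1 = char M2"
  proof
    fix t
    show "char M1 t = char M2 t"
      using char_sums_moments[OF assms(1,3), of t] char_sums_moments[OF assms(2,4), of t]
      unfolding assms(5) by (rule sums_unique2)
  qed
qed

section \<open>Inverting multiplication by a Beta(1, 1/2) variable\<close>

lemma arcsine_integral:
  fixes v :: real
  assumes v: "0 < v" "v < 1"
  shows "(\<integral>\<^sup>+b. ennreal (1 / (b * sqrt ((b - v) * (1 - b)))) * indicator {v<..<1} b \<partial>lborel) = ennreal (pi / sqrt v)"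
proof -
  \<comment> \<open>A Moebius map with value -1 at \<open>v\<close> and 1 at 1, for which
    \<open>1 - (g b)\<^sup>2\<close> is proportional to
    \<open>(b - v) * (1 - b) / b\<^sup>2\<close>; hence \<open>arcsin (g b)\<close> is an
    antiderivative up to a constant factor.\<close>
  define g where "g = (\<lambda>b. ((1 + v) * b - 2 * v) / ((1 - v) * b))"
  have gb: "\<bar>g b\<bar> \<le> 1" if "v \<le> b" "b \<le> 1" for b
  proof -
    have b0: "0 < b" using that v by simp
    have "(1 + v) * b - 2 * v \<le> (1 - v) * b" using mult_left_mono[of b 1 v] that v by (simp add: algebra_simps)
    moreover have "- ((1 - v) * b) \<le> (1 + v) * b - 2 * v" using that by (simp add: algebra_simps)
    ultimately show ?thesis using v b0 by (simp add: g_def abs_le_iff pos_divide_le_eq pos_le_divide_eq minus_le_iff[of "_ / _"])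
  qed
  have sq: "1 - (g b)\<^sup>2 = 4 * v * ((b - v) * (1 - b)) / ((1 - v) * b)\<^sup>2" if "v < b" for b
  proof -
    have nz: "(1 - v) * b \<noteq> 0" using v that by auto
    have "1 - (g b)\<^sup>2 = (((1 - v) * b)\<^sup>2 - ((1 + v) * b - 2 * v)\<^sup>2) / ((1 - v) * b)\<^sup>2"
    proof -
      have "1 - (n / d)\<^sup>2 = (d\<^sup>2 - n\<^sup>2) / d\<^sup>2" if "d \<noteq> 0" for n d :: real
        using that by (simp add: power_divide diff_divide_distrib)
      from this[OF nz] show ?thesis by (simp only: g_def)
    qed
    also have "((1 - v) * b)\<^sup>2 - ((1 + v) * b - 2 * v)\<^sup>2 = 4 * v * ((b - v) * (1 - b))"
      by (simp add: power2_eq_square algebra_simps)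
    finally show ?thesis .
  qed
  have hi: "((\<lambda>b. 1 / (b * sqrt ((b - v) * (1 - b)))) has_integral (arcsin (g 1) / sqrt v - arcsin (g v) / sqrt v)) {v..1}"
  proof (rule fundamental_theorem_of_calculus_interior)
    show "v \<le> 1" using v by simp
    have "continuous_on {v..1} g" unfolding g_def using v by (intro continuous_intros) auto
    then show "continuous_on {v..1} (\<lambda>b. arcsin (g b) / sqrt v)"
      using gb v by (intro continuous_on_divide continuous_on_arcsin continuous_on_const) (auto simp: abs_le_iff minus_le_iff)
    fix b assume b: "b \<in> {v<..<1}"
    then have bb: "v < b" "b < 1" "0 < b" using v by auto
    have pos: "0 < 1 - (g b)\<^sup>2" unfolding sq[OF bb(1)] using bb v by (intro divide_pos_pos mult_pos_pos) auto
    then have g1: "- 1 < g b" "g b < 1" by (auto simp: abs_square_less_1 abs_less_iff)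
    define Q where "Q = sqrt ((b - v) * (1 - b))"
    have Q: "0 < Q" using bb by (simp add: Q_def)
    have "sqrt (1 - (g b)\<^sup>2) = 2 * sqrt v * Q / ((1 - v) * b)"
      unfolding sq[OF bb(1)] using v bb by (simp add: real_sqrt_divide real_sqrt_mult Q_def)
    moreover have "(g has_real_derivative 2 * v / ((1 - v) * b\<^sup>2)) (at b)"
    proof -
      have nz: "(1 - v) * b \<noteq> 0" "1 - v \<noteq> 0" "b \<noteq> 0" using v bb by auto
      show ?thesis unfolding g_def
        apply (rule DERIV_cong)
         apply (rule derivative_intros nz)+
        using nz by (simp add: divide_simps del: right_minus_eq) algebra
    qed
    ultimately have "((\<lambda>b. arcsin (g b) / sqrt v) has_real_derivative
       inverse (2 * sqrt v * Q / ((1 - v) * b)) * (2 * v / ((1 - v) * b\<^sup>2)) / sqrt v) (at b)"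
      using DERIV_cdivide[OF DERIV_chain'[where g = arcsin and f = g, OF _ DERIV_arcsin[OF g1]]] by metis
    moreover have "inverse (2 * sqrt v * Q / ((1 - v) * b)) * (2 * v / ((1 - v) * b\<^sup>2)) / sqrt v = 1 / (b * Q)"
    proof -
      define w where "w = sqrt v"
      then have w: "w = sqrt v" "v = w * w" "w \<noteq> 0" using v by simp_all
      have nz: "1 - v \<noteq> 0" "b \<noteq> 0" "Q \<noteq> 0" using v bb Q by auto
      show ?thesis using nz w(3) unfolding w(1)[symmetric]
        by (simp add: divide_simps power2_eq_square w(2) del: right_minus_eq)
    qed
    ultimately show "((\<lambda>b. arcsin (g b) / sqrt v) has_vector_derivative 1 / (b * sqrt ((b - v) * (1 - b)))) (at b)"
      by (simp add: has_real_derivative_iff_has_vector_derivative[symmetric] Q_def)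
  qed
  have "g 1 = 1" "g v = -1" using v by (auto simp: g_def field_simps)
  then have "((\<lambda>b. 1 / (b * sqrt ((b - v) * (1 - b)))) has_integral (pi / sqrt v)) {v..1}"
    using hi by (simp add: add_divide_distrib[symmetric])
  then have hi2: "((\<lambda>b. 1 / (b * sqrt ((b - v) * (1 - b)))) has_integral (pi / sqrt v)) {v<..<1}"
    by (simp add: has_integral_Icc_iff_Ioo)
  show ?thesis
    by (rule nn_integral_has_integral_set[OF hi2]) (use v in auto)
qed

text \<open>The moment of order \<open>n\<close> of a Beta(1, 1/2) variable, whose density is
  \<open>1 / (2 * sqrt (1 - b))\<close> because \<open>Beta 1 (1 / 2) = 2\<close>.\<close>

definition beta_mom :: "nat \<Rightarrow> real" where
  "beta_mom n = Beta (real n + 1) (1 / 2) / 2"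

lemma beta_mom_integral:
  "(\<integral>\<^sup>+b. ennreal (b ^ n * (1 / (2 * sqrt (1 - b)))) * indicator {0<..<1} b \<partial>lborel) = ennreal (beta_mom n)"
proof -
  have "((\<lambda>t. t powr (real n + 1 - 1) * (1 - t) powr (1 / 2 - 1)) has_integral Beta (real n + 1) (1 / 2)) {0..1}"
    by (rule has_integral_Beta_real) auto
  then have "((\<lambda>t. t powr (real n + 1 - 1) * (1 - t) powr (1 / 2 - 1)) has_integral Beta (real n + 1) (1 / 2)) {0<..<1}"
    by (simp add: has_integral_Icc_iff_Ioo)
  then have "((\<lambda>t. (t powr (real n + 1 - 1) * (1 - t) powr (1 / 2 - 1)) / 2) has_integral beta_mom n) {0<..<1}"
    unfolding beta_mom_def by (rule has_integral_divide)
  then have h: "((\<lambda>b. b ^ n * (1 / (2 * sqrt (1 - b)))) has_integral beta_mom n) {0<..<1}"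
  proof (rule has_integral_eq[rotated])
    fix t :: real assume "t \<in> {0<..<1}"
    then have t: "0 < t" "0 < 1 - t" by auto
    then have "(1 - t) powr (1 / 2 - 1) = 1 / sqrt (1 - t)"
      by (simp add: powr_minus powr_half_sqrt divide_simps flip: powr_half_sqrt)
    then show "t powr (real n + 1 - 1) * (1 - t) powr (1 / 2 - 1) / 2 = t ^ n * (1 / (2 * sqrt (1 - t)))"
      using t by (simp add: powr_realpow)
  qed
  show ?thesis
    by (rule nn_integral_has_integral_set[OF h]) auto
qed

lemma beta_mom_pos: "0 < beta_mom n"
  by (simp add: beta_mom_def Beta_def Gamma_real_pos)

lemma nn_moments_unique:
  fixes M1 M2 :: "real measure"
  assumes M1: "sets M1 = sets borel" "AE x in M1. 0 \<le> x \<and> x \<le> K"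
    and M2: "sets M2 = sets borel" "AE x in M2. 0 \<le> x \<and> x \<le> K"
    and P: "prob_space M1"
    and eq: "\<And>n. (\<integral>\<^sup>+x. ennreal (x ^ n) \<partial>M1) = (\<integral>\<^sup>+x. ennreal (x ^ n) \<partial>M2)"
  shows "M1 = M2"
proof (rule bounded_moments_unique)
  interpret P1: prob_space M1 by fact
  have s: "space M1 = UNIV" "space M2 = UNIV" using sets_eq_imp_space_eq[OF M1(1)] sets_eq_imp_space_eq[OF M2(1)] by simp_all
  \<comment> \<open>That \<open>M2\<close> has total mass one is the equality of the moments of
    order zero.\<close>
  have P2: "prob_space M2"
    using eq[of 0] P1.emeasure_space_1 by (intro prob_spaceI) simp
  show "real_distribution M1" using P M1 by (simp add: real_distribution_def real_distribution_axioms_def)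
  show "real_distribution M2" using P2 M2 by (simp add: real_distribution_def real_distribution_axioms_def)
  show "AE x in M1. \<bar>x\<bar> \<le> K" using M1(2) by eventually_elim auto
  show "AE x in M2. \<bar>x\<bar> \<le> K" using M2(2) by eventually_elim auto
  fix n
  note [measurable_cong] = M1(1) M2(1)
  have [measurable]: "(\<lambda>x. x ^ n) \<in> borel_measurable M1" "(\<lambda>x. x ^ n) \<in> borel_measurable M2"
    by measurable
  have "(\<integral>x. x ^ n \<partial>M1) = enn2real (\<integral>\<^sup>+x. ennreal (x ^ n) \<partial>M1)"
    by (rule integral_eq_nn_integral) (use M1(2) in auto)
  moreover have "(\<integral>x. x ^ n \<partial>M2) = enn2real (\<integral>\<^sup>+x. ennreal (x ^ n) \<partial>M2)"
    by (rule integral_eq_nn_integral) (use M2(2) in auto)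
  ultimately show "(\<integral>x. x ^ n \<partial>M1) = (\<integral>x. x ^ n \<partial>M2)" using eq by simp
qed

text \<open>If the moments of \<open>\<mu>\<close> are those of \<open>R B\<close>, where \<open>R\<close> has the size-biased law of \<open>\<rho>\<close> and \<open>B\<close> is an
  independent Beta(1, 1/2) variable, then Abel's inversion expresses the tails of \<open>\<rho>\<close> through \<open>\<mu>\<close>.\<close>
lemma abel_tail:
  assumes \<rho>: "prob_space \<rho>" and [measurable_cong]: "sets \<rho> = sets borel" and \<rho>K: "AE x in \<rho>. 0 \<le> x \<and> x \<le> K"
    and \<mu>: "prob_space \<mu>" and sm: "sets \<mu> = sets borel" and \<mu>K: "AE x in \<mu>. 0 \<le> x \<and> x \<le> K"
    and mom: "\<And>n. (\<integral>\<^sup>+x. ennreal (x ^ Suc n) \<partial>\<rho>) * ennreal (beta_mom n) = (\<integral>\<^sup>+x. ennreal (x ^ n) \<partial>\<mu>)"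
    and r: "0 < r"
  shows "(\<integral>\<^sup>+s. ennreal (tail_kernel r s) \<partial>\<mu>) = ennreal (pi / (2 * sqrt r)) * emeasure \<rho> {r<..}"
proof -
  interpret \<rho>: prob_space \<rho> by fact
  interpret P: pair_sigma_finite \<rho> lborel ..
  \<comment> \<open>The factor \<open>x\<close> size-biases the first coordinate, the rest is the
    Beta(1, 1/2) density of the second. The image under multiplication is a candidate for
    \<open>\<mu>\<close>, identified below by its moments.\<close>
  define w where "w = (\<lambda>(x::real, b::real). ennreal x * (ennreal (1 / (2 * sqrt (1 - b))) * indicator {0<..<1} b))"
  have wm[measurable]: "w \<in> borel_measurable (\<rho> \<Otimes>\<^sub>M lborel)"
    unfolding w_def by measurable
  define \<mu>' where "\<mu>' = distr (density (\<rho> \<Otimes>\<^sub>M lborel) w) borel (\<lambda>p. fst p * snd p)"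
  have int: "(\<integral>\<^sup>+s. g s \<partial>\<mu>') = (\<integral>\<^sup>+x. ennreal x * (\<integral>\<^sup>+b. g (x * b) * (ennreal (1 / (2 * sqrt (1 - b))) * indicator {0<..<1} b) \<partial>lborel) \<partial>\<rho>)"
    if [measurable]: "g \<in> borel_measurable borel" for g
  proof -
    have "(\<integral>\<^sup>+s. g s \<partial>\<mu>') = (\<integral>\<^sup>+p. w p * g (fst p * snd p) \<partial>(\<rho> \<Otimes>\<^sub>M lborel))"
      unfolding \<mu>'_def by (subst nn_integral_distr, measurable, subst nn_integral_density, measurable)
    also have "\<dots> = (\<integral>\<^sup>+x. (\<integral>\<^sup>+b. w (x, b) * g (x * b) \<partial>lborel) \<partial>\<rho>)"
      by (subst lborel.nn_integral_fst[symmetric]) simp_all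
    also have "\<dots> = (\<integral>\<^sup>+x. ennreal x * (\<integral>\<^sup>+b. g (x * b) * (ennreal (1 / (2 * sqrt (1 - b))) * indicator {0<..<1} b) \<partial>lborel) \<partial>\<rho>)"
      by (subst nn_integral_cmult[symmetric]) (auto simp: w_def mult_ac)
    finally show ?thesis .
  qed
  have "\<mu> = \<mu>'"
  proof (rule nn_moments_unique[OF sm \<mu>K _ _ \<mu>])
    show "sets \<mu>' = sets borel" by (simp add: \<mu>'_def)
    have "AE x in \<rho>. AE b in lborel. 0 \<le> x \<and> x \<le> K"
      using \<rho>K by eventually_elim simp
    moreover have "{p \<in> space (\<rho> \<Otimes>\<^sub>M lborel). 0 \<le> fst p \<and> fst p \<le> K} \<in> sets (\<rho> \<Otimes>\<^sub>M lborel)"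
      by measurable
    ultimately have "AE p in \<rho> \<Otimes>\<^sub>M lborel. 0 \<le> fst p \<and> fst p \<le> K"
      using P.AE_pair_iff[of "\<lambda>x b. 0 \<le> x \<and> x \<le> K"] by blast
    then have "AE p in \<rho> \<Otimes>\<^sub>M lborel. w p > 0 \<longrightarrow> 0 \<le> fst p * snd p \<and> fst p * snd p \<le> K"
    proof eventually_elim
      case (elim p)
      have "fst p * snd p \<le> K * 1" if "0 < snd p" "snd p < 1" using elim that by (intro mult_mono) auto
      then show ?case using elim by (auto simp: w_def indicator_def split: prod.splits if_splits)
    qed
    then show "AE x in \<mu>'. 0 \<le> x \<and> x \<le> K"
      unfolding \<mu>'_def by (subst AE_distr_iff) (auto simp: AE_density case_prod_beta)
  next
    fix n
    have "(\<integral>\<^sup>+s. ennreal (s ^ n) \<partial>\<mu>') = (\<integral>\<^sup>+x. ennreal x * (\<integral>\<^sup>+b. ennreal ((x * b) ^ n) * (ennreal (1 / (2 * sqrt (1 - b))) * indicator {0<..<1} b) \<partial>lborel) \<partial>\<rho>)"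
      by (rule int) simp
    also have "\<dots> = (\<integral>\<^sup>+x. ennreal (x ^ Suc n) * ennreal (beta_mom n) \<partial>\<rho>)"
    proof (rule nn_integral_cong_AE, use \<rho>K in eventually_elim)
      fix x assume x: "0 \<le> x \<and> x \<le> K"
      have "(\<integral>\<^sup>+b. ennreal ((x * b) ^ n) * (ennreal (1 / (2 * sqrt (1 - b))) * indicator {0<..<1} b) \<partial>lborel)
         = (\<integral>\<^sup>+b. ennreal (x ^ n) * (ennreal (b ^ n * (1 / (2 * sqrt (1 - b)))) * indicator {0<..<1} b) \<partial>lborel)"
        using x by (intro nn_integral_cong) (auto simp: indicator_def power_mult_distrib ennreal_mult[symmetric] mult_ac)
      also have "\<dots> = ennreal (x ^ n) * ennreal (beta_mom n)"
        by (subst nn_integral_cmult, measurable, simp only: beta_mom_integral)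
      finally show "ennreal x * (\<integral>\<^sup>+b. ennreal ((x * b) ^ n) * (ennreal (1 / (2 * sqrt (1 - b))) * indicator {0<..<1} b) \<partial>lborel)
         = ennreal (x ^ Suc n) * ennreal (beta_mom n)"
        using x by (simp add: ennreal_mult mult.assoc)
    qed
    also have "\<dots> = (\<integral>\<^sup>+x. ennreal (x ^ n) \<partial>\<mu>)"
      by (subst nn_integral_multc) (auto simp: mom[symmetric])
    finally show "(\<integral>\<^sup>+s. ennreal (s ^ n) \<partial>\<mu>) = (\<integral>\<^sup>+s. ennreal (s ^ n) \<partial>\<mu>')" by simp
  qed
  then have "(\<integral>\<^sup>+s. ennreal (tail_kernel r s) \<partial>\<mu>) = (\<integral>\<^sup>+s. ennreal (tail_kernel r s) \<partial>\<mu>')" by simp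
  also have "\<dots> = (\<integral>\<^sup>+x. ennreal x * (\<integral>\<^sup>+b. ennreal (tail_kernel r (x * b)) * (ennreal (1 / (2 * sqrt (1 - b))) * indicator {0<..<1} b) \<partial>lborel) \<partial>\<rho>)"
    by (rule int) simp
  also have "\<dots> = (\<integral>\<^sup>+x. ennreal (pi / (2 * sqrt r)) * indicator {r<..} x \<partial>\<rho>)"
  proof (rule nn_integral_cong_AE, use \<rho>K in eventually_elim)
    fix x assume x: "0 \<le> x \<and> x \<le> K"
    show "ennreal x * (\<integral>\<^sup>+b. ennreal (tail_kernel r (x * b)) * (ennreal (1 / (2 * sqrt (1 - b))) * indicator {0<..<1} b) \<partial>lborel)
      = ennreal (pi / (2 * sqrt r)) * indicator {r<..} x"
    proof (cases "r < x")
      case False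
      have "ennreal (tail_kernel r (x * b)) * (ennreal (1 / (2 * sqrt (1 - b))) * indicator {0<..<1} b) = 0" for b
      proof -
        have "x * b \<le> x * 1" if "b < 1" using x that by (intro mult_left_mono) auto
        then show ?thesis using False by (auto simp: tail_kernel_def indicator_def)
      qed
      then have "(\<integral>\<^sup>+b. ennreal (tail_kernel r (x * b)) * (ennreal (1 / (2 * sqrt (1 - b))) * indicator {0<..<1} b) \<partial>lborel)
         = (\<integral>\<^sup>+b. 0 \<partial>(lborel :: real measure))"
        by (intro nn_integral_cong)
      then show ?thesis using False by simp
    next
      case True
      have x0: "0 < x" using True r by simp
      define v where "v = r / x"
      have v: "0 < v" "v < 1" using True r by (auto simp: v_def)
      have rv: "r = x * v" using x0 by (simp add: v_def)
      have "(\<integral>\<^sup>+b. ennreal (tail_kernel r (x * b)) * (ennreal (1 / (2 * sqrt (1 - b))) * indicator {0<..<1} b) \<partial>lborel)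
        = (\<integral>\<^sup>+b. ennreal (1 / (2 * (x * sqrt x))) * (ennreal (1 / (b * sqrt ((b - v) * (1 - b)))) * indicator {v<..<1} b) \<partial>lborel)"
      proof (rule nn_integral_cong)
        fix b :: real
        have iff: "r < x * b \<longleftrightarrow> v < b" using x0 by (simp add: rv)
        show "ennreal (tail_kernel r (x * b)) * (ennreal (1 / (2 * sqrt (1 - b))) * indicator {0<..<1} b)
          = ennreal (1 / (2 * (x * sqrt x))) * (ennreal (1 / (b * sqrt ((b - v) * (1 - b)))) * indicator {v<..<1} b)"
        proof (cases "v < b \<and> b < 1")
          case True
          then have b: "0 < b" "v < b" "b < 1" using v by auto
          have "tail_kernel r (x * b) * (1 / (2 * sqrt (1 - b))) = 1 / (2 * (x * sqrt x)) * (1 / (b * sqrt ((b - v) * (1 - b))))"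
            using b iff by (simp add: tail_kernel_def rv real_sqrt_mult flip: right_diff_distrib)
          then show ?thesis using b v x0 by (simp add: ennreal_mult[symmetric] tail_kernel_nonneg r)
        qed (use iff in \<open>auto simp: tail_kernel_def indicator_def\<close>)
      qed
      also have "\<dots> = ennreal (1 / (2 * (x * sqrt x))) * ennreal (pi / sqrt v)"
        by (subst nn_integral_cmult) (auto simp: arcsine_integral[OF v])
      finally have e: "(\<integral>\<^sup>+b. ennreal (tail_kernel r (x * b)) * (ennreal (1 / (2 * sqrt (1 - b))) * indicator {0<..<1} b) \<partial>lborel)
        = ennreal (1 / (2 * (x * sqrt x))) * ennreal (pi / sqrt v)" .
      \<comment> \<open>The size-biasing factor cancels the remaining powers of \<open>x\<close>, so
        every \<open>x\<close> above \<open>r\<close> contributes the same constant. This is what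
        makes the kernel reproduce a tail probability.\<close>
      have "x * (1 / (2 * (x * sqrt x)) * (pi / sqrt v)) = pi / (2 * sqrt r)"
        using x0 v by (simp add: rv real_sqrt_mult)
      then show ?thesis using True x0 v by (simp add: e ennreal_mult[symmetric])
    qed
  qed
  also have "\<dots> = ennreal (pi / (2 * sqrt r)) * emeasure \<rho> {r<..}"
    by (rule nn_integral_cmult_indicator) simp
  finally show ?thesis .
qed

section \<open>Comparison of the kernel integrals\<close>

text \<open>The law of \<open>ysum I \<tau> U\<close>, where \<open>U\<close> has survival function \<^term>\<open>Hexp I \<tau>\<close>.\<close>
context variances
begin

text \<open>Minus the derivative of \<open>Hexp\<close>; a probability density on the nonnegative
  half-line because \<open>Hexp\<close> falls from 1 to 0.\<close>

definition udens :: "real \<Rightarrow> real" where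
  "udens u = Hexp I \<tau> u * (\<Sum>i\<in>I. \<tau> i / (1 + u * \<tau> i)) / 2"

definition ulaw :: "real measure" where
  "ulaw = density lborel (\<lambda>u. ennreal (udens u) * indicator {0..} u)"

definition ylaw :: "real measure" where
  "ylaw = distr ulaw borel (ysum I \<tau>)"

lemma ysum_measurable[measurable]: "ysum I \<tau> \<in> borel_measurable borel"
  unfolding ysum_def[abs_def] by measurable

lemma Hexp_measurable[measurable]: "Hexp I \<tau> \<in> borel_measurable borel"
  unfolding Hexp_def[abs_def] by measurable

lemma udens_measurable[measurable]: "udens \<in> borel_measurable borel"
  unfolding udens_def[abs_def] by measurable

lemma udens_nonneg: "0 \<le> u \<Longrightarrow> 0 \<le> udens u"
  unfolding udens_def using one_plus_pos[of u] pos Hexp_pos[of u]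
  by (intro divide_nonneg_pos mult_nonneg_nonneg sum_nonneg) (auto simp: less_imp_le)

lemma sets_ylaw[measurable_cong, simp]: "sets ylaw = sets borel" by (simp add: ylaw_def)

lemma sets_ulaw[measurable_cong, simp]: "sets ulaw = sets borel" by (simp add: ulaw_def)

lemma ulaw_atLeast:
  assumes "0 \<le> a"
  shows "emeasure ulaw {a..} = ennreal (Hexp I \<tau> a)"
proof -
  have "emeasure ulaw {a..} = (\<integral>\<^sup>+u. ennreal (udens u) * indicator {a..} u \<partial>lborel)"
    unfolding ulaw_def by (subst emeasure_density)
      (auto intro!: nn_integral_cong simp: indicator_def assms order_trans[OF assms])
  also have "\<dots> = (\<integral>\<^sup>+u. ennreal (indicator {a..} u * udens u) * indicator {a..} u \<partial>lborel)"
    by (intro nn_integral_cong) (auto simp: indicator_def)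
  also have "\<dots> = ennreal (0 - - Hexp I \<tau> a)"
  proof (rule nn_integral_FTC_atLeast)
    show "((\<lambda>u. - Hexp I \<tau> u) has_real_derivative indicator {a..} x * udens x) (at x)" if "a \<le> x" for x
      using DERIV_minus[OF Hexp_deriv[of x]] that assms by (simp add: udens_def)
    show "0 \<le> indicator {a..} x * udens x" if "a \<le> x" for x using that assms udens_nonneg[of x] by simp
    show "((\<lambda>u. - Hexp I \<tau> u) \<longlongrightarrow> 0) at_top" using tendsto_minus[OF Hexp_tendsto] by simp
  qed measurable
  finally show ?thesis by simp
qed

lemma ulaw_null: "emeasure ulaw {..<0} = 0"
  unfolding ulaw_def by (subst emeasure_density)
   (auto simp: nn_integral_0_iff_AE indicator_def intro!: AE_I2)

lemma prob_space_ulaw: "prob_space ulaw"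
proof
  have "emeasure ulaw (space ulaw) = emeasure ulaw ({..<0} \<union> {0..})"
    by (rule arg_cong[where f = "emeasure ulaw"]) (auto simp: ulaw_def)
  also have "\<dots> = emeasure ulaw {..<0} + emeasure ulaw {0..}"
    by (rule plus_emeasure[symmetric]) auto
  also have "\<dots> = 1" by (simp add: ulaw_null ulaw_atLeast) (simp add: Hexp_def)
  finally show "emeasure ulaw (space ulaw) = 1" .
qed

lemma AE_ulaw: "AE u in ulaw. 0 \<le> u"
  unfolding ulaw_def by (subst AE_density) (auto simp: indicator_def intro!: AE_I2 split: if_splits)

lemma prob_space_ylaw: "prob_space ylaw"
  unfolding ylaw_def by (rule prob_space.prob_space_distr[OF prob_space_ulaw]) simp

lemma AE_ylaw: "AE y in ylaw. 0 \<le> y \<and> y \<le> real (card I)"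
  unfolding ylaw_def
proof (subst AE_distr_iff)
  show "AE u in ulaw. 0 \<le> ysum I \<tau> u \<and> ysum I \<tau> u \<le> real (card I)"
    using AE_ulaw
  proof eventually_elim
    case (elim u)
    then show ?case using ysum_less_card[of u] ysum_pos[of u]
      by (cases "u = 0") (auto simp: less_imp_le ysum_def)
  qed
qed auto

lemma ylaw_interval:
  assumes u: "0 < u" "u \<le> v"
  shows "emeasure ylaw {ysum I \<tau> u<..ysum I \<tau> v} = ennreal (Hexp I \<tau> u - Hexp I \<tau> v)"
proof -
  interpret U: prob_space ulaw by (rule prob_space_ulaw)
  have sp: "space ulaw = UNIV" by (simp add: ulaw_def)
  have inj: "ysum I \<tau> s < ysum I \<tau> t \<longleftrightarrow> s < t" if "0 \<le> s" "0 \<le> t" for s t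
    using ysum_strict_mono[of s t] ysum_strict_mono[of t s] that by (cases s t rule: linorder_cases) auto
  have "emeasure ylaw {ysum I \<tau> u<..ysum I \<tau> v} = emeasure ulaw {t. ysum I \<tau> u < ysum I \<tau> t \<and> ysum I \<tau> t \<le> ysum I \<tau> v}"
    unfolding ylaw_def by (subst emeasure_distr) (auto simp: sp intro!: arg_cong[where f = "emeasure ulaw"])
  also have "\<dots> = emeasure ulaw {u<..v}"
  proof (rule emeasure_eq_AE)
    show "AE t in ulaw. t \<in> {t. ysum I \<tau> u < ysum I \<tau> t \<and> ysum I \<tau> t \<le> ysum I \<tau> v} \<longleftrightarrow> t \<in> {u<..v}"
      using AE_ulaw
      by eventually_elim (use u inj in \<open>auto simp: not_less[symmetric]\<close>)
  qed measurable
  also have "\<dots> = emeasure ulaw {u..<v}"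
  proof (rule emeasure_eq_AE)
    have "AE t in ulaw. t \<noteq> a" for a
      unfolding ulaw_def using AE_lborel_singleton[of a] by (subst AE_density) auto
    from this[of u] this[of v] show "AE t in ulaw. t \<in> {u<..v} \<longleftrightarrow> t \<in> {u..<v}"
      by eventually_elim auto
  qed measurable
  also have "{u..<v} = {u..} - {v..}" by auto
  also have "emeasure ulaw ({u..} - {v..}) = emeasure ulaw {u..} - emeasure ulaw {v..}"
    using u by (intro emeasure_Diff) (auto simp: U.emeasure_finite)
  also have "\<dots> = ennreal (Hexp I \<tau> u) - ennreal (Hexp I \<tau> v)" using u by (simp add: ulaw_atLeast)
  also have "\<dots> = ennreal (Hexp I \<tau> u - Hexp I \<tau> v)"
    using Hexp_pos[of v] by (simp add: ennreal_minus)
  finally show ?thesis .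
qed

lemma ylaw_tail:
  assumes u: "0 < u" and Y: "real (card I) \<le> Y"
  shows "emeasure ylaw {ysum I \<tau> u<..Y} = ennreal (Hexp I \<tau> u)"
proof -
  have sp: "space ulaw = UNIV" by (simp add: ulaw_def)
  have inj: "ysum I \<tau> s < ysum I \<tau> t \<longleftrightarrow> s < t" if "0 \<le> s" "0 \<le> t" for s t
    using ysum_strict_mono[of s t] ysum_strict_mono[of t s] that by (cases s t rule: linorder_cases) auto
  have "emeasure ylaw {ysum I \<tau> u<..Y} = emeasure ulaw {t. ysum I \<tau> u < ysum I \<tau> t \<and> ysum I \<tau> t \<le> Y}"
    unfolding ylaw_def by (subst emeasure_distr) (auto simp: sp intro!: arg_cong[where f = "emeasure ulaw"])
  also have "\<dots> = emeasure ulaw {u..}"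
  proof (rule emeasure_eq_AE)
    have "AE t in ulaw. t \<noteq> u"
      unfolding ulaw_def using AE_lborel_singleton[of u] by (subst AE_density) auto
    then show "AE t in ulaw. t \<in> {t. ysum I \<tau> u < ysum I \<tau> t \<and> ysum I \<tau> t \<le> Y} \<longleftrightarrow> t \<in> {u..}"
      using AE_ulaw
    proof eventually_elim
      case (elim t)
      have "ysum I \<tau> t \<le> Y" using ysum_less_card[of t] elim Y by simp
      then show ?case using inj[of u t] u elim by auto
    qed
  qed measurable
  finally show ?thesis using u by (simp add: ulaw_atLeast)
qed

end

section \<open>Explicit laws on a bounded interval\<close>

lemma beta_nn_integral:
  assumes "0 < a" "0 < b"
  shows "(\<integral>\<^sup>+t. ennreal (t powr (a - 1) * (1 - t) powr (b - 1)) * indicator {0<..<1} t \<partial>lborel) = ennreal (Beta a b)"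
proof (rule nn_integral_has_integral_set)
  show "((\<lambda>t. t powr (a - 1) * (1 - t) powr (b - 1)) has_integral Beta a b) {0<..<1}"
    using has_integral_Beta_real[OF assms] by (simp add: has_integral_Icc_iff_Ioo)
qed auto

lemma nn_integral_FTC_open:
  fixes F f :: "real \<Rightarrow> real"
  assumes ab: "a \<le> b" and c: "continuous_on {a..b} F"
    and d: "\<And>x. a < x \<Longrightarrow> x < b \<Longrightarrow> (F has_real_derivative f x) (at x)"
    and nn: "\<And>x. a < x \<Longrightarrow> x < b \<Longrightarrow> 0 \<le> f x" and [measurable]: "f \<in> borel_measurable borel"
  shows "(\<integral>\<^sup>+x. ennreal (f x) * indicator {a<..<b} x \<partial>lborel) = ennreal (F b - F a)"
proof (rule nn_integral_has_integral_set)
  have "(f has_integral (F b - F a)) {a..b}"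
    by (rule fundamental_theorem_of_calculus_interior[OF ab c])
       (use d in \<open>auto simp: has_real_derivative_iff_has_vector_derivative\<close>)
  then show "(f has_integral (F b - F a)) {a<..<b}" by (simp add: has_integral_Icc_iff_Ioo)
qed (use nn in auto)

definition idens :: "real \<Rightarrow> (real \<Rightarrow> real) \<Rightarrow> real measure" where
  "idens k D = density lborel (\<lambda>s. ennreal (D s) * indicator {0<..<k} s)"

lemma sets_idens[simp, measurable_cong]: "sets (idens k D) = sets borel" by (simp add: idens_def)

lemma sigma_finite_idens:
  assumes [measurable]: "D \<in> borel_measurable borel"
  shows "sigma_finite_measure (idens k D)"
  unfolding idens_def by (subst sigma_finite_measure.sigma_finite_iff_density_finite[OF sigma_finite_lborel]) (auto simp: indicator_def)

lemma idens_interval: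
  assumes r: "0 \<le> r" "r < y" "r < k" and c: "continuous_on {r..k} F"
    and d: "\<And>x. r < x \<Longrightarrow> x < k \<Longrightarrow> (F has_real_derivative D x) (at x)"
    and nn: "\<And>x. r < x \<Longrightarrow> x < k \<Longrightarrow> 0 \<le> D x" and [measurable]: "D \<in> borel_measurable borel"
  shows "emeasure (idens k D) {r<..y} = ennreal (F (min y k) - F r)"
proof -
  have "emeasure (idens k D) {r<..y} = (\<integral>\<^sup>+s. ennreal (D s) * indicator {0<..<k} s * indicator {r<..y} s \<partial>lborel)"
    unfolding idens_def by (subst emeasure_density) auto
  also have "\<dots> = (\<integral>\<^sup>+s. ennreal (D s) * indicator {r<..<min y k} s \<partial>lborel)"
    using AE_lborel_singleton[of "min y k"]
    by (intro nn_integral_cong_AE, eventually_elim) (use r in \<open>auto simp: indicator_def min_def\<close>)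
  also have "\<dots> = ennreal (F (min y k) - F r)"
    by (rule nn_integral_FTC_open) (use r d nn in \<open>auto intro: continuous_on_subset[OF c]\<close>)
  finally show ?thesis .
qed

text \<open>For \<open>k\<close> equal variances this is \<open>Hexp\<close> as a function of
  \<open>ysum\<close>. The parameter may exceed the number of components of the law it is compared
  with, which later gives monotonicity in \<open>k\<close>.\<close>

definition Hk :: "real \<Rightarrow> real \<Rightarrow> real" where "Hk k y = (1 - y / k) powr (k / 2)"

definition eqlaw :: "real \<Rightarrow> real measure" where
  "eqlaw k = idens k (\<lambda>y. (1 - y / k) powr (k / 2 - 1) / 2)"

lemma powr_lin_deriv:
  fixes k y e :: real
  assumes "0 < k" "y < k"
  shows "((\<lambda>y. (1 - y / k) powr e) has_real_derivative - (e / k * (1 - y / k) powr (e - 1))) (at y)"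
proof -
  have p: "0 < 1 - y / k" using assms by simp
  have "((\<lambda>y. 1 - y / k) has_real_derivative - (1 / k)) (at y)"
    by (rule DERIV_cong, (rule derivative_intros)+) (use assms in auto)
  from DERIV_chain2[where f = "\<lambda>z. z powr e" and g = "\<lambda>y. 1 - y / k", OF has_real_derivative_powr[OF p] this]
  show ?thesis by (simp add: mult_ac)
qed

lemma powr_lin_continuous: "0 < (k::real) \<Longrightarrow> 0 < e \<Longrightarrow> continuous_on {r..k} (\<lambda>y. (1 - y / k) powr e)"
  by (rule continuous_on_powr'[where f = "\<lambda>y. 1 - y / k" and g = "\<lambda>_. e"]) (auto simp: divide_le_eq intro!: continuous_on_diff continuous_on_divide continuous_on_id)

lemma eqlaw_interval:
  assumes "0 \<le> r" "r < y" "r < k"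
  shows "emeasure (eqlaw k) {r<..y} = ennreal (Hk k r - Hk k (min y k))"
proof -
  have "emeasure (eqlaw k) {r<..y} = ennreal (- Hk k (min y k) - - Hk k r)"
    unfolding eqlaw_def
  proof (rule idens_interval[OF assms])
    show "continuous_on {r..k} (\<lambda>y. - Hk k y)" unfolding Hk_def
      using assms by (intro continuous_on_minus powr_lin_continuous) auto
    show "((\<lambda>y. - Hk k y) has_real_derivative (1 - x / k) powr (k / 2 - 1) / 2) (at x)" if "r < x" "x < k" for x
      unfolding Hk_def by (rule DERIV_cong[OF DERIV_minus[OF powr_lin_deriv]]) (use assms that in auto)
  qed auto
  then show ?thesis by simp
qed

text \<open>Minus the derivative of \<open>cmpf k\<close> is \<open>posd k - negd k\<close>; \<open>negF k\<close> is an antiderivative of \<open>negd k\<close>.\<close>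
definition cmpf :: "real \<Rightarrow> real \<Rightarrow> real" where "cmpf k y = y\<^sup>2 * (1 - y / k) powr (k / 2 - 4 / 3)"
definition posd :: "real \<Rightarrow> real \<Rightarrow> real" where
  "posd k y = (1 / 2 + 2 / (3 * k)) * y\<^sup>2 * (1 - y / k) powr (k / 2 - 4 / 3 - 1)"
definition negd :: "real \<Rightarrow> real \<Rightarrow> real" where
  "negd k y = 2 * y * (1 - y / k) powr (k / 2 - 4 / 3 - 1)"
definition negF :: "real \<Rightarrow> real \<Rightarrow> real" where
  "negF k y = - (2 * k\<^sup>2 * ((1 - y / k) powr (k / 2 - 4 / 3) / (k / 2 - 4 / 3)
      - (1 - y / k) powr (k / 2 - 4 / 3 + 1) / (k / 2 - 4 / 3 + 1)))"

lemma negF_deriv: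
  assumes k: "8 / 3 < k" "y < k"
  shows "(negF k has_real_derivative negd k y) (at y)"
proof -
  define e where "e = k / 2 - 4 / 3"
  have e: "0 < e" and k0: "0 < k" using k by (auto simp: e_def)
  have p: "0 < 1 - y / k" using k k0 by simp
  have d: "((\<lambda>y. - (2 * k\<^sup>2 * ((1 - y / k) powr e / e - (1 - y / k) powr (e + 1) / (e + 1)))) has_real_derivative
     - (2 * k\<^sup>2 * (- (e / k * (1 - y / k) powr (e - 1)) / e - - ((e + 1) / k * (1 - y / k) powr (e + 1 - 1)) / (e + 1)))) (at y)"
    by (intro DERIV_minus DERIV_cmult DERIV_diff DERIV_cdivide powr_lin_deriv k0 k)
  have eq: "- (2 * k\<^sup>2 * (- (e / k * (1 - y / k) powr (e - 1)) / e - - ((e + 1) / k * (1 - y / k) powr (e + 1 - 1)) / (e + 1)))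
    = 2 * y * (1 - y / k) powr (e - 1)"
  proof -
    have s: "(1 - y / k) powr (e + 1 - 1) = (1 - y / k) powr (e - 1) * (1 - y / k)"
      using p by (simp add: powr_diff)
    have g: "- (2 * k\<^sup>2 * (- (e / k * b) / e - - ((e + 1) / k * (b * t)) / (e + 1))) = 2 * (k * (1 - t)) * b" for b t
    proof -
      have cancel: "- (d / k * c) / d = - (c / k)" if "d \<noteq> 0" for c d :: real
        using that by simp
      have d: "e \<noteq> 0" "e + 1 \<noteq> 0" using e by auto
      show ?thesis unfolding cancel[OF d(1)] cancel[OF d(2)] using k0
        by (simp add: power2_eq_square field_simps)
    qed
    have "k * (1 - (1 - y / k)) = y" using k0 by simp
    then show ?thesis unfolding s using g[of "(1 - y / k) powr (e - 1)" "1 - y / k"] by simp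
  qed
  show ?thesis unfolding negF_def[abs_def] negd_def e_def[symmetric] by (rule DERIV_cong[OF d eq])
qed

lemma cmpf_deriv:
  assumes k: "8 / 3 < k" "y < k"
  shows "(cmpf k has_real_derivative negd k y - posd k y) (at y)"
proof -
  define e where "e = k / 2 - 4 / 3"
  have e: "0 < e" and k0: "0 < k" using k by (auto simp: e_def)
  have p: "0 < 1 - y / k" using k k0 by simp
  have "((\<lambda>y. y\<^sup>2 * (1 - y / k) powr e) has_real_derivative
     2 * y * (1 - y / k) powr e + - (e / k * (1 - y / k) powr (e - 1)) * y\<^sup>2) (at y)"
    by (intro DERIV_mult powr_lin_deriv k0 k) (auto intro!: derivative_eq_intros)
  moreover have "(1 - y / k) powr e = (1 - y / k) powr (e - 1) * (1 - y / k)"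
    using p by (simp add: powr_diff)
  moreover have "1 / 2 + 2 / (3 * k) = (2 + e) / k" using k0 by (simp add: e_def field_simps)
  ultimately have "((\<lambda>y. y\<^sup>2 * (1 - y / k) powr e) has_real_derivative
     2 * y * ((1 - y / k) powr (e - 1) * (1 - y / k)) + - (e / k * (1 - y / k) powr (e - 1)) * y\<^sup>2) (at y)"
    and c: "1 / 2 + 2 / (3 * k) = (2 + e) / k" by simp_all
  moreover have "2 * y * (b * (1 - y / k)) + - (e / k * b) * y\<^sup>2 = 2 * y * b - (2 + e) / k * y\<^sup>2 * b" for b
    by (simp add: power2_eq_square add_divide_distrib) (simp add: algebra_simps)
  ultimately show ?thesis unfolding cmpf_def[abs_def] negd_def posd_def e_def[symmetric] c by simp
qed

lemma negF_continuous: "8 / 3 < k \<Longrightarrow> continuous_on {r..k} (negF k)"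
  unfolding negF_def[abs_def] by (intro continuous_on_minus continuous_on_mult continuous_on_diff continuous_on_divide continuous_on_const powr_lin_continuous) auto

lemma cmpf_continuous: "8 / 3 < k \<Longrightarrow> continuous_on {r..k} (cmpf k)"
  unfolding cmpf_def[abs_def] by (intro continuous_on_mult continuous_on_power continuous_on_id powr_lin_continuous) auto

lemma negd_interval:
  assumes "0 \<le> r" "r < y" "r < k" "8 / 3 < k" "0 \<le> m"
  shows "emeasure (idens k (\<lambda>y. m * negd k y)) {r<..y} = ennreal (m * (negF k (min y k) - negF k r))"
proof -
  have "emeasure (idens k (\<lambda>y. m * negd k y)) {r<..y} = ennreal (m * negF k (min y k) - m * negF k r)"
  proof (rule idens_interval[OF assms(1-3)])
    show "(\<lambda>y. m * negd k y) \<in> borel_measurable borel" unfolding negd_def by measurable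
    show "0 \<le> m * negd k x" if "r < x" for x using that assms by (simp add: negd_def)
  qed (use assms negF_deriv in \<open>auto intro!: continuous_on_mult continuous_on_const negF_continuous DERIV_cmult\<close>)
  then show ?thesis by (simp add: right_diff_distrib)
qed

lemma posd_interval:
  assumes "0 \<le> r" "r < y" "r < k" "8 / 3 < k" "0 \<le> m"
  shows "emeasure (idens k (\<lambda>y. m * posd k y)) {r<..y}
    = ennreal (m * (negF k (min y k) - negF k r + cmpf k r - cmpf k (min y k)))"
proof -
  have "emeasure (idens k (\<lambda>y. m * posd k y)) {r<..y}
     = ennreal (m * (negF k (min y k) - cmpf k (min y k)) - m * (negF k r - cmpf k r))"
  proof (rule idens_interval[OF assms(1-3)])
    show "(\<lambda>y. m * posd k y) \<in> borel_measurable borel" unfolding posd_def by measurable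
    show "0 \<le> m * posd k x" if "r < x" for x using that assms by (simp add: posd_def)
    show "((\<lambda>y. m * (negF k y - cmpf k y)) has_real_derivative m * posd k x) (at x)" if "r < x" "x < k" for x
      using DERIV_cmult[OF DERIV_diff[OF negF_deriv[of k x] cmpf_deriv[of k x]], of m] that assms by simp
  qed (use assms in \<open>auto intro!: continuous_on_mult continuous_on_const continuous_on_diff negF_continuous cmpf_continuous\<close>)
  then show ?thesis by (simp add: algebra_simps)
qed

lemma negd_nonneg_diff:
  assumes "0 \<le> r" "r \<le> y" "y \<le> k" "8 / 3 < k"
  shows "negF k r \<le> negF k y" "negF k r - cmpf k r \<le> negF k y - cmpf k y"
proof -
  show "negF k r \<le> negF k y"
  proof (rule DERIV_nonneg_imp_increasing_open[OF assms(2)])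
    show "continuous_on {r..y} (negF k)" using negF_continuous[of k r] assms by (auto intro: continuous_on_subset)
    fix x assume "r < x" "x < y"
    then show "\<exists>z. (negF k has_real_derivative z) (at x) \<and> 0 \<le> z"
      using negF_deriv[of k x] assms by (intro exI[of _ "negd k x"]) (auto simp: negd_def)
  qed
  have "(\<lambda>t. negF k t - cmpf k t) r \<le> (\<lambda>t. negF k t - cmpf k t) y"
  proof (rule DERIV_nonneg_imp_increasing_open[OF assms(2)])
    show "continuous_on {r..y} (\<lambda>t. negF k t - cmpf k t)"
      using negF_continuous[of k r] cmpf_continuous[of k r] assms by (auto intro!: continuous_on_diff intro: continuous_on_subset)
    fix x assume "r < x" "x < y"
    then show "\<exists>z. ((\<lambda>t. negF k t - cmpf k t) has_real_derivative z) (at x) \<and> 0 \<le> z"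
      using DERIV_diff[OF negF_deriv[of k x] cmpf_deriv[of k x]] assms by (intro exI[of _ "posd k x"]) (auto simp: posd_def[of k x])
  qed
  then show "negF k r - cmpf k r \<le> negF k y - cmpf k y" by simp
qed

text \<open>The factor \<open>y\<close> of the density cancels \<open>1 / y\<close> in the kernel.
  The affine map of the unit interval onto \<open>{r<..<k}\<close> then leaves Beta integrals with
  first parameter 1/2 and 3/2, the second a multiple of the first, so the integrals of
  \<open>posd\<close> and \<open>negd\<close> share a common factor.\<close>

lemma idens_kernel:
  assumes r: "0 < r" "r < k" and e: "0 < e" and m: "0 \<le> m" and D: "\<And>y. D y = m * (A * y + C) * y * (1 - y / k) powr (e - 1)"
    and AC: "0 \<le> A" "0 \<le> C"
  shows "(\<integral>\<^sup>+s. ennreal (tail_kernel r s) \<partial>idens k D)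
    = ennreal (m * (A * ((2 * e * r + k) / (2 * e + 1)) + C) * (sqrt (k - r) * ((k - r) / k) powr (e - 1) * Beta (1 / 2) e))"
proof -
  have [measurable]: "D \<in> borel_measurable borel" unfolding D[abs_def] by measurable
  define Q where "Q = m * (sqrt (k - r) * ((k - r) / k) powr (e - 1))"
  have Q: "0 \<le> Q" using m r by (simp add: Q_def)
  have kr: "0 < k - r" and k0: "0 < k" using r by auto
  have "(\<integral>\<^sup>+s. ennreal (tail_kernel r s) \<partial>idens k D) = (\<integral>\<^sup>+s. ennreal (D s) * indicator {0<..<k} s * ennreal (tail_kernel r s) \<partial>lborel)"
    unfolding idens_def by (subst nn_integral_density) auto
  also have "\<dots> = ennreal (k - r) * (\<integral>\<^sup>+t. ennreal (D (r + (k - r) * t)) * indicator {0<..<k} (r + (k - r) * t) * ennreal (tail_kernel r (r + (k - r) * t)) \<partial>lborel)"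
    using kr by (subst nn_integral_real_affine[where c = "k - r" and t = r]) auto
  also have "\<dots> = ennreal (k - r) * (\<integral>\<^sup>+t. (ennreal (Q / (k - r) * (A * r + C)) * (ennreal (t powr (1 / 2 - 1) * (1 - t) powr (e - 1)) * indicator {0<..<1} t)
      + ennreal (Q * A) * (ennreal (t powr (3 / 2 - 1) * (1 - t) powr (e - 1)) * indicator {0<..<1} t)) \<partial>lborel)"
  proof (intro arg_cong[where f = "\<lambda>x. ennreal (k - r) * x"] nn_integral_cong)
    fix t :: real
    define s where "s = r + (k - r) * t"
    have sr: "r < s \<longleftrightarrow> 0 < t" using kr by (simp add: s_def zero_less_mult_iff)
    have "k - s = (k - r) * (1 - t)" by (simp add: s_def algebra_simps)
    then have sk: "s < k \<longleftrightarrow> t < 1" using kr by (simp add: zero_less_mult_iff flip: diff_gt_0_iff_gt[of k s])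
    show "ennreal (D s) * indicator {0<..<k} s * ennreal (tail_kernel r s)
     = ennreal (Q / (k - r) * (A * r + C)) * (ennreal (t powr (1 / 2 - 1) * (1 - t) powr (e - 1)) * indicator {0<..<1} t)
      + ennreal (Q * A) * (ennreal (t powr (3 / 2 - 1) * (1 - t) powr (e - 1)) * indicator {0<..<1} t)"
    proof (cases "0 < t \<and> t < 1")
      case True
      then have t: "0 < t" "t < 1" and s: "r < s" "s < k" "0 < s" using sr sk r by auto
      have b: "(1 - s / k) powr (e - 1) = ((k - r) / k) powr (e - 1) * (1 - t) powr (e - 1)"
      proof -
        have "1 - s / k = (k - r) / k * (1 - t)" using k0 by (simp add: s_def field_simps)
        moreover have "((k - r) / k * (1 - t)) powr (e - 1) = ((k - r) / k) powr (e - 1) * (1 - t) powr (e - 1)"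
          by (rule powr_mult)
        ultimately show ?thesis by simp
      qed
      have p1: "t powr (1 / 2 - 1) = 1 / sqrt t" using t by (simp add: powr_minus powr_half_sqrt divide_simps flip: powr_half_sqrt)
      have p2: "t powr (3 / 2 - 1) = t / sqrt t" using t by (simp add: powr_half_sqrt real_div_sqrt)
      have sq: "sqrt (s - r) = sqrt (k - r) * sqrt t" by (simp add: s_def real_sqrt_mult)
      have kk: "sqrt (k - r) * sqrt (k - r) = k - r" using kr by simp
      have "D s * tail_kernel r s = m * (A * s + C) * (1 - s / k) powr (e - 1) / sqrt (s - r)"
        using s by (simp add: D tail_kernel_def)
      also have "\<dots> = Q * (A * s + C) * (1 - t) powr (e - 1) / sqrt t / (k - r)"
      proof -
        have gen: "m * (A * s + C) * (P * T) / (w * st) = m * (w * P) * (A * s + C) * T / st / (w * w)"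
          if "w \<noteq> 0" "st \<noteq> 0" for w P T st :: real using that by (simp add: field_simps)
        have "sqrt (k - r) \<noteq> 0" "sqrt t \<noteq> 0" using kr t by simp_all
        from gen[OF this] show ?thesis unfolding b sq Q_def kk by simp
      qed
      also have "\<dots> = Q / (k - r) * (A * r + C) * (t powr (1 / 2 - 1) * (1 - t) powr (e - 1))
         + Q * A * (t powr (3 / 2 - 1) * (1 - t) powr (e - 1))"
      proof -
        have gen: "Q * (A * (r + d * t) + C) * T / st / d = Q / d * (A * r + C) * (1 / st * T) + Q * A * (t / st * T)"
          if "d \<noteq> 0" "st \<noteq> 0" for d st T :: real using that by (simp add: field_simps)
        show ?thesis unfolding p1 p2 s_def using kr t by (intro gen) auto
      qed
      finally have eq: "D s * tail_kernel r s = Q / (k - r) * (A * r + C) * (t powr (1 / 2 - 1) * (1 - t) powr (e - 1))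
         + Q * A * (t powr (3 / 2 - 1) * (1 - t) powr (e - 1))" .
      have "ennreal (D s) * ennreal (tail_kernel r s) = ennreal (D s * tail_kernel r s)"
        using r by (intro ennreal_mult''[symmetric] tail_kernel_nonneg)
      then show ?thesis using t s Q kr r AC by (simp add: eq ennreal_plus ennreal_mult[symmetric])
    next
      case False
      then show ?thesis using sr sk r by (auto simp: indicator_def tail_kernel_def)
    qed
  qed
  also have "\<dots> = ennreal (k - r) * (ennreal (Q / (k - r) * (A * r + C)) * ennreal (Beta (1 / 2) e) + ennreal (Q * A) * ennreal (Beta (3 / 2) e))"
  proof -
    have b: "(\<integral>\<^sup>+t. ennreal (t powr (1 / 2 - 1) * (1 - t) powr (e - 1)) * indicator {0<..<1} t \<partial>lborel) = ennreal (Beta (1 / 2) e)"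
      "(\<integral>\<^sup>+t. ennreal (t powr (3 / 2 - 1) * (1 - t) powr (e - 1)) * indicator {0<..<1} t \<partial>lborel) = ennreal (Beta (3 / 2) e)"
      using e by (intro beta_nn_integral; simp)+
    show ?thesis by (subst nn_integral_add, measurable, (subst nn_integral_cmult, measurable)+, simp only: b)
  qed
  also have "\<dots> = ennreal ((k - r) * (Q / (k - r) * (A * r + C) * Beta (1 / 2) e + Q * A * Beta (3 / 2) e))"
    using kr Q r AC e by (simp add: ennreal_mult[symmetric] ennreal_plus[symmetric] Beta_def Gamma_real_pos del: ennreal_plus)
  also have "Beta (3 / 2) e = Beta (1 / 2) e / (2 * e + 1)"
  proof -
    have "(1 / 2 + e) * Beta (1 / 2 + 1) e = 1 / 2 * Beta (1 / 2) e"
      by (rule Beta_plus1_left) (use e in \<open>auto dest: nonpos_Ints_nonpos\<close>)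
    then show ?thesis using e by (simp add: field_simps)
  qed
  also have "(k - r) * (Q / (k - r) * (A * r + C) * Beta (1 / 2) e + Q * A * (Beta (1 / 2) e / (2 * e + 1)))
     = m * (A * ((2 * e * r + k) / (2 * e + 1)) + C) * (sqrt (k - r) * ((k - r) / k) powr (e - 1) * Beta (1 / 2) e)"
    (is "?L = ?R")
  proof -
    have e1: "2 * e + 1 \<noteq> 0" using e by simp
    have "?L = Q * Beta (1 / 2) e * (A * r + C + A * (k - r) / (2 * e + 1))" using kr by (simp add: field_simps)
    also have "A * r + C + A * (k - r) / (2 * e + 1) = A * ((2 * e * r + k) / (2 * e + 1)) + C"
      using e1 by (simp add: field_simps)
    finally show ?thesis by (simp add: Q_def)
  qed
  finally show ?thesis .
qed

lemma Hk_mono: "0 < k \<Longrightarrow> 0 \<le> y \<Longrightarrow> y \<le> z \<Longrightarrow> z \<le> k \<Longrightarrow> Hk k z \<le> Hk k y"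
  unfolding Hk_def by (intro powr_mono2) (auto simp: divide_right_mono)

lemma kernel_posd_negd:
  assumes r: "0 < r" "r < k" and k: "8 / 3 < k" and m: "0 \<le> m"
  shows "(\<integral>\<^sup>+s. ennreal (tail_kernel r s) \<partial>idens k (\<lambda>y. m * negd k y)) < \<infinity>"
    "(\<integral>\<^sup>+s. ennreal (tail_kernel r s) \<partial>idens k (\<lambda>y. m * posd k y)) < \<infinity>"
    "3 * k \<le> r * (k + 4 / 3) \<Longrightarrow> (\<integral>\<^sup>+s. ennreal (tail_kernel r s) \<partial>idens k (\<lambda>y. m * negd k y))
       \<le> (\<integral>\<^sup>+s. ennreal (tail_kernel r s) \<partial>idens k (\<lambda>y. m * posd k y))"
    "r * (k + 4 / 3) \<le> 3 * k \<Longrightarrow> (\<integral>\<^sup>+s. ennreal (tail_kernel r s) \<partial>idens k (\<lambda>y. m * posd k y))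
       \<le> (\<integral>\<^sup>+s. ennreal (tail_kernel r s) \<partial>idens k (\<lambda>y. m * negd k y))"
proof -
  define e where "e = k / 2 - 4 / 3"
  have e: "0 < e" using k by (simp add: e_def)
  define Z where "Z = sqrt (k - r) * ((k - r) / k) powr (e - 1) * Beta (1 / 2) e"
  have Z: "0 \<le> Z" using r e by (simp add: Z_def Beta_def Gamma_real_pos less_imp_le)
  define c where "c = 1 / 2 + 2 / (3 * k)"
  have c: "0 < c" using k by (simp add: c_def add_pos_pos)
  have n: "(\<integral>\<^sup>+s. ennreal (tail_kernel r s) \<partial>idens k (\<lambda>y. m * negd k y)) = ennreal (m * 2 * Z)"
    using idens_kernel[OF r e m, of "\<lambda>y. m * negd k y" 0 2]
    by (simp add: negd_def e_def Z_def mult_ac)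
  have p: "(\<integral>\<^sup>+s. ennreal (tail_kernel r s) \<partial>idens k (\<lambda>y. m * posd k y)) = ennreal (m * (c * ((2 * e * r + k) / (2 * e + 1))) * Z)"
    using idens_kernel[OF r e m, of "\<lambda>y. m * posd k y" c 0] c
    by (simp add: posd_def e_def Z_def mult_ac c_def power2_eq_square)
  show "(\<integral>\<^sup>+s. ennreal (tail_kernel r s) \<partial>idens k (\<lambda>y. m * negd k y)) < \<infinity>" by (simp add: n)
  show "(\<integral>\<^sup>+s. ennreal (tail_kernel r s) \<partial>idens k (\<lambda>y. m * posd k y)) < \<infinity>" by (simp add: p)
  have k0: "0 < k" using k by simp
  have e1: "2 * e + 1 = k - 5 / 3" by (simp add: e_def)
  have e1p: "0 < k - 5 / 3" using k by simp
  \<comment> \<open>Apart from the common factor this is the kernel integral of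
    \<open>posd k - negd k\<close>, that is, of minus the derivative of \<open>cmpf k\<close>. It
    vanishes exactly at \<open>r = 3 * k / (k + 4/3)\<close>, the origin of the threshold.\<close>
  have "c * ((2 * e * r + k) / (2 * e + 1)) - 2 = (r * (k + 4 / 3) - 3 * k) * (k - 8 / 3) / (2 * k * (k - 5 / 3))"
  proof -
    have nz: "k - 5 / 3 \<noteq> 0" "k \<noteq> 0" using k by auto
    have c': "c = (k + 4 / 3) / (2 * k)" using nz by (simp add: c_def field_simps)
    have e2: "2 * e = k - 8 / 3" by (simp add: e_def)
    have "c * ((2 * e * r + k) / (2 * e + 1)) - 2 = ((k + 4 / 3) * ((k - 8 / 3) * r + k) - 4 * k * (k - 5 / 3)) / (2 * k * (k - 5 / 3))"
      unfolding c' e1 e2 using nz by (simp add: diff_divide_distrib)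
    also have "(k + 4 / 3) * ((k - 8 / 3) * r + k) - 4 * k * (k - 5 / 3) = (r * (k + 4 / 3) - 3 * k) * (k - 8 / 3)"
      by (simp add: field_simps)
    finally show ?thesis .
  qed
  note ce = this
  have den: "0 < 2 * k * (k - 5 / 3)" using k0 e1p by simp
  show "(\<integral>\<^sup>+s. ennreal (tail_kernel r s) \<partial>idens k (\<lambda>y. m * negd k y))
       \<le> (\<integral>\<^sup>+s. ennreal (tail_kernel r s) \<partial>idens k (\<lambda>y. m * posd k y))" if "3 * k \<le> r * (k + 4 / 3)"
  proof -
    have "0 \<le> (r * (k + 4 / 3) - 3 * k) * (k - 8 / 3) / (2 * k * (k - 5 / 3))"
      using that k den by (intro divide_nonneg_pos mult_nonneg_nonneg) auto
    then have "2 \<le> c * ((2 * e * r + k) / (2 * e + 1))" using ce by linarith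
    then show ?thesis unfolding n p using m Z by (intro ennreal_leI mult_right_mono mult_left_mono)
  qed
  show "(\<integral>\<^sup>+s. ennreal (tail_kernel r s) \<partial>idens k (\<lambda>y. m * posd k y))
       \<le> (\<integral>\<^sup>+s. ennreal (tail_kernel r s) \<partial>idens k (\<lambda>y. m * negd k y))" if "r * (k + 4 / 3) \<le> 3 * k"
  proof -
    have "(r * (k + 4 / 3) - 3 * k) * (k - 8 / 3) / (2 * k * (k - 5 / 3)) \<le> 0"
      using that k den by (intro divide_nonpos_pos mult_nonpos_nonneg) auto
    then have "c * ((2 * e * r + k) / (2 * e + 1)) \<le> 2" using ce by linarith
    then show ?thesis unfolding n p using m Z by (intro ennreal_leI mult_right_mono mult_left_mono)
  qed
qed

lemma Hk_ratio: "0 < k \<Longrightarrow> y < k \<Longrightarrow> 0 < y \<Longrightarrow> Hk k y = cmpf k y * exp (4 / 3 * ln (1 - y / k) - 2 * ln y)"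
proof -
  assume k: "0 < k" "y < k" "0 < y"
  have p: "0 < 1 - y / k" using k by simp
  have "exp (4 / 3 * ln (1 - y / k) - 2 * ln y) = (1 - y / k) powr (4 / 3) / y\<^sup>2"
    using p k by (simp add: exp_diff powr_def exp_double)
  then have "cmpf k y * exp (4 / 3 * ln (1 - y / k) - 2 * ln y) = (1 - y / k) powr (k / 2 - 4 / 3) * (1 - y / k) powr (4 / 3)"
    using k by (simp add: cmpf_def)
  also have "\<dots> = Hk k y" using p by (simp add: Hk_def powr_add[symmetric])
  finally show ?thesis by simp
qed

section \<open>General variances against equal ones\<close>

context variances
begin

lemma Hexp_rho: "0 < k \<Longrightarrow> ysum I \<tau> u < k \<Longrightarrow> Hexp I \<tau> u = Hk k (ysum I \<tau> u) * rho k u"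
  by (simp add: Hexp_def Hk_def rho_def powr_def exp_add[symmetric])

text \<open>Let the gap be \<open>Hk - Hexp\<close> at equal \<open>ysum\<close>, and
  \<open>m\<close> its quotient by \<open>cmpf k\<close> at level \<open>r\<close>. As the quotient
  decreases, the gap at \<open>y\<close> is at most \<open>m * cmpf k y\<close>, with equality at
  \<open>r\<close>. So the masses of \<open>{r<..y}\<close> under the two laws differ by at least
  \<open>m * (cmpf k r - cmpf k y)\<close>, and the condition on \<open>r\<close> says that this
  correction contributes nonnegatively to the kernel integral.\<close>

lemma ylaw_kernel_le_eqlaw:
  assumes k: "real (card I) \<le> k" "8 / 3 < k" and r: "8 / 3 \<le> r" "3 * k \<le> r * (k + 4 / 3)" "r < real (card I)"
  shows "(\<integral>\<^sup>+s. ennreal (tail_kernel r s) \<partial>ylaw) \<le> (\<integral>\<^sup>+s. ennreal (tail_kernel r s) \<partial>eqlaw k)"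
proof -
  have r0: "0 < r" and k0: "0 < k" and rk: "r < k" using r k by auto
  obtain u where u: "0 < u" "ysum I \<tau> u = r" using ysum_surj r r0 by metis
  define q where "q = (\<lambda>u. (1 - rho k u) * exp (4 / 3 * ln (1 - ysum I \<tau> u / k) - 2 * ln (ysum I \<tau> u)))"
  have q: "q v \<le> q u" if "u \<le> v" for v
    unfolding q_def by (rule ratio_decreasing) (use k u that r in auto)
  have hq: "Hk k (ysum I \<tau> v) - Hexp I \<tau> v = q v * cmpf k (ysum I \<tau> v)" if "0 < v" for v
  proof -
    have y: "0 < ysum I \<tau> v" "ysum I \<tau> v < k" using ysum_pos ysum_less_card[of v] that k by auto
    show ?thesis unfolding Hexp_rho[OF k0 y(2)] q_def Hk_ratio[OF k0 y(2) y(1)] by (simp add: algebra_simps)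
  qed
  define m where "m = q u"
  have m: "0 \<le> m"
  proof -
    have "rho k u \<le> 1"
      unfolding rho_alt[OF less_imp_le[OF u(1)]]
      by (rule rho_bound(2)[OF fin ne _ k(1) ysum_def _ refl refl refl refl])
         (use u r pos one_plus_pos[of u] in auto)
    then show ?thesis by (simp add: m_def q_def)
  qed
  have fr: "Hk k r - Hexp I \<tau> u = m * cmpf k r" using hq[OF u(1)] u by (simp add: m_def)
  have fge: "0 \<le> cmpf k y" for y by (simp add: cmpf_def)
  interpret Y: prob_space ylaw by (rule prob_space_ylaw)
  have interval: "\<exists>K. 0 \<le> K \<and> emeasure ylaw {r<..y} = ennreal K \<and> K + m * (cmpf k r - cmpf k (min y k)) \<le> Hk k r - Hk k (min y k)"
    if y: "r < y" for y
  proof (cases "y < real (card I)")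
    case True
    then obtain v where v: "0 < v" "ysum I \<tau> v = y" using ysum_surj y r0 by (metis less_trans)
    have uv: "u \<le> v"
    proof (rule ccontr)
      assume "\<not> u \<le> v"
      then show False using ysum_strict_mono[of v u] v u y by simp
    qed
    have "emeasure ylaw {r<..y} = ennreal (Hexp I \<tau> u - Hexp I \<tau> v)"
      using ylaw_interval[OF u(1) uv] u v by simp
    moreover have "0 \<le> Hexp I \<tau> u - Hexp I \<tau> v"
    proof -
      have "Hexp I \<tau> v \<le> Hexp I \<tau> u"
      proof (rule DERIV_nonpos_imp_nonincreasing[OF uv])
        fix t assume "u \<le> t" "t \<le> v"
        then have "0 \<le> t" using u by simp
        then show "\<exists>y. (Hexp I \<tau> has_real_derivative y) (at t) \<and> y \<le> 0"
          using Hexp_deriv[of t] udens_nonneg[of t]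
            by (intro exI[of _ "- (Hexp I \<tau> t * (\<Sum>i\<in>I. \<tau> i / (1 + t * \<tau> i)) / 2)"]) (auto simp: udens_def)
      qed
      then show ?thesis by simp
    qed
    moreover have "Hexp I \<tau> u - Hexp I \<tau> v + m * (cmpf k r - cmpf k (min y k)) \<le> Hk k r - Hk k (min y k)"
    proof -
      have "Hk k y - Hexp I \<tau> v \<le> m * cmpf k y"
        using hq[OF v(1)] v(2) q[OF uv] fge[of y] by (simp add: m_def mult_right_mono)
      then show ?thesis using fr True k by (simp add: algebra_simps min_def)
    qed
    ultimately show ?thesis by blast
  next
    case False
    have "emeasure ylaw {r<..y} = ennreal (Hexp I \<tau> u)" using ylaw_tail[OF u(1), of y] False u by simp
    moreover have "Hexp I \<tau> u + m * (cmpf k r - cmpf k (min y k)) \<le> Hk k r - Hk k (min y k)"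
    proof -
      \<comment> \<open>Beyond \<open>card I\<close> the law \<open>ylaw\<close> has no mass and the
        gap is \<open>Hk\<close> itself. Letting \<open>u\<close> tend to infinity in
        \<open>q\<close> gives the bound at \<open>card I\<close>, because \<open>rho\<close> tends
        to 0 there when \<open>card I < k\<close>; it persists to the right since
        \<open>Hk / cmpf\<close> decreases. At \<open>k\<close> the left side vanishes.\<close>
      have "Hk k (min y k) \<le> m * cmpf k (min y k)"
      proof (cases "y < k")
        case True
        let ?j = "real (card I)"
        have jk: "?j < k" "0 < ?j" using True False r r0 by auto
        have "(q \<longlongrightarrow> (1 - 0) * exp (4 / 3 * ln (1 - ?j / k) - 2 * ln ?j)) at_top"
        proof -
          have "(rho k \<longlongrightarrow> 0) at_top"
          proof -
            have "((\<lambda>u. Hexp I \<tau> u / (1 - ysum I \<tau> u / k) powr (k / 2)) \<longlongrightarrow> 0 / (1 - ?j / k) powr (k / 2)) at_top"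
              using jk k0 by (intro tendsto_intros Hexp_tendsto ysum_tendsto) auto
            moreover have "\<forall>\<^sub>F u in at_top. Hexp I \<tau> u / (1 - ysum I \<tau> u / k) powr (k / 2) = rho k u"
              using eventually_ge_at_top[of 0]
            proof eventually_elim
              case (elim u)
              then have yk: "ysum I \<tau> u < k" using ysum_less_card[of u] k by simp
              then have "0 < 1 - ysum I \<tau> u / k" using k0 by simp
              then show ?case unfolding Hexp_rho[OF k0 yk] using yk by (auto simp: Hk_def)
            qed
            ultimately show ?thesis by (simp add: tendsto_cong)
          qed
          then show ?thesis unfolding q_def using jk k0
            by (intro tendsto_intros ysum_tendsto) auto
        qed
        moreover have "\<forall>\<^sub>F v in at_top. q v \<le> m"
          using eventually_ge_at_top[of u] by eventually_elim (use q in \<open>simp add: m_def\<close>)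
        ultimately have "exp (4 / 3 * ln (1 - ?j / k) - 2 * ln ?j) \<le> m"
          by (intro tendsto_upperbound[where F = at_top]) auto
        moreover have "exp (4 / 3 * ln (1 - y / k) - 2 * ln y) \<le> exp (4 / 3 * ln (1 - ?j / k) - 2 * ln ?j)"
        proof -
          have "ln (1 - y / k) \<le> ln (1 - ?j / k)" "ln ?j \<le> ln y"
            using False True jk k0 by (auto simp: divide_right_mono)
          then show ?thesis by simp
        qed
        ultimately have "exp (4 / 3 * ln (1 - y / k) - 2 * ln y) \<le> m" by (rule order_trans[rotated])
        then have "cmpf k y * exp (4 / 3 * ln (1 - y / k) - 2 * ln y) \<le> cmpf k y * m"
          by (rule mult_left_mono[OF _ fge])
        then show ?thesis using Hk_ratio[OF k0 True] True y r0 by (simp add: mult.commute)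
      qed (use k0 m fge in \<open>simp add: Hk_def\<close>)
      then show ?thesis using fr by (simp add: algebra_simps)
    qed
    ultimately show ?thesis using Hexp_pos[of u] by (intro exI[of _ "Hexp I \<tau> u"]) (auto simp: less_imp_le)
  qed
  show ?thesis
  proof (rule tail_kernel_compare[OF r0, where \<nu> = "idens k (\<lambda>y. m * posd k y)" and \<nu>' = "idens k (\<lambda>y. m * negd k y)"])
    show "sigma_finite_measure ylaw" by unfold_locales
    show "sigma_finite_measure (eqlaw k)" unfolding eqlaw_def by (rule sigma_finite_idens) simp
    show "sigma_finite_measure (idens k (\<lambda>y. m * posd k y))" by (rule sigma_finite_idens) (simp add: posd_def)
    show "sigma_finite_measure (idens k (\<lambda>y. m * negd k y))" by (rule sigma_finite_idens) (simp add: negd_def)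
    fix y assume y: "r < y"
    obtain K where K: "0 \<le> K" "emeasure ylaw {r<..y} = ennreal K" "K + m * (cmpf k r - cmpf k (min y k)) \<le> Hk k r - Hk k (min y k)"
      using interval[OF y] by blast
    have ry: "r \<le> min y k" "min y k \<le> k" using y rk by auto
    note nn = negd_nonneg_diff[of r "min y k" k]
    have "emeasure ylaw {r<..y} + emeasure (idens k (\<lambda>y. m * posd k y)) {r<..y}
       = ennreal (K + m * (negF k (min y k) - negF k r + cmpf k r - cmpf k (min y k)))"
      using K(1) m nn ry r0 k(2) by (simp add: K(2) posd_interval[OF _ y rk k(2) m] ennreal_plus[symmetric] del: ennreal_plus)
    also have "\<dots> \<le> ennreal ((Hk k r - Hk k (min y k)) + m * (negF k (min y k) - negF k r))"
      using K(3) by (intro ennreal_leI) (simp add: algebra_simps)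
    also have "\<dots> = emeasure (eqlaw k) {r<..y} + emeasure (idens k (\<lambda>y. m * negd k y)) {r<..y}"
      using m nn ry r0 k(2) Hk_mono[OF k0 _ ry(1) ry(2)]
      by (simp add: negd_interval[OF _ y rk k(2) m] eqlaw_interval[OF _ y rk] ennreal_plus[symmetric] del: ennreal_plus)
    finally show "emeasure ylaw {r<..y} + emeasure (idens k (\<lambda>y. m * posd k y)) {r<..y} \<le> emeasure (eqlaw k) {r<..y} + emeasure (idens k (\<lambda>y. m * negd k y)) {r<..y}" .
  qed (use kernel_posd_negd[OF r0 rk k(2) m] r in \<open>auto simp: eqlaw_def\<close>)
qed

text \<open>Here the gap \<open>h\<close> itself decreases, so the interval masses are ordered
  directly and both correction measures are null.\<close>

lemma ylaw_kernel_le_eqlaw_small_card: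
  assumes c: "card I = 2 \<and> 4 / 3 \<le> r \<or> card I = 3 \<and> 2 \<le> r" and r: "r < real (card I)"
  shows "(\<integral>\<^sup>+s. ennreal (tail_kernel r s) \<partial>ylaw) \<le> (\<integral>\<^sup>+s. ennreal (tail_kernel r s) \<partial>eqlaw (real (card I)))"
proof -
  define k where "k = real (card I)"
  have r0: "0 < r" and k0: "0 < k" and rk: "r < k" using r c by (auto simp: k_def)
  obtain u where u: "0 < u" "ysum I \<tau> u = r" using ysum_surj r r0 by metis
  define h where "h = (\<lambda>v. Hk k (ysum I \<tau> v) - Hexp I \<tau> v)"
  have h: "h v \<le> h u" if uv: "u \<le> v" for v
  proof (rule DERIV_nonpos_imp_nonincreasing[OF uv])
    fix t assume t: "u \<le> t" "t \<le> v"
    then have t0: "0 < t" using u by simp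
    define Y' where "Y' = (\<Sum>i\<in>I. \<tau> i / (1 + t * \<tau> i)\<^sup>2)"
    have yt: "r \<le> ysum I \<tau> t" using ysum_strict_mono[of u t] u t by (cases "u = t") auto
    have yk: "ysum I \<tau> t < k" using ysum_less_card[of t] t0 by (simp add: k_def)
    have "t * Y' = (\<Sum>i\<in>I. t * \<tau> i / (1 + t * \<tau> i) * (1 - t * \<tau> i / (1 + t * \<tau> i)))"
      unfolding Y'_def sum_distrib_left using one_minus_mult t0 by (intro sum.cong) auto
    then have le: "ysum I \<tau> t * Hexp I \<tau> t \<le> t * Y' * (1 - ysum I \<tau> t / k) powr (k / 2 - 1)"
      using small_card_pointwise[OF t0] c yt by (auto simp: k_def)
    have "(ysum I \<tau> has_real_derivative Y') (at t)" unfolding Y'_def using t0 by (intro ysum_deriv) simp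
    from DERIV_chain2[OF powr_lin_deriv[OF k0 yk, of "k / 2"] this]
    have dH: "((\<lambda>t. Hk k (ysum I \<tau> t)) has_real_derivative - (k / 2 / k * (1 - ysum I \<tau> t / k) powr (k / 2 - 1)) * Y') (at t)"
      by (simp add: Hk_def)
    have "(h has_real_derivative (ysum I \<tau> t * Hexp I \<tau> t - t * Y' * (1 - ysum I \<tau> t / k) powr (k / 2 - 1)) / (2 * t)) (at t)"
      unfolding h_def
      by (rule DERIV_cong[OF DERIV_diff[OF dH Hexp_deriv]])
         (use t0 k0 in \<open>simp_all add: ysum_div field_simps\<close>)
    moreover have "(ysum I \<tau> t * Hexp I \<tau> t - t * Y' * (1 - ysum I \<tau> t / k) powr (k / 2 - 1)) / (2 * t) \<le> 0"
      using le t0 by (intro divide_nonpos_pos) auto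
    ultimately show "\<exists>y. (h has_real_derivative y) (at t) \<and> y \<le> 0" by blast
  qed
  interpret Y: prob_space ylaw by (rule prob_space_ylaw)
  let ?N = "null_measure borel :: real measure"
  have le: "emeasure ylaw {r<..y} \<le> emeasure (eqlaw k) {r<..y}" if y: "r < y" for y
  proof (cases "y < k")
    case True
    then obtain v where v: "0 < v" "ysum I \<tau> v = y" using ysum_surj y r0 by (metis less_trans k_def)
    have uv: "u \<le> v"
    proof (rule ccontr)
      assume "\<not> u \<le> v"
      then show False using ysum_strict_mono[of v u] v u y by simp
    qed
    have "Hexp I \<tau> u - Hexp I \<tau> v \<le> Hk k r - Hk k y" using h[OF uv] u v by (simp add: h_def)
    then show ?thesis using ylaw_interval[OF u(1) uv] u v True r0
      by (simp add: eqlaw_interval[OF _ y rk] ennreal_leI)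
  next
    case False
    \<comment> \<open>The gap tends to 0 at infinity, so the decreasing \<open>h\<close> is
      nonnegative at \<open>u\<close>; this settles the intervals that contain everything above
      \<open>r\<close>.\<close>
    have "((\<lambda>v. h v + Hexp I \<tau> v) \<longlongrightarrow> Hk k k) at_top"
    proof -
      have "continuous_on {0..k} (Hk k)" unfolding Hk_def using k0 by (intro powr_lin_continuous) auto
      then have "(Hk k \<longlongrightarrow> Hk k k) (at k within {0..k})" using k0 by (simp add: continuous_on_def)
      moreover have "filterlim (ysum I \<tau>) (at k within {0..k}) at_top"
        unfolding filterlim_at using ysum_tendsto
      proof (intro conjI)
        show "\<forall>\<^sub>F x in at_top. ysum I \<tau> x \<in> {0..k} \<and> ysum I \<tau> x \<noteq> k"
          using eventually_gt_at_top[of 0]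
        proof eventually_elim
          case (elim x)
          then show ?case using ysum_pos[of x] ysum_less_card[of x] by (auto simp: k_def)
        qed
      qed (simp add: k_def)
      ultimately have "((\<lambda>v. Hk k (ysum I \<tau> v)) \<longlongrightarrow> Hk k k) at_top" by (rule filterlim_compose)
      then show ?thesis by (simp add: h_def)
    qed
    then have "((\<lambda>v. (h v + Hexp I \<tau> v) - Hexp I \<tau> v) \<longlongrightarrow> Hk k k - 0) at_top"
      by (intro tendsto_diff Hexp_tendsto)
    then have "(h \<longlongrightarrow> 0) at_top" using k0 by (simp add: Hk_def)
    moreover have "\<forall>\<^sub>F v in at_top. h v \<le> h u"
      using eventually_ge_at_top[of u] by eventually_elim (rule h)
    ultimately have "0 \<le> h u" by (intro tendsto_upperbound[where F = at_top]) auto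
    then have "Hexp I \<tau> u \<le> Hk k r" using u by (simp add: h_def)
    then show ?thesis using ylaw_tail[OF u(1), of y] False u r0 k0
      by (simp add: eqlaw_interval[OF _ y rk] ennreal_leI k_def[symmetric] Hk_def min_def)
  qed
  have "(\<integral>\<^sup>+s. ennreal (tail_kernel r s) \<partial>ylaw) \<le> (\<integral>\<^sup>+s. ennreal (tail_kernel r s) \<partial>eqlaw k)"
  proof (rule tail_kernel_compare[OF r0, where \<nu> = ?N and \<nu>' = ?N])
    show "sigma_finite_measure ylaw" by unfold_locales
    show "sigma_finite_measure (eqlaw k)" unfolding eqlaw_def by (rule sigma_finite_idens) simp
    show "sigma_finite_measure ?N" "sigma_finite_measure ?N"
      by (auto intro!: finite_measure.axioms(1) finite_measureI simp: finite_measure_def[symmetric])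
  qed (use le in \<open>auto simp: eqlaw_def nn_integral_null_measure\<close>)
  then show ?thesis by (simp add: k_def)
qed

end

text \<open>The law of \<open>(\<Sum>X)\<^sup>2 / \<Sum>X\<^sup>2\<close> for \<open>k\<close> i.i.d. centred Gaussians: \<open>k\<close> times a
  Beta(1/2, (k-1)/2) variable.\<close>
definition rdens :: "real \<Rightarrow> real \<Rightarrow> real" where
  "rdens k s = (s / k) powr (1 / 2 - 1) * (1 - s / k) powr ((k - 1) / 2 - 1) / (k * Beta (1 / 2) ((k - 1) / 2))"

definition rlaw :: "real \<Rightarrow> real measure" where
  "rlaw k = idens k (rdens k)"

definition Ptail :: "real \<Rightarrow> real \<Rightarrow> real" where
  "Ptail k r = measure (rlaw k) {r<..}"

section \<open>Moments and tails in the equal-variance case\<close>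

lemma idens_nn_integral:
  assumes [measurable]: "D \<in> borel_measurable borel" "g \<in> borel_measurable borel" and k: "0 < k"
  shows "(\<integral>\<^sup>+s. g s \<partial>idens k D) = ennreal k * (\<integral>\<^sup>+t. ennreal (D (k * t)) * indicator {0<..<1} t * g (k * t) \<partial>lborel)"
proof -
  have "(\<integral>\<^sup>+s. g s \<partial>idens k D) = (\<integral>\<^sup>+s. ennreal (D s) * indicator {0<..<k} s * g s \<partial>lborel)"
    unfolding idens_def by (subst nn_integral_density) auto
  also have "\<dots> = ennreal k * (\<integral>\<^sup>+t. ennreal (D (k * t)) * indicator {0<..<k} (k * t) * g (k * t) \<partial>lborel)"
    using k by (subst nn_integral_real_affine[where c = k and t = 0]) auto
  also have "(\<lambda>t. indicator {0<..<k} (k * t) :: ennreal) = indicator {0<..<1}"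
    using k by (auto simp: indicator_def fun_eq_iff zero_less_mult_iff)
  finally show ?thesis by (simp add: fun_eq_iff)
qed

lemma rdens_measurable[measurable]: "rdens k \<in> borel_measurable borel"
  unfolding rdens_def[abs_def] by measurable

lemma sets_rlaw[simp, measurable_cong]: "sets (rlaw k) = sets borel" by (simp add: rlaw_def)
lemma sets_eqlaw[simp, measurable_cong]: "sets (eqlaw k) = sets borel" by (simp add: eqlaw_def)

lemma Beta_pos: "0 < a \<Longrightarrow> 0 < b \<Longrightarrow> 0 < Beta a (b::real)"
  by (simp add: Beta_def Gamma_real_pos)

lemma rlaw_nn_integral:
  assumes k: "1 < k" and [measurable]: "g \<in> borel_measurable borel"
  shows "(\<integral>\<^sup>+s. g s \<partial>rlaw k) = ennreal (1 / Beta (1 / 2) ((k - 1) / 2)) *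
    (\<integral>\<^sup>+t. ennreal (t powr (1 / 2 - 1) * (1 - t) powr ((k - 1) / 2 - 1)) * indicator {0<..<1} t * g (k * t) \<partial>lborel)"
proof -
  define Bt where "Bt = Beta (1 / 2) ((k - 1) / 2)"
  have Bt: "0 < Bt" using k by (simp add: Bt_def Beta_pos)
  have k0: "0 < k" using k by simp
  have "(\<integral>\<^sup>+s. g s \<partial>rlaw k) = ennreal k * (\<integral>\<^sup>+t. ennreal (rdens k (k * t)) * indicator {0<..<1} t * g (k * t) \<partial>lborel)"
    unfolding rlaw_def using k by (intro idens_nn_integral) auto
  also have "\<dots> = ennreal k * (\<integral>\<^sup>+t. ennreal (1 / (k * Bt)) * (ennreal (t powr (1 / 2 - 1) * (1 - t) powr ((k - 1) / 2 - 1)) * indicator {0<..<1} t * g (k * t)) \<partial>lborel)"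
  proof (intro arg_cong[where f = "\<lambda>x. ennreal k * x"] nn_integral_cong)
    fix t :: real
    have "rdens k (k * t) = 1 / (k * Bt) * (t powr (1 / 2 - 1) * (1 - t) powr ((k - 1) / 2 - 1))"
      using k0 by (simp add: rdens_def Bt_def)
    then show "ennreal (rdens k (k * t)) * indicator {0<..<1} t * g (k * t)
      = ennreal (1 / (k * Bt)) * (ennreal (t powr (1 / 2 - 1) * (1 - t) powr ((k - 1) / 2 - 1)) * indicator {0<..<1} t * g (k * t))"
      using k0 Bt by (simp only: ennreal_mult' divide_nonneg_pos mult_pos_pos zero_le_one mult.assoc)
  qed
  also have "\<dots> = ennreal k * (ennreal (1 / (k * Bt)) * (\<integral>\<^sup>+t. ennreal (t powr (1 / 2 - 1) * (1 - t) powr ((k - 1) / 2 - 1)) * indicator {0<..<1} t * g (k * t) \<partial>lborel))"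
    by (subst nn_integral_cmult) auto
  also have "ennreal k * (ennreal (1 / (k * Bt)) * x) = ennreal (1 / Bt) * x" for x
    using k0 Bt by (simp add: mult.assoc[symmetric] ennreal_mult[symmetric])
  finally show ?thesis by (simp add: Bt_def)
qed

lemma rlaw_moment:
  assumes k: "1 < k"
  shows "(\<integral>\<^sup>+s. ennreal (s ^ n) \<partial>rlaw k) = ennreal (k ^ n * Beta (real n + 1 / 2) ((k - 1) / 2) / Beta (1 / 2) ((k - 1) / 2))"
proof -
  have b: "0 < Beta (1 / 2) ((k - 1) / 2)" "0 < Beta (real n + 1 / 2) ((k - 1) / 2)" using k by (auto intro!: Beta_pos)
  have "(\<integral>\<^sup>+t. ennreal (t powr (1 / 2 - 1) * (1 - t) powr ((k - 1) / 2 - 1)) * indicator {0<..<1} t * ennreal ((k * t) ^ n) \<partial>lborel)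
     = (\<integral>\<^sup>+t. ennreal (k ^ n) * (ennreal (t powr (real n + 1 / 2 - 1) * (1 - t) powr ((k - 1) / 2 - 1)) * indicator {0<..<1} t) \<partial>lborel)"
  proof (rule nn_integral_cong)
    fix t :: real
    show "ennreal (t powr (1 / 2 - 1) * (1 - t) powr ((k - 1) / 2 - 1)) * indicator {0<..<1} t * ennreal ((k * t) ^ n)
      = ennreal (k ^ n) * (ennreal (t powr (real n + 1 / 2 - 1) * (1 - t) powr ((k - 1) / 2 - 1)) * indicator {0<..<1} t)"
    proof (cases "0 < t \<and> t < 1")
      case True
      have "t powr (real n + 1 / 2 - 1) = t ^ n * t powr (1 / 2 - 1)"
      proof -
        have "real n + 1 / 2 - 1 = real n + (1 / 2 - 1)" by simp
        then show ?thesis using True by (simp only: powr_add powr_realpow)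
      qed
      then show ?thesis using True k by (simp add: ennreal_mult[symmetric] power_mult_distrib mult_ac)
    qed (auto simp: indicator_def)
  qed
  also have "\<dots> = ennreal (k ^ n) * ennreal (Beta (real n + 1 / 2) ((k - 1) / 2))"
    using k by (subst nn_integral_cmult, simp) (subst beta_nn_integral, auto)
  finally have "(\<integral>\<^sup>+s. ennreal (s ^ n) \<partial>rlaw k) = ennreal (1 / Beta (1 / 2) ((k - 1) / 2)) * (ennreal (k ^ n) * ennreal (Beta (real n + 1 / 2) ((k - 1) / 2)))"
    using k by (subst rlaw_nn_integral) auto
  then show ?thesis using b k by (simp add: ennreal_mult[symmetric])
qed

lemma eqlaw_moment:
  assumes k: "0 < k"
  shows "(\<integral>\<^sup>+s. ennreal (s ^ n) \<partial>eqlaw k) = ennreal (k ^ Suc n * Beta (real n + 1) (k / 2) / 2)"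
proof -
  have "(\<integral>\<^sup>+s. ennreal (s ^ n) \<partial>eqlaw k)
     = ennreal k * (\<integral>\<^sup>+t. ennreal ((1 - k * t / k) powr (k / 2 - 1) / 2) * indicator {0<..<1} t * ennreal ((k * t) ^ n) \<partial>lborel)"
    unfolding eqlaw_def using k by (intro idens_nn_integral) auto
  also have "\<dots> = ennreal k * (\<integral>\<^sup>+t. ennreal (k ^ n / 2) * (ennreal (t powr (real n + 1 - 1) * (1 - t) powr (k / 2 - 1)) * indicator {0<..<1} t) \<partial>lborel)"
  proof (intro arg_cong[where f = "\<lambda>x. ennreal k * x"] nn_integral_cong)
    fix t :: real
    show "ennreal ((1 - k * t / k) powr (k / 2 - 1) / 2) * indicator {0<..<1} t * ennreal ((k * t) ^ n)
      = ennreal (k ^ n / 2) * (ennreal (t powr (real n + 1 - 1) * (1 - t) powr (k / 2 - 1)) * indicator {0<..<1} t)"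
    proof (cases "0 < t \<and> t < 1")
      case True
      then show ?thesis using k by (simp add: ennreal_mult[symmetric] power_mult_distrib powr_realpow mult_ac)
    qed (auto simp: indicator_def)
  qed
  also have "\<dots> = ennreal k * (ennreal (k ^ n / 2) * ennreal (Beta (real n + 1) (k / 2)))"
    using k by (subst nn_integral_cmult, simp) (subst beta_nn_integral, auto)
  finally show ?thesis using k Beta_pos[of "real n + 1" "k / 2"] by (simp add: ennreal_mult[symmetric])
qed

lemma prob_space_rlaw: assumes k: "1 < k" shows "prob_space (rlaw k)"
proof
  have "Beta (1 / 2) ((k - 1) / 2) > 0" using k by (simp add: Beta_pos)
  then show "emeasure (rlaw k) (space (rlaw k)) = 1"
    using rlaw_moment[OF k, of 0] by simp
qed

lemma prob_space_eqlaw: assumes k: "0 < k" shows "prob_space (eqlaw k)"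
proof
  have "k * Beta 1 (k / 2) = 2"
  proof -
    have "k / 2 \<notin> \<int>\<^sub>\<le>\<^sub>0" using k by (auto dest: nonpos_Ints_nonpos)
    then have "Gamma (k / 2 + 1) = k / 2 * Gamma (k / 2)" by (rule Gamma_plus1)
    moreover have "0 < Gamma (k / 2 + 1)" using k by (simp add: Gamma_real_pos)
    moreover have "k * Beta 1 (k / 2) = k * Gamma (k / 2) / Gamma (k / 2 + 1)"
      by (simp add: Beta_def add.commute[of 1 "k / 2"])
    ultimately show ?thesis by (simp add: nonzero_divide_eq_eq)
  qed
  then show "emeasure (eqlaw k) (space (eqlaw k)) = 1"
    using eqlaw_moment[OF k, of 0] by simp
qed

lemma AE_idens:
  assumes [measurable]: "D \<in> borel_measurable borel"
  shows "AE s in idens k D. 0 < s \<and> s < k"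
  unfolding idens_def by (subst AE_density) (auto simp: indicator_def split: if_splits)

text \<open>Size-biasing Beta(1/2, (k-1)/2) gives Beta(3/2, (k-1)/2), and an independent Beta(1,
  1/2) factor turns this into Beta(1, k/2); the identity says this for moments, after scaling by
  \<open>k\<close>. So \<open>eqlaw k\<close> is the mixture that \<open>abel_tail\<close> asks
  for.\<close>

lemma beta_moment_identity:
  assumes k: "1 < k"
  shows "k ^ Suc n * Beta (real (Suc n) + 1 / 2) ((k - 1) / 2) / Beta (1 / 2) ((k - 1) / 2) * beta_mom n
     = k ^ Suc n * Beta (real n + 1) (k / 2) / 2"
proof -
  have g: "Gamma a \<noteq> 0" if "0 < a" for a :: real using Gamma_real_pos[OF that] by simp
  have *: "Beta (real n + 3 / 2) ((k - 1) / 2) / Beta (1 / 2) ((k - 1) / 2) * Beta (real n + 1) (1 / 2) = Beta (real n + 1) (k / 2)"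
  proof -
    have e: "real n + 3 / 2 + (k - 1) / 2 = real n + 1 + k / 2" "1 / 2 + (k - 1) / 2 = k / 2"
      "real n + 1 + 1 / 2 = real n + 3 / 2" by (simp_all add: field_simps)
    have "Gamma (real n + 3 / 2) \<noteq> 0" "Gamma ((k - 1) / 2) \<noteq> 0" "Gamma (1 / 2 :: real) \<noteq> 0" "Gamma (k / 2) \<noteq> 0"
      "Gamma (real n + 1 + k / 2) \<noteq> 0" using k by (auto intro!: g)
    then show ?thesis unfolding Beta_def e by (simp add: divide_simps)
  qed
  have "real (Suc n) + 1 / 2 = real n + 3 / 2" by simp
  then show ?thesis unfolding beta_mom_def *[symmetric] by (simp only: times_divide_eq_left times_divide_eq_right divide_divide_eq_left mult_ac)
qed

lemma eqlaw_kernel: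
  assumes k: "1 < k" and r: "0 < r"
  shows "(\<integral>\<^sup>+s. ennreal (tail_kernel r s) \<partial>eqlaw k) = ennreal (pi / (2 * sqrt r)) * ennreal (Ptail k r)"
proof -
  interpret R: prob_space "rlaw k" using k by (rule prob_space_rlaw)
  have "(\<integral>\<^sup>+s. ennreal (tail_kernel r s) \<partial>eqlaw k) = ennreal (pi / (2 * sqrt r)) * emeasure (rlaw k) {r<..}"
  proof (rule abel_tail[where K = k])
    show "AE x in rlaw k. 0 \<le> x \<and> x \<le> k" unfolding rlaw_def by (rule eventually_mono[OF AE_idens]) auto
    show "AE x in eqlaw k. 0 \<le> x \<and> x \<le> k" unfolding eqlaw_def
      by (rule eventually_mono[OF AE_idens]) auto
    fix n
    have "0 \<le> k ^ Suc n * Beta (real (Suc n) + 1 / 2) ((k - 1) / 2) / Beta (1 / 2) ((k - 1) / 2)"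
      using k by (intro divide_nonneg_pos mult_nonneg_nonneg less_imp_le[OF Beta_pos] Beta_pos) auto
    then have "(\<integral>\<^sup>+x. ennreal (x ^ Suc n) \<partial>rlaw k) * ennreal (beta_mom n)
       = ennreal (k ^ Suc n * Beta (real (Suc n) + 1 / 2) ((k - 1) / 2) / Beta (1 / 2) ((k - 1) / 2) * beta_mom n)"
      unfolding rlaw_moment[OF k] using beta_mom_pos[of n] by (intro ennreal_mult[symmetric]) auto
    then show "(\<integral>\<^sup>+x. ennreal (x ^ Suc n) \<partial>rlaw k) * ennreal (beta_mom n) = (\<integral>\<^sup>+x. ennreal (x ^ n) \<partial>eqlaw k)"
      using k by (simp only: beta_moment_identity[OF k] eqlaw_moment)
  qed (use k r in \<open>auto intro: prob_space_eqlaw prob_space_rlaw\<close>)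
  then show ?thesis by (simp add: Ptail_def R.emeasure_eq_measure)
qed

lemma rlaw_tail:
  assumes k: "1 < k" and r: "0 \<le> r"
  shows "ennreal (Ptail k r) = ennreal (1 / Beta (1 / 2) ((k - 1) / 2)) *
    (\<integral>\<^sup>+t. ennreal (t powr (1 / 2 - 1) * (1 - t) powr ((k - 1) / 2 - 1)) * indicator {r / k<..<1} t \<partial>lborel)"
proof -
  interpret R: prob_space "rlaw k" using k by (rule prob_space_rlaw)
  have "ennreal (Ptail k r) = (\<integral>\<^sup>+s. indicator {r<..} s \<partial>rlaw k)"
    by (simp add: Ptail_def R.emeasure_eq_measure)
  also have "\<dots> = ennreal (1 / Beta (1 / 2) ((k - 1) / 2)) *
    (\<integral>\<^sup>+t. ennreal (t powr (1 / 2 - 1) * (1 - t) powr ((k - 1) / 2 - 1)) * indicator {0<..<1} t * indicator {r<..} (k * t) \<partial>lborel)"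
    using k by (subst rlaw_nn_integral) auto
  also have "(\<integral>\<^sup>+t. ennreal (t powr (1 / 2 - 1) * (1 - t) powr ((k - 1) / 2 - 1)) * indicator {0<..<1} t * indicator {r<..} (k * t) \<partial>lborel)
    = (\<integral>\<^sup>+t. ennreal (t powr (1 / 2 - 1) * (1 - t) powr ((k - 1) / 2 - 1)) * indicator {r / k<..<1} t \<partial>lborel)"
  proof (rule nn_integral_cong)
    fix t
    have "0 \<le> r / k" using k r by simp
    moreover have "r < k * t \<longleftrightarrow> r / k < t" using k by (simp add: pos_divide_less_eq mult.commute)
    ultimately show "ennreal (t powr (1 / 2 - 1) * (1 - t) powr ((k - 1) / 2 - 1)) * indicator {0<..<1} t * indicator {r<..} (k * t)
       = ennreal (t powr (1 / 2 - 1) * (1 - t) powr ((k - 1) / 2 - 1)) * indicator {r / k<..<1} t"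
      by (auto simp: indicator_def)
  qed
  finally show ?thesis .
qed

lemma Ptail_strict:
  assumes k: "1 < k" and r: "0 \<le> r" "r < r'" "r' \<le> k"
  shows "Ptail k r' < Ptail k r"
proof -
  interpret R: prob_space "rlaw k" using k by (rule prob_space_rlaw)
  have "Ptail k r = measure (rlaw k) ({r<..r'} \<union> {r'<..})"
    unfolding Ptail_def using r by (intro arg_cong[where f = "measure (rlaw k)"]) auto
  also have "\<dots> = measure (rlaw k) {r<..r'} + Ptail k r'"
    unfolding Ptail_def by (rule R.finite_measure_Union) auto
  finally have eq: "Ptail k r = measure (rlaw k) {r<..r'} + Ptail k r'" .
  have "emeasure (rlaw k) {r<..r'} \<noteq> 0"
  proof
    assume "emeasure (rlaw k) {r<..r'} = 0"
    then have "AE s in lborel. (ennreal (rdens k s) * indicator {0<..<k} s) * indicator {r<..r'} s = 0"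
      unfolding rlaw_def idens_def by (subst (asm) emeasure_density) (auto simp: nn_integral_0_iff_AE)
    then have "AE s in lborel. s \<notin> {r<..<r'}"
    proof eventually_elim
      case (elim s)
      have "0 < rdens k s" if "r < s" "s < r'"
        using that r k by (auto simp: rdens_def intro!: divide_pos_pos mult_pos_pos Beta_pos)
      then show ?case using elim r by (auto simp: indicator_def split: if_splits)
    qed
    then have "emeasure lborel {r<..<r'} = 0" by (subst (asm) AE_iff_measurable[of "{r<..<r'}"]) auto
    then show False using r by simp
  qed
  then have "0 < measure (rlaw k) {r<..r'}"
    by (simp add: R.emeasure_eq_measure zero_less_measure_iff)
  then show ?thesis using eq by simp
qed

text \<open>Markov's inequality: the mean of \<open>rlaw k\<close> is 1 for every \<open>k\<close>.
  The bound is independent of \<open>k\<close> and will control the quantiles for large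
  \<open>k\<close>.\<close>

lemma Ptail_le_inverse:
  assumes k: "1 < k" and r: "0 < r"
  shows "Ptail k r \<le> 1 / r"
proof -
  interpret R: prob_space "rlaw k" using k by (rule prob_space_rlaw)
  have half: "(1 / 2 :: real) \<notin> \<int>\<^sub>\<le>\<^sub>0" by (auto dest: nonpos_Ints_nonpos)
  have "Beta (1 / 2 + 1) ((k - 1) / 2) * (1 / 2 + (k - 1) / 2) = 1 / 2 * Beta (1 / 2) ((k - 1) / 2)"
    using Beta_plus1_left[OF half, of "(k - 1) / 2"] by (simp add: mult.commute)
  then have "k * Beta (1 + 1 / 2) ((k - 1) / 2) / Beta (1 / 2) ((k - 1) / 2) = 1"
    using k Beta_pos[of "1 / 2" "(k - 1) / 2"] by (simp add: field_simps add.commute)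
  then have m: "(\<integral>\<^sup>+s. ennreal s \<partial>rlaw k) = 1"
    using rlaw_moment[OF k, of 1] k Beta_pos[of "3 / 2" "(k - 1) / 2"] by simp
  have "ennreal (Ptail k r) * ennreal r = (\<integral>\<^sup>+s. ennreal r * indicator {r<..} s \<partial>rlaw k)"
    by (subst nn_integral_cmult_indicator) (auto simp: Ptail_def R.emeasure_eq_measure mult.commute)
  also have "\<dots> \<le> (\<integral>\<^sup>+s. ennreal s \<partial>rlaw k)"
    by (intro nn_integral_mono) (auto simp: indicator_def ennreal_leI)
  finally have "ennreal (Ptail k r * r) \<le> ennreal 1" using r by (simp add: m ennreal_mult Ptail_def)
  then show ?thesis using r by (simp add: field_simps)
qed

section \<open>The self-normalised Gaussian sum\<close>

definition gaussian :: "real \<Rightarrow> real \<Rightarrow> real measure" where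
  "gaussian a s = density lborel (\<lambda>x. ennreal (normal_density a s x))"

lemma prob_space_gaussian: "0 < s \<Longrightarrow> prob_space (gaussian a s)"
  unfolding gaussian_def by (rule prob_space_normal_density)

lemma sets_gaussian[simp, measurable_cong]: "sets (gaussian a s) = sets borel"
  by (simp add: gaussian_def)

lemma space_gaussian[simp]: "space (gaussian a s) = UNIV"
  by (simp add: gaussian_def)

lemma density_PiM:
  fixes M N :: "'i \<Rightarrow> 'a measure" and w :: "'i \<Rightarrow> 'a \<Rightarrow> ennreal"
  assumes I: "finite I" and M: "\<And>i. i \<in> I \<Longrightarrow> prob_space (M i)" and N: "\<And>i. i \<in> I \<Longrightarrow> prob_space (N i)"
    and w: "\<And>i. i \<in> I \<Longrightarrow> w i \<in> borel_measurable (M i)"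
    and eq: "\<And>i. i \<in> I \<Longrightarrow> N i = density (M i) (w i)"
  shows "PiM I N = density (PiM I M) (\<lambda>x. \<Prod>i\<in>I. w i (x i))"
proof -
  \<comment> \<open>Outside \<open>I\<close> a point mass is put in, because the product locale asks
    for a probability measure at every index.\<close>
  define M' where "M' = (\<lambda>i. if i \<in> I then M i else return (count_space UNIV) undefined)"
  define N' where "N' = (\<lambda>i. if i \<in> I then N i else return (count_space UNIV) undefined)"
  have M': "PiM I M = PiM I M'" and N': "PiM I N = PiM I N'"
    by (auto simp: M'_def N'_def intro!: PiM_cong)
  have pM: "prob_space (M' i)" for i using M by (auto simp: M'_def intro: prob_space_return)
  have pN: "prob_space (N' i)" for i using N by (auto simp: N'_def intro: prob_space_return)
  interpret M: product_prob_space M' I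
    by (simp add: product_prob_space_def product_prob_space_axioms_def product_sigma_finite_def pM prob_space_imp_sigma_finite)
  interpret N: product_prob_space N' I
    by (simp add: product_prob_space_def product_prob_space_axioms_def product_sigma_finite_def pN prob_space_imp_sigma_finite)
  have s: "sets (N' i) = sets (M' i)" if "i \<in> I" for i using that eq by (simp add: N'_def M'_def)
  have wm[measurable]: "(\<lambda>x. \<Prod>i\<in>I. w i (x i)) \<in> borel_measurable (PiM I M')"
  proof (rule borel_measurable_prod_ennreal)
    fix i assume i: "i \<in> I"
    then have "w i \<in> borel_measurable (M' i)" using w by (simp add: M'_def)
    then show "(\<lambda>x. w i (x i)) \<in> borel_measurable (PiM I M')"
      by (rule measurable_compose[OF measurable_component_singleton[OF i]])
  qed
  have "density (PiM I M') (\<lambda>x. \<Prod>i\<in>I. w i (x i)) = PiM I N'"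
  proof (rule N.PiM_eqI[OF I])
    show "sets (density (PiM I M') (\<lambda>x. \<Prod>i\<in>I. w i (x i))) = sets (PiM I N')"
      using s by (auto intro!: sets_PiM_cong)
    fix A assume A: "\<And>i. i \<in> I \<Longrightarrow> A i \<in> sets (N' i)"
    then have A': "A i \<in> sets (M' i)" if "i \<in> I" for i using s that by auto
    have "emeasure (density (PiM I M') (\<lambda>x. \<Prod>i\<in>I. w i (x i))) (Pi\<^sub>E I A)
      = (\<integral>\<^sup>+x. (\<Prod>i\<in>I. w i (x i)) * indicator (Pi\<^sub>E I A) x \<partial>PiM I M')"
      using A' I by (intro emeasure_density wm sets_PiM_I_finite)
    also have "\<dots> = (\<integral>\<^sup>+x. (\<Prod>i\<in>I. w i (x i) * indicator (A i) (x i)) \<partial>PiM I M')"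
    proof (rule nn_integral_cong)
      fix x assume x: "x \<in> space (PiM I M')"
      have "indicator (Pi\<^sub>E I A) x = (\<Prod>i\<in>I. indicator (A i) (x i) :: ennreal)"
      proof (cases "\<forall>i\<in>I. x i \<in> A i")
        case True
        then show ?thesis using x by (auto simp: space_PiM PiE_def Pi_def indicator_def)
      next
        case False
        then obtain i where "i \<in> I" "x i \<notin> A i" by blast
        then show ?thesis using I by (auto simp: indicator_def PiE_def Pi_def intro!: prod_zero[symmetric])
      qed
      then show "(\<Prod>i\<in>I. w i (x i)) * indicator (Pi\<^sub>E I A) x = (\<Prod>i\<in>I. w i (x i) * indicator (A i) (x i))"
        by (simp add: prod.distrib)
    qed
    also have "\<dots> = (\<Prod>i\<in>I. \<integral>\<^sup>+x. w i x * indicator (A i) x \<partial>M' i)"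
    proof (rule M.product_nn_integral_prod[OF I])
      fix i assume i: "i \<in> I"
      have [measurable]: "w i \<in> borel_measurable (M' i)" "A i \<in> sets (M' i)" using w i A' by (auto simp: M'_def)
      show "(\<lambda>x. w i x * indicator (A i) x) \<in> borel_measurable (M' i)" by measurable
    qed
    also have "\<dots> = (\<Prod>i\<in>I. emeasure (N' i) (A i))"
    proof (rule prod.cong[OF refl])
      fix i assume i: "i \<in> I"
      then show "(\<integral>\<^sup>+x. w i x * indicator (A i) x \<partial>M' i) = emeasure (N' i) (A i)"
        using A'[OF i] w[OF i] eq[OF i] by (simp add: N'_def M'_def emeasure_density)
    qed
    finally show "emeasure (density (PiM I M') (\<lambda>x. \<Prod>i\<in>I. w i (x i))) (Pi\<^sub>E I A) = (\<Prod>i\<in>I. emeasure (N' i) (A i))" .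
  qed
  then show ?thesis by (simp add: M' N')
qed

section \<open>Moments of the self-normalised sum\<close>

lemma gaussian_sum_moment:
  fixes s :: "'i \<Rightarrow> real"
  assumes I: "finite I" "I \<noteq> {}" and s: "\<And>i. i \<in> I \<Longrightarrow> 0 < s i"
  shows "(\<integral>\<^sup>+x. ennreal ((\<Sum>i\<in>I. x i) ^ (2 * n)) \<partial>PiM I (\<lambda>i. gaussian 0 (s i)))
    = ennreal (fact (2 * n) / (2 ^ n * fact n) * (\<Sum>i\<in>I. (s i)\<^sup>2) ^ n)"
proof -
  define s' where "s' = (\<lambda>i. if i \<in> I then s i else 1)"
  have PiM_s': "PiM I (\<lambda>i. gaussian 0 (s i)) = PiM I (\<lambda>i. gaussian 0 (s' i))"
    by (intro PiM_cong) (auto simp: s'_def)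
  have s'0: "0 < s' i" for i using s by (auto simp: s'_def)
  interpret product_prob_space "\<lambda>i. gaussian 0 (s' i)" I
    by (simp add: product_prob_space_def product_prob_space_axioms_def product_sigma_finite_def prob_space_gaussian s'0 prob_space_imp_sigma_finite)
  let ?M = "PiM I (\<lambda>i. gaussian 0 (s' i))"
  define \<sigma> where "\<sigma> = sqrt (\<Sum>i\<in>I. (s i)\<^sup>2)"
  have sp: "0 < (\<Sum>i\<in>I. (s i)\<^sup>2)" using I s by (intro sum_pos) (auto simp: power2_eq_square)
  then have \<sigma>: "0 < \<sigma>" "\<sigma>\<^sup>2 = (\<Sum>i\<in>I. (s i)\<^sup>2)" by (auto simp: \<sigma>_def)
  have D: "distributed ?M lborel (\<lambda>x. \<Sum>i\<in>I. x i) (normal_density (\<Sum>i\<in>I. 0) (sqrt (\<Sum>i\<in>I. (s' i)\<^sup>2)))"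
  proof (rule P.sum_indep_normal[where X = "\<lambda>i x. x i" and \<mu> = "\<lambda>_. 0" and \<sigma> = s', OF I])
    show "P.indep_vars (\<lambda>i. borel) (\<lambda>i x. x i) I"
    proof -
      have "P.indep_vars (\<lambda>i. gaussian 0 (s' i)) (\<lambda>i x. x i) I"
      proof (subst P.indep_vars_iff_distr_eq_PiM'[OF I(2)])
        show "random_variable (gaussian 0 (s' i)) (\<lambda>x. x i)" if "i \<in> I" for i
          using that by (rule measurable_component_singleton)
        have "distr ?M (PiM I (\<lambda>i. gaussian 0 (s' i))) (\<lambda>x. \<lambda>i\<in>I. x i) = distr ?M ?M (\<lambda>x. x)"
          by (rule distr_cong) (auto simp: space_PiM PiE_restrict)
        moreover have "PiM I (\<lambda>i. distr ?M (gaussian 0 (s' i)) (\<lambda>x. x i)) = ?M"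
          by (intro PiM_cong refl) (simp add: PiM_component)
        ultimately show "distr ?M (PiM I (\<lambda>i. gaussian 0 (s' i))) (\<lambda>x. \<lambda>i\<in>I. x i) = PiM I (\<lambda>i. distr ?M (gaussian 0 (s' i)) (\<lambda>x. x i))"
          by simp
      qed
      then show ?thesis by (simp add: P.indep_vars_def cong: measurable_cong_sets)
    qed
    show "0 < s' i" if "i \<in> I" for i by (rule s'0)
    show "distributed ?M lborel (\<lambda>x. x i) (normal_density 0 (s' i))" if "i \<in> I" for i
    proof -
      have "distr ?M lborel (\<lambda>x. x i) = distr ?M (gaussian 0 (s' i)) (\<lambda>x. x i)"
        by (rule distr_cong) auto
      also have "\<dots> = gaussian 0 (s' i)" using that by (rule PiM_component)
      finally show ?thesis unfolding distributed_def using that by (simp add: gaussian_def)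
    qed
  qed
  have "sqrt (\<Sum>i\<in>I. (s' i)\<^sup>2) = \<sigma>" by (simp add: \<sigma>_def s'_def)
  then have D': "distributed ?M lborel (\<lambda>x. \<Sum>i\<in>I. x i) (normal_density 0 \<sigma>)" using D by simp
  have "(\<integral>\<^sup>+x. ennreal ((\<Sum>i\<in>I. x i) ^ (2 * n)) \<partial>?M) = (\<integral>\<^sup>+x. ennreal (normal_density 0 \<sigma> x) * ennreal (x ^ (2 * n)) \<partial>lborel)"
    by (rule distributed_nn_integral[OF D', symmetric]) simp
  also have "\<dots> = (\<integral>\<^sup>+x. ennreal (normal_density 0 \<sigma> x * x ^ (2 * n)) \<partial>lborel)"
    by (simp add: ennreal_mult)
  also have "\<dots> = ennreal (fact (2 * n) / ((2 / \<sigma>\<^sup>2) ^ n * fact n))"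
    using normal_moment_even[of \<sigma> 0 n] \<sigma>
    by (intro nn_integral_eq_integral[THEN trans]) (auto simp: has_bochner_integral_iff)
  also have "fact (2 * n) / ((2 / \<sigma>\<^sup>2) ^ n * fact n) = fact (2 * n) / (2 ^ n * fact n) * (\<Sum>i\<in>I. (s i)\<^sup>2) ^ n"
    using \<sigma> by (simp add: power_divide)
  finally show ?thesis unfolding PiM_s' .
qed

lemma gaussian_tilt:
  assumes s: "0 < s" and u: "0 \<le> u"
  shows "gaussian 0 (s / sqrt (1 + u * s\<^sup>2)) = density (gaussian 0 s) (\<lambda>x. ennreal (sqrt (1 + u * s\<^sup>2) * exp (- (u * x\<^sup>2 / 2))))"
proof -
  have p: "0 < 1 + u * s\<^sup>2" using u by (simp add: add_pos_nonneg)
  have "normal_density 0 (s / sqrt (1 + u * s\<^sup>2)) x = normal_density 0 s x * (sqrt (1 + u * s\<^sup>2) * exp (- (u * x\<^sup>2 / 2)))" for x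
  proof -
    have m1: "- (x - 0)\<^sup>2 / (2 * (s / sqrt (1 + u * s\<^sup>2))\<^sup>2) = - (x - 0)\<^sup>2 / (2 * s\<^sup>2) + - (u * x\<^sup>2 / 2)"
      using p s by (simp add: power_divide field_simps)
    have m2: "1 / sqrt (2 * pi * (s / sqrt (1 + u * s\<^sup>2))\<^sup>2) = 1 / sqrt (2 * pi * s\<^sup>2) * sqrt (1 + u * s\<^sup>2)"
      using p s by (simp add: power_divide real_sqrt_divide real_sqrt_mult)
    show ?thesis unfolding normal_density_def m1 m2 exp_add by (simp only: mult_ac)
  qed
  then show ?thesis unfolding gaussian_def
    by (subst density_density_eq) (auto simp: ennreal_mult')
qed

lemma ennreal_mult_cong:
  "0 \<le> a \<Longrightarrow> 0 \<le> c \<Longrightarrow> a * b = c * d \<Longrightarrow> ennreal a * ennreal b = ennreal c * ennreal d"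
  by (simp add: ennreal_mult'[symmetric])

definition selfnorm :: "'i set \<Rightarrow> ('i \<Rightarrow> real) \<Rightarrow> real" where
  "selfnorm I x = (\<Sum>i\<in>I. x i)\<^sup>2 / (\<Sum>i\<in>I. (x i)\<^sup>2)"

lemma selfnorm_bounds: "finite I \<Longrightarrow> 0 \<le> selfnorm I x \<and> selfnorm I x \<le> real (card I)"
proof
  assume I: "finite I"
  show "0 \<le> selfnorm I x" by (simp add: selfnorm_def sum_nonneg)
  show "selfnorm I x \<le> real (card I)"
    using sum_squared_le_sum_of_squares[of x I] sum_nonneg[of I "\<lambda>i. (x i)\<^sup>2"]
    by (cases "(\<Sum>i\<in>I. (x i)\<^sup>2) = 0") (auto simp: selfnorm_def divide_le_eq mult.commute)
qed

lemma gamma_integral: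
  assumes T: "0 < T"
  shows "(\<integral>\<^sup>+u. ennreal (u ^ n * exp (- (u * T / 2))) * indicator {0..} u \<partial>lborel) = ennreal (fact n * (2 / T) ^ Suc n)"
proof -
  define c where "c = 2 / T"
  have c: "0 < c" using T by (simp add: c_def)
  have "(\<integral>\<^sup>+u. ennreal (u ^ n * exp (- (u * T / 2))) * indicator {0..} u \<partial>lborel)
     = ennreal c * (\<integral>\<^sup>+x. ennreal ((c * x) ^ n * exp (- (c * x * T / 2))) * indicator {0..} (c * x) \<partial>lborel)"
    using c by (subst nn_integral_real_affine[where c = c and t = 0]) auto
  also have "\<dots> = ennreal c * (\<integral>\<^sup>+x. ennreal (c ^ n) * (ennreal (x ^ n * exp (- x)) * indicator {0..} x) \<partial>lborel)"
  proof (intro arg_cong[where f = "\<lambda>x. ennreal c * x"] nn_integral_cong)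
    fix x :: real
    have "c * x * T / 2 = x" using T by (simp add: c_def)
    moreover have "0 \<le> c * x \<longleftrightarrow> 0 \<le> x" using c by (simp add: zero_le_mult_iff)
    ultimately show "ennreal ((c * x) ^ n * exp (- (c * x * T / 2))) * indicator {0..} (c * x)
      = ennreal (c ^ n) * (ennreal (x ^ n * exp (- x)) * indicator {0..} x)"
      using c by (simp add: indicator_def power_mult_distrib ennreal_mult'[symmetric] mult.assoc)
  qed
  also have "\<dots> = ennreal c * (ennreal (c ^ n) * (\<integral>\<^sup>+x. ennreal (x ^ n * exp (- x)) * indicator {0..} x \<partial>lborel))"
    by (subst nn_integral_cmult) auto
  also have "(\<integral>\<^sup>+x. ennreal (x ^ n * exp (- x)) * indicator {0..} x \<partial>lborel) = ennreal (fact n)"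
    using nn_intergal_power_times_exp_Ici[of n] by (simp add: mult.commute)
  finally show ?thesis using c by (simp add: c_def[symmetric] ennreal_mult[symmetric] mult_ac)
qed

lemma gaussian_moment_tilt:
  fixes s :: "'i \<Rightarrow> real"
  assumes I: "finite I" "I \<noteq> {}" and s: "\<And>i. i \<in> I \<Longrightarrow> 0 < s i" and u: "0 < u"
  shows "(\<integral>\<^sup>+x. ennreal ((\<Sum>i\<in>I. x i) ^ (2 * n) * exp (- (u * (\<Sum>i\<in>I. (x i)\<^sup>2) / 2))) \<partial>PiM I (\<lambda>i. gaussian 0 (s i)))
    = ennreal (Hexp I (\<lambda>i. (s i)\<^sup>2) u * (fact (2 * n) / (2 ^ n * fact n) * (ysum I (\<lambda>i. (s i)\<^sup>2) u / u) ^ n))"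
proof -
  let ?\<tau> = "\<lambda>i. (s i)\<^sup>2"
  define H where "H = Hexp I ?\<tau> u"
  have H: "0 < H" by (simp add: H_def Hexp_def)
  have p: "0 < 1 + u * (s i)\<^sup>2" for i using u by (simp add: add_pos_nonneg)
  \<comment> \<open>Tilting keeps the coordinates independent centred Gaussians and replaces the
    variance \<open>\<tau>\<close> by \<open>\<tau> / (1 + u * \<tau>)\<close>; the new variances
    add up to \<open>ysum I \<tau> u / u\<close>.\<close>
  define s' where "s' = (\<lambda>i. s i / sqrt (1 + u * (s i)\<^sup>2))"
  have s': "0 < s' i" if "i \<in> I" for i using s[OF that] p[of i] by (simp add: s'_def)
  define w where "w = (\<lambda>i x. ennreal (sqrt (1 + u * (s i)\<^sup>2) * exp (- (u * x\<^sup>2 / 2))))"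
  let ?M = "PiM I (\<lambda>i. gaussian 0 (s i))"
  have tilt: "PiM I (\<lambda>i. gaussian 0 (s' i)) = density ?M (\<lambda>x. \<Prod>i\<in>I. w i (x i))"
    unfolding s'_def w_def
    using s s' u gaussian_tilt[of "s _" u]
    by (intro density_PiM I prob_space_gaussian) (auto simp: s'_def)
  have W: "(\<Prod>i\<in>I. w i (x i)) = ennreal (exp (- (u * (\<Sum>i\<in>I. (x i)\<^sup>2) / 2)) / H)" for x :: "'i \<Rightarrow> real"
  proof -
    have "(\<Prod>i\<in>I. w i (x i)) = ennreal (\<Prod>i\<in>I. sqrt (1 + u * (s i)\<^sup>2) * exp (- (u * (x i)\<^sup>2 / 2)))"
      unfolding w_def using p by (intro prod_ennreal) (auto simp: less_imp_le)
    also have "(\<Prod>i\<in>I. sqrt (1 + u * (s i)\<^sup>2) * exp (- (u * (x i)\<^sup>2 / 2)))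
       = (\<Prod>i\<in>I. exp (ln (1 + u * (s i)\<^sup>2) / 2)) * (\<Prod>i\<in>I. exp (- (u * (x i)\<^sup>2 / 2)))"
      unfolding prod.distrib
    proof (intro arg_cong2[where f = "(*)"] prod.cong refl)
      fix i
      have "exp (ln (1 + u * (s i)\<^sup>2) / 2) = (1 + u * (s i)\<^sup>2) powr (1 / 2)" using p[of i] by (simp add: powr_def)
      then show "sqrt (1 + u * (s i)\<^sup>2) = exp (ln (1 + u * (s i)\<^sup>2) / 2)" using p[of i] by (simp add: powr_half_sqrt)
    qed
    also have "\<dots> = exp ((\<Sum>i\<in>I. ln (1 + u * (s i)\<^sup>2)) / 2) * exp (- (u * (\<Sum>i\<in>I. (x i)\<^sup>2) / 2))"
    proof -
      have "(\<Sum>i\<in>I. ln (1 + u * (s i)\<^sup>2)) / 2 = (\<Sum>i\<in>I. ln (1 + u * (s i)\<^sup>2) / 2)" by (rule sum_divide_distrib)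
      moreover have "- (u * (\<Sum>i\<in>I. (x i)\<^sup>2) / 2) = (\<Sum>i\<in>I. - (u * (x i)\<^sup>2 / 2))"
        by (simp only: sum_negf sum_distrib_left sum_divide_distrib)
      ultimately show ?thesis by (simp only: exp_sum[OF I(1)])
    qed
    also have "\<dots> = exp (- (u * (\<Sum>i\<in>I. (x i)\<^sup>2) / 2)) / H"
    proof -
      have "exp (a / 2) * E = E / exp (- a / 2)" for a E :: real
      proof -
        have "exp (a / 2) * exp (- a / 2) = 1" by (simp flip: exp_add)
        then have "exp (a / 2) * E * exp (- a / 2) = E" by (metis mult.assoc mult.commute mult_1)
        then show ?thesis by (simp add: nonzero_eq_divide_eq)
      qed
      then show ?thesis unfolding H_def Hexp_def .
    qed
    finally show ?thesis .
  qed
  have m1[measurable]: "(\<lambda>x. \<Sum>i\<in>I. x i) \<in> borel_measurable ?M" "(\<lambda>x. \<Sum>i\<in>I. (x i)\<^sup>2) \<in> borel_measurable ?M"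
    by (auto intro!: borel_measurable_sum borel_measurable_power measurable_compose[OF measurable_component_singleton[of _ I "\<lambda>i. gaussian 0 (s i)"]])
  have "ennreal (fact (2 * n) / (2 ^ n * fact n) * (\<Sum>i\<in>I. (s' i)\<^sup>2) ^ n)
     = (\<integral>\<^sup>+x. ennreal ((\<Sum>i\<in>I. x i) ^ (2 * n)) \<partial>PiM I (\<lambda>i. gaussian 0 (s' i)))"
    by (rule gaussian_sum_moment[symmetric, OF I s'])
  also have "\<dots> = (\<integral>\<^sup>+x. ennreal (exp (- (u * (\<Sum>i\<in>I. (x i)\<^sup>2) / 2)) / H) * ennreal ((\<Sum>i\<in>I. x i) ^ (2 * n)) \<partial>?M)"
    unfolding tilt W by (subst nn_integral_density) auto
  also have "\<dots> = (\<integral>\<^sup>+x. ennreal (1 / H) * ennreal ((\<Sum>i\<in>I. x i) ^ (2 * n) * exp (- (u * (\<Sum>i\<in>I. (x i)\<^sup>2) / 2))) \<partial>?M)"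
  proof (rule nn_integral_cong)
    fix x :: "'i \<Rightarrow> real"
    show "ennreal (exp (- (u * (\<Sum>i\<in>I. (x i)\<^sup>2) / 2)) / H) * ennreal ((\<Sum>i\<in>I. x i) ^ (2 * n))
      = ennreal (1 / H) * ennreal ((\<Sum>i\<in>I. x i) ^ (2 * n) * exp (- (u * (\<Sum>i\<in>I. (x i)\<^sup>2) / 2)))"
      using H by (intro ennreal_mult_cong) auto
  qed
  also have "\<dots> = ennreal (1 / H) * (\<integral>\<^sup>+x. ennreal ((\<Sum>i\<in>I. x i) ^ (2 * n) * exp (- (u * (\<Sum>i\<in>I. (x i)\<^sup>2) / 2))) \<partial>?M)"
    by (rule nn_integral_cmult) measurable
  finally have "ennreal H * ennreal (fact (2 * n) / (2 ^ n * fact n) * (\<Sum>i\<in>I. (s' i)\<^sup>2) ^ n)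
     = (ennreal H * ennreal (1 / H)) * (\<integral>\<^sup>+x. ennreal ((\<Sum>i\<in>I. x i) ^ (2 * n) * exp (- (u * (\<Sum>i\<in>I. (x i)\<^sup>2) / 2))) \<partial>?M)"
    by (simp add: mult.assoc)
  also have "ennreal H * ennreal (1 / H) = 1" using H by (simp add: ennreal_mult[symmetric])
  finally have "(\<integral>\<^sup>+x. ennreal ((\<Sum>i\<in>I. x i) ^ (2 * n) * exp (- (u * (\<Sum>i\<in>I. (x i)\<^sup>2) / 2))) \<partial>?M)
     = ennreal (H * (fact (2 * n) / (2 ^ n * fact n) * (\<Sum>i\<in>I. (s' i)\<^sup>2) ^ n))"
    using H by (simp add: ennreal_mult'[symmetric])
  moreover have "(\<Sum>i\<in>I. (s' i)\<^sup>2) = ysum I ?\<tau> u / u"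
    unfolding ysum_def sum_divide_distrib
    by (intro sum.cong refl) (use u p in \<open>simp add: s'_def power_divide less_imp_le\<close>)
  ultimately show ?thesis by (simp add: H_def)
qed

text \<open>The closed form serves to cancel the factorials of the Gaussian moments and of the Gamma
  integral in \<open>selfnorm_moment\<close>.\<close>

lemma beta_mom_eq: "beta_mom n = 4 ^ Suc n * fact (Suc n) * fact n / (2 * fact (2 * Suc n))"
proof (induction n)
  case 0
  have "Beta 1 (1 / 2 :: real) = 2"
  proof -
    have "(1 / 2 :: real) \<notin> \<int>\<^sub>\<le>\<^sub>0" by (auto dest: nonpos_Ints_nonpos)
    from Gamma_plus1[OF this] have "Gamma (3 / 2 :: real) = Gamma (1 / 2) / 2" by simp
    moreover have ne: "Gamma (3 / 2 :: real) \<noteq> 0" by (rule less_imp_neq[symmetric], rule Gamma_real_pos) simp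
    ultimately have "Gamma (1 / 2) / Gamma (3 / 2) = (2::real)" by (simp add: nonzero_divide_eq_eq[OF ne])
    then show ?thesis by (simp add: Beta_def)
  qed
  then show ?case by (simp add: beta_mom_def)
next
  case (Suc n)
  have n: "real n + 1 \<notin> \<int>\<^sub>\<le>\<^sub>0" by (auto dest: nonpos_Ints_nonpos)
  have "(real n + 1 + 1 / 2) * Beta (real n + 1 + 1) (1 / 2) = (real n + 1) * Beta (real n + 1) (1 / 2)"
    by (rule Beta_plus1_left[OF n])
  then have "beta_mom (Suc n) = (real n + 1) / (real n + 3 / 2) * beta_mom n"
    by (simp add: beta_mom_def field_simps)
  also have "\<dots> = (real n + 1) / (real n + 3 / 2) * (4 ^ Suc n * fact (Suc n) * fact n / (2 * fact (2 * Suc n)))"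
    by (simp only: Suc)
  also have "\<dots> = 4 ^ Suc (Suc n) * fact (Suc (Suc n)) * fact (Suc n) / (2 * fact (2 * Suc (Suc n)))"
  proof -
    have f: "fact (2 * Suc (Suc n)) = (2 * real n + 4) * (2 * real n + 3) * fact (2 * Suc n)"
      by (simp add: fact_reduce[of "Suc (Suc (Suc (Suc (2 * n))))"] algebra_simps numeral_eq_Suc)
    have g: "fact (Suc (Suc n)) = (real n + 2) * fact (Suc n)" "fact (Suc n) = (real n + 1) * (fact n :: real)"
      by (simp_all add: algebra_simps)
    have "(real n + 1) / (real n + 3 / 2) * (P * F * G / (2 * K)) = 4 * P * ((real n + 2) * F) * ((real n + 1) * G) / (2 * ((2 * real n + 4) * (2 * real n + 3) * K))"
      if "K \<noteq> 0" for P F G K :: real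
    proof -
      have "real n + 3 / 2 \<noteq> 0" "2 * real n + 3 \<noteq> 0" "2 * real n + 4 \<noteq> 0" by (simp_all add: add_nonneg_eq_0_iff)
      then show ?thesis using that by (simp add: divide_simps) (simp add: algebra_simps)
    qed
    from this[of "fact (2 * Suc n)" "4 ^ Suc n" "fact (Suc n)" "fact n"]
    show ?thesis unfolding f g(1) by (simp only: g(2)[symmetric] power_Suc fact_nonzero not_False_eq_True mult.assoc simp_thms)
  qed
  finally show ?case .
qed

text \<open>A Gamma integral in \<open>u\<close> represents the negative power of the sum of
  squares. The denominator becomes an exponential weight, and this weight is a tilting of the
  Gaussian law.\<close>

lemma selfnorm_power_integral:
  assumes I: "finite I"
  shows "ennreal (selfnorm I x ^ Suc n) = ennreal (1 / (2 ^ Suc n * fact n)) *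
    (\<integral>\<^sup>+u. ennreal (u ^ n) * ennreal ((\<Sum>i\<in>I. x i) ^ (2 * Suc n) * exp (- (u * (\<Sum>i\<in>I. (x i)\<^sup>2) / 2))) * indicator {0..} u \<partial>lborel)"
proof -
  define T where "T = (\<Sum>i\<in>I. (x i)\<^sup>2)"
  define S where "S = (\<Sum>i\<in>I. x i)"
  have S0: "0 \<le> S ^ (2 * Suc n)" by (rule zero_le_even_power) simp
  have T0: "0 \<le> T" by (simp add: T_def sum_nonneg)
  have "(\<integral>\<^sup>+u. ennreal (u ^ n) * ennreal (S ^ (2 * Suc n) * exp (- (u * T / 2))) * indicator {0..} u \<partial>lborel)
    = (\<integral>\<^sup>+u. ennreal (S ^ (2 * Suc n)) * (ennreal (u ^ n * exp (- (u * T / 2))) * indicator {0..} u) \<partial>lborel)"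
  proof (rule nn_integral_cong)
    fix u :: real
    show "ennreal (u ^ n) * ennreal (S ^ (2 * Suc n) * exp (- (u * T / 2))) * indicator {0..} u
      = ennreal (S ^ (2 * Suc n)) * (ennreal (u ^ n * exp (- (u * T / 2))) * indicator {0..} u)"
    proof (cases "0 \<le> u")
      case True
      have "ennreal (u ^ n) * ennreal (S ^ (2 * Suc n) * exp (- (u * T / 2)))
        = ennreal (S ^ (2 * Suc n)) * ennreal (u ^ n * exp (- (u * T / 2)))"
        using S0 True by (intro ennreal_mult_cong) (auto simp del: power_Suc mult_Suc_right)
      then show ?thesis using True by (simp only: indicator_simps atLeast_iff mult_1_right)
    qed simp
  qed
  also have "\<dots> = ennreal (S ^ (2 * Suc n)) * (\<integral>\<^sup>+u. ennreal (u ^ n * exp (- (u * T / 2))) * indicator {0..} u \<partial>lborel)"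
    by (rule nn_integral_cmult) measurable
  finally have e: "(\<integral>\<^sup>+u. ennreal (u ^ n) * ennreal (S ^ (2 * Suc n) * exp (- (u * T / 2))) * indicator {0..} u \<partial>lborel)
     = ennreal (S ^ (2 * Suc n)) * (\<integral>\<^sup>+u. ennreal (u ^ n * exp (- (u * T / 2))) * indicator {0..} u \<partial>lborel)" .
  have "ennreal (selfnorm I x ^ Suc n) = ennreal (1 / (2 ^ Suc n * fact n)) *
      (ennreal (S ^ (2 * Suc n)) * (\<integral>\<^sup>+u. ennreal (u ^ n * exp (- (u * T / 2))) * indicator {0..} u \<partial>lborel))"
  proof (cases "T = 0")
    \<comment> \<open>All \<open>x i\<close> vanish. The quotient is 0 by the convention for
      division by 0, and the right side is 0 because \<open>S\<close> is, although the Gamma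
      integral is infinite.\<close>
    case True
    then have "\<forall>i\<in>I. x i = 0" using I by (simp add: T_def sum_nonneg_eq_0_iff)
    then have "S = 0" by (simp add: S_def)
    then show ?thesis using True by (simp add: selfnorm_def T_def)
  next
    case False
    then have T: "0 < T" using T0 by simp
    have "1 / (2 ^ Suc n * fact n) * (S ^ (2 * Suc n) * (fact n * (2 / T) ^ Suc n)) = S ^ (2 * Suc n) / T ^ Suc n"
      using T by (simp add: power_divide)
    also have "\<dots> = selfnorm I x ^ Suc n"
      by (simp only: selfnorm_def S_def[symmetric] T_def[symmetric] power_divide power_mult)
    finally have eq: "1 / (2 ^ Suc n * fact n) * (S ^ (2 * Suc n) * (fact n * (2 / T) ^ Suc n)) = selfnorm I x ^ Suc n" .
    have "ennreal a * (ennreal b * ennreal c) = ennreal (a * (b * c))" if "0 \<le> a" "0 \<le> b" for a b c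
      using that by (simp add: ennreal_mult')
    from this[of "1 / (2 ^ Suc n * fact n)" "S ^ (2 * Suc n)" "fact n * (2 / T) ^ Suc n"]
    show ?thesis unfolding gamma_integral[OF T] eq using S0 by simp
  qed
  then show ?thesis unfolding e[unfolded S_def T_def, symmetric] S_def T_def .
qed

lemma selfnorm_measurable:
  "selfnorm I \<in> borel_measurable (PiM I (\<lambda>i. gaussian (a i) (s i)))"
  unfolding selfnorm_def[abs_def]
  by (intro borel_measurable_divide borel_measurable_sum borel_measurable_power
     measurable_compose[OF measurable_component_singleton[of _ I "\<lambda>i. gaussian (a i) (s i)"]]) auto

lemma prob_space_PiM_gaussian:
  assumes "\<And>i. i \<in> I \<Longrightarrow> 0 < s i"
  shows "prob_space (PiM I (\<lambda>i. gaussian (a i) (s i)))"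
  by (intro prob_space_PiM prob_space_gaussian assms)

lemma variances_square: "finite I \<Longrightarrow> I \<noteq> {} \<Longrightarrow> (\<And>i. i \<in> I \<Longrightarrow> 0 < s i) \<Longrightarrow> variances I (\<lambda>i. (s i)\<^sup>2)"
  by unfold_locales (auto simp: power2_eq_square)

text \<open>Exchanging the integrals over \<open>x\<close> and \<open>u\<close> leaves
  \<open>u ^ n * Hexp * (ysum / u) ^ Suc n\<close>, which is \<open>2 * udens * ysum ^ n\<close>.
  One power of \<open>ysum / u\<close> is absorbed into the density; this produces the law
  \<open>ylaw\<close> and explains why the left side has one power more.\<close>

lemma selfnorm_moment:
  fixes s :: "'i \<Rightarrow> real"
  assumes I: "finite I" "I \<noteq> {}" and s: "\<And>i. i \<in> I \<Longrightarrow> 0 < s i"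
  shows "(\<integral>\<^sup>+x. ennreal (selfnorm I x ^ Suc n) \<partial>PiM I (\<lambda>i. gaussian 0 (s i))) * ennreal (beta_mom n)
    = (\<integral>\<^sup>+y. ennreal (y ^ n) \<partial>variances.ylaw I (\<lambda>i. (s i)\<^sup>2))"
proof -
  let ?\<tau> = "\<lambda>i. (s i)\<^sup>2"
  interpret V: variances I ?\<tau> using I s by (rule variances_square)
  let ?M = "PiM I (\<lambda>i. gaussian 0 (s i))"
  interpret M: prob_space ?M using s by (rule prob_space_PiM_gaussian)
  interpret P: pair_sigma_finite ?M lborel ..
  define N where "N = Suc n"
  define c :: real where "c = 1 / (2 ^ N * fact n)"
  define d :: real where "d = fact (2 * N) / (2 ^ N * fact N)"
  have c: "0 \<le> c" and d: "0 \<le> d" by (auto simp: c_def d_def)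
  have [measurable]: "(\<lambda>x. \<Sum>i\<in>I. x i) \<in> borel_measurable ?M" "(\<lambda>x. \<Sum>i\<in>I. (x i)\<^sup>2) \<in> borel_measurable ?M"
    by (auto intro!: borel_measurable_sum borel_measurable_power measurable_compose[OF measurable_component_singleton[of _ I "\<lambda>i. gaussian 0 (s i)"]])
  define F where "F = (\<lambda>(x::'i \<Rightarrow> real, u::real). ennreal (u ^ n) * ennreal ((\<Sum>i\<in>I. x i) ^ (2 * N) * exp (- (u * (\<Sum>i\<in>I. (x i)\<^sup>2) / 2))) * indicator {0..} u)"
  have Fm[measurable]: "F \<in> borel_measurable (?M \<Otimes>\<^sub>M lborel)" unfolding F_def by measurable
  have Fx: "(\<lambda>u. F (x, u)) \<in> borel_measurable borel" for x unfolding F_def by simp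
  have Fu: "(\<lambda>x. F (x, u)) \<in> borel_measurable ?M" for u unfolding F_def by simp
  have "(\<integral>\<^sup>+x. ennreal (selfnorm I x ^ N) \<partial>?M) = (\<integral>\<^sup>+x. ennreal c * (\<integral>\<^sup>+u. F (x, u) \<partial>lborel) \<partial>?M)"
    unfolding N_def selfnorm_power_integral[OF I(1)] by (simp add: F_def c_def N_def)
  also have "\<dots> = ennreal c * (\<integral>\<^sup>+x. (\<integral>\<^sup>+u. F (x, u) \<partial>lborel) \<partial>?M)"
    by (intro nn_integral_cmult lborel.borel_measurable_nn_integral_fst Fm)
  also have "(\<integral>\<^sup>+x. (\<integral>\<^sup>+u. F (x, u) \<partial>lborel) \<partial>?M) = (\<integral>\<^sup>+u. (\<integral>\<^sup>+x. F (x, u) \<partial>?M) \<partial>lborel)"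
    by (rule P.Fubini'[symmetric]) (simp add: split_beta')
  also have "\<dots> = (\<integral>\<^sup>+u. ennreal (2 * d) * (ennreal (V.udens u) * indicator {0..} u * ennreal (ysum I ?\<tau> u ^ n)) \<partial>lborel)"
  proof (rule nn_integral_cong_AE, use AE_lborel_singleton[of 0] in eventually_elim)
    fix u :: real assume u0: "u \<noteq> 0"
    show "(\<integral>\<^sup>+x. F (x, u) \<partial>?M) = ennreal (2 * d) * (ennreal (V.udens u) * indicator {0..} u * ennreal (ysum I ?\<tau> u ^ n))"
    proof (cases "0 < u")
      case True
      have y: "0 < ysum I ?\<tau> u" using V.ysum_pos[OF True] .
      have "(\<integral>\<^sup>+x. F (x, u) \<partial>?M) = ennreal (u ^ n) * (\<integral>\<^sup>+x. ennreal ((\<Sum>i\<in>I. x i) ^ (2 * N) * exp (- (u * (\<Sum>i\<in>I. (x i)\<^sup>2) / 2))) \<partial>?M)"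
        using True by (subst nn_integral_cmult[symmetric]) (auto simp: F_def)
      also have "\<dots> = ennreal (u ^ n) * ennreal (Hexp I ?\<tau> u * (d * (ysum I ?\<tau> u / u) ^ N))"
        using gaussian_moment_tilt[OF I s True, where n = N] by (simp only: d_def)
      also have "\<dots> = ennreal (u ^ n * (Hexp I ?\<tau> u * (d * (ysum I ?\<tau> u / u) ^ N)))"
        using True by (intro ennreal_mult'[symmetric]) simp
      also have "u ^ n * (Hexp I ?\<tau> u * (d * (ysum I ?\<tau> u / u) ^ N)) = 2 * d * (V.udens u * ysum I ?\<tau> u ^ n)"
        unfolding V.udens_def V.ysum_div[OF u0] N_def using True by (simp add: power_divide)
      also have "ennreal \<dots> = ennreal (2 * d) * (ennreal (V.udens u) * ennreal (ysum I ?\<tau> u ^ n))"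
        using d y True V.udens_nonneg[of u] by (simp add: ennreal_mult)
      finally show ?thesis using True by simp
    qed (use u0 in \<open>simp add: F_def\<close>)
  qed
  also have "\<dots> = ennreal (2 * d) * (\<integral>\<^sup>+u. ennreal (V.udens u) * indicator {0..} u * ennreal (ysum I ?\<tau> u ^ n) \<partial>lborel)"
    by (rule nn_integral_cmult) measurable
  also have "(\<integral>\<^sup>+u. ennreal (V.udens u) * indicator {0..} u * ennreal (ysum I ?\<tau> u ^ n) \<partial>lborel) = (\<integral>\<^sup>+y. ennreal (y ^ n) \<partial>V.ylaw)"
    unfolding V.ylaw_def V.ulaw_def by (subst nn_integral_distr, measurable, subst nn_integral_density, measurable)
  finally have "(\<integral>\<^sup>+x. ennreal (selfnorm I x ^ N) \<partial>?M) * ennreal (beta_mom n)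
     = ennreal c * (ennreal (2 * d) * (\<integral>\<^sup>+y. ennreal (y ^ n) \<partial>V.ylaw)) * ennreal (beta_mom n)" by simp
  also have "\<dots> = (ennreal c * ennreal (2 * d) * ennreal (beta_mom n)) * (\<integral>\<^sup>+y. ennreal (y ^ n) \<partial>V.ylaw)"
    by (simp only: mult_ac)
  also have "ennreal c * ennreal (2 * d) * ennreal (beta_mom n) = ennreal (c * (2 * d) * beta_mom n)"
    using c d beta_mom_pos[of n] by (simp add: ennreal_mult)
  also have "c * (2 * d) * beta_mom n = 1"
  proof -
    have "(2::real) ^ N * 2 ^ N = 4 ^ N" by (simp flip: power_mult_distrib)
    then show ?thesis unfolding beta_mom_eq c_def d_def N_def[symmetric] by (simp add: field_simps)
  qed
  finally show ?thesis by (simp add: N_def)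
qed

lemma selfnorm_tail:
  fixes s :: "'i \<Rightarrow> real"
  assumes I: "finite I" "I \<noteq> {}" and s: "\<And>i. i \<in> I \<Longrightarrow> 0 < s i" and r: "0 < r"
  shows "(\<integral>\<^sup>+y. ennreal (tail_kernel r y) \<partial>variances.ylaw I (\<lambda>i. (s i)\<^sup>2))
     = ennreal (pi / (2 * sqrt r)) * emeasure (PiM I (\<lambda>i. gaussian 0 (s i))) {x \<in> space (PiM I (\<lambda>i. gaussian 0 (s i))). r < selfnorm I x}"
proof -
  let ?\<tau> = "\<lambda>i. (s i)\<^sup>2"
  interpret V: variances I ?\<tau> using I s by (rule variances_square)
  let ?M = "PiM I (\<lambda>i. gaussian 0 (s i))"
  interpret M: prob_space ?M using s by (rule prob_space_PiM_gaussian)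
  note [measurable] = selfnorm_measurable[of I "\<lambda>_. 0" s]
  let ?R = "distr ?M borel (selfnorm I)"
  have "(\<integral>\<^sup>+y. ennreal (tail_kernel r y) \<partial>V.ylaw) = ennreal (pi / (2 * sqrt r)) * emeasure ?R {r<..}"
  proof (rule abel_tail[where K = "real (card I)"])
    show "prob_space ?R" by (rule M.prob_space_distr) simp
    show "AE x in ?R. 0 \<le> x \<and> x \<le> real (card I)"
      by (subst AE_distr_iff) (use selfnorm_bounds[OF I(1)] in auto)
    show "(\<integral>\<^sup>+x. ennreal (x ^ Suc n) \<partial>?R) * ennreal (beta_mom n) = (\<integral>\<^sup>+x. ennreal (x ^ n) \<partial>V.ylaw)" for n
    proof -
      have "(\<integral>\<^sup>+x. ennreal (x ^ Suc n) \<partial>?R) = (\<integral>\<^sup>+x. ennreal (selfnorm I x ^ Suc n) \<partial>?M)"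
        by (rule nn_integral_distr) measurable
      then show ?thesis by (simp only: selfnorm_moment[OF I s])
    qed
  qed (use V.AE_ylaw V.prob_space_ylaw r in auto)
  then show ?thesis by (subst (asm) emeasure_distr) (auto intro!: arg_cong2[where f = "(*)"] arg_cong2[where f = emeasure])
qed

text \<open>The three regimes are those in which the kernel integrals are ordered; on both sides
  these are tail probabilities times the same factor \<open>pi / (2 * sqrt r)\<close>. For
  \<open>r\<close> not below the number of components the event is empty by Cauchy-Schwarz.\<close>

theorem selfnorm_tail_le:
  fixes s :: "'i \<Rightarrow> real"
  assumes I: "finite I" and s: "\<And>i. i \<in> I \<Longrightarrow> 0 < s i"
    and c: "card I = 2 \<and> 4 / 3 \<le> r \<or> card I = 3 \<and> 2 \<le> r
       \<or> 4 \<le> card I \<and> 8 / 3 \<le> r \<and> 3 * real (card I) \<le> r * (real (card I) + 4 / 3)"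
  shows "measure (PiM I (\<lambda>i. gaussian 0 (s i))) {x \<in> space (PiM I (\<lambda>i. gaussian 0 (s i))). r < selfnorm I x} \<le> Ptail (real (card I)) r"
proof (cases "r < real (card I)")
  case False
  then have empty: "{x \<in> space (PiM I (\<lambda>i. gaussian 0 (s i))). r < selfnorm I x} = {}"
    using selfnorm_bounds[OF I] by (auto simp: not_less intro: order_trans)
  show ?thesis unfolding empty by (simp add: Ptail_def)
next
  case True
  have ne: "I \<noteq> {}" and r: "0 < r" and k: "1 < real (card I)" using c by auto
  let ?\<tau> = "\<lambda>i. (s i)\<^sup>2"
  interpret V: variances I ?\<tau> using I ne s by (rule variances_square)
  let ?M = "PiM I (\<lambda>i. gaussian 0 (s i))"
  interpret M: prob_space ?M using s by (rule prob_space_PiM_gaussian)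
  let ?A = "{x \<in> space ?M. r < selfnorm I x}"
  have "(\<integral>\<^sup>+y. ennreal (tail_kernel r y) \<partial>V.ylaw) \<le> (\<integral>\<^sup>+y. ennreal (tail_kernel r y) \<partial>eqlaw (real (card I)))"
  proof (cases "4 \<le> card I")
    case True
    then show ?thesis using c \<open>r < real (card I)\<close> by (intro V.ylaw_kernel_le_eqlaw) auto
  next
    case False
    then show ?thesis using c True by (intro V.ylaw_kernel_le_eqlaw_small_card) auto
  qed
  note kle = this
  have em: "ennreal (pi / (2 * sqrt r)) * ennreal a = ennreal (pi / (2 * sqrt r) * a)" for a
    using r by (intro ennreal_mult'[symmetric]) simp
  have "(\<integral>\<^sup>+y. ennreal (tail_kernel r y) \<partial>V.ylaw) = ennreal (pi / (2 * sqrt r) * measure ?M ?A)"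
    using selfnorm_tail[of I s r, OF I ne s r] by (simp only: em M.emeasure_eq_measure)
  moreover have "(\<integral>\<^sup>+y. ennreal (tail_kernel r y) \<partial>eqlaw (real (card I))) = ennreal (pi / (2 * sqrt r) * Ptail (real (card I)) r)"
    using eqlaw_kernel[OF k r] by (simp only: em)
  ultimately have "ennreal (pi / (2 * sqrt r) * measure ?M ?A) \<le> ennreal (pi / (2 * sqrt r) * Ptail (real (card I)) r)"
    using kle by (simp only:)
  then have "pi / (2 * sqrt r) * measure ?M ?A \<le> pi / (2 * sqrt r) * Ptail (real (card I)) r"
    using r by (subst (asm) ennreal_le_iff) (auto simp: Ptail_def)
  moreover have "0 < pi / (2 * sqrt r)" using r by simp
  ultimately show ?thesis by (simp only: mult_le_cancel_left_pos)
qed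

text \<open>The equal-variance case is itself an instance of the comparison, with fewer components.\<close>
lemma Ptail_mono:
  fixes j :: nat and k :: real
  assumes j: "2 \<le> j" "real j \<le> k" and k: "8 / 3 < k" and r: "8 / 3 \<le> r" "3 * k \<le> r * (k + 4 / 3)" "r < real j"
  shows "Ptail (real j) r \<le> Ptail k r"
proof -
  let ?I = "{..<j}" and ?\<tau> = "\<lambda>_::nat. 1::real"
  interpret V: variances ?I ?\<tau> by unfold_locales (use j in \<open>auto simp: lessThan_empty_iff\<close>)
  interpret Y: prob_space V.ylaw by (rule V.prob_space_ylaw)
  have cI: "real (card ?I) = real j" by simp
  have r0: "0 < r" and j1: "1 < real j" and j0: "0 < real j" using r j by auto
  interpret E: prob_space "eqlaw (real j)" using j0 by (rule prob_space_eqlaw)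
  \<comment> \<open>With all variances equal to 1 the two survival functions coincide, so
    \<open>eqlaw (real j)\<close> and \<open>V.ylaw\<close> agree on the intervals above
    \<open>r\<close>, and the comparison with \<open>k \<ge> j\<close> applies.\<close>
  have HY: "Hexp ?I ?\<tau> u = Hk (real j) (ysum ?I ?\<tau> u)" if "0 \<le> u" for u
  proof -
    have p: "0 < 1 + u" using that by simp
    have "1 - ysum ?I ?\<tau> u / real j = inverse (1 + u)"
    proof -
      have "ysum ?I ?\<tau> u / real j = u / (1 + u)" using j0 by (simp add: ysum_def)
      then have "1 - ysum ?I ?\<tau> u / real j = 1 - u / (1 + u)" by (simp only:)
      also have "\<dots> = inverse (1 + u)" using p by (simp add: divide_simps)
      finally show ?thesis .
    qed
    then have "Hk (real j) (ysum ?I ?\<tau> u) = exp (real j / 2 * ln (inverse (1 + u)))" using p by (simp add: Hk_def powr_def)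
    then show ?thesis using p by (simp add: Hexp_def ln_inverse)
  qed
  obtain u where u: "0 < u" "ysum ?I ?\<tau> u = r" using V.ysum_surj[of r] r r0 by auto
  have "emeasure (eqlaw (real j)) {r<..y} = emeasure V.ylaw {r<..y}" if y: "r < y" for y
  proof (cases "y < real j")
    case True
    obtain v where v: "0 < v" "ysum ?I ?\<tau> v = y" using V.ysum_surj[of y] True y r0 by auto
    have uv: "u \<le> v"
    proof (rule ccontr)
      assume "\<not> u \<le> v"
      then show False using V.ysum_strict_mono[of v u] v u y by simp
    qed
    show ?thesis using V.ylaw_interval[OF u(1) uv] u v True r0 r HY[of u] HY[of v] y
      by (simp add: eqlaw_interval)
  next
    case False
    then show ?thesis using V.ylaw_tail[OF u(1), of y] u r0 r HY[of u] y j0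
      by (simp add: eqlaw_interval Hk_def min_def)
  qed
  then have "(\<integral>\<^sup>+y. ennreal (tail_kernel r y) \<partial>eqlaw (real j)) = (\<integral>\<^sup>+y. ennreal (tail_kernel r y) \<partial>V.ylaw)"
    unfolding tail_kernel_integral[OF r0 E.sigma_finite_measure_axioms sets_eqlaw]
      tail_kernel_integral[OF r0 Y.sigma_finite_measure_axioms V.sets_ylaw]
    by (intro nn_integral_cong) (metis greaterThanAtMost_empty not_le_imp_less emeasure_empty)
  also have "\<dots> \<le> (\<integral>\<^sup>+y. ennreal (tail_kernel r y) \<partial>eqlaw k)"
    using j k r by (intro V.ylaw_kernel_le_eqlaw) auto
  finally have le: "(\<integral>\<^sup>+y. ennreal (tail_kernel r y) \<partial>eqlaw (real j)) \<le> (\<integral>\<^sup>+y. ennreal (tail_kernel r y) \<partial>eqlaw k)" .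
  have k1: "1 < k" using k by simp
  have em: "ennreal (pi / (2 * sqrt r)) * ennreal a = ennreal (pi / (2 * sqrt r) * a)" for a
    using r0 by (intro ennreal_mult'[symmetric]) simp
  have "ennreal (pi / (2 * sqrt r) * Ptail (real j) r) \<le> ennreal (pi / (2 * sqrt r) * Ptail k r)"
    using le unfolding eqlaw_kernel[OF j1 r0] eqlaw_kernel[OF k1 r0] em .
  then have "pi / (2 * sqrt r) * Ptail (real j) r \<le> pi / (2 * sqrt r) * Ptail k r"
    using r0 by (subst (asm) ennreal_le_iff) (auto simp: Ptail_def)
  moreover have "0 < pi / (2 * sqrt r)" using r0 by simp
  ultimately show ?thesis by (simp only: mult_le_cancel_left_pos)
qed

section \<open>Critical levels\<close>

lemma neg_ln_remainder_series_upper: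
  fixes x :: real
  assumes x: "0 \<le> x" "x < 1"
  shows "- ln (1 - x) - x \<le> x\<^sup>2 / 2 + x ^ 3 / 3 + x ^ 4 / (4 * (1 - x))"
proof -
  define d where "d = (\<lambda>t::real. t\<^sup>2 / 2 + t ^ 3 / 3 + t ^ 4 / (4 * (1 - t)) + ln (1 - t) + t)"
  have "d 0 \<le> d x"
  proof (rule DERIV_nonneg_imp_nondecreasing[OF x(1)])
    fix t :: real assume t: "0 \<le> t" "t \<le> x"
    then have t1: "t < 1" using x by simp
    have nz: "1 - t \<noteq> 0" "0 < 1 - t" "4 * (1 - t) \<noteq> 0" using t1 by auto
    have "(d has_real_derivative t ^ 4 / (4 * (1 - t)\<^sup>2)) (at t)"
      unfolding d_def
      apply (rule DERIV_cong)
       apply (rule derivative_intros nz | simp)+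
      using nz(1) by (simp add: divide_simps del: right_minus_eq) algebra
    then show "\<exists>y. (d has_real_derivative y) (at t) \<and> 0 \<le> y"
      by (intro exI[of _ "t ^ 4 / (4 * (1 - t)\<^sup>2)"]) auto
  qed
  then show ?thesis by (simp add: d_def)
qed

lemma neg_ln_remainder_pos:
  fixes x :: real
  assumes x: "0 < x" "x < 1"
  shows "0 < - ln (1 - x) - x"
  using ln_less_self[of "1 - x"] ln_le_minus_one[of "1 - x"] x ln_eq_minus_one[of "1 - x"] by force

text \<open>\<open>2 * w / (2 + w)\<close> is the Pade approximant of \<open>1 - exp (- w)\<close>
  of type [1/1]; it removes the exponential from the derivative test in
  \<open>limit_ratio_increasing\<close>.\<close>

lemma one_minus_exp_upper:
  fixes w :: real
  assumes "0 \<le> w"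
  shows "(1 - exp (- w)) * (2 + w) \<le> 2 * w"
proof -
  define d where "d = (\<lambda>t::real. 2 * t - (1 - exp (- t)) * (2 + t))"
  have "d 0 \<le> d w"
  proof (rule DERIV_nonneg_imp_nondecreasing[OF assms])
    fix t :: real assume t: "0 \<le> t" "t \<le> w"
    have "(d has_real_derivative 1 - exp (- t) * (1 + t)) (at t)"
      unfolding d_def
      by (rule DERIV_cong, (rule derivative_intros DERIV_fun_exp | simp)+) (simp add: algebra_simps)
    moreover have "exp (- t) * (1 + t) \<le> 1"
      using exp_ge_add_one_self[of t] by (simp add: exp_minus divide_simps mult.commute)
    ultimately show "\<exists>y. (d has_real_derivative y) (at t) \<and> 0 \<le> y"
      by (intro exI[of _ "1 - exp (- t) * (1 + t)"]) auto
  qed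
  then show ?thesis by (simp add: d_def)
qed

text \<open>The polynomial is \<open>2 - 2/3 * x - y * x / 4\<close> at
  \<open>y = 3 - 4/3 * x\<close>, the least \<open>y = k * x\<close> that satisfies
  \<open>3 \<le> y + 4/3 * x\<close>. The cut at 0.16 is close to the point where this lower bound
  for \<open>y\<close> is overtaken by \<open>18 * x\<close>.\<close>

lemma neg_ln_remainder_upper_small:
  fixes x :: real
  assumes x: "0 < x" "x \<le> 16 / 100"
  shows "(2 - 17 / 12 * x + x\<^sup>2 / 3) * (- ln (1 - x) - x) \<le> x\<^sup>2"
proof -
  have b: "- ln (1 - x) - x \<le> x\<^sup>2 * (1 / 2 + x / 3 + x\<^sup>2 / (4 * (84 / 100)))"
  proof -
    have "x ^ 4 / (4 * (1 - x)) \<le> x ^ 4 / (4 * (84 / 100))" using x by (intro divide_left_mono) auto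
    moreover have "x\<^sup>2 * (1 / 2 + x / 3 + x\<^sup>2 / (4 * (84 / 100))) = x\<^sup>2 / 2 + x ^ 3 / 3 + x ^ 4 / (4 * (84 / 100))"
      by (simp add: power2_eq_square power3_eq_cube power4_eq_xxxx field_simps)
    ultimately show ?thesis using neg_ln_remainder_series_upper[of x] x by linarith
  qed
  have "(2 - 17 / 12 * x + x\<^sup>2 / 3) * (1 / 2 + x / 3 + x\<^sup>2 / (4 * (84 / 100))) \<le> 1"
  proof -
    have "(2 - 17 / 12 * x + x\<^sup>2 / 3) * (1 / 2 + x / 3 + x\<^sup>2 / (4 * (84 / 100))) - 1
      = x * (- 1 / 24 + x * (1 / 1.68 - 17 / 36 + 1 / 6) + x\<^sup>2 * (1 / 9 - 17 / (12 * 3.36)) + x ^ 3 / (3 * 3.36))"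
      by (simp add: power2_eq_square power3_eq_cube field_simps)
    moreover have "- 1 / 24 + x * (1 / 1.68 - 17 / 36 + 1 / 6) + x\<^sup>2 * (1 / 9 - 17 / (12 * 3.36)) + x ^ 3 / (3 * 3.36) \<le> 0"
    proof -
      have "x ^ 3 = x * x\<^sup>2" by (simp add: power2_eq_square power3_eq_cube)
      also have "\<dots> \<le> 0.16 * x\<^sup>2" using x by (intro mult_right_mono) auto
      finally have "x ^ 3 / (3 * 3.36) \<le> 0.16 * x\<^sup>2 / (3 * 3.36)" by simp
      moreover have "0 \<le> x\<^sup>2" by simp
      moreover have "0 \<le> (0.16 - x)\<^sup>2" by simp
      then have "2 * 0.16 * x - 0.16\<^sup>2 \<le> x\<^sup>2" by (simp add: power2_eq_square algebra_simps)
      ultimately show ?thesis using x by (simp add: power2_eq_square field_simps)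
    qed
    ultimately show ?thesis using mult_nonneg_nonpos[OF less_imp_le[OF x(1)], of "- 1 / 24 + x * (1 / 1.68 - 17 / 36 + 1 / 6) + x\<^sup>2 * (1 / 9 - 17 / (12 * 3.36)) + x ^ 3 / (3 * 3.36)"]
      by linarith
  qed
  then have "x\<^sup>2 * ((2 - 17 / 12 * x + x\<^sup>2 / 3) * (1 / 2 + x / 3 + x\<^sup>2 / (4 * (84 / 100)))) \<le> x\<^sup>2 * 1"
    by (intro mult_left_mono) auto
  moreover have "(2 - 17 / 12 * x + x\<^sup>2 / 3) * (- ln (1 - x) - x) \<le> (2 - 17 / 12 * x + x\<^sup>2 / 3) * (x\<^sup>2 * (1 / 2 + x / 3 + x\<^sup>2 / (4 * (84 / 100))))"
    using b x by (intro mult_left_mono add_nonneg_nonneg) auto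
  ultimately show ?thesis by (simp add: mult_ac)
qed

text \<open>The same polynomial at \<open>y = 18 * x\<close>, which is a lower bound for
  \<open>k * x\<close> when \<open>18 \<le> k\<close>. Beyond 0.47 it will suffice to bound
  \<open>1 - exp (- w)\<close> by 1.\<close>

lemma neg_ln_remainder_upper_mid:
  fixes x :: real
  assumes x: "16 / 100 \<le> x" "x \<le> 47 / 100"
  shows "(2 - 2 / 3 * x - 9 / 2 * x\<^sup>2) * (- ln (1 - x) - x) \<le> x\<^sup>2"
proof -
  have "x\<^sup>2 * (1 / 2 + x / 3 + x\<^sup>2 / (4 * (1 - x))) = x\<^sup>2 / 2 + x ^ 3 / 3 + x ^ 4 / (4 * (1 - x))"
    using x by (simp add: power2_eq_square power3_eq_cube power4_eq_xxxx distrib_left)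
  then have b: "- ln (1 - x) - x \<le> x\<^sup>2 * (1 / 2 + x / 3 + x\<^sup>2 / (4 * (1 - x)))"
    using neg_ln_remainder_series_upper[of x] x by linarith
  have "(2 - 2 / 3 * x - 9 / 2 * x\<^sup>2) * (1 / 2 + x / 3 + x\<^sup>2 / (4 * (1 - x))) \<le> 1"
  proof -
    have "(2 - 2 / 3 * x - 9 / 2 * x\<^sup>2) * ((1 / 2 + x / 3) * (4 * (1 - x)) + x\<^sup>2) \<le> 1 * (4 * (1 - x))"
    proof -
      \<comment> \<open>Expanding at the left end point makes the inequality linear in the powers of
        \<open>v\<close>, each of which is at most 31/100 times the preceding one.\<close>
      define v where "v = x - 16 / 100"
      have v: "0 \<le> v" "v \<le> 31 / 100" using x by (auto simp: v_def)
      have xv: "x = v + 16 / 100" by (simp add: v_def)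
      have v2: "0 \<le> v\<^sup>2" "v\<^sup>2 \<le> 31 / 100 * v" using v mult_right_mono[of v "31 / 100" v] by (auto simp: power2_eq_square)
      have v3: "0 \<le> v ^ 3" "v ^ 3 \<le> 31 / 100 * v\<^sup>2" using v mult_right_mono[of v "31 / 100" "v * v"] by (auto simp: power2_eq_square power3_eq_cube)
      have v4: "0 \<le> v ^ 4" "v ^ 4 \<le> 31 / 100 * v ^ 3" using v mult_right_mono[of v "31 / 100" "v * v * v"] by (auto simp: power4_eq_xxxx power3_eq_cube)
      show ?thesis using v v2 v3 v4 unfolding xv
        by (simp add: power2_eq_square power3_eq_cube power4_eq_xxxx field_simps)
    qed
    moreover have "(2 - 2 / 3 * x - 9 / 2 * x\<^sup>2) * (1 / 2 + x / 3 + x\<^sup>2 / (4 * (1 - x))) = (2 - 2 / 3 * x - 9 / 2 * x\<^sup>2) * ((1 / 2 + x / 3) * (4 * (1 - x)) + x\<^sup>2) / (4 * (1 - x))"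
      using x by (simp add: divide_simps)
    ultimately show ?thesis using x by (simp add: pos_divide_le_eq)
  qed
  then have "x\<^sup>2 * ((2 - 2 / 3 * x - 9 / 2 * x\<^sup>2) * (1 / 2 + x / 3 + x\<^sup>2 / (4 * (1 - x)))) \<le> x\<^sup>2 * 1"
    by (intro mult_left_mono) auto
  moreover have "(2 - 2 / 3 * x - 9 / 2 * x\<^sup>2) * (- ln (1 - x) - x) \<le> (2 - 2 / 3 * x - 9 / 2 * x\<^sup>2) * (x\<^sup>2 * (1 / 2 + x / 3 + x\<^sup>2 / (4 * (1 - x))))"
  proof (rule mult_left_mono[OF b])
    have "x\<^sup>2 \<le> 47 / 100 * x" using x by (simp add: power2_eq_square mult_right_mono)
    then show "0 \<le> 2 - 2 / 3 * x - 9 / 2 * x\<^sup>2" using x by simp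
  qed
  ultimately show ?thesis by (simp add: mult_ac)
qed

definition explaw :: "real measure" where
  "explaw = density lborel (\<lambda>y. ennreal (exp (- y / 2) / 2) * indicator {0<..} y)"

lemma sets_explaw[simp, measurable_cong]: "sets explaw = sets borel" by (simp add: explaw_def)

lemma explaw_interval:
  assumes "0 \<le> r" "r < y"
  shows "emeasure explaw {r<..y} = ennreal (exp (- r / 2) - exp (- y / 2))"
proof -
  have "emeasure explaw {r<..y} = (\<integral>\<^sup>+s. ennreal (exp (- s / 2) / 2) * indicator {0<..} s * indicator {r<..y} s \<partial>lborel)"
    unfolding explaw_def by (subst emeasure_density) auto
  also have "\<dots> = (\<integral>\<^sup>+s. ennreal (exp (- s / 2) / 2) * indicator {r<..<y} s \<partial>lborel)"
    using AE_lborel_singleton[of y]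
    by (intro nn_integral_cong_AE, eventually_elim) (use assms in \<open>auto simp: indicator_def\<close>)
  also have "\<dots> = ennreal (- exp (- y / 2) - - exp (- r / 2))"
    by (rule nn_integral_FTC_open)
       (use assms in \<open>auto intro!: continuous_intros derivative_eq_intros\<close>)
  finally show ?thesis by simp
qed

lemma sigma_finite_explaw: "sigma_finite_measure explaw"
  unfolding explaw_def by (subst sigma_finite_measure.sigma_finite_iff_density_finite[OF sigma_finite_lborel]) (auto simp: indicator_def)

text \<open>Up to the constant \<open>2 * ln k\<close>, the value of \<open>G\<close> at
  \<open>y / k\<close> is the logarithm of \<open>(exp (- y / 2) - Hk k y) / cmpf k y\<close>. From
  the level \<open>3 * k / (k + 4/3)\<close> on this quotient increases, the opposite of
  \<open>ratio_decreasing\<close>, which is why the exponential limit bounds the equal-variance tail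
  from below.\<close>

lemma limit_ratio_increasing:
  fixes k :: real
  assumes k: "18 \<le> k" and x: "0 < a" "3 \<le> k * a + 4 / 3 * a" "a \<le> b" "b < 1"
  defines "w \<equiv> \<lambda>x. k / 2 * (- ln (1 - x) - x)"
  defines "G \<equiv> \<lambda>x. 4 / 3 * ln (1 - x) - 2 * ln x + ln (exp (w x) - 1)"
  shows "G a \<le> G b"
proof (rule DERIV_nonneg_imp_nondecreasing[OF x(3)])
  fix t assume t: "a \<le> t" "t \<le> b"
  then have t0: "0 < t" "t < 1" using x by auto
  have y: "3 - 4 / 3 * t \<le> k * t"
  proof -
    have "(k + 4 / 3) * a \<le> (k + 4 / 3) * t" using t k by (intro mult_left_mono) auto
    then show ?thesis using x(2) by (simp add: algebra_simps)
  qed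
  have y18: "18 * t \<le> k * t" using k t0 by simp
  define l where "l = - ln (1 - t) - t"
  have l: "0 < l" using neg_ln_remainder_pos t0 by (simp add: l_def)
  have wt: "w t = k / 2 * l" by (simp add: w_def l_def)
  have w0: "0 < w t" using l k by (simp add: wt)
  define E where "E = 1 - exp (- w t)"
  have E: "0 < E" "E < 1" using w0 by (auto simp: E_def)
  \<comment> \<open>The derivative of \<open>G\<close> is the right side minus the left side,
    divided by \<open>E * t * (1 - t)\<close>.\<close>
  have key: "(2 - 2 / 3 * t) * E \<le> k / 2 * t\<^sup>2"
  proof (cases "47 / 100 \<le> t")
    case True
    have "(2 - 2 / 3 * t) * E \<le> (2 - 2 / 3 * t) * 1" using E t0 by (intro mult_left_mono) auto
    also have "\<dots> \<le> 9 * (47 / 100 * t)" using True by simp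
    also have "\<dots> \<le> 9 * (t * t)" using True t0 by (intro mult_left_mono mult_right_mono) auto
    also have "\<dots> \<le> k / 2 * (t * t)" using k by (intro mult_right_mono) auto
    finally show ?thesis by (simp add: power2_eq_square)
  next
    case False
    have "(2 - 2 / 3 * t - k * t / 4 * t) * l \<le> t\<^sup>2"
    proof (cases "t \<le> 16 / 100")
      case True
      have "(3 - 4 / 3 * t) / 4 * t \<le> k * t / 4 * t" using y t0 by (intro mult_right_mono divide_right_mono) auto
      then have "(2 - 2 / 3 * t - k * t / 4 * t) * l \<le> (2 - 17 / 12 * t + t\<^sup>2 / 3) * l"
        using l by (intro mult_right_mono) (auto simp: power2_eq_square field_simps)
      also have "\<dots> \<le> t\<^sup>2" unfolding l_def using t0 True by (intro neg_ln_remainder_upper_small)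
      finally show ?thesis .
    next
      case b: False
      have "18 * t / 4 * t \<le> k * t / 4 * t" using y18 t0 by (intro mult_right_mono divide_right_mono) auto
      then have "(2 - 2 / 3 * t - k * t / 4 * t) * l \<le> (2 - 2 / 3 * t - 9 / 2 * t\<^sup>2) * l"
        using l by (intro mult_right_mono) (auto simp: power2_eq_square field_simps)
      also have "\<dots> \<le> t\<^sup>2" unfolding l_def using b False by (intro neg_ln_remainder_upper_mid) auto
      finally show ?thesis .
    qed
    then have "k * ((2 - 2 / 3 * t - k * t / 4 * t) * l) \<le> k * t\<^sup>2" using k by (intro mult_left_mono) auto
    then have a1: "(2 - 2 / 3 * t) * (2 * w t) \<le> k / 2 * t\<^sup>2 * (2 + w t)"
      by (simp add: wt power2_eq_square field_simps)
    have "(2 - 2 / 3 * t) * E * (2 + w t) = (2 - 2 / 3 * t) * (E * (2 + w t))" by simp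
    also have "\<dots> \<le> (2 - 2 / 3 * t) * (2 * w t)"
      using one_minus_exp_upper[of "w t"] w0 t0 by (intro mult_left_mono) (auto simp: E_def)
    also note a1
    finally show ?thesis using w0 by (simp add: mult_right_le_imp_le)
  qed
  have dw: "(w has_real_derivative k / 2 * (t / (1 - t))) (at t)"
  proof -
    have nz: "0 < 1 - t" "1 - t \<noteq> 0" using t0 by auto
    show ?thesis unfolding w_def
      apply (rule DERIV_cong)
       apply (rule derivative_intros nz)+
      using nz(2) by (simp add: divide_simps)
  qed
  have ew: "1 < exp (w t)" using w0 by simp
  have "(G has_real_derivative 4 / 3 * (1 / (1 - t) * (0 - 1)) - 2 * (1 / t) + 1 / (exp (w t) - 1) * (exp (w t) * (k / 2 * (t / (1 - t))) - 0)) (at t)"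
    unfolding G_def
    using t0 ew
    by (intro DERIV_add DERIV_diff DERIV_cmult DERIV_ln_divide[THEN DERIV_chain2] DERIV_ln_divide DERIV_fun_exp dw DERIV_const DERIV_ident) auto
  moreover have "0 \<le> 4 / 3 * (1 / (1 - t) * (0 - 1)) - 2 * (1 / t) + 1 / (exp (w t) - 1) * (exp (w t) * (k / 2 * (t / (1 - t))) - 0)"
  proof -
    have e: "1 / (exp (w t) - 1) * exp (w t) = 1 / E"
      using ew by (simp add: E_def exp_minus field_simps)
    have "1 / (exp (w t) - 1) * (exp (w t) * (k / 2 * (t / (1 - t))) - 0) = 1 / E * (k / 2 * (t / (1 - t)))"
      by (simp only: e[symmetric] diff_0_right mult.assoc)
    moreover have "4 / 3 * (1 / (1 - t) * (0 - 1)) - 2 * (1 / t) + 1 / E * (k / 2 * (t / (1 - t)))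
       = (k / 2 * t\<^sup>2 - (2 - 2 / 3 * t) * E) / (E * t * (1 - t))"
    proof -
      have nz: "1 - t \<noteq> 0" "t \<noteq> 0" "E \<noteq> 0" using t0 E by auto
      then show ?thesis by (simp add: divide_simps del: right_minus_eq) algebra
    qed
    moreover have "0 \<le> (k / 2 * t\<^sup>2 - (2 - 2 / 3 * t) * E) / (E * t * (1 - t))"
      using key t0 E by (intro divide_nonneg_pos) auto
    ultimately show ?thesis by simp
  qed
  ultimately show "\<exists>y. (G has_real_derivative y) (at t) \<and> 0 \<le> y" by blast
qed

text \<open>Compared with \<open>ylaw_kernel_le_eqlaw\<close> the roles of \<open>posd\<close> and
  \<open>negd\<close> are exchanged, and so is the condition on \<open>r\<close>. At this
  \<open>r\<close> it holds with equality: the correction has net kernel integral 0.\<close>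

lemma explaw_kernel_le_eqlaw:
  assumes k: "18 \<le> k" and r: "r = 3 * k / (k + 4 / 3)"
  shows "(\<integral>\<^sup>+s. ennreal (tail_kernel r s) \<partial>explaw) \<le> (\<integral>\<^sup>+s. ennreal (tail_kernel r s) \<partial>eqlaw k)"
proof -
  have r0: "0 < r" and k0: "0 < k" and k8: "8 / 3 < k" using k by (auto simp: r)
  have rk: "r < k"
  proof -
    have "r \<le> 3" using k by (simp add: r divide_le_eq)
    then show ?thesis using k by simp
  qed
  have req: "r * (k + 4 / 3) = 3 * k" using k by (simp add: r)
  define w where "w = (\<lambda>x. k / 2 * (- ln (1 - x) - x))"
  define G where "G = (\<lambda>x. 4 / 3 * ln (1 - x) - 2 * ln x + ln (exp (w x) - 1))"
  have h: "exp (- y / 2) - Hk k y = cmpf k y * exp (G (y / k) - 2 * ln k)" if y: "0 < y" "y < k" for y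
  proof -
    have x: "0 < y / k" "y / k < 1" using y k0 by auto
    have w0: "0 < w (y / k)" using neg_ln_remainder_pos[OF x] k by (simp add: w_def)
    have "exp (- y / 2) = Hk k y * exp (w (y / k))"
      using x k0 by (simp add: Hk_def powr_def w_def exp_add[symmetric] right_diff_distrib)
    then have "exp (- y / 2) - Hk k y = Hk k y * (exp (w (y / k)) - 1)" by (simp add: algebra_simps)
    also have "\<dots> = cmpf k y * (exp (4 / 3 * ln (1 - y / k) - 2 * ln y) * (exp (w (y / k)) - 1))"
      unfolding Hk_ratio[OF k0 y(2) y(1)] by simp
    also have "exp (4 / 3 * ln (1 - y / k) - 2 * ln y) * (exp (w (y / k)) - 1) = exp (G (y / k) - 2 * ln k)"
    proof -
      have e: "exp (ln (exp (w (y / k)) - 1)) = exp (w (y / k)) - 1" using w0 by simp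
      have "ln (y / k) = ln y - ln k" using y k0 by (simp add: ln_div)
      then have "G (y / k) - 2 * ln k = (4 / 3 * ln (1 - y / k) - 2 * ln y) + ln (exp (w (y / k)) - 1)"
        by (simp add: G_def)
      then show ?thesis by (simp only: exp_add e)
    qed
    finally show ?thesis .
  qed
  define m where "m = exp (G (r / k) - 2 * ln k)"
  have m: "0 \<le> m" by (simp add: m_def)
  have fr: "exp (- r / 2) - Hk k r = m * cmpf k r" using h[OF r0 rk] by (simp add: m_def)
  have fge: "0 \<le> cmpf k y" for y by (simp add: cmpf_def)
  have hy: "m * cmpf k (min y k) \<le> exp (- y / 2) - Hk k (min y k)" if y: "r < y" for y
  proof (cases "y < k")
    case True
    have "G (r / k) \<le> G (y / k)"
      unfolding G_def w_def
    proof (rule limit_ratio_increasing[OF k])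
      show "3 \<le> k * (r / k) + 4 / 3 * (r / k)"
        using req k0 by (simp add: field_simps)
      show "0 < r / k" "r / k \<le> y / k" "y / k < 1" using r0 k0 y True by (auto simp: divide_right_mono)
    qed
    then have "m \<le> exp (G (y / k) - 2 * ln k)" by (simp add: m_def)
    then have "m * cmpf k y \<le> exp (G (y / k) - 2 * ln k) * cmpf k y" by (rule mult_right_mono[OF _ fge])
    then show ?thesis using h[of y] y r0 True by (simp add: mult.commute)
  next
    case False
    then show ?thesis using k0 k8 by (simp add: cmpf_def Hk_def)
  qed
  show ?thesis
  proof (rule tail_kernel_compare[OF r0, where \<nu> = "idens k (\<lambda>y. m * negd k y)" and \<nu>' = "idens k (\<lambda>y. m * posd k y)"])
    show "sigma_finite_measure explaw" by (rule sigma_finite_explaw)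
    show "sigma_finite_measure (eqlaw k)" unfolding eqlaw_def by (rule sigma_finite_idens) simp
    show "sigma_finite_measure (idens k (\<lambda>y. m * posd k y))" by (rule sigma_finite_idens) (simp add: posd_def)
    show "sigma_finite_measure (idens k (\<lambda>y. m * negd k y))" by (rule sigma_finite_idens) (simp add: negd_def)
    fix y assume y: "r < y"
    have ry: "r \<le> min y k" "min y k \<le> k" using y rk by auto
    note nn = negd_nonneg_diff[of r "min y k" k]
    have ee: "exp (- y / 2) \<le> exp (- r / 2)" using y by simp
    have "emeasure explaw {r<..y} + emeasure (idens k (\<lambda>y. m * negd k y)) {r<..y}
       = ennreal (exp (- r / 2) - exp (- y / 2) + m * (negF k (min y k) - negF k r))"
      using m nn ry r0 k8 ee by (simp add: explaw_interval[OF _ y] negd_interval[OF _ y rk k8 m] ennreal_plus[symmetric] del: ennreal_plus)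
    also have "\<dots> \<le> ennreal ((Hk k r - Hk k (min y k)) + m * (negF k (min y k) - negF k r + cmpf k r - cmpf k (min y k)))"
    proof (rule ennreal_leI)
      have "(Hk k r - Hk k (min y k)) + m * (negF k (min y k) - negF k r + cmpf k r - cmpf k (min y k))
        - (exp (- r / 2) - exp (- y / 2) + m * (negF k (min y k) - negF k r))
       = (exp (- y / 2) - Hk k (min y k) - m * cmpf k (min y k)) - (exp (- r / 2) - Hk k r - m * cmpf k r)"
        by (simp add: algebra_simps)
      then show "exp (- r / 2) - exp (- y / 2) + m * (negF k (min y k) - negF k r)
        \<le> (Hk k r - Hk k (min y k)) + m * (negF k (min y k) - negF k r + cmpf k r - cmpf k (min y k))"
        using hy[OF y] fr by linarith
    qed
    also have "\<dots> = emeasure (eqlaw k) {r<..y} + emeasure (idens k (\<lambda>y. m * posd k y)) {r<..y}"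
      using m nn ry r0 k8 Hk_mono[OF k0 _ ry(1) ry(2)]
      by (simp add: posd_interval[OF _ y rk k8 m] eqlaw_interval[OF _ y rk] ennreal_plus[symmetric] del: ennreal_plus)
    finally show "emeasure explaw {r<..y} + emeasure (idens k (\<lambda>y. m * negd k y)) {r<..y} \<le> emeasure (eqlaw k) {r<..y} + emeasure (idens k (\<lambda>y. m * posd k y)) {r<..y}" .
  qed (use kernel_posd_negd[OF r0 rk k8 m] req in \<open>auto simp: eqlaw_def\<close>)
qed

section \<open>The exponential limit as a normal tail\<close>

lemma gaussian_half_integral:
  assumes t: "0 < t"
  shows "(\<integral>\<^sup>+y. ennreal (exp (- t * y / 2) / sqrt (y - r)) * indicator {r<..} y \<partial>lborel) = ennreal (exp (- t * r / 2) * sqrt (2 * pi / t))"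
proof -
  have G: "0 < Gamma (1 / 2 :: real)" by (simp add: Gamma_real_pos)
  have "((\<lambda>s::real. s powr (1 / 2 - 1) / exp s) has_integral Gamma (1 / 2 :: real)) {0..}"
    by (rule Gamma_integral_real) simp
  then have "(\<integral>\<^sup>+s. ennreal (s powr (1 / 2 - 1) / exp s) * indicator {0..} s \<partial>lborel) = ennreal (Gamma (1 / 2))"
    by (rule nn_integral_has_integral_set) auto
  moreover have "(\<integral>\<^sup>+s. ennreal (s powr (1 / 2 - 1) / exp s) * indicator {0..} s \<partial>lborel)
     = (\<integral>\<^sup>+s. ennreal (s powr (1 / 2 - 1) / exp s) * indicator {0<..} s \<partial>lborel)"
    using AE_lborel_singleton[of "0::real"] by (intro nn_integral_cong_AE, eventually_elim) (auto simp: indicator_def)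
  ultimately have g: "(\<integral>\<^sup>+s. ennreal (s powr (1 / 2 - 1) / exp s) * indicator {0<..} s \<partial>lborel) = ennreal (Gamma (1 / 2))"
    by simp
  have "(\<integral>\<^sup>+y. ennreal (exp (- t * y / 2) / sqrt (y - r)) * indicator {r<..} y \<partial>lborel)
    = ennreal (2 / t) * (\<integral>\<^sup>+s. ennreal (exp (- t * (r + 2 / t * s) / 2) / sqrt (r + 2 / t * s - r)) * indicator {r<..} (r + 2 / t * s) \<partial>lborel)"
    using t by (subst nn_integral_real_affine[where c = "2 / t" and t = r]) auto
  also have "\<dots> = ennreal (2 / t) * (\<integral>\<^sup>+s. ennreal (exp (- t * r / 2) / sqrt (2 / t)) * (ennreal (s powr (1 / 2 - 1) / exp s) * indicator {0<..} s) \<partial>lborel)"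
  proof (intro arg_cong[where f = "\<lambda>x. ennreal (2 / t) * x"] nn_integral_cong)
    fix s :: real
    show "ennreal (exp (- t * (r + 2 / t * s) / 2) / sqrt (r + 2 / t * s - r)) * indicator {r<..} (r + 2 / t * s)
      = ennreal (exp (- t * r / 2) / sqrt (2 / t)) * (ennreal (s powr (1 / 2 - 1) / exp s) * indicator {0<..} s)"
    proof (cases "0 < s")
      case True
      have p: "s powr (1 / 2 - 1) = 1 / sqrt s" using True by (simp add: powr_minus powr_half_sqrt divide_simps flip: powr_half_sqrt)
      have "- t * (r + 2 / t * s) / 2 = - t * r / 2 + - s" using t by (simp add: field_simps)
      then have "exp (- t * (r + 2 / t * s) / 2) = exp (- t * r / 2) * exp (- s)" by (simp only: exp_add)
      then have "exp (- t * (r + 2 / t * s) / 2) / sqrt (r + 2 / t * s - r) = exp (- t * r / 2) / sqrt (2 / t) * (s powr (1 / 2 - 1) / exp s)"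
        using t True unfolding p by (simp add: exp_minus real_sqrt_mult real_sqrt_divide divide_simps)
      moreover have "0 \<le> exp (- t * r / 2) / sqrt (2 / t)" using t by simp
      ultimately show ?thesis using True t by (simp add: ennreal_mult'[symmetric])
    next
      case False
      then have "2 / t * s \<le> 0" using t by (intro mult_nonneg_nonpos) auto
      then have "indicator {r<..} (r + 2 / t * s) = (0 :: ennreal)" by (simp add: indicator_def)
      then show ?thesis using False by (simp only: mult_zero_right) simp
    qed
  qed
  also have "\<dots> = ennreal (2 / t) * (ennreal (exp (- t * r / 2) / sqrt (2 / t)) * ennreal (Gamma (1 / 2)))"
    by (subst nn_integral_cmult, measurable, simp only: g)
  also have "\<dots> = ennreal (2 / t * (exp (- t * r / 2) / sqrt (2 / t) * Gamma (1 / 2)))"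
    using t G by (simp add: ennreal_mult'[symmetric])
  also have "2 / t * (exp (- t * r / 2) / sqrt (2 / t) * Gamma (1 / 2)) = exp (- t * r / 2) * sqrt (2 * pi / t)"
  proof -
    have "2 / t / sqrt (2 / t) = sqrt (2 / t)" using t by (intro real_div_sqrt) simp
    moreover have "sqrt (2 * pi / t) = sqrt (2 / t) * sqrt pi" by (simp add: real_sqrt_mult[symmetric])
    moreover have "2 / t * (exp (- t * r / 2) / sqrt (2 / t) * Gamma (1 / 2)) = exp (- t * r / 2) * (2 / t / sqrt (2 / t) * sqrt pi)"
      by (simp add: Gamma_one_half_real)
    ultimately show ?thesis by (simp only:)
  qed
  finally show ?thesis .
qed

lemma Phi_diff:
  assumes "a \<le> x"
  shows "Phi x = Phi a + integral {a..x} std_normal_density"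
proof -
  let ?M = "density lborel std_normal_density"
  interpret M: prob_space ?M by (rule prob_space_normal_density) simp
  interpret M: finite_borel_measure ?M by unfold_locales simp
  have c: "continuous_on S std_normal_density" for S :: "real set"
    unfolding std_normal_density_def by (intro continuous_intros) auto
  have h: "(std_normal_density has_integral integral {a..x} std_normal_density) {a..x}"
    by (intro integrable_integral integrable_continuous_interval c)
  have "Phi x - Phi a = measure ?M {a<..x}"
    unfolding Phi_def using assms by (cases "a = x") (auto simp: M.cdf_diff_eq)
  also have "\<dots> = integral {a..x} std_normal_density"
  proof -
    have "emeasure ?M {a<..x} = (\<integral>\<^sup>+t. ennreal (std_normal_density t) * indicator {a<..x} t \<partial>lborel)"
      by (subst emeasure_density) auto
    also have "\<dots> = (\<integral>\<^sup>+t. ennreal (std_normal_density t) * indicator {a..x} t \<partial>lborel)"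
      using AE_lborel_singleton[of a] by (intro nn_integral_cong_AE, eventually_elim) (auto simp: indicator_def)
    also have "\<dots> = ennreal (integral {a..x} std_normal_density)"
      by (rule nn_integral_has_integral_set[OF h]) auto
    finally show ?thesis
      using integral_nonneg[OF has_integral_integrable[OF h]] by (simp add: M.emeasure_eq_measure)
  qed
  finally show ?thesis by simp
qed

lemma Phi_deriv: "(Phi has_real_derivative std_normal_density x) (at x)"
proof -
  have c: "continuous_on S std_normal_density" for S :: "real set"
    unfolding std_normal_density_def by (intro continuous_intros) auto
  have "((\<lambda>t. integral {x - 1..t} std_normal_density) has_real_derivative std_normal_density x) (at x within {x - 1..x + 1})"
    by (rule integral_has_real_derivative[OF c]) auto
  then have "((\<lambda>t. integral {x - 1..t} std_normal_density) has_real_derivative std_normal_density x) (at x)"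
    using at_within_interior[of x "{x - 1..x + 1}"] by simp
  then have "((\<lambda>t. Phi (x - 1) + integral {x - 1..t} std_normal_density) has_real_derivative 0 + std_normal_density x) (at x)"
    by (intro DERIV_add DERIV_const)
  then show ?thesis unfolding add_0
    by (rule has_field_derivative_transform_within_open[where S = "{x - 1<..}"])
       (auto intro!: Phi_diff[symmetric])
qed

lemma Phi_tendsto: "(Phi \<longlongrightarrow> 0) at_bot"
proof -
  let ?M = "density lborel std_normal_density"
  interpret M: prob_space ?M by (rule prob_space_normal_density) simp
  interpret M: finite_borel_measure ?M by unfold_locales simp
  show ?thesis unfolding Phi_def[abs_def] by (rule M.cdf_lim_at_bot)
qed

text \<open>Writing \<open>2 * exp (- y / 2) / y\<close> as the integral of
  \<open>exp (- t * y / 2)\<close> over \<open>t \<ge> 1\<close> removes \<open>1 / y\<close> from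
  the kernel. After the exchange of integrals the one in \<open>y\<close> is a Gamma integral, and
  the remaining function of \<open>t\<close> is the derivative of a multiple of
  \<open>Phi (- sqrt (t * r))\<close>.\<close>

lemma explaw_kernel:
  assumes r: "0 < r"
  shows "(\<integral>\<^sup>+s. ennreal (tail_kernel r s) \<partial>explaw) = ennreal (pi / (2 * sqrt r) * (2 * Phi (- sqrt r)))"
proof -
  define F where "F = (\<lambda>(y::real, t::real). ennreal (exp (- t * y / 2) / sqrt (y - r)) * indicator {r<..} y * indicator {1..} t)"
  have [measurable]: "F \<in> borel_measurable (lborel \<Otimes>\<^sub>M lborel)" unfolding F_def by measurable
  have inner: "(\<integral>\<^sup>+t. ennreal (exp (- t * y / 2)) * indicator {1..} t \<partial>lborel) = ennreal (2 * exp (- y / 2) / y)" if y: "0 < y" for y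
  proof -
    have "(\<integral>\<^sup>+t. ennreal (exp (- t * y / 2)) * indicator {1..} t \<partial>lborel) = ennreal (0 - (- (2 / y * exp (- 1 * y / 2))))"
    proof (rule nn_integral_FTC_atLeast)
      show "((\<lambda>t. - (2 / y * exp (- t * y / 2))) has_real_derivative exp (- t * y / 2)) (at t)" for t
        using y by (auto intro!: derivative_eq_intros)
      show "((\<lambda>t. - (2 / y * exp (- t * y / 2))) \<longlongrightarrow> 0) at_top" using y by real_asymp
    qed auto
    then show ?thesis by simp
  qed
  have "(\<integral>\<^sup>+s. ennreal (tail_kernel r s) \<partial>explaw)
     = (\<integral>\<^sup>+y. ennreal (exp (- y / 2) / 2) * indicator {0<..} y * ennreal (tail_kernel r y) \<partial>lborel)"
    unfolding explaw_def by (subst nn_integral_density) auto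
  also have "\<dots> = (\<integral>\<^sup>+y. ennreal (1 / 4) * (\<integral>\<^sup>+t. F (y, t) \<partial>lborel) \<partial>lborel)"
  proof (rule nn_integral_cong)
    fix y :: real
    show "ennreal (exp (- y / 2) / 2) * indicator {0<..} y * ennreal (tail_kernel r y) = ennreal (1 / 4) * (\<integral>\<^sup>+t. F (y, t) \<partial>lborel)"
    proof (cases "r < y")
      case True
      then have y: "0 < y" using r by simp
      have "(\<integral>\<^sup>+t. F (y, t) \<partial>lborel) = (\<integral>\<^sup>+t. ennreal (1 / sqrt (y - r)) * (ennreal (exp (- t * y / 2)) * indicator {1..} t) \<partial>lborel)"
        using True by (intro nn_integral_cong) (auto simp: F_def indicator_def ennreal_mult'[symmetric])
      also have "\<dots> = ennreal (1 / sqrt (y - r)) * ennreal (2 * exp (- y / 2) / y)"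
        by (subst nn_integral_cmult, measurable, simp only: inner[OF y])
      finally have i: "(\<integral>\<^sup>+t. F (y, t) \<partial>lborel) = ennreal (1 / sqrt (y - r)) * ennreal (2 * exp (- y / 2) / y)" .
      have "ennreal (exp (- y / 2) / 2) * ennreal (tail_kernel r y) = ennreal (exp (- y / 2) / 2 * (1 / (y * sqrt (y - r))))"
        using True by (simp add: tail_kernel_def ennreal_mult'[symmetric])
      also have "exp (- y / 2) / 2 * (1 / (y * sqrt (y - r))) = 1 / 4 * (1 / sqrt (y - r) * (2 * exp (- y / 2) / y))"
        by simp
      also have "ennreal \<dots> = ennreal (1 / 4) * (ennreal (1 / sqrt (y - r)) * ennreal (2 * exp (- y / 2) / y))"
      proof -
        have "ennreal (a * (b * c)) = ennreal a * (ennreal b * ennreal c)" if "0 \<le> a" "0 \<le> b" for a b c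
          using that by (simp add: ennreal_mult')
        from this[of "1 / 4" "1 / sqrt (y - r)" "2 * exp (- y / 2) / y"] True show ?thesis by simp
      qed
      finally show ?thesis using y by (simp add: i)
    qed (simp add: tail_kernel_def F_def)
  qed
  also have "\<dots> = ennreal (1 / 4) * (\<integral>\<^sup>+y. (\<integral>\<^sup>+t. F (y, t) \<partial>lborel) \<partial>lborel)"
    by (intro nn_integral_cmult lborel.borel_measurable_nn_integral_fst) measurable
  also have "(\<integral>\<^sup>+y. (\<integral>\<^sup>+t. F (y, t) \<partial>lborel) \<partial>lborel) = (\<integral>\<^sup>+t. (\<integral>\<^sup>+y. F (y, t) \<partial>lborel) \<partial>lborel)"
    by (rule lborel_pair.Fubini'[symmetric]) (simp add: split_beta')
  also have "\<dots> = (\<integral>\<^sup>+t. ennreal (exp (- t * r / 2) * sqrt (2 * pi / t)) * indicator {1..} t \<partial>lborel)"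
  proof (rule nn_integral_cong)
    fix t :: real
    show "(\<integral>\<^sup>+y. F (y, t) \<partial>lborel) = ennreal (exp (- t * r / 2) * sqrt (2 * pi / t)) * indicator {1..} t"
    proof (cases "1 \<le> t")
      case True
      then have "(\<integral>\<^sup>+y. F (y, t) \<partial>lborel) = (\<integral>\<^sup>+y. ennreal (exp (- t * y / 2) / sqrt (y - r)) * indicator {r<..} y \<partial>lborel)"
        by (simp add: F_def)
      then show ?thesis using True by (simp only: gaussian_half_integral[of t r]) simp
    qed (simp add: F_def)
  qed
  also have "\<dots> = ennreal (0 - (- (4 * pi / sqrt r * Phi (- sqrt (1 * r)))))"
  proof (rule nn_integral_FTC_atLeast)
    show "0 \<le> exp (- t * r / 2) * sqrt (2 * pi / t)" if "1 \<le> t" for t using that by simp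
    show "((\<lambda>t. - (4 * pi / sqrt r * Phi (- sqrt (t * r)))) has_real_derivative exp (- t * r / 2) * sqrt (2 * pi / t)) (at t)" if "1 \<le> t" for t
    proof -
      have t: "0 < t * r" "0 < t" using that r by auto
      have ds: "((\<lambda>t. - sqrt (t * r)) has_real_derivative - (r / (2 * sqrt (t * r)))) (at t)"
        using t by (auto intro!: derivative_eq_intros simp: divide_simps)
      have "((\<lambda>t. - (4 * pi / sqrt r * Phi (- sqrt (t * r)))) has_real_derivative - (4 * pi / sqrt r * (std_normal_density (- sqrt (t * r)) * - (r / (2 * sqrt (t * r)))))) (at t)"
        by (intro DERIV_minus DERIV_cmult DERIV_chain2[OF Phi_deriv ds])
      moreover have "- (4 * pi / sqrt r * (std_normal_density (- sqrt (t * r)) * - (r / (2 * sqrt (t * r))))) = exp (- t * r / 2) * sqrt (2 * pi / t)"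
      proof -
        have "std_normal_density (- sqrt (t * r)) = 1 / sqrt (2 * pi) * exp (- t * r / 2)"
          using t by (simp add: std_normal_density_def)
        moreover have "- (a * (1 / q * E * - c)) = E * (a * c / q)" for a q E c :: real by simp
        moreover have "4 * pi / sqrt r * (r / (2 * sqrt (t * r))) / sqrt (2 * pi) = sqrt (2 * pi / t)"
        proof -
          have "r / (sqrt r * sqrt r) = 1" "2 * pi / sqrt (2 * pi) = sqrt (2 * pi)" using r by (auto simp: real_div_sqrt)
          then show ?thesis using t r by (simp add: real_sqrt_mult real_sqrt_divide field_simps)
        qed
        ultimately show ?thesis by (simp only:)
      qed
      ultimately show ?thesis by simp
    qed
    have "filterlim (\<lambda>t. - sqrt (t * r)) at_bot at_top" using r by real_asymp
    from filterlim_compose[OF Phi_tendsto this] have "((\<lambda>t. Phi (- sqrt (t * r))) \<longlongrightarrow> 0) at_top" .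
    then have "((\<lambda>t. - (4 * pi / sqrt r * Phi (- sqrt (t * r)))) \<longlongrightarrow> - (4 * pi / sqrt r * 0)) at_top"
      by (intro tendsto_intros)
    then show "((\<lambda>t. - (4 * pi / sqrt r * Phi (- sqrt (t * r)))) \<longlongrightarrow> 0) at_top" by simp
  qed measurable
  also have "ennreal (1 / 4) * ennreal (0 - (- (4 * pi / sqrt r * Phi (- sqrt (1 * r))))) = ennreal (pi / (2 * sqrt r) * (2 * Phi (- sqrt r)))"
    by (subst ennreal_mult'[symmetric]) auto
  finally show ?thesis .
qed

lemma Phi_mono: "x \<le> y \<Longrightarrow> Phi x \<le> Phi y"
  by (rule DERIV_nonneg_imp_nondecreasing) (auto intro!: exI Phi_deriv)

text \<open>The level stays below its limit 3, so by monotonicity of \<open>Phi\<close> the value at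
  \<open>- sqrt 3\<close> serves all \<open>k\<close> at once.\<close>

lemma Ptail_ge_limit:
  assumes k: "18 \<le> k"
  shows "2 * Phi (- sqrt 3) \<le> Ptail k (3 * k / (k + 4 / 3))"
proof -
  define r where "r = 3 * k / (k + 4 / 3)"
  have r: "0 < r" "r \<le> 3" using k by (auto simp: r_def divide_le_eq)
  have "ennreal (pi / (2 * sqrt r) * (2 * Phi (- sqrt r))) \<le> ennreal (pi / (2 * sqrt r)) * ennreal (Ptail k r)"
    using explaw_kernel_le_eqlaw[OF k r_def] k r by (simp only: explaw_kernel[OF r(1)] eqlaw_kernel)
  also have "\<dots> = ennreal (pi / (2 * sqrt r) * Ptail k r)" using r by (intro ennreal_mult'[symmetric]) simp
  finally have "pi / (2 * sqrt r) * (2 * Phi (- sqrt r)) \<le> pi / (2 * sqrt r) * Ptail k r"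
    using r by (subst (asm) ennreal_le_iff) (auto simp: Ptail_def)
  moreover have "0 < pi / (2 * sqrt r)" using r by simp
  ultimately have "2 * Phi (- sqrt r) \<le> Ptail k r" by (simp only: mult_le_cancel_left_pos)
  moreover have "Phi (- sqrt 3) \<le> Phi (- sqrt r)" using r by (intro Phi_mono) simp
  ultimately show ?thesis by (simp add: r_def)
qed

text \<open>The quotient is the convergent \<open>1 / (x + 1 / (x + 2 / x))\<close> of the continued
  fraction for the Mills ratio. Right side minus left side decreases in \<open>x\<close> and tends
  to 0 at infinity, hence is nonnegative.\<close>

lemma mills_upper:
  assumes x: "0 < x"
  shows "Phi (- x) \<le> std_normal_density x * ((x\<^sup>2 + 2) / (x ^ 3 + 3 * x))"
proof -
  define D where "D = (\<lambda>t. std_normal_density t * ((t\<^sup>2 + 2) / (t ^ 3 + 3 * t)) - Phi (- t))"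
  have D: "D t \<le> D x" if "x \<le> t" for t
  proof (rule DERIV_nonpos_imp_nonincreasing[OF that])
    fix s assume "x \<le> s" "s \<le> t"
    then have s: "0 < s" using x by simp
    have nz: "s ^ 3 + 3 * s \<noteq> 0" "s \<noteq> 0" "s\<^sup>2 + 3 \<noteq> 0"
      using s by (auto simp: add_pos_pos less_imp_neq[symmetric])
    have d1: "((\<lambda>t. (t\<^sup>2 + 2) / (t ^ 3 + 3 * t)) has_real_derivative (2 * s * (s ^ 3 + 3 * s) - (s\<^sup>2 + 2) * (3 * s\<^sup>2 + 3)) / (s ^ 3 + 3 * s)\<^sup>2) (at s)"
      by (rule DERIV_cong, (rule derivative_intros nz)+) (simp add: power2_eq_square)
    have d2: "(std_normal_density has_real_derivative - s * std_normal_density s) (at s)"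
    proof -
      have "((\<lambda>x. exp (- x\<^sup>2 / 2)) has_real_derivative - s * exp (- s\<^sup>2 / 2)) (at s)"
        by (auto intro!: derivative_eq_intros)
      from DERIV_cmult[OF this, of "1 / sqrt (2 * pi)"] show ?thesis
        unfolding std_normal_density_def by (simp add: mult_ac)
    qed
    have d3: "((\<lambda>t. Phi (- t)) has_real_derivative std_normal_density (- s) * - 1) (at s)"
      by (rule DERIV_chain2[OF Phi_deriv]) (auto intro!: derivative_eq_intros)
    have e: "std_normal_density (- s) = std_normal_density s" by (simp add: std_normal_density_def)
    have "(D has_real_derivative (- s * std_normal_density s) * ((s\<^sup>2 + 2) / (s ^ 3 + 3 * s))
       + (2 * s * (s ^ 3 + 3 * s) - (s\<^sup>2 + 2) * (3 * s\<^sup>2 + 3)) / (s ^ 3 + 3 * s)\<^sup>2 * std_normal_density s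
       - std_normal_density (- s) * - 1) (at s)"
      unfolding D_def by (intro DERIV_diff DERIV_mult d1 d2 d3)
    moreover have "(- s * std_normal_density s) * ((s\<^sup>2 + 2) / (s ^ 3 + 3 * s))
       + (2 * s * (s ^ 3 + 3 * s) - (s\<^sup>2 + 2) * (3 * s\<^sup>2 + 3)) / (s ^ 3 + 3 * s)\<^sup>2 * std_normal_density s
       - std_normal_density (- s) * - 1 = std_normal_density s * (- 6 / (s * (s\<^sup>2 + 3))\<^sup>2)"
    proof -
      have q: "s ^ 3 + 3 * s = s * (s\<^sup>2 + 3)" by (simp add: power2_eq_square power3_eq_cube algebra_simps)
      have "- s * ((s\<^sup>2 + 2) / (s * (s\<^sup>2 + 3))) + (2 * s * (s * (s\<^sup>2 + 3)) - (s\<^sup>2 + 2) * (3 * s\<^sup>2 + 3)) / (s * (s\<^sup>2 + 3))\<^sup>2 + 1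
         = - 6 / (s * (s\<^sup>2 + 3))\<^sup>2"
        using nz(2,3) by (simp add: divide_simps) algebra
      then show ?thesis unfolding e q by algebra
    qed
    ultimately show "\<exists>y. (D has_real_derivative y) (at s) \<and> y \<le> 0"
      using s by (intro exI[of _ "std_normal_density s * (- 6 / (s * (s\<^sup>2 + 3))\<^sup>2)"]) (auto simp: mult_nonneg_nonpos)
  qed
  have "(D \<longlongrightarrow> 0) at_top"
  proof -
    have "((\<lambda>t. std_normal_density t * ((t\<^sup>2 + 2) / (t ^ 3 + 3 * t))) \<longlongrightarrow> 0) at_top"
      unfolding std_normal_density_def by real_asymp
    moreover have "((\<lambda>t. Phi (- t)) \<longlongrightarrow> 0) at_top"
      by (rule filterlim_compose[OF Phi_tendsto filterlim_uminus_at_bot_at_top])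
    ultimately show ?thesis unfolding D_def using tendsto_diff by fastforce
  qed
  moreover have "\<forall>\<^sub>F t in at_top. D t \<le> D x"
    using eventually_ge_at_top[of x] by eventually_elim (rule D)
  ultimately have "0 \<le> D x" by (intro tendsto_upperbound[where F = at_top]) auto
  then show ?thesis by (simp add: D_def)
qed

section \<open>Numerical bounds at the critical levels\<close>

lemma exp3_lower: "20 \<le> exp (3 :: real)"
proof -
  have "(\<Sum>i<10. 3 ^ i /\<^sub>R fact i) \<le> exp (3::real)"
    using sum_le_suminf[OF summable_exp_generic[of "3::real"], of "{..<10}"] by (simp add: exp_def)
  moreover have "(\<Sum>i<10. 3 ^ i /\<^sub>R fact i :: real) \<ge> 20"
    by (simp add: fact_numeral eval_nat_numeral lessThan_Suc fact_reduce)
  ultimately show ?thesis by linarith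
qed

text \<open>The value is about 0.0833; the bound 0.0865 is still small enough for the estimates at
  \<open>k = 2, ..., 5\<close>. Squaring leaves only \<open>exp 3\<close> and \<open>pi\<close> to
  be bounded.\<close>

lemma alpha_max_bound: "2 * Phi (- sqrt 3) \<le> 173 / 2000"
proof -
  have e: "sqrt 3 ^ 3 = 3 * sqrt (3::real)" by (simp add: power3_eq_cube)
  have "Phi (- sqrt 3) \<le> std_normal_density (sqrt 3) * (((sqrt 3)\<^sup>2 + 2) / (sqrt 3 ^ 3 + 3 * sqrt 3))"
    by (rule mills_upper) simp
  also have "\<dots> = exp (- 3 / 2) / sqrt (2 * pi) * (5 / (6 * sqrt 3))"
    unfolding e by (simp add: std_normal_density_def)
  finally have "2 * Phi (- sqrt 3) \<le> exp (- 3 / 2) / sqrt (2 * pi) * (5 / (3 * sqrt 3))" by simp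
  moreover have "exp (- 3 / 2) / sqrt (2 * pi) * (5 / (3 * sqrt 3)) \<le> 173 / 2000"
  proof (rule power2_le_imp_le)
    have "(exp (- 3 / 2) / sqrt (2 * pi) * (5 / (3 * sqrt 3)))\<^sup>2 = exp (- 3) / (2 * pi) * (25 / 27)"
      by (simp add: power_mult_distrib power_divide exp_double[symmetric])
    also have "\<dots> = 25 / (54 * (pi * exp 3))" by (simp add: exp_minus divide_simps)
    also have "\<dots> \<le> 25 / (54 * (31 / 10 * 20))"
    proof (intro divide_left_mono mult_left_mono mult_mono)
      show "31 / 10 \<le> pi" using pi_approx(1) by simp
    qed (use exp3_lower in auto)
    also have "\<dots> \<le> (173 / 2000)\<^sup>2" by (simp add: power2_eq_square)
    finally show "(exp (- 3 / 2) / sqrt (2 * pi) * (5 / (3 * sqrt 3)))\<^sup>2 \<le> (173 / 2000)\<^sup>2" .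
  qed simp
  ultimately show ?thesis by linarith
qed

text \<open>The Taylor polynomial of degree two of the inverse square root at 1. With it in place of
  the root, the Beta integral in \<open>Ptail\<close> becomes a sum of powers.\<close>

lemma inverse_sqrt_lower:
  fixes t :: real
  assumes "0 < t" "t < 1"
  shows "1 + (1 - t) / 2 + 3 / 8 * (1 - t)\<^sup>2 \<le> t powr (1 / 2 - 1)"
proof -
  define s where "s = 1 - t"
  have s: "0 < s" "s < 1" "t = 1 - s" using assms by (auto simp: s_def)
  define p where "p = 1 + s / 2 + 3 / 8 * s\<^sup>2"
  have "t * p\<^sup>2 = 1 - 5 / 8 * s ^ 3 - 15 / 64 * s ^ 4 - 9 / 64 * s ^ 5"
    unfolding p_def s(3) by (simp add: power2_eq_square power3_eq_cube power4_eq_xxxx field_simps eval_nat_numeral)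
  also have "\<dots> \<le> 1"
  proof -
    have "0 < s ^ 3" "0 < s ^ 4" "0 < s ^ 5" using s by simp_all
    then show ?thesis by linarith
  qed
  finally have "(sqrt t * p)\<^sup>2 \<le> 1\<^sup>2" using assms by (simp add: power_mult_distrib)
  then have "sqrt t * p \<le> 1" by (rule power2_le_imp_le) simp
  then have "p \<le> 1 / sqrt t" using assms by (simp add: pos_le_divide_eq mult.commute)
  also have "1 / sqrt t = t powr (1 / 2 - 1)"
    using assms by (simp add: powr_minus powr_half_sqrt divide_simps flip: powr_half_sqrt)
  finally show ?thesis by (simp add: p_def s_def)
qed

lemma Ptail_lower:
  assumes k: "1 < k" and r: "0 < r" "r < k"
  defines "s \<equiv> 1 - r / k"
  shows "(2 / (k - 1) * s powr ((k - 1) / 2) + 1 / (k + 1) * s powr ((k + 1) / 2) + 3 / (4 * (k + 3)) * s powr ((k + 3) / 2))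
     / Beta (1 / 2) ((k - 1) / 2) \<le> Ptail k r"
proof -
  define v where "v = r / k"
  have v: "0 < v" "v < 1" using k r by (auto simp: v_def)
  have B: "0 < Beta (1 / 2) ((k - 1) / 2)" using k by (simp add: Beta_pos)
  define F where "F = (\<lambda>t. 2 / (k - 1) * (1 - t / 1) powr ((k - 1) / 2) + 1 / (k + 1) * (1 - t / 1) powr ((k + 1) / 2) + 3 / (4 * (k + 3)) * (1 - t / 1) powr ((k + 3) / 2))"
  define f where "f = (\<lambda>t. (1 + (1 - t) / 2 + 3 / 8 * (1 - t)\<^sup>2) * (1 - t) powr ((k - 1) / 2 - 1))"
  have "(\<integral>\<^sup>+t. ennreal (f t) * indicator {v<..<1} t \<partial>lborel) = ennreal (- F 1 - - F v)"
  proof (rule nn_integral_FTC_open)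
    show "v \<le> 1" using v by simp
    show "continuous_on {v..1} (\<lambda>t. - F t)"
      unfolding F_def using k by (intro continuous_on_minus continuous_on_add continuous_on_mult continuous_on_const powr_lin_continuous) auto
    fix t assume t: "v < t" "t < 1"
    show "0 \<le> f t" using t by (simp add: f_def)
    have "((\<lambda>t. - F t) has_real_derivative - (2 / (k - 1) * - ((k - 1) / 2 / 1 * (1 - t / 1) powr ((k - 1) / 2 - 1))
       + 1 / (k + 1) * - ((k + 1) / 2 / 1 * (1 - t / 1) powr ((k + 1) / 2 - 1))
       + 3 / (4 * (k + 3)) * - ((k + 3) / 2 / 1 * (1 - t / 1) powr ((k + 3) / 2 - 1)))) (at t)"
      unfolding F_def by (intro DERIV_minus DERIV_add DERIV_cmult powr_lin_deriv) (use t in auto)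
    moreover have "- (2 / (k - 1) * - ((k - 1) / 2 / 1 * (1 - t / 1) powr ((k - 1) / 2 - 1))
       + 1 / (k + 1) * - ((k + 1) / 2 / 1 * (1 - t / 1) powr ((k + 1) / 2 - 1))
       + 3 / (4 * (k + 3)) * - ((k + 3) / 2 / 1 * (1 - t / 1) powr ((k + 3) / 2 - 1))) = f t"
    proof -
      have e: "(k + 1) / 2 - 1 = ((k - 1) / 2 - 1) + 1" "(k + 3) / 2 - 1 = ((k - 1) / 2 - 1) + 2" by (simp_all add: field_simps)
      have p: "(1 - t) powr ((k + 1) / 2 - 1) = (1 - t) powr ((k - 1) / 2 - 1) * (1 - t)"
        "(1 - t) powr ((k + 3) / 2 - 1) = (1 - t) powr ((k - 1) / 2 - 1) * (1 - t)\<^sup>2"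
        unfolding e using t by (simp_all only: powr_add) (simp_all add: powr_numeral)
      have c: "2 / (k - 1) * ((k - 1) / 2 * X) = X" "1 / (k + 1) * ((k + 1) / 2 * X) = X / 2" "3 / (4 * (k + 3)) * ((k + 3) / 2 * X) = 3 / 8 * X" for X
        using k by (simp_all add: field_simps)
      show ?thesis unfolding div_by_1 mult_minus_right c p f_def by (simp add: algebra_simps)
    qed
    ultimately show "((\<lambda>t. - F t) has_real_derivative f t) (at t)" by simp
  qed (simp add: f_def)
  also have "- F 1 - - F v = F v" using k by (simp add: F_def)
  finally have I: "(\<integral>\<^sup>+t. ennreal (f t) * indicator {v<..<1} t \<partial>lborel) = ennreal (F v)" .
  have "ennreal (1 / Beta (1 / 2) ((k - 1) / 2) * F v) = ennreal (1 / Beta (1 / 2) ((k - 1) / 2)) * ennreal (F v)"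
    using B by (intro ennreal_mult') simp
  also have "\<dots> \<le> ennreal (Ptail k r)"
    unfolding rlaw_tail[OF k less_imp_le[OF r(1)]] I[symmetric]
  proof (intro mult_left_mono nn_integral_mono)
    fix t
    show "ennreal (f t) * indicator {v<..<1} t \<le> ennreal (t powr (1 / 2 - 1) * (1 - t) powr ((k - 1) / 2 - 1)) * indicator {r / k<..<1} t"
    proof (cases "v < t \<and> t < 1")
      case True
      then have "f t \<le> t powr (1 / 2 - 1) * (1 - t) powr ((k - 1) / 2 - 1)"
        unfolding f_def using v by (intro mult_right_mono inverse_sqrt_lower) auto
      then show ?thesis using True by (simp add: v_def ennreal_leI)
    qed (auto simp: indicator_def)
  qed simp
  finally have "1 / Beta (1 / 2) ((k - 1) / 2) * F v \<le> Ptail k r" by (subst (asm) ennreal_le_iff) (auto simp: Ptail_def)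
  then show ?thesis by (simp add: F_def v_def s_def)
qed

lemma Beta_values:
  "Beta (1 / 2) (1 / 2 :: real) = pi" "Beta (1 / 2) (1 :: real) = 2"
  "Beta (1 / 2) (3 / 2 :: real) = pi / 2" "Beta (1 / 2) (2 :: real) = 4 / 3"
proof -
  have half: "(1 / 2 :: real) \<notin> \<int>\<^sub>\<le>\<^sub>0" "(1 :: real) \<notin> \<int>\<^sub>\<le>\<^sub>0" by (auto dest: nonpos_Ints_nonpos)
  show b1: "Beta (1 / 2) (1 / 2 :: real) = pi" by (simp add: Beta_def Gamma_one_half_real)
  show b2: "Beta (1 / 2) (1 :: real) = 2"
  proof -
    from Gamma_plus1[OF half(1)] have g: "Gamma (3 / 2 :: real) = Gamma (1 / 2) / 2" by simp
    have ne: "Gamma (1 / 2 :: real) \<noteq> 0" by (simp add: Gamma_one_half_real)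
    have "Beta (1 / 2) (1 :: real) = Gamma (1 / 2) / Gamma (3 / 2)" by (simp add: Beta_def)
    also have "\<dots> = 2" unfolding g using ne by simp
    finally show ?thesis .
  qed
  show "Beta (1 / 2) (3 / 2 :: real) = pi / 2"
    using Beta_plus1_right[OF half(1), of "1 / 2"] by (simp add: b1)
  show "Beta (1 / 2) (2 :: real) = 4 / 3"
    using Beta_plus1_right[OF half(2), of "1 / 2"] by (simp add: b2)
qed

text \<open>For two, three and four components the level is two thirds of their number, so
  \<open>s = 1 / 3\<close> in \<open>Ptail_lower\<close>. The level 153/55 is
  \<open>3 * k / (k + 4/3)\<close> at \<open>k = 17\<close>, the largest \<open>k\<close> to which
  the value at 5 will be carried.\<close>

lemma Ptail_small_values:
  "173 / 2000 \<le> Ptail 2 (4 / 3)" "173 / 2000 \<le> Ptail 3 2"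
  "173 / 2000 \<le> Ptail 4 (8 / 3)" "173 / 2000 \<le> Ptail 5 (153 / 55)"
proof -
  have q: "577 / 1000 \<le> sqrt (1 / 3 :: real)" by (rule real_le_rsqrt) (simp add: power2_eq_square)
  have pi: "3 < pi" "pi \<le> 315 / 100" using pi_approx by simp_all
  have p1: "(1 / 3 :: real) powr (1 / 2) = sqrt (1 / 3)" by (simp add: powr_half_sqrt)
  show "173 / 2000 \<le> Ptail 2 (4 / 3)"
  proof -
    have "(2 * (577 / 1000)) / (315 / 100) \<le> (2 * sqrt (1 / 3) + 0 + 0) / pi" using q pi by (intro frac_le) auto
    also have "\<dots> \<le> (2 / (2 - 1) * (1 / 3) powr ((2 - 1) / 2) + 1 / (2 + 1) * (1 / 3) powr ((2 + 1) / 2) + 3 / (4 * (2 + 3)) * (1 / 3) powr ((2 + 3) / 2))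
     / Beta (1 / 2) ((2 - 1) / 2)"
      using p1 Beta_values(1) by (auto intro!: divide_right_mono add_mono)
    also have "\<dots> \<le> Ptail 2 (4 / 3)" using Ptail_lower[of 2 "4 / 3"] by simp
    finally show ?thesis by simp
  qed
  show "173 / 2000 \<le> Ptail 3 2"
  proof -
    have "(1 / 3) / 2 \<le> (2 / (3 - 1) * (1 / 3) powr ((3 - 1) / 2) + 1 / (3 + 1) * (1 / 3) powr ((3 + 1) / 2) + 3 / (4 * (3 + 3)) * (1 / 3) powr ((3 + 3) / 2))
     / Beta (1 / 2) ((3 - 1) / (2::real))"
      using Beta_values(2) by (auto intro!: divide_right_mono)
    also have "\<dots> \<le> Ptail 3 2" using Ptail_lower[of 3 2] by simp
    finally show ?thesis by simp
  qed
  show "173 / 2000 \<le> Ptail 4 (8 / 3)"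
  proof -
    have pw: "(1 / 3 :: real) powr (3 / 2) = 1 / 3 * sqrt (1 / 3)" "(1 / 3 :: real) powr (5 / 2) = 1 / 9 * sqrt (1 / 3)"
      "(1 / 3 :: real) powr (7 / 2) = 1 / 27 * sqrt (1 / 3)"
    proof -
      have "(1 / 3 :: real) powr (3 / 2) = (1 / 3) powr (1 + 1 / 2)" "(1 / 3 :: real) powr (5 / 2) = (1 / 3) powr (2 + 1 / 2)"
       "(1 / 3 :: real) powr (7 / 2) = (1 / 3) powr (3 + 1 / 2)" by simp_all
      then show "(1 / 3 :: real) powr (3 / 2) = 1 / 3 * sqrt (1 / 3)" "(1 / 3 :: real) powr (5 / 2) = 1 / 9 * sqrt (1 / 3)"
      "(1 / 3 :: real) powr (7 / 2) = 1 / 27 * sqrt (1 / 3)"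
        by (simp_all only: powr_add p1) (simp_all add: power2_eq_square power3_eq_cube)
    qed
    have "173 / 2000 \<le> (2 / 9 + 1 / 45) * (577 / 1000) * 2 / (315 / 100 :: real)" by simp
    also have "\<dots> \<le> (2 / 9 + 1 / 45 + 1 / 252) * sqrt (1 / 3) * 2 / pi"
      using q pi by (intro frac_le mult_mono) auto
    also have "\<dots> = (2 / (4 - 1) * (1 / 3) powr ((4 - 1) / 2) + 1 / (4 + 1) * (1 / 3) powr ((4 + 1) / 2) + 3 / (4 * (4 + 3)) * (1 / 3) powr ((4 + 3) / 2))
     / Beta (1 / 2) ((4 - 1) / 2)"
      by (simp add: pw Beta_values(3))
    also have "\<dots> \<le> Ptail 4 (8 / 3)" using Ptail_lower[of 4 "8 / 3"] by simp
    finally show ?thesis .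
  qed
  show "173 / 2000 \<le> Ptail 5 (153 / 55)"
  proof -
    have "173 / 2000 \<le> (1 / 2 * (122 / 275)\<^sup>2 + 1 / 6 * (122 / 275) ^ 3 + 3 / 32 * (122 / 275) ^ 4) / (4 / 3 :: real)"
      by (simp add: power2_eq_square power3_eq_cube power4_eq_xxxx)
    also have "\<dots> = (2 / (5 - 1) * (122 / 275) powr ((5 - 1) / 2) + 1 / (5 + 1) * (122 / 275) powr ((5 + 1) / 2) + 3 / (4 * (5 + 3)) * (122 / 275) powr ((5 + 3) / 2))
     / Beta (1 / 2) ((5 - 1) / (2::real))"
      by (simp add: Beta_values(4))
    also have "\<dots> \<le> Ptail 5 (153 / 55)" using Ptail_lower[of 5 "153 / 55"] by simp
    finally show ?thesis .
  qed
qed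

text \<open>\<open>Ptail\<close> strictly decreases up to \<open>k\<close>, so a level
  \<open>r'\<close> whose tail is at least \<open>2 * Phi (- sqrt 3)\<close> satisfies
  \<open>r' \<le> r\<close>. It remains to exhibit such a level at or above the boundary of the
  regime in \<open>selfnorm_tail_le\<close>.\<close>

lemma Ptail_threshold:
  fixes k :: nat
  assumes k: "2 \<le> k" and r: "0 \<le> r" and P: "Ptail (real k) r \<le> 2 * Phi (- sqrt 3)"
  shows "k = 2 \<and> 4 / 3 \<le> r \<or> k = 3 \<and> 2 \<le> r \<or> 4 \<le> k \<and> 8 / 3 \<le> r \<and> 3 * real k \<le> r * (real k + 4 / 3)"
proof -
  have ge: "r' \<le> r" if "2 * Phi (- sqrt 3) \<le> Ptail (real k) r'" "r' \<le> real k" for r'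
  proof (rule ccontr)
    assume "\<not> r' \<le> r"
    then have "Ptail (real k) r' < Ptail (real k) r" using k r that by (intro Ptail_strict) auto
    then show False using that P by simp
  qed
  note a = alpha_max_bound
  consider "k = 2" | "k = 3" | "k = 4" | "5 \<le> k" "k \<le> 17" | "18 \<le> k" using k by linarith
  then show ?thesis
  proof cases
    case 1
    then show ?thesis using ge[of "4 / 3"] a Ptail_small_values(1) by simp
  next
    case 2
    then show ?thesis using ge[of 2] a Ptail_small_values(2) by simp
  next
    case 3
    then show ?thesis using ge[of "8 / 3"] a Ptail_small_values(3) by simp
  next
    case 4
    \<comment> \<open>For \<open>k \<le> 17\<close> the threshold \<open>3 * k / (k + 4/3)\<close>
      is at most its value 153/55 at 17, so one level serves the whole range, and
      \<open>Ptail_mono\<close> carries its tail bound from 5 to \<open>k\<close>.\<close>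
    have c: "3 * real k \<le> 153 / 55 * (real k + 4 / 3)" using 4 by simp
    have "Ptail (real 5) (153 / 55) \<le> Ptail (real k) (153 / 55)"
      using 4 c by (intro Ptail_mono) auto
    then have "153 / 55 \<le> r" using ge[of "153 / 55"] a Ptail_small_values(4) 4 by simp
    moreover from this have "153 / 55 * (real k + 4 / 3) \<le> r * (real k + 4 / 3)" by (intro mult_right_mono) auto
    with c have "3 * real k \<le> r * (real k + 4 / 3)" by (rule order_trans)
    ultimately show ?thesis using 4 by simp
  next
    case 5
    have le: "3 * real k / (real k + 4 / 3) \<le> r"
    proof (rule ge)
      show "2 * Phi (- sqrt 3) \<le> Ptail (real k) (3 * real k / (real k + 4 / 3))"
        using 5 by (intro Ptail_ge_limit) simp
      have "3 * real k / (real k + 4 / 3) \<le> 3" using 5 by (simp add: divide_le_eq)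
      then show "3 * real k / (real k + 4 / 3) \<le> real k" using 5 by simp
    qed
    then have "3 * real k \<le> r * (real k + 4 / 3)" using 5 by (simp add: pos_divide_le_eq)
    moreover have "8 / 3 \<le> 3 * real k / (real k + 4 / 3)" using 5 by (simp add: pos_le_divide_eq)
    ultimately show ?thesis using 5 le by simp
  qed
qed

section \<open>The t-distribution\<close>

lemma t_density_nonneg: "0 < \<nu> \<Longrightarrow> 0 \<le> t_density \<nu> x"
  unfolding t_density_def by (intro mult_nonneg_nonneg divide_nonneg_nonneg less_imp_le[OF Gamma_real_pos]) auto

lemma t_density_measurable[measurable]: "t_density \<nu> \<in> borel_measurable borel"
  unfolding t_density_def[abs_def] by measurable

definition tlaw :: "real \<Rightarrow> real measure" where
  "tlaw \<nu> = density lborel (t_density \<nu>)"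

lemma sets_tlaw[simp, measurable_cong]: "sets (tlaw \<nu>) = sets borel" by (simp add: tlaw_def)
lemma space_tlaw[simp]: "space (tlaw \<nu>) = UNIV" by (simp add: tlaw_def)

text \<open>Change of variables \<open>s = T\<^sup>2 / (\<nu> + T\<^sup>2)\<close>: the Beta(1/2,
  \<nu>/2) density times the derivative of \<open>s\<close> is the density of the absolute value of
  a t-variable, whence the factor 2.\<close>

lemma t_substitution:
  assumes \<nu>: "0 < \<nu>" and T: "0 < T"
  shows "(T\<^sup>2 / (\<nu> + T\<^sup>2)) powr (1 / 2 - 1) * (1 - T\<^sup>2 / (\<nu> + T\<^sup>2)) powr (\<nu> / 2 - 1) / Beta (1 / 2) (\<nu> / 2) * (2 * \<nu> * T / (\<nu> + T\<^sup>2)\<^sup>2)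
    = 2 * t_density \<nu> T"
proof -
  define w where "w = 1 + T\<^sup>2 / \<nu>"
  have w: "0 < w" using \<nu> by (simp add: w_def add_pos_nonneg)
  have nw: "\<nu> + T\<^sup>2 = \<nu> * w" using \<nu> by (simp add: w_def field_simps)
  have s: "1 - T\<^sup>2 / (\<nu> + T\<^sup>2) = inverse w"
  proof -
    have "1 - T\<^sup>2 / (\<nu> + T\<^sup>2) = \<nu> / (\<nu> + T\<^sup>2)" using \<nu> by (simp add: field_simps add_pos_nonneg less_imp_neq[symmetric])
    then show ?thesis using \<nu> w by (simp add: nw inverse_eq_divide)
  qed
  have p1: "(T\<^sup>2 / (\<nu> + T\<^sup>2)) powr (1 / 2 - 1) = sqrt \<nu> * w powr (1 / 2) / T"
  proof -
    have "(T\<^sup>2 / (\<nu> + T\<^sup>2)) powr (1 / 2 - 1) = 1 / sqrt (T\<^sup>2 / (\<nu> + T\<^sup>2))"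
      using T \<nu> by (simp add: powr_minus powr_half_sqrt divide_simps add_pos_nonneg flip: powr_half_sqrt)
    also have "\<dots> = sqrt (\<nu> * w) / T" using T by (simp add: real_sqrt_divide nw)
    finally show ?thesis using w by (simp add: real_sqrt_mult powr_half_sqrt)
  qed
  have p2: "inverse w powr (\<nu> / 2 - 1) = w powr (1 - \<nu> / 2)"
    using w by (simp add: powr_minus[symmetric] inverse_powr)
  have "w powr (1 / 2) * w powr (1 - \<nu> / 2) / w\<^sup>2 = w powr (- (\<nu> + 1) / 2)"
  proof -
    have e: "1 / 2 + (1 - \<nu> / 2) + - 2 = - (\<nu> + 1) / 2" by (simp add: field_simps)
    have "w powr (- 2) = 1 / w\<^sup>2" using w by (simp add: powr_minus powr_numeral divide_inverse)
    then have "w powr (1 / 2) * w powr (1 - \<nu> / 2) / w\<^sup>2 = w powr (1 / 2) * w powr (1 - \<nu> / 2) * w powr (- 2)" by simp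
    also have "\<dots> = w powr (1 / 2 + (1 - \<nu> / 2) + - 2)" by (simp only: powr_add)
    finally show ?thesis by (simp only: e)
  qed
  note p3 = this
  have B: "1 / Beta (1 / 2) (\<nu> / 2) = Gamma ((\<nu> + 1) / 2) / (sqrt pi * Gamma (\<nu> / 2))"
    by (simp add: Beta_def Gamma_one_half_real add_divide_distrib add.commute)
  have "sqrt \<nu> * w powr (1 / 2) / T * w powr (1 - \<nu> / 2) / Beta (1 / 2) (\<nu> / 2) * (2 * \<nu> * T / (\<nu> * w)\<^sup>2)
     = 2 * (sqrt \<nu> / \<nu>) * (1 / Beta (1 / 2) (\<nu> / 2)) * (w powr (1 / 2) * w powr (1 - \<nu> / 2) / w\<^sup>2)"
    using T \<nu> by (simp add: power2_eq_square divide_simps)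
  also have "\<dots> = 2 * t_density \<nu> T"
  proof -
    have "sqrt \<nu> / \<nu> = 1 / sqrt \<nu>" using \<nu> by (simp add: real_div_sqrt field_simps)
    then show ?thesis unfolding p3 B t_density_def w_def[symmetric] by (simp add: real_sqrt_mult)
  qed
  finally show ?thesis unfolding p1 s p2 unfolding nw .
qed

text \<open>The ratio \<open>R\<close> exceeds \<open>k * (q\<^sup>2 / (k - 1 + q\<^sup>2))\<close>
  exactly when the absolute value of the t-statistic exceeds \<open>q\<close>; here this
  correspondence is carried out between the two densities.\<close>

lemma t_tail:
  assumes k: "1 < k" and q: "0 \<le> q"
  shows "2 * emeasure (tlaw (k - 1)) {q..} = ennreal (Ptail k (k * (q\<^sup>2 / (k - 1 + q\<^sup>2))))"
proof -
  define \<nu> where "\<nu> = k - 1"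
  have \<nu>: "0 < \<nu>" using k by (simp add: \<nu>_def)
  define B where "B = Beta (1 / 2) (\<nu> / 2)"
  have B: "0 < B" using \<nu> by (simp add: B_def Beta_pos)
  define g where "g = (\<lambda>T. T\<^sup>2 / (\<nu> + T\<^sup>2))"
  define g' where "g' = (\<lambda>T. 2 * \<nu> * T / (\<nu> + T\<^sup>2)\<^sup>2)"
  define f where "f = (\<lambda>s::real. s powr (1 / 2 - 1) * (1 - s) powr (\<nu> / 2 - 1) / B)"
  \<comment> \<open>The substitution rule is for compact intervals, so \<open>{q..}\<close> is
    exhausted by \<open>{q..b n}\<close>.\<close>
  define b where "b = (\<lambda>n::nat. q + 1 + real n)"
  have npos: "0 < \<nu> + T\<^sup>2" for T using \<nu> by (simp add: add_pos_nonneg)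
  have dg: "(g has_real_derivative g' T) (at T)" for T
  proof -
    have nz: "\<nu> + T\<^sup>2 \<noteq> 0" using npos[of T] by simp
    show ?thesis unfolding g_def g'_def
      apply (rule DERIV_cong)
       apply (rule derivative_intros nz)+
      by (simp add: power2_eq_square algebra_simps)
  qed
  have g1: "g T < 1" for T using npos[of T] \<nu> by (simp add: g_def divide_less_eq)
  have gmono: "g x \<le> g y" if "0 \<le> x" "x \<le> y" for x y
  proof (rule DERIV_nonneg_imp_nondecreasing[OF that(2)])
    fix t assume "x \<le> t" "t \<le> y"
    then show "\<exists>z. (g has_real_derivative z) (at t) \<and> 0 \<le> z"
      using that \<nu> by (intro exI[of _ "g' t"] conjI dg) (auto simp: g'_def)
  qed
  let ?F = "density lborel (\<lambda>s. ennreal (f s))" and ?T = "density lborel (\<lambda>T. ennreal (2 * t_density \<nu> T))"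
  have step: "emeasure ?F {g q..g (b n)} = emeasure ?T {q..b n}" for n
  proof -
    have "emeasure ?F {g q..g (b n)} = (\<integral>\<^sup>+s. ennreal (f s) * indicator {g q..g (b n)} s \<partial>lborel)"
      by (subst emeasure_density) (auto simp: f_def)
    also have "\<dots> = (\<integral>\<^sup>+T. ennreal (f (g T)) * ennreal (g' T) * indicator {q..b n} T \<partial>lborel)"
    proof (rule nn_integral_substitution_aux)
      show "(\<lambda>s. ennreal (f s)) \<in> borel_measurable borel" unfolding f_def by measurable
      show "continuous_on {q..b n} g'" unfolding g'_def using npos by (intro continuous_intros) (auto simp: less_imp_neq[symmetric])
      show "q < b n" by (simp add: b_def)
    qed (use dg q \<nu> in \<open>auto simp: g'_def\<close>)
    also have "\<dots> = (\<integral>\<^sup>+T. ennreal (2 * t_density \<nu> T) * indicator {q..b n} T \<partial>lborel)"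
      \<comment> \<open>At \<open>T = 0\<close>, which lies in the range if \<open>q = 0\<close>,
        the integrands differ because \<open>g'\<close> vanishes; the point is a null set.\<close>
      using AE_lborel_singleton[of "0::real"]
    proof (intro nn_integral_cong_AE, eventually_elim)
      case (elim T)
      show ?case
      proof (cases "q \<le> T")
        case True
        then have T: "0 < T" using q elim by simp
        have "f (g T) * g' T = 2 * t_density \<nu> T"
          unfolding f_def g_def g'_def B_def by (rule t_substitution[OF \<nu> T])
        moreover have "0 \<le> f (g T)" using B by (simp add: f_def)
        ultimately show ?thesis by (simp add: ennreal_mult'[symmetric])
      qed simp
    qed
    also have "\<dots> = emeasure ?T {q..b n}" by (subst emeasure_density) auto
    finally show ?thesis .
  qed
  have bmono: "b n \<le> b (Suc n)" "q \<le> b n" "0 \<le> b n" for n using q by (auto simp: b_def)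
  have "emeasure ?F (\<Union>n. {g q..g (b n)}) = (SUP n. emeasure ?F {g q..g (b n)})"
  proof (rule SUP_emeasure_incseq[symmetric])
    show "incseq (\<lambda>n. {g q..g (b n)})"
    proof (rule incseq_SucI)
      fix n
      show "{g q..g (b n)} \<subseteq> {g q..g (b (Suc n))}" using gmono[OF bmono(3) bmono(1), of n] by auto
    qed
  qed auto
  also have "\<dots> = (SUP n. emeasure ?T {q..b n})" by (simp only: step)
  also have "\<dots> = emeasure ?T (\<Union>n. {q..b n})"
  proof (rule SUP_emeasure_incseq)
    show "incseq (\<lambda>n. {q..b n})"
    proof (rule incseq_SucI)
      fix n
      show "{q..b n} \<subseteq> {q..b (Suc n)}" using bmono(1)[of n] by auto
    qed
  qed auto
  also have "(\<Union>n. {q..b n}) = {q..}"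
  proof -
    have "\<exists>n. x \<le> b n" for x
    proof -
      obtain n where "x \<le> real n" using real_arch_simple by blast
      then show ?thesis using q by (intro exI[of _ n]) (simp add: b_def)
    qed
    then show ?thesis by auto
  qed
  also have "(\<Union>n. {g q..g (b n)}) = {g q..<1}"
  proof -
    have "(\<lambda>n. g (b n)) \<longlonglongrightarrow> 1"
    proof -
      have "(g \<longlongrightarrow> 1) at_top" unfolding g_def using \<nu> by real_asymp
      moreover have "filterlim b at_top sequentially" unfolding b_def by real_asymp
      ultimately show ?thesis by (rule filterlim_compose)
    qed
    note lim = this
    have "\<exists>n. x \<le> g (b n)" if x: "x < 1" for x
    proof -
      obtain N where "\<forall>n\<ge>N. x < g (b n)" using order_tendstoD(1)[OF lim x] by (auto simp: eventually_sequentially)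
      then have "x < g (b N)" by blast
      then show ?thesis by (intro exI[of _ N]) simp
    qed
    moreover have "x < 1" if "x \<le> g (b n)" for x n using that g1[of "b n"] by linarith
    ultimately show ?thesis by auto
  qed
  finally have eq: "emeasure ?F {g q..<1} = emeasure ?T {q..}" .
  have "emeasure ?F {g q..<1} = (\<integral>\<^sup>+s. ennreal (f s) * indicator {g q..<1} s \<partial>lborel)"
    by (subst emeasure_density) (auto simp: f_def)
  also have "\<dots> = (\<integral>\<^sup>+s. ennreal (1 / B) * (ennreal (s powr (1 / 2 - 1) * (1 - s) powr (\<nu> / 2 - 1)) * indicator {g q<..<1} s) \<partial>lborel)"
    using AE_lborel_singleton[of "g q"]
    by (intro nn_integral_cong_AE, eventually_elim) (use B in \<open>auto simp: indicator_def f_def ennreal_mult'[symmetric]\<close>)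
  also have "\<dots> = ennreal (1 / B) * (\<integral>\<^sup>+s. ennreal (s powr (1 / 2 - 1) * (1 - s) powr (\<nu> / 2 - 1)) * indicator {g q<..<1} s \<partial>lborel)"
    by (rule nn_integral_cmult) measurable
  also have "\<dots> = ennreal (Ptail k (k * g q))"
  proof -
    have "0 \<le> k * g q" using k npos[of q] by (simp add: g_def)
    from rlaw_tail[OF k this] show ?thesis using k by (simp add: B_def \<nu>_def)
  qed
  finally have "emeasure ?T {q..} = ennreal (Ptail k (k * g q))" using eq by simp
  moreover have "emeasure ?T {q..} = 2 * emeasure (tlaw \<nu>) {q..}"
  proof -
    have "emeasure ?T {q..} = (\<integral>\<^sup>+T. 2 * (ennreal (t_density \<nu> T) * indicator {q..} T) \<partial>lborel)"
      using t_density_nonneg[OF \<nu>]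
      by (subst emeasure_density) (auto intro!: nn_integral_cong simp: ennreal_mult mult.assoc)
    also have "\<dots> = 2 * emeasure (tlaw \<nu>) {q..}"
      unfolding tlaw_def by (subst nn_integral_cmult, simp, subst emeasure_density, auto)
    finally show ?thesis .
  qed
  ultimately show ?thesis by (simp add: \<nu>_def g_def)
qed

lemma rlaw_zero: assumes k: "1 < k" shows "Ptail k 0 = 1"
proof -
  interpret R: prob_space "rlaw k" using k by (rule prob_space_rlaw)
  have "AE s in rlaw k. s \<in> {0<..}" unfolding rlaw_def by (rule eventually_mono[OF AE_idens]) auto
  then show ?thesis unfolding Ptail_def by (rule R.prob_eq_1[THEN iffD2, rotated]) simp
qed

lemma tlaw_singleton: "emeasure (tlaw \<nu>) {a} = 0"
  unfolding tlaw_def using AE_lborel_singleton[of a]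
  by (subst emeasure_density) (auto simp: nn_integral_0_iff_AE indicator_def elim: eventually_mono)

lemma tlaw_symmetric: "emeasure (tlaw \<nu>) {..- q} = emeasure (tlaw \<nu>) {q..}"
proof -
  have s: "t_density \<nu> (- x) = t_density \<nu> x" for x by (simp add: t_density_def)
  have "emeasure (tlaw \<nu>) {..- q} = (\<integral>\<^sup>+x. ennreal (t_density \<nu> x) * indicator {..- q} x \<partial>lborel)"
    unfolding tlaw_def by (subst emeasure_density) auto
  also have "\<dots> = (\<integral>\<^sup>+x. ennreal (t_density \<nu> (0 + -1 * x)) * indicator {..- q} (0 + -1 * x) \<partial>lborel)"
    by (subst nn_integral_real_affine[where c = "-1" and t = 0]) auto
  also have "\<dots> = (\<integral>\<^sup>+x. ennreal (t_density \<nu> x) * indicator {q..} x \<partial>lborel)"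
    by (intro nn_integral_cong) (auto simp: s indicator_def)
  also have "\<dots> = emeasure (tlaw \<nu>) {q..}"
    unfolding tlaw_def by (subst emeasure_density) auto
  finally show ?thesis .
qed

text \<open>The normalisation is read off from \<open>t_tail\<close> at \<open>q = 0\<close>
  together with the symmetry of the density.\<close>

lemma prob_space_tlaw: assumes \<nu>: "0 < \<nu>" shows "prob_space (tlaw \<nu>)"
proof
  have "emeasure (tlaw \<nu>) UNIV = emeasure (tlaw \<nu>) ({..0} \<union> {0<..})"
    by (rule arg_cong[where f = "emeasure (tlaw \<nu>)"]) auto
  also have "\<dots> = emeasure (tlaw \<nu>) {..0} + emeasure (tlaw \<nu>) {0<..}"
    by (rule plus_emeasure[symmetric]) auto
  also have "emeasure (tlaw \<nu>) {0<..} = emeasure (tlaw \<nu>) {0..}"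
  proof -
    have "emeasure (tlaw \<nu>) {0..} = emeasure (tlaw \<nu>) ({0} \<union> {0<..})"
      by (rule arg_cong[where f = "emeasure (tlaw \<nu>)"]) auto
    also have "\<dots> = emeasure (tlaw \<nu>) {0} + emeasure (tlaw \<nu>) {0<..}" by (rule plus_emeasure[symmetric]) auto
    finally show ?thesis by (simp add: tlaw_singleton)
  qed
  also have "emeasure (tlaw \<nu>) {..0} = emeasure (tlaw \<nu>) {0..}" using tlaw_symmetric[of \<nu> 0] by simp
  also have "emeasure (tlaw \<nu>) {0..} + emeasure (tlaw \<nu>) {0..} = 1"
    using t_tail[of "\<nu> + 1" 0] \<nu> rlaw_zero[of "\<nu> + 1"] by (simp add: mult_2)
  finally show "emeasure (tlaw \<nu>) (space (tlaw \<nu>)) = 1" by simp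
qed

lemma t_cdf_tail:
  assumes k: "1 < k" and q: "0 \<le> q"
  shows "Ptail k (k * (q\<^sup>2 / (k - 1 + q\<^sup>2))) = 2 * (1 - t_cdf (k - 1) q)"
proof -
  interpret T: prob_space "tlaw (k - 1)" using k by (intro prob_space_tlaw) simp
  have "emeasure (tlaw (k - 1)) {q..} = emeasure (tlaw (k - 1)) ({q} \<union> {q<..})"
    by (rule arg_cong[where f = "emeasure (tlaw (k - 1))"]) auto
  also have "\<dots> = emeasure (tlaw (k - 1)) {q} + emeasure (tlaw (k - 1)) {q<..}" by (rule plus_emeasure[symmetric]) auto
  finally have e: "emeasure (tlaw (k - 1)) {q..} = emeasure (tlaw (k - 1)) {q<..}" by (simp add: tlaw_singleton)
  have "measure (tlaw (k - 1)) (space (tlaw (k - 1)) - {..q}) = 1 - measure (tlaw (k - 1)) {..q}"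
    by (rule T.prob_compl) simp
  moreover have "space (tlaw (k - 1)) - {..q} = {q<..}" by auto
  ultimately have "measure (tlaw (k - 1)) {q<..} = 1 - t_cdf (k - 1) q" by (simp add: t_cdf_def cdf_def tlaw_def)
  then have m: "emeasure (tlaw (k - 1)) {q..} = ennreal (1 - t_cdf (k - 1) q)" using e by (simp add: T.emeasure_eq_measure)
  have "0 \<le> 1 - t_cdf (k - 1) q" using T.prob_le_1[of "{..q}"] by (simp add: t_cdf_def cdf_def tlaw_def)
  have "ennreal (2 * (1 - t_cdf (k - 1) q)) = ennreal 2 * ennreal (1 - t_cdf (k - 1) q)" by (rule ennreal_mult') simp
  also have "\<dots> = ennreal (Ptail k (k * (q\<^sup>2 / (k - 1 + q\<^sup>2))))" using t_tail[OF k q] unfolding m by simp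
  finally have "ennreal (2 * (1 - t_cdf (k - 1) q)) = ennreal (Ptail k (k * (q\<^sup>2 / (k - 1 + q\<^sup>2))))" .
  then show ?thesis using \<open>0 \<le> 1 - t_cdf (k - 1) q\<close> by (subst (asm) ennreal_inj) (auto simp: Ptail_def)
qed

lemma t_cdf_nonpos:
  assumes \<nu>: "0 < \<nu>" and x: "x \<le> 0"
  shows "t_cdf \<nu> x \<le> 1 / 2"
proof -
  interpret T: prob_space "tlaw \<nu>" using \<nu> by (rule prob_space_tlaw)
  have "t_cdf \<nu> x \<le> t_cdf \<nu> 0" unfolding t_cdf_def cdf_def tlaw_def[symmetric]
    using x by (intro T.finite_measure_mono) auto
  also have "t_cdf \<nu> 0 = 1 / 2" using t_cdf_tail[of "\<nu> + 1" 0] \<nu> rlaw_zero[of "\<nu> + 1"] by simp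
  finally show ?thesis .
qed

text \<open>Right continuity makes the infimum attained. The quantile is nonnegative because the
  distribution function is at most 1/2 up to 0.\<close>

lemma t_quantile_props:
  assumes \<nu>: "0 < \<nu>" and p: "1 / 2 < p" "p < 1"
  shows "0 \<le> t_quantile \<nu> p" "p \<le> t_cdf \<nu> (t_quantile \<nu> p)" "\<And>x. x < t_quantile \<nu> p \<Longrightarrow> t_cdf \<nu> x < p"
    "{x. p \<le> t_cdf \<nu> x} \<noteq> {}" "bdd_below {x. p \<le> t_cdf \<nu> x}"
proof -
  interpret T: prob_space "tlaw \<nu>" using \<nu> by (rule prob_space_tlaw)
  interpret T: finite_borel_measure "tlaw \<nu>" by unfold_locales simp
  have c: "t_cdf \<nu> = cdf (tlaw \<nu>)" by (simp add: t_cdf_def[abs_def] tlaw_def)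
  define S where "S = {x. p \<le> t_cdf \<nu> x}"
  have pos: "0 \<le> x" if "x \<in> S" for x
    using that t_cdf_nonpos[OF \<nu>, of x] p by (force simp: S_def)
  show bdd: "bdd_below {x. p \<le> t_cdf \<nu> x}" using pos by (intro bdd_belowI[of _ 0]) (auto simp: S_def)
  have "((\<lambda>x. t_cdf \<nu> x) \<longlongrightarrow> 1) at_top"
    using T.cdf_lim_at_top T.prob_space by (simp add: c)
  then have "\<forall>\<^sub>F x in at_top. p < t_cdf \<nu> x" using p by (intro order_tendstoD(1))
  then obtain N where "p < t_cdf \<nu> N" by (auto simp: eventually_at_top_linorder)
  then have "N \<in> {x. p \<le> t_cdf \<nu> x}" by simp
  then show ne: "{x. p \<le> t_cdf \<nu> x} \<noteq> {}" by blast
  have q: "t_quantile \<nu> p = Inf S" by (simp add: t_quantile_def S_def)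
  show "0 \<le> t_quantile \<nu> p" unfolding q using ne pos by (intro cInf_greatest) (auto simp: S_def)
  show "t_cdf \<nu> x < p" if "x < t_quantile \<nu> p" for x
  proof (rule ccontr)
    assume "\<not> t_cdf \<nu> x < p"
    then have "x \<in> S" by (simp add: S_def)
    then have "Inf S \<le> x" using bdd by (intro cInf_lower) (auto simp: S_def)
    then show False using that q by simp
  qed
  show "p \<le> t_cdf \<nu> (t_quantile \<nu> p)"
  proof (rule tendsto_lowerbound)
    show "(t_cdf \<nu> \<longlongrightarrow> t_cdf \<nu> (t_quantile \<nu> p)) (at_right (t_quantile \<nu> p))"
      using T.cdf_is_right_cont[of "t_quantile \<nu> p"] by (simp add: c continuous_within)
    show "\<forall>\<^sub>F x in at_right (t_quantile \<nu> p). p \<le> t_cdf \<nu> x"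
    proof (rule eventually_at_right_less[THEN eventually_mono])
      fix x assume "t_quantile \<nu> p < x"
      then obtain s where "s \<in> S" "s < x" using ne cInf_lessD[of S x] by (auto simp: q S_def)
      then have "p \<le> t_cdf \<nu> s" "t_cdf \<nu> s \<le> t_cdf \<nu> x" by (auto simp: S_def c intro!: T.cdf_nondecreasing)
      then show "p \<le> t_cdf \<nu> x" by simp
    qed
  qed simp
qed

lemma alpha_lt_1: "2 * Phi (- sqrt 3) < 1"
  using alpha_max_bound by simp

text \<open>For the second claim: \<open>q\<^sup>2 = k - 1\<close> corresponds to the level
  \<open>k / 2\<close> of the ratio, where Markov's inequality bounds the tail by
  \<open>2 / k \<le> \<alpha>\<close>; a larger quantile would contradict this.\<close>

lemma quantile_ratio:
  fixes k :: nat
  assumes k: "2 \<le> k" and \<alpha>: "0 < \<alpha>" "\<alpha> < 1"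
  defines "q \<equiv> t_quantile (real k - 1) (1 - \<alpha> / 2)"
  shows "Ptail (real k) (real k * (q\<^sup>2 / (real k - 1 + q\<^sup>2))) \<le> \<alpha>"
    "2 / \<alpha> \<le> real k \<Longrightarrow> q\<^sup>2 \<le> real k - 1"
proof -
  have k1: "1 < real k" and \<nu>: "0 < real k - 1" using k by auto
  have p: "1 / 2 < 1 - \<alpha> / 2" "1 - \<alpha> / 2 < 1" using \<alpha> by auto
  note Q = t_quantile_props[OF \<nu> p, folded q_def]
  show "Ptail (real k) (real k * (q\<^sup>2 / (real k - 1 + q\<^sup>2))) \<le> \<alpha>"
    unfolding t_cdf_tail[OF k1 Q(1)] using Q(2) by simp
  assume K: "2 / \<alpha> \<le> real k"
  show "q\<^sup>2 \<le> real k - 1"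
  proof (rule ccontr)
    assume "\<not> q\<^sup>2 \<le> real k - 1"
    then have "sqrt (real k - 1) < q" using Q(1) \<nu> by (intro real_less_lsqrt) auto
    then have "t_cdf (real k - 1) (sqrt (real k - 1)) < 1 - \<alpha> / 2" by (rule Q(3))
    then have "\<alpha> < Ptail (real k) (real k * ((sqrt (real k - 1))\<^sup>2 / (real k - 1 + (sqrt (real k - 1))\<^sup>2)))"
      using t_cdf_tail[OF k1, of "sqrt (real k - 1)"] \<nu> by simp
    also have "real k * ((sqrt (real k - 1))\<^sup>2 / (real k - 1 + (sqrt (real k - 1))\<^sup>2)) = real k / 2"
      using \<nu> by (simp add: field_simps)
    also have "Ptail (real k) (real k / 2) \<le> 1 / (real k / 2)" using k1 by (intro Ptail_le_inverse) auto
    also have "\<dots> \<le> \<alpha>" using K \<alpha> k1 by (simp add: field_simps)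
    finally show False by simp
  qed
qed

text \<open>The rate \<open>sqrt (k - 1)\<close> is the one that \<open>sdev_perturb\<close> can
  absorb. Below \<open>2 / \<alpha>\<close> only finitely many \<open>k\<close> occur, and the sum
  in \<open>B\<close> dominates their quantiles.\<close>

lemma quantile_bound:
  assumes \<alpha>: "0 < \<alpha>" "\<alpha> < 1"
  obtains B where "0 < B" "\<And>k::nat. 2 \<le> k \<Longrightarrow> t_quantile (real k - 1) (1 - \<alpha> / 2) \<le> B * sqrt (real k - 1)"
proof -
  define q where "q = (\<lambda>k::nat. t_quantile (real k - 1) (1 - \<alpha> / 2))"
  define B where "B = 1 + (\<Sum>k<nat \<lceil>2 / \<alpha>\<rceil>. \<bar>q k\<bar>)"
  have B1: "1 \<le> B" by (simp add: B_def sum_nonneg)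
  show ?thesis
  proof (rule that[of B])
    show "0 < B" using B1 by simp
    fix k :: nat assume k: "2 \<le> k"
    have s1: "1 \<le> sqrt (real k - 1)" using k by simp
    show "t_quantile (real k - 1) (1 - \<alpha> / 2) \<le> B * sqrt (real k - 1)"
    proof (cases "2 / \<alpha> \<le> real k")
      case True
      from quantile_ratio(2)[OF k \<alpha> True] have "q k \<le> sqrt (real k - 1)"
        by (simp add: q_def real_le_rsqrt)
      also have "\<dots> \<le> B * sqrt (real k - 1)" using B1 s1 by simp
      finally show ?thesis by (simp add: q_def)
    next
      case False
      then have "k < nat \<lceil>2 / \<alpha>\<rceil>" by linarith
      then have "\<bar>q k\<bar> \<le> (\<Sum>k<nat \<lceil>2 / \<alpha>\<rceil>. \<bar>q k\<bar>)" by (intro member_le_sum) auto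
      then have "q k \<le> B * 1" by (simp add: B_def)
      also have "\<dots> \<le> B * sqrt (real k - 1)" using B1 s1 by (intro mult_left_mono) auto
      finally show ?thesis by (simp add: q_def)
    qed
  qed
qed

text \<open>Critical values decrease with the level. This is what removes the random level from the
  problem: rejection at any \<open>a \<le> \<alpha>\<close> is contained in rejection at
  \<open>\<alpha>\<close>.\<close>

lemma IM_reject_mono:
  assumes C: "2 \<le> card C" and a: "a \<le> \<alpha>" and \<alpha>: "\<alpha> < 1" and R: "IM_reject a C x"
  shows "IM_reject \<alpha> C x"
proof -
  have a0: "0 < a" using R by (simp add: IM_reject_def)
  have \<nu>: "0 < real (card C) - 1" using C by simp
  have "t_quantile (real (card C) - 1) (1 - \<alpha> / 2) \<le> t_quantile (real (card C) - 1) (1 - a / 2)"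
    unfolding t_quantile_def
  proof (rule cInf_superset_mono)
    show "{x. 1 - a / 2 \<le> t_cdf (real (card C) - 1) x} \<noteq> {}"
      using t_quantile_props(4)[OF \<nu>, of "1 - a / 2"] a0 a \<alpha> by simp
    show "bdd_below {x. 1 - \<alpha> / 2 \<le> t_cdf (real (card C) - 1) x}"
      using t_quantile_props(5)[OF \<nu>, of "1 - \<alpha> / 2"] a0 a \<alpha> by simp
    show "{x. 1 - a / 2 \<le> t_cdf (real (card C) - 1) x} \<subseteq> {x. 1 - \<alpha> / 2 \<le> t_cdf (real (card C) - 1) x}"
      using a by auto
  qed
  then show ?thesis using R a by (simp add: IM_reject_def)
qed

section \<open>Anticoncentration along the diagonal\<close>

lemma gaussian_shift:
  assumes s: "0 < s"
  shows "gaussian v s = distr (gaussian 0 s) borel (\<lambda>x. x + v)"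
    "gaussian v s = density (gaussian 0 s) (\<lambda>x. ennreal (exp (v * x / s\<^sup>2 - v\<^sup>2 / (2 * s\<^sup>2))))"
proof -
  interpret G: prob_space "gaussian 0 s" using s by (rule prob_space_gaussian)
  have "distributed (gaussian 0 s) lborel (\<lambda>x. x) (normal_density 0 s)"
  proof -
    have "distr (gaussian 0 s) lborel (\<lambda>x. x) = distr (gaussian 0 s) (gaussian 0 s) (\<lambda>x. x)"
      by (rule distr_cong) auto
    then show ?thesis by (simp add: distributed_def gaussian_def)
  qed
  from G.normal_density_affine[OF this s, of 1 v]
  have "distributed (gaussian 0 s) lborel (\<lambda>x. v + 1 * x) (normal_density v s)" by simp
  then have "distr (gaussian 0 s) lborel (\<lambda>x. v + 1 * x) = gaussian v s"
    by (simp add: distributed_def gaussian_def)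
  moreover have "distr (gaussian 0 s) lborel (\<lambda>x. v + 1 * x) = distr (gaussian 0 s) borel (\<lambda>x. x + v)"
    by (rule distr_cong) auto
  ultimately show "gaussian v s = distr (gaussian 0 s) borel (\<lambda>x. x + v)" by simp
  have "normal_density v s x = normal_density 0 s x * exp (v * x / s\<^sup>2 - v\<^sup>2 / (2 * s\<^sup>2))" for x
  proof -
    have "- (x - v)\<^sup>2 / (2 * s\<^sup>2) = - (x - 0)\<^sup>2 / (2 * s\<^sup>2) + (v * x / s\<^sup>2 - v\<^sup>2 / (2 * s\<^sup>2))"
      using s by (simp add: field_simps power2_eq_square)
    then show ?thesis unfolding normal_density_def by (simp only: exp_add mult.assoc)
  qed
  then show "gaussian v s = density (gaussian 0 s) (\<lambda>x. ennreal (exp (v * x / s\<^sup>2 - v\<^sup>2 / (2 * s\<^sup>2))))"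
    unfolding gaussian_def by (subst density_density_eq) (auto simp: ennreal_mult')
qed

text \<open>Translation along the diagonal costs a likelihood ratio; averaging the shifts by \<open>v\<close> and \<open>-v\<close>
  turns its linear part into a hyperbolic cosine, which is at least 1.\<close>
lemma gaussian_two_shifts:
  fixes s :: "'i \<Rightarrow> real"
  assumes I: "finite I" "I \<noteq> {}" and s: "\<And>i. i \<in> I \<Longrightarrow> 0 < s i" and c: "0 < c" "\<And>i. i \<in> I \<Longrightarrow> c \<le> (s i)\<^sup>2"
    and A: "A \<in> sets (PiM I (\<lambda>i. gaussian 0 (s i)))"
  defines "G \<equiv> PiM I (\<lambda>i. gaussian 0 (s i))"
  shows "2 * exp (- (real (card I) * v\<^sup>2 / (2 * c))) * measure G A
    \<le> measure G {x \<in> space G. (\<lambda>i\<in>I. x i + v) \<in> A} + measure G {x \<in> space G. (\<lambda>i\<in>I. x i - v) \<in> A}"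
proof -
  interpret G: prob_space G unfolding G_def using s by (rule prob_space_PiM_gaussian)
  define L where "L = (\<lambda>x. \<Sum>i\<in>I. x i / (s i)\<^sup>2)"
  define b where "b = (\<lambda>v::real. \<Sum>i\<in>I. v\<^sup>2 / (2 * (s i)\<^sup>2))"
  have Lm[measurable]: "L \<in> borel_measurable G" unfolding L_def G_def
    by (intro borel_measurable_sum borel_measurable_divide measurable_compose[OF measurable_component_singleton[of _ I "\<lambda>i. gaussian 0 (s i)"]]) auto
  have A'[measurable]: "A \<in> sets G" using A by (simp add: G_def)
  have shift: "emeasure G {x \<in> space G. (\<lambda>i\<in>I. x i + v) \<in> A} = (\<integral>\<^sup>+x. ennreal (exp (v * L x - b v)) * indicator A x \<partial>G)" for v
  proof -
    have P: "PiM I (\<lambda>i. gaussian v (s i)) = density G (\<lambda>x. \<Prod>i\<in>I. ennreal (exp (v * x i / (s i)\<^sup>2 - v\<^sup>2 / (2 * (s i)\<^sup>2))))"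
      unfolding G_def using s by (intro density_PiM I prob_space_gaussian gaussian_shift(2)) auto
    have W: "(\<Prod>i\<in>I. ennreal (exp (v * x i / (s i)\<^sup>2 - v\<^sup>2 / (2 * (s i)\<^sup>2)))) = ennreal (exp (v * L x - b v))" for x
    proof -
      have "(\<Sum>i\<in>I. v * x i / (s i)\<^sup>2 - v\<^sup>2 / (2 * (s i)\<^sup>2)) = v * L x - b v"
        by (simp add: sum_subtractf L_def b_def sum_distrib_left)
      then show ?thesis by (simp add: prod_ennreal exp_sum[OF I(1), symmetric])
    qed
    have "PiM I (\<lambda>i. gaussian v (s i)) = PiM I (\<lambda>i. distr (gaussian 0 (s i)) (gaussian 0 (s i)) (\<lambda>x. x + v))"
    proof (intro PiM_cong refl)
      fix i assume "i \<in> I"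
      then have "gaussian v (s i) = distr (gaussian 0 (s i)) borel (\<lambda>x. x + v)" using s by (intro gaussian_shift(1))
      also have "\<dots> = distr (gaussian 0 (s i)) (gaussian 0 (s i)) (\<lambda>x. x + v)" by (rule distr_cong) auto
      finally show "gaussian v (s i) = distr (gaussian 0 (s i)) (gaussian 0 (s i)) (\<lambda>x. x + v)" .
    qed
    also have "\<dots> = distr G G (compose I (\<lambda>x. x + v))"
      unfolding G_def using s by (intro distr_PiM_finite_prob_space'[symmetric] I prob_space_gaussian) auto
    finally have D: "density G (\<lambda>x. ennreal (exp (v * L x - b v))) = distr G G (compose I (\<lambda>x. x + v))"
      unfolding P W .
    have "emeasure (distr G G (compose I (\<lambda>x. x + v))) A = emeasure G (compose I (\<lambda>x. x + v) -` A \<inter> space G)"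
    proof (rule emeasure_distr[OF _ A'])
      show "compose I (\<lambda>x. x + v) \<in> measurable G G"
        unfolding compose_def G_def
        by (intro measurable_restrict) (auto intro!: borel_measurable_add
          measurable_compose[OF measurable_component_singleton[of _ I "\<lambda>i. gaussian 0 (s i)"]])
    qed
    also have "compose I (\<lambda>x. x + v) -` A \<inter> space G = {x \<in> space G. (\<lambda>i\<in>I. x i + v) \<in> A}"
      by (auto simp: compose_def)
    finally show ?thesis unfolding D[symmetric] by (subst (asm) emeasure_density) auto
  qed
  have bv: "b v \<le> real (card I) * v\<^sup>2 / (2 * c)" "b (- v) = b v"
  proof -
    have "b v \<le> (\<Sum>i\<in>I. v\<^sup>2 / (2 * c))"
      unfolding b_def using c s by (intro sum_mono divide_left_mono) (auto intro!: mult_pos_pos simp: less_imp_neq[symmetric])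
    then show "b v \<le> real (card I) * v\<^sup>2 / (2 * c)" by simp
    show "b (- v) = b v" by (simp add: b_def)
  qed
  let ?e = "exp (- (real (card I) * v\<^sup>2 / (2 * c)))"
  have pt: "2 * ?e \<le> exp (v * L x - b v) + exp (- v * L x - b (- v))" for x
  proof -
    have "2 \<le> exp (v * L x) + exp (- (v * L x))"
      using exp_ge_add_one_self[of "v * L x"] exp_ge_add_one_self[of "- (v * L x)"] by linarith
    then have "2 * exp (- b v) \<le> (exp (v * L x) + exp (- (v * L x))) * exp (- b v)" by (intro mult_right_mono) auto
    also have "\<dots> = exp (v * L x - b v) + exp (- v * L x - b (- v))"
      by (simp add: bv(2) distrib_right flip: exp_add)
    also have "2 * ?e \<le> 2 * exp (- b v)" using bv(1) by simp
    finally (xtrans) show ?thesis .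
  qed
  have "ennreal (2 * ?e) * emeasure G A = (\<integral>\<^sup>+x. ennreal (2 * ?e) * indicator A x \<partial>G)"
    by (rule nn_integral_cmult_indicator[symmetric]) simp
  also have "\<dots> \<le> (\<integral>\<^sup>+x. ennreal (exp (v * L x - b v)) * indicator A x + ennreal (exp (- v * L x - b (- v))) * indicator A x \<partial>G)"
  proof (rule nn_integral_mono)
    fix x
    show "ennreal (2 * ?e) * indicator A x \<le> ennreal (exp (v * L x - b v)) * indicator A x + ennreal (exp (- v * L x - b (- v))) * indicator A x"
      using pt[of x] by (auto simp: indicator_def ennreal_plus[symmetric] ennreal_leI simp del: ennreal_plus)
  qed
  also have "\<dots> = emeasure G {x \<in> space G. (\<lambda>i\<in>I. x i + v) \<in> A} + emeasure G {x \<in> space G. (\<lambda>i\<in>I. x i + - v) \<in> A}"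
    unfolding shift by (rule nn_integral_add) measurable
  finally have "ennreal (2 * ?e * measure G A) \<le> ennreal (measure G {x \<in> space G. (\<lambda>i\<in>I. x i + v) \<in> A} + measure G {x \<in> space G. (\<lambda>i\<in>I. x i + - v) \<in> A})"
    by (simp add: G.emeasure_eq_measure ennreal_mult')
  then show ?thesis by (subst (asm) ennreal_le_iff) auto
qed

text \<open>\<open>h\<close> is constant along the diagonal, so translates of the layer by multiples
  of its width are disjoint. By \<open>gaussian_two_shifts\<close> each of the \<open>J\<close>
  pairs of opposite translates has at least \<open>2 * exp (- (1 / (2 * c)))\<close> times the mass
  of the layer, while all of them together have mass at most 1.\<close>

lemma gaussian_anticoncentration:
  fixes s :: "'i \<Rightarrow> real" and h :: "('i \<Rightarrow> real) \<Rightarrow> real"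
  assumes I: "finite I" "I \<noteq> {}" and s: "\<And>i. i \<in> I \<Longrightarrow> 0 < s i" and c: "0 < c" "\<And>i. i \<in> I \<Longrightarrow> c \<le> (s i)\<^sup>2"
    and hm: "h \<in> borel_measurable (PiM I (\<lambda>i. gaussian 0 (s i)))"
    and hinv: "\<And>x v. h (\<lambda>i\<in>I. x i + v) = h x" and \<delta>: "0 < \<delta>" and J: "0 < J" "real J * \<delta> \<le> 1"
    and \<kappa>: "\<kappa> = 1 \<or> \<kappa> = -1"
  defines "G \<equiv> PiM I (\<lambda>i. gaussian 0 (s i))"
  shows "measure G {x \<in> space G. h x - \<delta> < \<kappa> * (\<Sum>i\<in>I. x i) / sqrt (real (card I)) \<and> \<kappa> * (\<Sum>i\<in>I. x i) / sqrt (real (card I)) \<le> h x}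
    \<le> exp (1 / (2 * c)) / (2 * real J)"
proof -
  interpret G: prob_space G unfolding G_def using s by (rule prob_space_PiM_gaussian)
  define k where "k = real (card I)"
  have k: "0 < k" using I by (simp add: k_def card_gt_0_iff)
  define N where "N = (\<lambda>x. \<kappa> * (\<Sum>i\<in>I. x i) / sqrt k)"
  \<comment> \<open>Strip \<open>j\<close> consists of the points whose distance below
    \<open>h\<close>, in units of \<open>\<delta>\<close>, has integer part \<open>j\<close>.
    Translation along the diagonal permutes the strips, and strip 0 is the layer.\<close>
  define E where "E = (\<lambda>j::int. {x \<in> space G. \<lfloor>(h x - N x) / \<delta>\<rfloor> = j})"
  have [measurable]: "h \<in> borel_measurable G" using hm by (simp add: G_def)
  have Nm[measurable]: "N \<in> borel_measurable G" unfolding N_def G_def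
    by (intro borel_measurable_divide borel_measurable_times borel_measurable_const borel_measurable_sum
       measurable_compose[OF measurable_component_singleton[of _ I "\<lambda>i. gaussian 0 (s i)"]]) auto
  have Em[measurable]: "E j \<in> sets G" for j unfolding E_def by measurable
  have E0: "{x \<in> space G. h x - \<delta> < N x \<and> N x \<le> h x} = E 0"
    using \<delta> by (auto simp: E_def floor_eq_iff divide_less_eq zero_le_divide_iff)
  have shiftE: "{x \<in> space G. (\<lambda>i\<in>I. x i + \<kappa> * (of_int j * \<delta>) / sqrt k) \<in> E 0} = E j" for j
  proof -
    have "N (\<lambda>i\<in>I. x i + \<kappa> * (of_int j * \<delta>) / sqrt k) = N x + of_int j * \<delta>" for x
    proof -
      have kk: "\<kappa> * \<kappa> = 1" using \<kappa> by auto
      have sk: "k / (sqrt k * sqrt k) = 1" using k by simp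
      have "N (\<lambda>i\<in>I. x i + \<kappa> * (of_int j * \<delta>) / sqrt k) = \<kappa> * ((\<Sum>i\<in>I. x i) + k * (\<kappa> * (of_int j * \<delta>) / sqrt k)) / sqrt k"
        by (simp add: N_def sum.distrib k_def)
      also have "\<dots> = N x + (\<kappa> * \<kappa>) * (k / (sqrt k * sqrt k)) * (of_int j * \<delta>)"
        by (simp add: N_def distrib_left add_divide_distrib)
      finally show ?thesis unfolding kk sk by simp
    qed
    note Ns = this
    have "(h x - (N x + of_int j * \<delta>)) / \<delta> = (h x - N x) / \<delta> - of_int j" for x
      using \<delta> by (simp add: field_simps)
    moreover have "(\<lambda>i\<in>I. x i + \<kappa> * (of_int j * \<delta>) / sqrt k) \<in> space G" for x by (simp add: G_def space_PiM)
    ultimately show ?thesis unfolding E_def using Ns hinv by auto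
  qed
  define K where "K = {- int J..int J} - {0}"
  have K: "finite K" "real (card K) = 2 * real J" by (auto simp: K_def)
  have low: "2 * exp (- (1 / (2 * c))) * measure G (E 0) \<le> measure G (E j) + measure G (E (- j))" if j: "j \<in> K" for j
  proof -
    define v where "v = \<kappa> * (of_int j * \<delta>) / sqrt k"
    \<comment> \<open>Each coordinate moves by only \<open>j * \<delta> / sqrt k\<close> in absolute
      value, so the cost \<open>k * v\<^sup>2 / (2 * c)\<close> of the shift does not grow with the
      number of components. This is the source of the uniformity.\<close>
    have "k * v\<^sup>2 = (of_int j * \<delta>)\<^sup>2" using k \<kappa> by (auto simp: v_def power_divide power_mult_distrib)
    also have "\<dots> \<le> 1"
    proof -
      have "\<bar>of_int j\<bar> * \<delta> \<le> real J * \<delta>" using j \<delta> by (intro mult_right_mono) (auto simp: K_def)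
      then have "\<bar>of_int j\<bar> * \<delta> \<le> 1" using J(2) by linarith
      then have "\<bar>of_int j * \<delta>\<bar> \<le> 1" using \<delta> by (simp add: abs_mult)
      then show ?thesis by (simp add: abs_square_le_1)
    qed
    finally have "k * v\<^sup>2 / (2 * c) \<le> 1 / (2 * c)" using c by (intro divide_right_mono) auto
    then have "2 * exp (- (1 / (2 * c))) * measure G (E 0) \<le> 2 * exp (- (k * v\<^sup>2 / (2 * c))) * measure G (E 0)"
      by (intro mult_right_mono mult_left_mono) auto
    also have "\<dots> \<le> measure G {x \<in> space G. (\<lambda>i\<in>I. x i + v) \<in> E 0} + measure G {x \<in> space G. (\<lambda>i\<in>I. x i - v) \<in> E 0}"
      unfolding G_def k_def by (rule gaussian_two_shifts[OF I s c]) (use Em[of 0] in \<open>simp_all add: G_def\<close>)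
    also have "{x \<in> space G. (\<lambda>i\<in>I. x i + v) \<in> E 0} = E j" unfolding v_def by (rule shiftE)
    also have "{x \<in> space G. (\<lambda>i\<in>I. x i - v) \<in> E 0} = E (- j)" using shiftE[of "- j"] by (simp add: v_def)
    finally show ?thesis .
  qed
  have "real (card K) * (2 * exp (- (1 / (2 * c))) * measure G (E 0)) \<le> (\<Sum>j\<in>K. measure G (E j) + measure G (E (- j)))"
    using sum_bounded_below[of K "2 * exp (- (1 / (2 * c))) * measure G (E 0)"] low by simp
  also have "\<dots> = (\<Sum>j\<in>K. measure G (E j)) + (\<Sum>j\<in>K. measure G (E (- j)))" by (rule sum.distrib)
  also have "(\<Sum>j\<in>K. measure G (E (- j))) = (\<Sum>j\<in>K. measure G (E j))"
    by (rule sum.reindex_bij_witness[of _ uminus uminus]) (auto simp: K_def)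
  also have "(\<Sum>j\<in>K. measure G (E j)) = measure G (\<Union>j\<in>K. E j)"
    by (rule G.finite_measure_finite_Union[symmetric]) (auto simp: K disjoint_family_on_def E_def)
  finally have "real (card K) * (2 * exp (- (1 / (2 * c))) * measure G (E 0)) \<le> 1 + 1"
    using G.prob_le_1[of "\<Union>j\<in>K. E j"] by linarith
  then have "real J * (2 * exp (- (1 / (2 * c))) * measure G (E 0)) \<le> 1" unfolding K by linarith
  then have "exp (1 / (2 * c)) / (2 * real J) * (real J * (2 * exp (- (1 / (2 * c))) * measure G (E 0))) \<le> exp (1 / (2 * c)) / (2 * real J) * 1"
    by (intro mult_left_mono) auto
  also have "exp (1 / (2 * c)) / (2 * real J) * (real J * (2 * exp (- (1 / (2 * c))) * measure G (E 0))) = (exp (1 / (2 * c)) * exp (- (1 / (2 * c)))) * measure G (E 0)"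
    using J by simp
  finally have "measure G (E 0) \<le> exp (1 / (2 * c)) / (2 * real J)" unfolding exp_add[symmetric] by simp
  then show ?thesis using E0 by (simp add: N_def k_def)
qed

section \<open>The test under approximation\<close>

definition sdev :: "'i set \<Rightarrow> ('i \<Rightarrow> real) \<Rightarrow> real" where
  "sdev I x = sqrt ((\<Sum>i\<in>I. (x i - (\<Sum>j\<in>I. x j) / real (card I))\<^sup>2) / (real (card I) - 1))"

lemma sum_square_centered:
  fixes x :: "'i \<Rightarrow> real"
  assumes I: "finite I" "I \<noteq> {}"
  shows "(\<Sum>i\<in>I. (x i - (\<Sum>j\<in>I. x j) / real (card I))\<^sup>2) = (\<Sum>i\<in>I. (x i)\<^sup>2) - (\<Sum>i\<in>I. x i)\<^sup>2 / real (card I)"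
proof -
  define k where "k = real (card I)"
  define m where "m = (\<Sum>j\<in>I. x j) / k"
  have k: "0 < k" using I by (simp add: k_def card_gt_0_iff)
  have S: "(\<Sum>j\<in>I. x j) = k * m" using k by (simp add: m_def)
  have "(\<Sum>i\<in>I. (x i - m)\<^sup>2) = (\<Sum>i\<in>I. (x i)\<^sup>2 - 2 * m * x i + m\<^sup>2)"
    by (intro sum.cong refl) (simp add: power2_eq_square algebra_simps)
  also have "\<dots> = (\<Sum>i\<in>I. (x i)\<^sup>2) - 2 * m * (\<Sum>i\<in>I. x i) + k * m\<^sup>2"
    by (simp add: sum.distrib sum_subtractf sum_distrib_left k_def)
  also have "\<dots> = (\<Sum>i\<in>I. (x i)\<^sup>2) - (\<Sum>i\<in>I. x i)\<^sup>2 / k"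
    unfolding S using k by (simp add: power2_eq_square field_simps)
  finally show ?thesis by (simp add: m_def k_def)
qed

lemma sdev_shift:
  assumes I: "finite I" "I \<noteq> {}"
  shows "sdev I (\<lambda>i\<in>I. x i + v) = sdev I x"
proof -
  have k: "real (card I) \<noteq> 0" using I by simp
  have "(\<Sum>j\<in>I. (\<lambda>i\<in>I. x i + v) j) / real (card I) = (\<Sum>j\<in>I. x j) / real (card I) + v"
    using k by (simp add: sum.distrib field_simps)
  then show ?thesis unfolding sdev_def by (intro arg_cong[where f = sqrt] arg_cong2[where f = "(/)"] refl sum.cong) simp_all
qed

lemma sum_abs_le:
  fixes z :: "'i \<Rightarrow> real"
  assumes I: "finite I" "I \<noteq> {}"
  shows "\<bar>\<Sum>i\<in>I. z i\<bar> / sqrt (real (card I)) \<le> sqrt (\<Sum>i\<in>I. (z i)\<^sup>2)"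
proof -
  have k: "0 < real (card I)" using I by (simp add: card_gt_0_iff)
  have "0 \<le> (\<Sum>i\<in>I. (z i - (\<Sum>j\<in>I. z j) / real (card I))\<^sup>2)" by (rule sum_nonneg) simp
  then have "(\<Sum>i\<in>I. z i)\<^sup>2 / real (card I) \<le> (\<Sum>i\<in>I. (z i)\<^sup>2)" unfolding sum_square_centered[OF I] by simp
  then have "sqrt ((\<Sum>i\<in>I. z i)\<^sup>2 / real (card I)) \<le> sqrt (\<Sum>i\<in>I. (z i)\<^sup>2)" by simp
  then show ?thesis by (simp add: real_sqrt_divide)
qed

text \<open>Centring is a contraction in the Euclidean norm. The gain
  \<open>1 / sqrt (k - 1)\<close> compensates the growth of the quantile allowed in
  \<open>quantile_bound\<close>.\<close>

lemma sdev_perturb: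
  assumes I: "finite I" "I \<noteq> {}" and k: "2 \<le> card I"
  shows "sdev I y - sdev I x \<le> sqrt (\<Sum>i\<in>I. (x i - y i)\<^sup>2) / sqrt (real (card I) - 1)"
proof -
  define m where "m = (\<lambda>x. (\<Sum>j\<in>I. x j) / real (card I))"
  have m: "m y - m x = m (\<lambda>i. y i - x i)" by (simp add: m_def sum_subtractf diff_divide_distrib)
  have s: "sdev I x = L2_set (\<lambda>i. x i - m x) I / sqrt (real (card I) - 1)" for x
    by (simp add: sdev_def L2_set_def m_def real_sqrt_divide)
  have "L2_set (\<lambda>i. y i - m y) I = L2_set (\<lambda>i. (x i - m x) + ((y i - x i) - m (\<lambda>i. y i - x i))) I"
    unfolding m[symmetric] by (intro L2_set_cong refl) simp
  also have "\<dots> \<le> L2_set (\<lambda>i. x i - m x) I + L2_set (\<lambda>i. (y i - x i) - m (\<lambda>i. y i - x i)) I"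
    by (rule L2_set_triangle_ineq)
  also have "L2_set (\<lambda>i. (y i - x i) - m (\<lambda>i. y i - x i)) I \<le> sqrt (\<Sum>i\<in>I. (y i - x i)\<^sup>2)"
    unfolding L2_set_def m_def sum_square_centered[OF I] by simp
  also have "(\<Sum>i\<in>I. (y i - x i)\<^sup>2) = (\<Sum>i\<in>I. (x i - y i)\<^sup>2)" by (simp add: power2_commute)
  finally have "L2_set (\<lambda>i. y i - m y) I - L2_set (\<lambda>i. x i - m x) I \<le> sqrt (\<Sum>i\<in>I. (x i - y i)\<^sup>2)" by simp
  then show ?thesis unfolding s diff_divide_distrib[symmetric] using k by (intro divide_right_mono) auto
qed

text \<open>Clearing the quotient gives a boundary that is stable under perturbation. If
  \<open>sdev C x = 0\<close>, then \<open>tstat\<close> is 0 by the convention for division by 0,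
  and there is no rejection because the quantile is nonnegative.\<close>

lemma IM_reject_iff:
  assumes k: "2 \<le> card C" and \<alpha>: "0 < \<alpha>" "\<alpha> < 1"
  shows "IM_reject \<alpha> C x \<longleftrightarrow> sdev C x \<noteq> 0 \<and>
    t_quantile (real (card C) - 1) (1 - \<alpha> / 2) * sdev C x < \<bar>\<Sum>i\<in>C. x i\<bar> / sqrt (real (card C))"
proof -
  have q: "0 \<le> t_quantile (real (card C) - 1) (1 - \<alpha> / 2)" using k \<alpha> by (intro t_quantile_props) auto
  have kp: "0 < real (card C)" using k by simp
  have "real (card C) powr (- 1 / 2) = 1 / sqrt (real (card C))"
    using kp by (simp add: powr_half_sqrt[symmetric] powr_minus_divide)
  then have t: "tstat C x = ((\<Sum>i\<in>C. x i) / sqrt (real (card C))) / sdev C x"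
    by (simp add: tstat_def sdev_def Let_def)
  have D: "0 \<le> sdev C x" using k by (auto simp: sdev_def intro!: divide_nonneg_nonneg sum_nonneg)
  show ?thesis
  proof (cases "sdev C x = 0")
    case True then show ?thesis using q by (simp add: IM_reject_def t)
  next
    case False
    then have "0 < sdev C x" using D by simp
    then show ?thesis using \<alpha> by (simp add: IM_reject_def t pos_less_divide_eq abs_divide del: divide_divide_eq_left)
  qed
qed

lemma selfnorm_gt:
  assumes I: "finite I" and k: "2 \<le> card I" and q: "0 \<le> q"
    and N: "q * sdev I y < \<bar>\<Sum>i\<in>I. y i\<bar> / sqrt (real (card I))"
  shows "real (card I) * (q\<^sup>2 / (real (card I) - 1 + q\<^sup>2)) < selfnorm I y"
proof -
  define k' S T where "k' = real (card I)" and "S = (\<Sum>i\<in>I. y i)" and "T = (\<Sum>i\<in>I. (y i)\<^sup>2)"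
  have ne: "I \<noteq> {}" using k by auto
  have kp: "2 \<le> k'" using k by (simp add: k'_def)
  have nn: "0 \<le> q * sdev I y" using k q by (auto simp: sdev_def intro!: mult_nonneg_nonneg divide_nonneg_nonneg sum_nonneg)
  have "(q * sdev I y)\<^sup>2 < (\<bar>S\<bar> / sqrt k')\<^sup>2" using N nn by (intro power_strict_mono) (auto simp: S_def k'_def)
  also have "(\<bar>S\<bar> / sqrt k')\<^sup>2 = S\<^sup>2 / k'" using kp by (simp add: power_divide)
  finally have "q\<^sup>2 * (sdev I y)\<^sup>2 < S\<^sup>2 / k'" by (simp add: power_mult_distrib)
  moreover have "(sdev I y)\<^sup>2 = (T - S\<^sup>2 / k') / (k' - 1)"
  proof -
    have "0 \<le> T - S\<^sup>2 / k'" unfolding T_def S_def k'_def sum_square_centered[OF I ne, symmetric] by (rule sum_nonneg) simp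
    then show ?thesis unfolding sdev_def sum_square_centered[OF I ne] using kp by (simp add: T_def S_def k'_def)
  qed
  ultimately have *: "q\<^sup>2 * ((T - S\<^sup>2 / k') / (k' - 1)) < S\<^sup>2 / k'" by simp
  have T: "0 < T"
  proof (rule ccontr)
    assume "\<not> 0 < T"
    then have "T = 0" using sum_nonneg[of I "\<lambda>i. (y i)\<^sup>2"] by (simp add: T_def not_less)
    then have "S = 0" using I by (simp add: S_def T_def sum_nonneg_eq_0_iff)
    then show False using * \<open>T = 0\<close> by simp
  qed
  have d: "0 < k' - 1 + q\<^sup>2" using kp zero_le_power2[of q] by linarith
  have "k' * (q\<^sup>2 * (k' * T - S\<^sup>2)) < k' * (S\<^sup>2 * (k' - 1))" using * kp by (simp add: field_simps)
  then have "q\<^sup>2 * (k' * T - S\<^sup>2) < S\<^sup>2 * (k' - 1)" using kp by (subst (asm) mult_less_cancel_left_pos) auto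
  then have "k' * q\<^sup>2 * T < S\<^sup>2 * (k' - 1 + q\<^sup>2)" by (simp add: algebra_simps)
  then have "k' * (q\<^sup>2 / (k' - 1 + q\<^sup>2)) < S\<^sup>2 / T" using T d by (simp add: field_simps)
  then show ?thesis by (simp add: selfnorm_def S_def T_def k'_def)
qed

text \<open>The normalised sum moves by at most \<open>\<epsilon>\<close>, and
  \<open>q * sdev\<close> increases by at most \<open>B * \<epsilon>\<close> because the factors
  \<open>sqrt (k - 1)\<close> cancel.\<close>

lemma IM_reject_perturb:
  assumes k: "2 \<le> card C" and \<alpha>: "0 < \<alpha>" "\<alpha> < 1" and B: "0 < B"
  defines "q \<equiv> t_quantile (real (card C) - 1) (1 - \<alpha> / 2)"
  assumes qB: "q \<le> B * sqrt (real (card C) - 1)"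
    and R: "IM_reject \<alpha> C x" and \<epsilon>: "sqrt (\<Sum>i\<in>C. (x i - y i)\<^sup>2) \<le> \<epsilon>"
  shows "q * sdev C y - \<epsilon> * (1 + B) < \<bar>\<Sum>i\<in>C. y i\<bar> / sqrt (real (card C))"
proof -
  have C: "finite C" "C \<noteq> {}" using k by (auto intro: card_ge_0_finite)
  have q: "0 \<le> q" unfolding q_def using k \<alpha> by (intro t_quantile_props) auto
  have kp: "0 < sqrt (real (card C) - 1)" using k by simp
  have e0: "0 \<le> \<epsilon>" using \<epsilon> sum_nonneg[of C "\<lambda>i. (x i - y i)\<^sup>2"] by (meson order_trans real_sqrt_ge_zero zero_le_power2)
  have "\<bar>\<Sum>i\<in>C. x i\<bar> \<le> \<bar>\<Sum>i\<in>C. y i\<bar> + \<bar>\<Sum>i\<in>C. x i - y i\<bar>" unfolding sum_subtractf by linarith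
  then have "\<bar>\<Sum>i\<in>C. x i\<bar> / sqrt (real (card C)) \<le> \<bar>\<Sum>i\<in>C. y i\<bar> / sqrt (real (card C)) + \<bar>\<Sum>i\<in>C. x i - y i\<bar> / sqrt (real (card C))"
    unfolding add_divide_distrib[symmetric] by (intro divide_right_mono) auto
  also have "\<dots> \<le> \<bar>\<Sum>i\<in>C. y i\<bar> / sqrt (real (card C)) + \<epsilon>" using sum_abs_le[OF C, of "\<lambda>i. x i - y i"] \<epsilon> by linarith
  finally have 1: "q * sdev C x < \<bar>\<Sum>i\<in>C. y i\<bar> / sqrt (real (card C)) + \<epsilon>"
    using R IM_reject_iff[OF k \<alpha>] by (simp add: q_def)
  have "q * (sdev C y - sdev C x) \<le> q * (\<epsilon> / sqrt (real (card C) - 1))"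
    using sdev_perturb[OF C k, of y x] divide_right_mono[OF \<epsilon>, of "sqrt (real (card C) - 1)"] kp q by (intro mult_left_mono) auto
  also have "\<dots> \<le> B * sqrt (real (card C) - 1) * (\<epsilon> / sqrt (real (card C) - 1))"
    using qB e0 kp by (intro mult_right_mono) auto
  also have "\<dots> = \<epsilon> * B" using kp by simp
  finally show ?thesis using 1 by (simp add: algebra_simps)
qed

text \<open>Rejection forces one of four events: the approximation is off by more than
  \<open>\<epsilon>\<close>, the Gaussian vector lies beyond the critical boundary itself, or its
  normalised sum, taken with one of the two signs, lies in the layer just below that
  boundary.\<close>

lemma reject_prob_perturb:
  fixes X Y :: "'i \<Rightarrow> 'w \<Rightarrow> real"
  assumes M: "prob_space M" and k: "2 \<le> card C" and \<alpha>: "0 < \<alpha>" "\<alpha> \<le> 2 * Phi (- sqrt 3)"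
    and B: "0 < B" "t_quantile (real (card C) - 1) (1 - \<alpha> / 2) \<le> B * sqrt (real (card C) - 1)"
    and X: "\<And>i. i \<in> C \<Longrightarrow> X i \<in> borel_measurable M"
    and Y: "\<And>i. i \<in> C \<Longrightarrow> distributed M lborel (Y i) (normal_density 0 (s i))" "prob_space.indep_vars M (\<lambda>_. borel) Y C"
    and s: "\<And>i. i \<in> C \<Longrightarrow> 0 < s i" "\<And>i. i \<in> C \<Longrightarrow> c \<le> (s i)\<^sup>2" and c: "0 < c"
    and J: "0 < J" "real J * (\<epsilon> * (1 + B)) \<le> 1" and \<epsilon>: "0 < \<epsilon>"
  shows "measure M {\<omega> \<in> space M. IM_reject \<alpha> C (\<lambda>i. X i \<omega>)}
    \<le> measure M {\<omega> \<in> space M. \<epsilon> < sqrt (\<Sum>i\<in>C. (X i \<omega> - Y i \<omega>)\<^sup>2)} + \<alpha> + exp (1 / (2 * c)) / real J"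
proof -
  interpret prob_space M by (rule M)
  have C: "finite C" "C \<noteq> {}" using k by (auto intro: card_ge_0_finite)
  have \<alpha>1: "\<alpha> < 1" using \<alpha>(2) alpha_lt_1 by simp
  define q where "q = t_quantile (real (card C) - 1) (1 - \<alpha> / 2)"
  define r where "r = real (card C) * (q\<^sup>2 / (real (card C) - 1 + q\<^sup>2))"
  define \<delta> where "\<delta> = \<epsilon> * (1 + B)"
  have q: "0 \<le> q" unfolding q_def using k \<alpha> \<alpha>1 by (intro t_quantile_props) auto
  have \<delta>: "0 < \<delta>" using \<epsilon> B by (simp add: \<delta>_def)
  define G where "G = PiM C (\<lambda>i. gaussian 0 (s i))"
  interpret G: prob_space G unfolding G_def using s(1) by (rule prob_space_PiM_gaussian)
  have Ym: "Y i \<in> borel_measurable M" if "i \<in> C" for i using distributed_measurable[OF Y(1)[OF that]] by simp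
  have "distr M (PiM C (\<lambda>_. borel)) (\<lambda>\<omega>. \<lambda>i\<in>C. Y i \<omega>) = PiM C (\<lambda>i. distr M borel (Y i))"
    using indep_vars_iff_distr_eq_PiM'[OF C(2), of Y "\<lambda>_. borel"] Ym Y(2) by simp
  also have "\<dots> = G" unfolding G_def
  proof (rule PiM_cong[OF refl])
    fix i assume i: "i \<in> C"
    have "distr M borel (Y i) = distr M lborel (Y i)" by (rule distr_cong) simp_all
    also have "\<dots> = gaussian 0 (s i)" using distributed_distr_eq_density[OF Y(1)[OF i]] by (simp add: gaussian_def)
    finally show "distr M borel (Y i) = gaussian 0 (s i)" .
  qed
  finally have law: "distr M (PiM C (\<lambda>_. borel)) (\<lambda>\<omega>. \<lambda>i\<in>C. Y i \<omega>) = G" .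
  have Y': "(\<lambda>\<omega>. \<lambda>i\<in>C. Y i \<omega>) \<in> measurable M G"
    unfolding G_def by (rule measurable_restrict) (simp add: Ym cong: measurable_cong_sets)
  have setsG: "sets G = sets (PiM C (\<lambda>_. borel))" unfolding G_def by (rule sets_PiM_cong) simp_all
  have push: "measure M {\<omega> \<in> space M. P (\<lambda>i\<in>C. Y i \<omega>)} = measure G {x \<in> space G. P x}" if "{x \<in> space G. P x} \<in> sets G" for P
  proof -
    have "measure G {x \<in> space G. P x} = measure (distr M (PiM C (\<lambda>_. borel)) (\<lambda>\<omega>. \<lambda>i\<in>C. Y i \<omega>)) {x \<in> space G. P x}"
      unfolding law ..
    also have "\<dots> = measure M ((\<lambda>\<omega>. \<lambda>i\<in>C. Y i \<omega>) -` {x \<in> space G. P x} \<inter> space M)"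
      using that Y' by (intro measure_distr) (auto simp: setsG cong: measurable_cong_sets)
    also have "(\<lambda>\<omega>. \<lambda>i\<in>C. Y i \<omega>) -` {x \<in> space G. P x} \<inter> space M = {\<omega> \<in> space M. P (\<lambda>i\<in>C. Y i \<omega>)}"
      using measurable_space[OF Y'] by auto
    finally show ?thesis by simp
  qed
  have comp: "(\<lambda>x. x i) \<in> borel_measurable G" if "i \<in> C" for i unfolding G_def
    by (rule measurable_compose[OF measurable_component_singleton[of _ C "\<lambda>i. gaussian 0 (s i)"]]) (use that in auto)
  have snm: "selfnorm C \<in> borel_measurable G" unfolding G_def by (rule selfnorm_measurable)
  define N where "N = (\<lambda>x. (\<Sum>i\<in>C. x i) / sqrt (real (card C)))"
  have Nm: "N \<in> borel_measurable G" unfolding N_def by (intro borel_measurable_divide borel_measurable_sum comp) auto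
  have sm: "sdev C \<in> borel_measurable G"
  proof -
    note [measurable] = comp
    show ?thesis unfolding sdev_def[abs_def] by measurable
  qed
  then have Dm: "(\<lambda>x. q * sdev C x) \<in> borel_measurable G" by measurable
  define A1 where "A1 = {\<omega> \<in> space M. \<epsilon> < sqrt (\<Sum>i\<in>C. (X i \<omega> - Y i \<omega>)\<^sup>2)}"
  define P2 where "P2 = (\<lambda>x. r < selfnorm C x)"
  define P3 where "P3 = (\<lambda>\<kappa> x. q * sdev C x - \<delta> < \<kappa> * (\<Sum>i\<in>C. x i) / sqrt (real (card C)) \<and> \<kappa> * (\<Sum>i\<in>C. x i) / sqrt (real (card C)) \<le> q * sdev C x)"
  have m1: "A1 \<in> sets M"
  proof -
    note [measurable] = X Ym
    show ?thesis unfolding A1_def by measurable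
  qed
  have m2: "{x \<in> space G. P2 x} \<in> sets G" unfolding P2_def using snm by measurable
  have m3: "{x \<in> space G. P3 \<kappa> x} \<in> sets G" for \<kappa>
  proof -
    have e: "P3 \<kappa> = (\<lambda>x. q * sdev C x - \<delta> < \<kappa> * N x \<and> \<kappa> * N x \<le> q * sdev C x)" by (simp add: P3_def N_def)
    show ?thesis unfolding e
      by (intro sets.sets_Collect_conj borel_measurable_less borel_measurable_le borel_measurable_diff borel_measurable_times borel_measurable_const Nm Dm)
  qed
  have pre: "{\<omega> \<in> space M. P (\<lambda>i\<in>C. Y i \<omega>)} \<in> sets M" if "{x \<in> space G. P x} \<in> sets G" for P
  proof -
    have "(\<lambda>\<omega>. \<lambda>i\<in>C. Y i \<omega>) -` {x \<in> space G. P x} \<inter> space M = {\<omega> \<in> space M. P (\<lambda>i\<in>C. Y i \<omega>)}"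
      using measurable_space[OF Y'] by auto
    then show ?thesis using measurable_sets[OF Y' that] by simp
  qed
  define A2 A3 where "A2 = {\<omega> \<in> space M. P2 (\<lambda>i\<in>C. Y i \<omega>)}" and "A3 = (\<lambda>\<kappa>. {\<omega> \<in> space M. P3 \<kappa> (\<lambda>i\<in>C. Y i \<omega>)})"
  have sub: "{\<omega> \<in> space M. IM_reject \<alpha> C (\<lambda>i. X i \<omega>)} \<subseteq> A1 \<union> A2 \<union> A3 1 \<union> A3 (-1)"
  proof (rule subsetI, rule ccontr)
    fix \<omega> assume "\<omega> \<in> {\<omega> \<in> space M. IM_reject \<alpha> C (\<lambda>i. X i \<omega>)}" and n: "\<omega> \<notin> A1 \<union> A2 \<union> A3 1 \<union> A3 (-1)"
    then have \<omega>: "\<omega> \<in> space M" "IM_reject \<alpha> C (\<lambda>i. X i \<omega>)" by auto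
    let ?y = "\<lambda>i\<in>C. Y i \<omega>"
    have "(\<Sum>i\<in>C. (X i \<omega> - ?y i)\<^sup>2) = (\<Sum>i\<in>C. (X i \<omega> - Y i \<omega>)\<^sup>2)" by (intro sum.cong) auto
    then have le: "sqrt (\<Sum>i\<in>C. (X i \<omega> - ?y i)\<^sup>2) \<le> \<epsilon>" using n \<omega> by (simp add: A1_def not_less)
    have 1: "q * sdev C ?y - \<delta> < \<bar>\<Sum>i\<in>C. ?y i\<bar> / sqrt (real (card C))"
      using IM_reject_perturb[OF k \<alpha>(1) \<alpha>1 B(1) B(2) \<omega>(2) le] by (simp only: q_def \<delta>_def)
    have "\<not> q * sdev C ?y < \<bar>\<Sum>i\<in>C. ?y i\<bar> / sqrt (real (card C))"
      using selfnorm_gt[OF C(1) k q, of ?y] n \<omega>(1) unfolding A2_def P2_def r_def by blast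
    with 1 n \<omega>(1) show False unfolding A3_def P3_def by (cases "0 \<le> (\<Sum>i\<in>C. ?y i)") (auto simp del: restrict_apply)
  qed
  have "measure M {\<omega> \<in> space M. IM_reject \<alpha> C (\<lambda>i. X i \<omega>)} \<le> measure M (A1 \<union> A2 \<union> A3 1 \<union> A3 (-1))"
    using sub m1 pre[OF m2] pre[OF m3] by (intro finite_measure_mono) (auto simp: A2_def A3_def)
  also have "\<dots> \<le> measure M A1 + measure M A2 + measure M (A3 1) + measure M (A3 (-1))"
    using m1 pre[OF m2] pre[OF m3] unfolding A2_def[symmetric] A3_def[symmetric]
    by (intro order_trans[OF measure_Un_le] add_mono order_refl) (auto simp: A2_def A3_def)
  \<comment> \<open>Here the bound on \<open>\<alpha>\<close> enters: the level \<open>r\<close> has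
    tail at most \<open>\<alpha>\<close> under equal variances, \<open>Ptail_threshold\<close>
    therefore places it in a regime of \<open>selfnorm_tail_le\<close>, and the same tail bounds the
    probability for arbitrary variances.\<close>
  also have "measure M A2 \<le> \<alpha>"
  proof -
    have P: "Ptail (real (card C)) r \<le> \<alpha>" unfolding r_def q_def using k \<alpha>(1) \<alpha>1 by (rule quantile_ratio(1))
    have r0: "0 \<le> r" using k by (simp add: r_def)
    have "measure M A2 = measure G {x \<in> space G. P2 x}" unfolding A2_def by (rule push[OF m2])
    also have "\<dots> \<le> Ptail (real (card C)) r" unfolding G_def P2_def
      using C(1) s(1) Ptail_threshold[OF k r0 order_trans[OF P \<alpha>(2)]] by (rule selfnorm_tail_le)
    finally show ?thesis using P by simp
  qed
  finally have le: "measure M {\<omega> \<in> space M. IM_reject \<alpha> C (\<lambda>i. X i \<omega>)} \<le> measure M A1 + \<alpha> + measure M (A3 1) + measure M (A3 (-1))"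
    by simp
  have A3: "measure M (A3 \<kappa>) \<le> exp (1 / (2 * c)) / (2 * real J)" if "\<kappa> = 1 \<or> \<kappa> = -1" for \<kappa>
  proof -
    have "measure M (A3 \<kappa>) = measure G {x \<in> space G. P3 \<kappa> x}" unfolding A3_def by (rule push[OF m3])
    also have "\<dots> \<le> exp (1 / (2 * c)) / (2 * real J)" unfolding G_def P3_def
      using Dm J(2) sdev_shift[OF C] by (intro gaussian_anticoncentration C s c \<delta> J that) (simp_all add: G_def \<delta>_def)
    finally show ?thesis .
  qed
  show ?thesis using le A3[of 1] A3[of "-1"] by (simp add: A1_def)
qed

section \<open>Uniform level under the representation condition\<close>

lemma centered_gaussian_normal:
  assumes M: "prob_space M" and X: "X \<in> borel_measurable M" and G: "centered_gaussian M X"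
    and v: "c \<le> prob_space.variance M X" and c: "0 < c"
  shows "\<exists>\<sigma>>0. distributed M lborel X (normal_density 0 \<sigma>) \<and> c \<le> \<sigma>\<^sup>2"
proof -
  interpret prob_space M by (rule M)
  have "\<not> (AE \<omega> in M. X \<omega> = 0)"
  proof
    assume z: "AE \<omega> in M. X \<omega> = 0"
    then have "expectation X = 0" by (rule integral_eq_zero_AE)
    then have "variance X = expectation (\<lambda>\<omega>. (X \<omega>)\<^sup>2)" by simp
    also have "\<dots> = 0" using z by (intro integral_eq_zero_AE) auto
    finally show False using v c by simp
  qed
  then obtain \<sigma> where "0 < \<sigma>" "distributed M lborel X (normal_density 0 \<sigma>)"
    using G by (auto simp: centered_gaussian_def)
  moreover from this have "variance X = \<sigma>\<^sup>2" by (rule normal_distributed_variance)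
  ultimately show ?thesis using v by auto
qed

text \<open>Dominated convergence is applied to the indicators of the unions \<open>F n\<close>. As
  the almost sure convergence is uniform over \<open>A n\<close>, one event covers all members at
  once, and their number does not enter the bound.\<close>

lemma uniform_AE_imp_in_measure:
  fixes Z :: "'c \<Rightarrow> 'w \<Rightarrow> real"
  assumes M: "prob_space M" and fin: "\<And>n. finite (A n)" and Z: "\<And>n C. C \<in> A n \<Longrightarrow> Z C \<in> borel_measurable M"
    and AE: "AE \<omega> in M. \<forall>\<epsilon>>0. \<forall>\<^sub>F n in sequentially. \<forall>C\<in>A n. Z C \<omega> \<le> \<epsilon>"
    and \<epsilon>: "0 < \<epsilon>" and \<eta>: "0 < \<eta>"
  shows "\<forall>\<^sub>F n in sequentially. \<forall>C\<in>A n. measure M {\<omega> \<in> space M. \<epsilon> < Z C \<omega>} \<le> \<eta>"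
proof -
  interpret prob_space M by (rule M)
  define F where "F = (\<lambda>n. \<Union>C\<in>A n. {\<omega> \<in> space M. \<epsilon> < Z C \<omega>})"
  have Fm: "{\<omega> \<in> space M. \<epsilon> < Z C \<omega>} \<in> sets M" if "C \<in> A n" for n C
    using Z[OF that] by (intro borel_measurable_less) auto
  have F[measurable]: "F n \<in> sets M" for n unfolding F_def using fin Fm by (intro sets.finite_UN) auto
  have "(\<lambda>n. integral\<^sup>L M (indicator (F n) :: 'w \<Rightarrow> real)) \<longlonglongrightarrow> integral\<^sup>L M (\<lambda>_. 0 :: real)"
  proof (rule integral_dominated_convergence[where w = "\<lambda>_. 1"])
    show "AE \<omega> in M. (\<lambda>n. indicator (F n) \<omega> :: real) \<longlonglongrightarrow> 0"
      using AE
    proof eventually_elim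
      case (elim \<omega>)
      then have "\<forall>\<^sub>F n in sequentially. \<forall>C\<in>A n. Z C \<omega> \<le> \<epsilon>" using \<epsilon> by blast
      then have "\<forall>\<^sub>F n in sequentially. indicator (F n) \<omega> = (0::real)"
        by (rule eventually_mono) (auto simp: F_def indicator_def not_less)
      then show ?case by (rule tendsto_eventually)
    qed
  qed (auto simp: indicator_def)
  then have "(\<lambda>n. measure M (F n)) \<longlonglongrightarrow> 0" by simp
  then have "\<forall>\<^sub>F n in sequentially. measure M (F n) < \<eta>" using \<eta> by (rule order_tendstoD)
  then show ?thesis
  proof (rule eventually_mono, intro ballI)
    fix n C assume n: "measure M (F n) < \<eta>" and C: "C \<in> A n"
    have "measure M {\<omega> \<in> space M. \<epsilon> < Z C \<omega>} \<le> measure M (F n)"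
      by (rule finite_measure_mono[OF _ F]) (use C in \<open>auto simp: F_def\<close>)
    then show "measure M {\<omega> \<in> space M. \<epsilon> < Z C \<omega>} \<le> \<eta>" using n by simp
  qed
qed

lemma IM_reject_restrict: "IM_reject \<alpha> C (restrict x C) = IM_reject \<alpha> C x"
  by (simp add: IM_reject_def tstat_def Let_def)

lemma IM_reject_sets:
  assumes k: "2 \<le> card C" and \<alpha>: "0 < \<alpha>" "\<alpha> < 1"
  shows "{x \<in> space (PiM C (\<lambda>_. borel)). IM_reject \<alpha> C x} \<in> sets (PiM C (\<lambda>_. borel))"
proof -
  have [measurable]: "sdev C \<in> borel_measurable (PiM C (\<lambda>_. borel))"
    unfolding sdev_def[abs_def] by measurable
  have [measurable]: "(\<lambda>x. \<bar>\<Sum>i\<in>C. x i\<bar> / sqrt (real (card C))) \<in> borel_measurable (PiM C (\<lambda>_. borel))"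
    by measurable
  have [measurable]: "(\<lambda>x. t_quantile (real (card C) - 1) (1 - \<alpha> / 2) * sdev C x) \<in> borel_measurable (PiM C (\<lambda>_. borel))"
    by measurable
  show ?thesis unfolding IM_reject_iff[OF k \<alpha>]
    by (intro sets.sets_Collect_conj sets.sets_Collect_neg borel_measurable_less borel_measurable_neq) measurable
qed

lemma IM_reject_vimage:
  assumes k: "2 \<le> card C" and \<alpha>: "0 < \<alpha>" "\<alpha> < 1"
    and X: "\<And>i. i \<in> C \<Longrightarrow> (\<lambda>\<omega>. X \<omega> i) \<in> borel_measurable M"
  shows "{\<omega> \<in> space M. IM_reject \<alpha> C (X \<omega>)} \<in> sets M"
    "measure M {\<omega> \<in> space M. IM_reject \<alpha> C (X \<omega>)} =
      measure (distr M (PiM C (\<lambda>_. borel)) (\<lambda>\<omega>. restrict (X \<omega>) C)) {x \<in> space (PiM C (\<lambda>_. borel)). IM_reject \<alpha> C x}"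
proof -
  have X': "(\<lambda>\<omega>. restrict (X \<omega>) C) \<in> measurable M (PiM C (\<lambda>_. borel))"
    using X by (intro measurable_restrict)
  have e: "(\<lambda>\<omega>. restrict (X \<omega>) C) -` {x \<in> space (PiM C (\<lambda>_. borel)). IM_reject \<alpha> C x} \<inter> space M = {\<omega> \<in> space M. IM_reject \<alpha> C (X \<omega>)}"
    using measurable_space[OF X'] by (auto simp: IM_reject_restrict)
  show "{\<omega> \<in> space M. IM_reject \<alpha> C (X \<omega>)} \<in> sets M"
    using measurable_sets[OF X' IM_reject_sets[OF k \<alpha>]] unfolding e .
  show "measure M {\<omega> \<in> space M. IM_reject \<alpha> C (X \<omega>)} =
      measure (distr M (PiM C (\<lambda>_. borel)) (\<lambda>\<omega>. restrict (X \<omega>) C)) {x \<in> space (PiM C (\<lambda>_. borel)). IM_reject \<alpha> C x}"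
    using measure_distr[OF X' IM_reject_sets[OF k \<alpha>]] unfolding e by simp
qed

lemma ASAGR_reject_uniform:
  fixes \<eta> :: real
  assumes fin: "\<And>n. finite (Cs n)" and card: "\<And>n C. C \<in> Cs n \<Longrightarrow> 2 \<le> card C"
    and S: "\<And>n \<C> C. \<C> \<in> Cs n \<Longrightarrow> C \<in> \<C> \<Longrightarrow> (\<lambda>\<omega>. S \<C> \<omega> C) \<in> borel_measurable M"
    and gauss: "ASAGR M' S' Sg M Cs S" and \<alpha>: "0 < \<alpha>" "\<alpha> \<le> 2 * Phi (- sqrt 3)" and \<eta>: "0 < \<eta>"
  shows "\<forall>\<^sub>F n in sequentially. \<forall>\<C>\<in>Cs n. measure M {\<omega> \<in> space M. IM_reject \<alpha> \<C> (S \<C> \<omega>)} \<le> \<alpha> + \<eta>"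
proof -
  have M': "prob_space M'" using gauss by (simp add: ASAGR_def)
  have \<alpha>1: "\<alpha> < 1" using \<alpha>(2) alpha_lt_1 by simp
  have S'm: "(\<lambda>\<omega>. S' \<C> \<omega> C) \<in> borel_measurable M'" and Sgm: "(\<lambda>\<omega>. Sg \<C> \<omega> C) \<in> borel_measurable M'"
    if "\<C> \<in> Cs n" "C \<in> \<C>" for n \<C> C using gauss that unfolding ASAGR_def by blast+
  have law: "distr M' (PiM \<C> (\<lambda>_. borel)) (\<lambda>\<omega>. restrict (S' \<C> \<omega>) \<C>) = distr M (PiM \<C> (\<lambda>_. borel)) (\<lambda>\<omega>. restrict (S \<C> \<omega>) \<C>)"
    if "\<C> \<in> Cs n" for n \<C> using gauss that unfolding ASAGR_def by blast
  have cg: "centered_gaussian M' (\<lambda>\<omega>. Sg \<C> \<omega> C)" if "\<C> \<in> Cs n" "C \<in> \<C>" for n \<C> C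
    using gauss that unfolding ASAGR_def by blast
  have ind: "prob_space.indep_vars M' (\<lambda>_. borel) (\<lambda>C \<omega>. Sg \<C> \<omega> C) \<C>" if "\<C> \<in> Cs n" for n \<C>
    using gauss that unfolding ASAGR_def by blast
  have "\<exists>c>0. \<forall>\<^sub>F n in sequentially. \<forall>\<C>\<in>Cs n. \<forall>C\<in>\<C>. c \<le> prob_space.variance M' (\<lambda>\<omega>. Sg \<C> \<omega> C)"
    using gauss unfolding ASAGR_def by (elim conjE)
  then obtain c where c: "0 < c"
    "\<forall>\<^sub>F n in sequentially. \<forall>\<C>\<in>Cs n. \<forall>C\<in>\<C>. c \<le> prob_space.variance M' (\<lambda>\<omega>. Sg \<C> \<omega> C)" by blast
  have AE: "AE \<omega> in M'. \<forall>\<epsilon>>0. \<forall>\<^sub>F n in sequentially. \<forall>\<C>\<in>Cs n. sqrt (\<Sum>C\<in>\<C>. (S' \<C> \<omega> C - Sg \<C> \<omega> C)\<^sup>2) \<le> \<epsilon>"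
    using gauss unfolding ASAGR_def by (elim conjE)
  obtain B where B: "0 < B" "\<And>k::nat. 2 \<le> k \<Longrightarrow> t_quantile (real k - 1) (1 - \<alpha> / 2) \<le> B * sqrt (real k - 1)"
    using quantile_bound[OF \<alpha>(1) \<alpha>1] by blast
  \<comment> \<open>\<open>J\<close> makes the two boundary layers cost at most
    \<open>\<eta> / 2\<close> together; \<open>\<epsilon>\<close> is then such that \<open>J\<close>
    layers of width \<open>\<epsilon> * (1 + B)\<close> have total width 1. Neither depends on the
    partition.\<close>
  define J where "J = Suc (nat \<lceil>exp (1 / (2 * c)) / (\<eta> / 2)\<rceil>)"
  have J: "0 < J" by (simp add: J_def)
  have "exp (1 / (2 * c)) / (\<eta> / 2) \<le> real J" unfolding J_def by linarith
  then have J2: "exp (1 / (2 * c)) / real J \<le> \<eta> / 2" using \<eta> J by (simp add: field_simps)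
  define \<epsilon> where "\<epsilon> = 1 / (real J * (1 + B))"
  have \<epsilon>: "0 < \<epsilon>" using J B by (simp add: \<epsilon>_def)
  have J\<epsilon>: "real J * (\<epsilon> * (1 + B)) \<le> 1" using J B by (simp add: \<epsilon>_def)
  have "\<forall>\<^sub>F n in sequentially. \<forall>\<C>\<in>Cs n. measure M' {\<omega> \<in> space M'. \<epsilon> < sqrt (\<Sum>C\<in>\<C>. (S' \<C> \<omega> C - Sg \<C> \<omega> C)\<^sup>2)} \<le> \<eta> / 2"
  proof (rule uniform_AE_imp_in_measure[OF M' fin _ AE \<epsilon>])
    fix n \<C> assume C: "\<C> \<in> Cs n"
    note [measurable] = S'm[OF C] Sgm[OF C]
    show "(\<lambda>\<omega>. sqrt (\<Sum>C\<in>\<C>. (S' \<C> \<omega> C - Sg \<C> \<omega> C)\<^sup>2)) \<in> borel_measurable M'" by measurable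
  qed (use \<eta> in auto)
  with c(2) show ?thesis
  proof eventually_elim
    case (elim n)
    show ?case
    proof
      fix \<C> assume C: "\<C> \<in> Cs n"
      have "\<forall>C\<in>\<C>. \<exists>\<sigma>>0. distributed M' lborel (\<lambda>\<omega>. Sg \<C> \<omega> C) (normal_density 0 \<sigma>) \<and> c \<le> \<sigma>\<^sup>2"
        using elim(1) C by (intro ballI centered_gaussian_normal M' Sgm[OF C] cg[OF C] c(1)) auto
      then obtain s where s: "\<And>C. C \<in> \<C> \<Longrightarrow> 0 < s C" "\<And>C. C \<in> \<C> \<Longrightarrow> distributed M' lborel (\<lambda>\<omega>. Sg \<C> \<omega> C) (normal_density 0 (s C))"
        "\<And>C. C \<in> \<C> \<Longrightarrow> c \<le> (s C)\<^sup>2" by metis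
      have "measure M {\<omega> \<in> space M. IM_reject \<alpha> \<C> (S \<C> \<omega>)} = measure M' {\<omega> \<in> space M'. IM_reject \<alpha> \<C> (S' \<C> \<omega>)}"
        using IM_reject_vimage(2)[where X = "S \<C>", OF card[OF C] \<alpha>(1) \<alpha>1 S[OF C]]
          IM_reject_vimage(2)[where X = "S' \<C>", OF card[OF C] \<alpha>(1) \<alpha>1 S'm[OF C]] by (simp only: law[OF C])
      also have "\<dots> \<le> measure M' {\<omega> \<in> space M'. \<epsilon> < sqrt (\<Sum>C\<in>\<C>. (S' \<C> \<omega> C - Sg \<C> \<omega> C)\<^sup>2)} + \<alpha> + exp (1 / (2 * c)) / real J"
        using reject_prob_perturb[OF M' card[OF C] \<alpha> B(1) B(2)[OF card[OF C]] S'm[OF C] s(2) ind[OF C] s(1) s(3) c(1) J J\<epsilon> \<epsilon>] by simp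
      also have "\<dots> \<le> \<eta> / 2 + \<alpha> + \<eta> / 2" using elim(2) C J2 by (intro add_mono) auto
      finally show "measure M {\<omega> \<in> space M. IM_reject \<alpha> \<C> (S \<C> \<omega>)} \<le> \<alpha> + \<eta>" by simp
    qed
  qed
qed

text \<open>Law of total probability over the selected partition. Outside \<open>Cs1\<close>
  condition (i) applies. Inside, (ii) replaces the conditional rejection probability by the
  unconditional one, which is uniformly at most \<open>\<alpha> + \<eta>\<close>; so each selection
  event contributes at most \<open>\<alpha> + 2 * \<eta>\<close> times its own mass, and these
  events are disjoint.\<close>

theorem theorem6:
  fixes M :: "'o measure"
    and X :: "nat \<Rightarrow> 'x set"
    and Cs :: "nat \<Rightarrow> 'x set set set"
    and S :: "'x set set \<Rightarrow> 'o \<Rightarrow> 'x set \<Rightarrow> real"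
    and M' :: "'w measure"
    and S' Sg :: "'x set set \<Rightarrow> 'w \<Rightarrow> 'x set \<Rightarrow> real"
    and \<alpha> :: real
    and Chat :: "nat \<Rightarrow> 'o \<Rightarrow> 'x set set"
    and ahat :: "nat \<Rightarrow> 'o \<Rightarrow> real"
    and Cs1 :: "nat \<Rightarrow> 'x set set set"
  assumes P: "prob_space M"
    and X_fin: "\<And>n. finite (X n)"
    and Cs_fin: "\<And>n. finite (Cs n)"
    and Cs_part: "\<And>n \<C>. \<C> \<in> Cs n \<Longrightarrow> partition_on (X n) \<C> \<and> card \<C> \<ge> 2"
    and S_meas: "\<And>n \<C> C. \<C> \<in> Cs n \<Longrightarrow> C \<in> \<C> \<Longrightarrow> (\<lambda>\<omega>. S \<C> \<omega> C) \<in> borel_measurable M"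
    and gauss: "ASAGR M' S' Sg M Cs S"
    and \<alpha>_pos: "0 < \<alpha>"
    and \<alpha>_le: "\<alpha> \<le> 2 * Phi (- sqrt 3)"
    and Chat_in: "\<And>n \<omega>. \<omega> \<in> space M \<Longrightarrow> Chat n \<omega> \<in> Cs n"
    and Chat_meas: "\<And>n \<C>. {\<omega> \<in> space M. Chat n \<omega> = \<C>} \<in> sets M"
    and ahat_meas: "\<And>n. ahat n \<in> borel_measurable M"
    and ahat_range: "\<And>n \<omega>. \<omega> \<in> space M \<Longrightarrow> 0 \<le> ahat n \<omega> \<and> ahat n \<omega> \<le> \<alpha>"
    and Cs1_sub: "\<And>n. Cs1 n \<subseteq> Cs n"
    and cond_i: "(\<lambda>n. measure M {\<omega> \<in> space M. Chat n \<omega> \<notin> Cs1 n}) \<longlonglongrightarrow> 0"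
    and cond_ii: "\<forall>\<epsilon>>0. \<forall>\<^sub>F n in sequentially. \<forall>\<C>\<in>Cs1 n.
        measure M {\<omega> \<in> space M. Chat n \<omega> = \<C>} > 0 \<longrightarrow>
        \<bar>measure M {\<omega> \<in> space M. IM_reject \<alpha> \<C> (S \<C> \<omega>) \<and> Chat n \<omega> = \<C>}
            / measure M {\<omega> \<in> space M. Chat n \<omega> = \<C>}
         - measure M {\<omega> \<in> space M. IM_reject \<alpha> \<C> (S \<C> \<omega>)}\<bar> \<le> \<epsilon>"
  shows "limsup (\<lambda>n. ereal (measure M
           {\<omega> \<in> space M. IM_reject (ahat n \<omega>) (Chat n \<omega>) (S (Chat n \<omega>) \<omega>)})) \<le> ereal \<alpha>"
proof -
  interpret prob_space M by (rule P)
  have \<alpha>1: "\<alpha> < 1" using \<alpha>_le alpha_lt_1 by simp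
  have card: "2 \<le> card \<C>" if "\<C> \<in> Cs n" for n \<C> using Cs_part[OF that] by simp
  define R where "R = (\<lambda>n. {\<omega> \<in> space M. IM_reject (ahat n \<omega>) (Chat n \<omega>) (S (Chat n \<omega>) \<omega>)})"
  have ev: "\<forall>\<^sub>F n in sequentially. measure M (R n) \<le> \<alpha> + 3 * \<eta>" if \<eta>: "0 < \<eta>" for \<eta>
  proof -
    have "\<forall>\<^sub>F n in sequentially. measure M {\<omega> \<in> space M. Chat n \<omega> \<notin> Cs1 n} < \<eta>"
      using cond_i \<eta> by (rule order_tendstoD)
    moreover have "\<forall>\<^sub>F n in sequentially. \<forall>\<C>\<in>Cs n. measure M {\<omega> \<in> space M. IM_reject \<alpha> \<C> (S \<C> \<omega>)} \<le> \<alpha> + \<eta>"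
      by (rule ASAGR_reject_uniform[OF Cs_fin card S_meas gauss \<alpha>_pos \<alpha>_le \<eta>])
    moreover note cond_ii[rule_format, OF \<eta>]
    ultimately show ?thesis
    proof eventually_elim
      case (elim n)
      define E where "E = (\<lambda>\<C>. {\<omega> \<in> space M. Chat n \<omega> = \<C>})"
      define V where "V = (\<lambda>\<C>. {\<omega> \<in> space M. IM_reject \<alpha> \<C> (S \<C> \<omega>) \<and> Chat n \<omega> = \<C>})"
      have fin: "finite (Cs1 n)" using Cs1_sub Cs_fin by (rule finite_subset)
      have E: "E \<C> \<in> sets M" for \<C> unfolding E_def by (rule Chat_meas)
      have V: "V \<C> \<in> sets M" if "\<C> \<in> Cs n" for \<C>
        unfolding V_def using IM_reject_vimage(1)[OF card[OF that] \<alpha>_pos \<alpha>1 S_meas[OF that]] Chat_meas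
        by (intro sets.sets_Collect_conj)
      have U: "{\<omega> \<in> space M. Chat n \<omega> \<notin> Cs1 n} \<in> sets M"
      proof -
        have "{\<omega> \<in> space M. Chat n \<omega> \<notin> Cs1 n} = space M - (\<Union>\<C>\<in>Cs1 n. E \<C>)" by (auto simp: E_def)
        also have "\<dots> \<in> sets M" using fin E by (intro sets.Diff sets.top sets.finite_UN)
        finally show ?thesis .
      qed
      have VU: "(\<Union>\<C>\<in>Cs1 n. V \<C>) \<in> sets M" using fin V Cs1_sub by (intro sets.finite_UN) auto
      have "R n \<subseteq> {\<omega> \<in> space M. Chat n \<omega> \<notin> Cs1 n} \<union> (\<Union>\<C>\<in>Cs1 n. V \<C>)"
      proof
        fix \<omega> assume \<omega>: "\<omega> \<in> R n"
        then have "\<omega> \<in> space M" by (simp add: R_def)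
        then have "IM_reject \<alpha> (Chat n \<omega>) (S (Chat n \<omega>) \<omega>)"
          using \<omega> ahat_range[of \<omega> n] Chat_in[of \<omega> n] \<alpha>1 by (intro IM_reject_mono[of _ "ahat n \<omega>" \<alpha>] card) (auto simp: R_def)
        then show "\<omega> \<in> {\<omega> \<in> space M. Chat n \<omega> \<notin> Cs1 n} \<union> (\<Union>\<C>\<in>Cs1 n. V \<C>)"
          using \<omega> by (auto simp: R_def V_def)
      qed
      then have "measure M (R n) \<le> measure M ({\<omega> \<in> space M. Chat n \<omega> \<notin> Cs1 n} \<union> (\<Union>\<C>\<in>Cs1 n. V \<C>))"
        using U VU by (intro finite_measure_mono) auto
      also have "\<dots> \<le> measure M {\<omega> \<in> space M. Chat n \<omega> \<notin> Cs1 n} + measure M (\<Union>\<C>\<in>Cs1 n. V \<C>)"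
        using U VU by (rule measure_Un_le)
      also have "\<dots> \<le> \<eta> + (\<Sum>\<C>\<in>Cs1 n. measure M (V \<C>))"
        using elim(1) fin V Cs1_sub[of n] by (intro add_mono finite_measure_subadditive_finite) auto
      also have "(\<Sum>\<C>\<in>Cs1 n. measure M (V \<C>)) \<le> (\<Sum>\<C>\<in>Cs1 n. (\<alpha> + 2 * \<eta>) * measure M (E \<C>))"
      proof (rule sum_mono)
        fix \<C> assume C: "\<C> \<in> Cs1 n"
        then have C': "\<C> \<in> Cs n" using Cs1_sub by auto
        show "measure M (V \<C>) \<le> (\<alpha> + 2 * \<eta>) * measure M (E \<C>)"
        proof (cases "0 < measure M (E \<C>)")
          case True
          then have "\<bar>measure M (V \<C>) / measure M (E \<C>) - measure M {\<omega> \<in> space M. IM_reject \<alpha> \<C> (S \<C> \<omega>)}\<bar> \<le> \<eta>"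
            using elim(3) C unfolding V_def E_def by blast
          then have "measure M (V \<C>) / measure M (E \<C>) \<le> \<alpha> + 2 * \<eta>" using elim(2) C' by (auto simp: abs_le_iff)
          then show ?thesis using True by (simp add: divide_le_eq)
        next
          \<comment> \<open>Condition (ii) says nothing about selection events of probability 0, but
            there both sides vanish.\<close>
          case False
          have "measure M (V \<C>) \<le> measure M (E \<C>)" using E by (intro finite_measure_mono) (auto simp: V_def E_def)
          then show ?thesis using False by (simp add: not_less measure_le_0_iff)
        qed
      qed
      also have "\<dots> = (\<alpha> + 2 * \<eta>) * measure M (\<Union>\<C>\<in>Cs1 n. E \<C>)"
        using fin E by (subst finite_measure_finite_Union) (auto simp: disjoint_family_on_def E_def sum_distrib_left)
      also have "\<dots> \<le> (\<alpha> + 2 * \<eta>) * 1" using \<alpha>_pos \<eta> by (intro mult_left_mono) auto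
      finally show ?case by simp
    qed
  qed
  have "limsup (\<lambda>n. ereal (measure M (R n))) \<le> ereal \<alpha> + ereal \<eta>" if "0 < \<eta>" for \<eta>
  proof (rule Limsup_bounded)
    show "\<forall>\<^sub>F n in sequentially. ereal (measure M (R n)) \<le> ereal \<alpha> + ereal \<eta>"
      using ev[of "\<eta> / 3"] that by simp
  qed
  then have "limsup (\<lambda>n. ereal (measure M (R n))) \<le> ereal \<alpha>" by (rule ereal_le_epsilon2) blast
  then show ?thesis by (simp add: R_def)
qed

end
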